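(* Let $r>1$ be real and let $f:I\to I$ be a $\mathcal{C}^r$ map. Let $\mu$ be an $f$-ergodic measure with $h_f(\mu)\ge\frac{R(f)}{r}$. Then $$\limsup_{(g,\nu)\to(f,\mu),\ \nu\ g\text{-invariant}}h_g(\nu)\le h_f(\mu),$$ where the convergence is $\mathcal{C}^r$-weak for $g$ and weak-$*$ for $\nu$; that is, for every sequence $(g_k)$ of $\mathcal{C}^r$ maps $I\to I$ with $g_k\to f$ $\mathcal{C}^r$-weakly and every sequence $(\nu_k)$ of $g_k$-invariant Borel probability measures with $\nu_k\to\mu$ in the weak-$*$ topology, $\limsup_{k\to\infty}h_{g_k}(\nu_k)\le h_f(\mu)$.
   Context: $I$ denotes the interval $[0,1]$ or the circle $\mathbb{S}^1$. For real $r>1$, a map $g:I\to I$ is $\mathcal{C}^r$ if it is $\mathcal{C}^{\lfloor r\rfloor}$ and $g^{(\lfloor r\rfloor)}$ is $(r-\lfloor r\rfloor)$-Hölder. A sequence of $\mathcal{C}^r$ maps $(g_k)$ converges $\mathcal{C}^r$-weakly to $f$ if it converges to $f$ in the $\mathcal{C}^1$-topology and is bounded in the $\mathcal{C}^r$-norm. An $f$-ergodic measure is an $f$-invariant ergodic Borel probability measure. $h_g(\nu)$ is the metric entropy of $\nu$ for $g$. $R(g):=\lim_{n\to\infty}\frac1n\log^+\|(g^n)'\|_\infty$, where $\log^+=\max\{0,\log\}$ and $\|\cdot\|_\infty$ is the supremum over $I$. *)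

theory Defs
  imports "HOL-Probability.Probability"
begin

text \<open>
  The interval and the circle are treated uniformly: a one-dimensional space consists of
  its points, and of a parametrization of them by a closed connected set of reals. The
  circle is the unit circle of the complex plane, parametrized with period 1 by its
  universal covering.
\<close>

record 'a space1 =
  pts :: "'a set"
  pdom :: "real set"
  param :: "real \<Rightarrow> 'a"

definition unit_interval :: "real space1" where
  "unit_interval = \<lparr>pts = {0..1}, pdom = {0..1}, param = (\<lambda>t. t)\<rparr>"

definition unit_circle :: "complex space1" where
  "unit_circle = \<lparr>pts = sphere 0 1, pdom = UNIV, param = (\<lambda>t. cis (2 * pi * t))\<rparr>"

definition is_lift :: "('a::metric_space) space1 \<Rightarrow> ('a \<Rightarrow> 'a) \<Rightarrow> (real \<Rightarrow> real) \<Rightarrow> bool" where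
  "is_lift I g F \<longleftrightarrow> continuous_on (pdom I) F \<and> F ` pdom I \<subseteq> pdom I \<and>
     (\<forall>t\<in>pdom I. g (param I t) = param I (F t))"

text \<open>
  A lift of a continuous map exists; on the parameter domain it is unique for the interval,
  and unique up to an additive integer constant for the circle. Hence its derivatives of
  order at least 1 do not depend on the choice.
\<close>

definition lift_of :: "('a::metric_space) space1 \<Rightarrow> ('a \<Rightarrow> 'a) \<Rightarrow> real \<Rightarrow> real" where
  "lift_of I g = (SOME F. is_lift I g F)"

definition deriv_within :: "real set \<Rightarrow> (real \<Rightarrow> real) \<Rightarrow> real \<Rightarrow> real" where
  "deriv_within J F = (\<lambda>t. vector_derivative F (at t within J))"

text \<open>
  The \<open>j\<close>-th derivative of \<open>g\<close> at the point \<open>param I t\<close> (for \<open>j \<ge> 1\<close>); at the end points of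
  the interval the derivatives are one-sided.
\<close>

definition nderiv :: "('a::metric_space) space1 \<Rightarrow> nat \<Rightarrow> ('a \<Rightarrow> 'a) \<Rightarrow> real \<Rightarrow> real" where
  "nderiv I j g = (deriv_within (pdom I) ^^ j) (lift_of I g)"

definition Cn_on :: "nat \<Rightarrow> real set \<Rightarrow> (real \<Rightarrow> real) \<Rightarrow> bool" where
  "Cn_on n J F \<longleftrightarrow>
     (\<forall>j<n. \<forall>t\<in>J. (deriv_within J ^^ j) F differentiable (at t within J)) \<and>
     continuous_on J ((deriv_within J ^^ n) F)"

definition holder_on :: "real \<Rightarrow> real set \<Rightarrow> (real \<Rightarrow> real) \<Rightarrow> bool" where
  "holder_on \<alpha> J F \<longleftrightarrow> (\<exists>C. \<forall>s\<in>J. \<forall>t\<in>J. \<bar>F s - F t\<bar> \<le> C * \<bar>s - t\<bar> powr \<alpha>)"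

text \<open>
  For integral \<open>r\<close> the Hoelder condition has exponent 0 and only says that the last
  derivative is bounded, which already follows from its continuity.
\<close>

definition Cr_map :: "real \<Rightarrow> ('a::metric_space) space1 \<Rightarrow> ('a \<Rightarrow> 'a) \<Rightarrow> bool" where
  "Cr_map r I g \<longleftrightarrow> g ` pts I \<subseteq> pts I \<and> continuous_on (pts I) g \<and>
     Cn_on (nat \<lfloor>r\<rfloor>) (pdom I) (lift_of I g) \<and>
     holder_on (r - of_int \<lfloor>r\<rfloor>) (pdom I) (nderiv I (nat \<lfloor>r\<rfloor>) g)"

definition Cr_norm :: "real \<Rightarrow> ('a::real_normed_vector) space1 \<Rightarrow> ('a \<Rightarrow> 'a) \<Rightarrow> ereal" where
  "Cr_norm r I g =
     (SUP x\<in>pts I. ereal (norm (g x))) +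
     (SUP j\<in>{1..nat \<lfloor>r\<rfloor>}. SUP t\<in>pdom I. ereal \<bar>nderiv I j g t\<bar>) +
     (SUP s\<in>pdom I. SUP t\<in>pdom I.
        ereal (\<bar>nderiv I (nat \<lfloor>r\<rfloor>) g s - nderiv I (nat \<lfloor>r\<rfloor>) g t\<bar>
               / \<bar>s - t\<bar> powr (r - of_int \<lfloor>r\<rfloor>)))"

definition C1_converges ::
  "('a::metric_space) space1 \<Rightarrow> (nat \<Rightarrow> 'a \<Rightarrow> 'a) \<Rightarrow> ('a \<Rightarrow> 'a) \<Rightarrow> bool" where
  "C1_converges I g f \<longleftrightarrow>
     uniform_limit (pts I) g f sequentially \<and>
     uniform_limit (pdom I) (\<lambda>k. nderiv I 1 (g k)) (nderiv I 1 f) sequentially"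

definition Cr_weakly_converges ::
  "real \<Rightarrow> ('a::real_normed_vector) space1 \<Rightarrow> (nat \<Rightarrow> 'a \<Rightarrow> 'a) \<Rightarrow> ('a \<Rightarrow> 'a) \<Rightarrow> bool" where
  "Cr_weakly_converges r I g f \<longleftrightarrow>
     C1_converges I g f \<and> (\<exists>C::real. \<forall>k. Cr_norm r I (g k) \<le> ereal C)"

text \<open>
  The supremum is that of a bounded set when \<open>g\<close> is continuously differentiable. Since
  \<open>ln 0 = 0\<close>, a vanishing derivative contributes 0, as with the convention \<open>log 0 = -\<infinity>\<close>.
\<close>

definition growth_rate :: "('a::metric_space) space1 \<Rightarrow> ('a \<Rightarrow> 'a) \<Rightarrow> real" where
  "growth_rate I g =
     lim (\<lambda>n. max 0 (ln (SUP t\<in>pdom I. \<bar>nderiv I 1 (g ^^ n) t\<bar>)) / real n)"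

definition borel_prob_on :: "('a::metric_space) space1 \<Rightarrow> 'a measure \<Rightarrow> bool" where
  "borel_prob_on I M \<longleftrightarrow> prob_space M \<and> sets M = sets (restrict_space borel (pts I))"

definition invariant_measure :: "('a::metric_space) space1 \<Rightarrow> ('a \<Rightarrow> 'a) \<Rightarrow> 'a measure \<Rightarrow> bool" where
  "invariant_measure I g M \<longleftrightarrow>
     borel_prob_on I M \<and> g \<in> measurable M M \<and> distr M M g = M"

definition ergodic_measure :: "('a::metric_space) space1 \<Rightarrow> ('a \<Rightarrow> 'a) \<Rightarrow> 'a measure \<Rightarrow> bool" where
  "ergodic_measure I g M \<longleftrightarrow> invariant_measure I g M \<and>
     (\<forall>A\<in>sets M. g -` A \<inter> space M = A \<longrightarrow> measure M A = 0 \<or> measure M A = 1)"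

definition weak_star_converges ::
  "('a::metric_space) space1 \<Rightarrow> (nat \<Rightarrow> 'a measure) \<Rightarrow> 'a measure \<Rightarrow> bool" where
  "weak_star_converges I \<nu> \<mu> \<longleftrightarrow>
     (\<forall>\<phi> :: 'a \<Rightarrow> real. continuous_on (pts I) \<phi> \<longrightarrow>
        (\<lambda>k. integral\<^sup>L (\<nu> k) \<phi>) \<longlonglongrightarrow> integral\<^sup>L \<mu> \<phi>)"

definition finite_partition :: "'a measure \<Rightarrow> 'a set set \<Rightarrow> bool" where
  "finite_partition M P \<longleftrightarrow> finite P \<and> P \<subseteq> sets M \<and> partition_on (space M) P"

definition partition_entropy :: "'a measure \<Rightarrow> 'a set set \<Rightarrow> real" where
  "partition_entropy M P = - (\<Sum>A\<in>P. measure M A * ln (measure M A))"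

text \<open>The common refinement of the preimages of \<open>P\<close> under \<open>T ^^ i\<close> for \<open>i < n\<close>.\<close>

definition dyn_join :: "'a measure \<Rightarrow> ('a \<Rightarrow> 'a) \<Rightarrow> 'a set set \<Rightarrow> nat \<Rightarrow> 'a set set" where
  "dyn_join M T P n =
     {B. B \<noteq> {} \<and> (\<exists>A\<in>{..<n} \<rightarrow> P. B = {x \<in> space M. \<forall>i<n. (T ^^ i) x \<in> A i})}"

definition metric_entropy_wrt :: "'a measure \<Rightarrow> ('a \<Rightarrow> 'a) \<Rightarrow> 'a set set \<Rightarrow> real" where
  "metric_entropy_wrt M T P = lim (\<lambda>n. partition_entropy M (dyn_join M T P n) / real n)"

definition metric_entropy :: "'a measure \<Rightarrow> ('a \<Rightarrow> 'a) \<Rightarrow> ereal" where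
  "metric_entropy M T = (SUP P\<in>{P. finite_partition M P}. ereal (metric_entropy_wrt M T P))"

end

theory Submission
  imports Defs
begin

text \<open>
  Entropy is bounded by coding orbits. A code consists of an equivalence relation on the points and
  of a class function, the cost, that satisfies Kraft's inequality; refining the relation by a
  symbol adds to the cost. If the classes of a code determine the \<open>Q\<close>-itinerary up to time \<open>n\<close>,
  Gibbs' inequality bounds the entropy of the \<open>n\<close>-th refinement of \<open>Q\<close> by the mean cost.

  Let the exponent of \<open>\<mu>\<close> be nonnegative. As long as the derivative of the map \<open>g\<close> in question is not small, an orbit is
  followed at a fixed scale \<open>\<epsilon>\<close>, with a mean cost of nearly \<open>h(\<mu>)\<close> per step, by the conditional
  probabilities of the symbols of a fine partition. When \<open>\<bar>g'\<bar>\<close> is about \<open>exp (- m)\<close>, the current arc is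
  cut at the level sets \<open>g' \<in> {0, 2 exp (- m), - 2 exp (- m)}\<close>, intersected with a grid of mesh \<open>exp (- m / (r - 1))\<close>. By
  Rolle's theorem and the bound on the \<open>C\<^sup>r\<close> norm each relevant cell of the grid contains less than \<open>r\<close> level points, so
  this costs about \<open>m / (r - 1)\<close>. But then the arc is contracted to the scale \<open>exp (- m r / (r - 1))\<close>, and nothing has
  to be coded before it has grown to the scale \<open>\<epsilon>\<close> again, which takes at least \<open>m r / ((r - 1) R)\<close> steps for
  \<open>R\<close> slightly above the growth rate. Hence a critical passage costs at most \<open>R / r\<close> per step, nearly at most \<open>h(\<mu>)\<close>.
  The remaining costs near the critical set are integrals of continuous functions, which pass to the
  limit and are small because \<open>ln \<bar>f'\<bar>\<close> is \<open>\<mu>\<close>-integrable. The partition \<open>Q\<close> is arbitrary for each map: it is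
  coded explicitly only outside a compact set of nearly full measure on which nearby points lie in
  the same cell of \<open>Q\<close>.

  If the exponent of \<open>\<mu>\<close> is negative, then so is, for \<open>g\<close> and \<open>\<nu>\<close> close to \<open>f\<close> and \<open>\<mu>\<close>, the mean growth over long time blocks,
  and a code that mainly records which blocks expand shows that the entropies tend to 0.
\<close>

text \<open>The times at which an orbit is followed at the scale \<epsilon> depend on the orbit, so
  the mean of the conditional cost over these times is not an integral. This is where ergodicity
  enters: the cost is replaced by its averages over time windows, and for \<mu> these exceed
  h(\<mu>) only by an amount of small mean. Every step is then charged one of two rates, either the
  windowed average or the rate of the critical passages, and the total is governed by the larger
  one.

  A second obstacle is uniformity in the map. The distance below which \<open>Q\<close> is constant
  on a compact set depends on the map and on \<open>Q\<close>; so may the depth \<open>Dm\<close>,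
  the grids and the lengths of the runs. Finally, the growth rate bounds long iterates and not a
  single step, so arcs are measured in an adapted distance in which one step expands by at most exp
  R.\<close>

section \<open>Codes and their costs\<close>

text \<open>The last clause is Kraft's inequality: \<open>u\<close> is the length of a code word, in nats.\<close>

definition gibbs :: "'a set \<Rightarrow> ('a \<Rightarrow> 'a \<Rightarrow> bool) \<Rightarrow> ('a \<Rightarrow> real) \<Rightarrow> bool" where
  "gibbs S E u \<longleftrightarrow> (\<forall>x\<in>S. E x x) \<and> (\<forall>x\<in>S. \<forall>y\<in>S. E x y \<longrightarrow> E y x) \<and>
     (\<forall>x\<in>S. \<forall>y\<in>S. \<forall>z\<in>S. E x y \<longrightarrow> E y z \<longrightarrow> E x z) \<and>
     (\<forall>x\<in>S. \<forall>y\<in>S. E x y \<longrightarrow> u x = u y) \<and>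
     (\<forall>Y. finite Y \<longrightarrow> Y \<subseteq> S \<longrightarrow> (\<forall>x\<in>Y. \<forall>y\<in>Y. E x y \<longrightarrow> x = y) \<longrightarrow> (\<Sum>y\<in>Y. exp (- u y)) \<le> 1)"

lemma gibbsD:
  assumes "gibbs S E u"
  shows "x \<in> S \<Longrightarrow> E x x" "x \<in> S \<Longrightarrow> y \<in> S \<Longrightarrow> E x y \<Longrightarrow> E y x"
    "x \<in> S \<Longrightarrow> y \<in> S \<Longrightarrow> z \<in> S \<Longrightarrow> E x y \<Longrightarrow> E y z \<Longrightarrow> E x z"
    "x \<in> S \<Longrightarrow> y \<in> S \<Longrightarrow> E x y \<Longrightarrow> u x = u y"
    "finite Y \<Longrightarrow> Y \<subseteq> S \<Longrightarrow> (\<And>x y. x \<in> Y \<Longrightarrow> y \<in> Y \<Longrightarrow> E x y \<Longrightarrow> x = y) \<Longrightarrow>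
      (\<Sum>y\<in>Y. exp (- u y)) \<le> 1"
proof -
  note a = assms[unfolded gibbs_def]
  show "x \<in> S \<Longrightarrow> E x x" using conjunct1[OF a] by blast
  show "x \<in> S \<Longrightarrow> y \<in> S \<Longrightarrow> E x y \<Longrightarrow> E y x" using conjunct1[OF conjunct2[OF a]] by blast
  show "x \<in> S \<Longrightarrow> y \<in> S \<Longrightarrow> z \<in> S \<Longrightarrow> E x y \<Longrightarrow> E y z \<Longrightarrow> E x z"
    using conjunct1[OF conjunct2[OF conjunct2[OF a]]] by blast
  show "x \<in> S \<Longrightarrow> y \<in> S \<Longrightarrow> E x y \<Longrightarrow> u x = u y"
    using conjunct1[OF conjunct2[OF conjunct2[OF conjunct2[OF a]]]] by blast
  show "finite Y \<Longrightarrow> Y \<subseteq> S \<Longrightarrow> (\<And>x y. x \<in> Y \<Longrightarrow> y \<in> Y \<Longrightarrow> E x y \<Longrightarrow> x = y) \<Longrightarrow>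
      (\<Sum>y\<in>Y. exp (- u y)) \<le> 1"
    using conjunct2[OF conjunct2[OF conjunct2[OF conjunct2[OF a]]]] by simp
qed

lemma gibbs_trivial: "gibbs S (\<lambda>x y. True) (\<lambda>x. 0)"
proof -
  have "(\<Sum>y\<in>Y. exp (- 0)) \<le> (1::real)" if "finite Y" "\<forall>x\<in>Y. \<forall>y\<in>Y. x = y" for Y :: "'a set"
  proof -
    have "card Y \<le> Suc 0" using that by (subst card_le_Suc0_iff_eq) auto
    then show ?thesis by simp
  qed
  then show ?thesis unfolding gibbs_def by auto
qed

text \<open>The chain rule for code lengths. Inequivalent points are grouped by their old class. On
  a group \<open>u\<close> is constant and the new symbols are distinct, so the weights
  \<open>exp (- v)\<close> of a group sum to at most 1, and Kraft's inequality for one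
  representative of each group finishes the estimate. The hypothesis concerns one class at a time,
  so that symbols may be weighted differently in each old class.\<close>

lemma gibbs_step:
  assumes g: "gibbs S E u"
    and v: "\<And>x y. x \<in> S \<Longrightarrow> y \<in> S \<Longrightarrow> E x y \<Longrightarrow> c x = c y \<Longrightarrow> v x = v y"
    and le: "\<And>Y. finite Y \<Longrightarrow> Y \<subseteq> S \<Longrightarrow> Y \<noteq> {} \<Longrightarrow> (\<And>x y. x \<in> Y \<Longrightarrow> y \<in> Y \<Longrightarrow> E x y) \<Longrightarrow>
        inj_on c Y \<Longrightarrow> (\<Sum>y\<in>Y. exp (- v y)) \<le> 1"
  shows "gibbs S (\<lambda>x y. E x y \<and> c x = c y) (\<lambda>x. u x + v x)"
proof -
  note D = gibbsD[OF g]
  have main: "(\<Sum>y\<in>Y. exp (- (u y + v y))) \<le> 1"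
    if Y: "finite Y" "Y \<subseteq> S" "\<forall>x\<in>Y. \<forall>y\<in>Y. E x y \<and> c x = c y \<longrightarrow> x = y" for Y
  proof -
    define K where "K y = {x\<in>Y. E y x}" for y
    define rep where "rep A = (SOME y. y \<in> A)" for A :: "'a set"
    have repK: "rep (K y) \<in> K y" if "y \<in> Y" for y
      unfolding rep_def by (rule someI[of _ y]) (use that Y D(1) in \<open>auto simp: K_def\<close>)
    have Keq: "K x = K y" if "x \<in> Y" "y \<in> Y" "E x y" for x y
      unfolding K_def using that Y(2) D(2,3) by blast
    define Z where "Z = (\<lambda>y. rep (K y)) ` Y"
    have Zs: "Z \<subseteq> Y" using repK by (auto simp: Z_def K_def)
    have repE: "E y (rep (K y))" if "y \<in> Y" for y using repK[OF that] by (simp add: K_def)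
    have Zsep: "x = y" if "x \<in> Z" "y \<in> Z" "E x y" for x y
    proof -
      from that obtain a b where ab: "a \<in> Y" "b \<in> Y" "x = rep (K a)" "y = rep (K b)" by (auto simp: Z_def)
      have "K a = K x" using Keq[of a x] ab repE[of a] Zs that by auto
      moreover have "K b = K y" using Keq[of b y] ab repE[of b] Zs that by auto
      moreover have "K x = K y" using Keq that Zs by auto
      ultimately show ?thesis using ab by simp
    qed
    have "(\<Sum>y\<in>Y. exp (- (u y + v y))) = (\<Sum>z\<in>Z. \<Sum>y\<in>{y\<in>Y. rep (K y) = z}. exp (- (u y + v y)))"
      by (rule sum.group[symmetric]) (use Y in \<open>auto simp: Z_def\<close>)
    also have "\<dots> \<le> (\<Sum>z\<in>Z. exp (- u z))"
    proof (rule sum_mono)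
      fix z assume z: "z \<in> Z"
      let ?F = "{y\<in>Y. rep (K y) = z}"
      have Ez: "E y z" if "y \<in> ?F" for y using repE[of y] that by auto
      have zS: "z \<in> S" using z Zs Y by auto
      have EF: "E x y" if "x \<in> ?F" "y \<in> ?F" for x y
        using Ez[OF that(1)] Ez[OF that(2)] D(2)[of y z] D(3)[of x z y] that Y zS by auto
      have "(\<Sum>y\<in>?F. exp (- (u y + v y))) = (\<Sum>y\<in>?F. exp (- u z) * exp (- v y))"
        by (rule sum.cong) (use D(4) Ez zS Y in \<open>auto simp: exp_add[symmetric] subset_eq\<close>)
      also have "\<dots> = exp (- u z) * (\<Sum>y\<in>?F. exp (- v y))" by (simp add: sum_distrib_left)
      also have "\<dots> \<le> exp (- u z) * 1"
      proof (rule mult_left_mono)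
        show "(\<Sum>y\<in>?F. exp (- v y)) \<le> 1"
        proof (cases "?F = {}")
          case False
          show ?thesis
          proof (rule le)
            show "inj_on c ?F" using Y(3) EF by (auto simp: inj_on_def)
          qed (use Y False EF in auto)
        next
          case True
          show ?thesis unfolding True by simp
        qed
      qed simp
      finally show "(\<Sum>y\<in>?F. exp (- (u y + v y))) \<le> exp (- u z)" by simp
    qed
    also have "\<dots> \<le> 1"
      by (rule D(5)) (use Y Zs Zsep finite_subset in auto)
    finally show ?thesis .
  qed
  have "\<forall>x\<in>S. E x x \<and> c x = c x" using D(1) by blast
  moreover have "\<forall>x\<in>S. \<forall>y\<in>S. E x y \<and> c x = c y \<longrightarrow> E y x \<and> c y = c x" using D(2) by auto
  moreover have "\<forall>x\<in>S. \<forall>y\<in>S. \<forall>z\<in>S. E x y \<and> c x = c y \<longrightarrow> E y z \<and> c y = c z \<longrightarrow> E x z \<and> c x = c z"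
    by (intro ballI impI conjI) (use D(3) in blast, simp)
  moreover have "\<forall>x\<in>S. \<forall>y\<in>S. E x y \<and> c x = c y \<longrightarrow> u x + v x = u y + v y"
  proof (intro ballI impI)
    fix x y assume "x \<in> S" "y \<in> S" "E x y \<and> c x = c y"
    then show "u x + v x = u y + v y" using D(4)[of x y] v[of x y] by simp
  qed
  ultimately show ?thesis unfolding gibbs_def using main by (intro conjI allI impI) (assumption | blast)+
qed

text \<open>The uniform code: where at most \<open>exp v\<close> symbols occur in a class, each of
  them may be given the length \<open>v\<close>.\<close>

lemma gibbs_count:
  assumes g: "gibbs S E u"
    and v: "\<And>x y. x \<in> S \<Longrightarrow> y \<in> S \<Longrightarrow> E x y \<Longrightarrow> c x = c y \<Longrightarrow> v x = v y"
    and le: "\<And>Y y. finite Y \<Longrightarrow> Y \<subseteq> S \<Longrightarrow> (\<And>x y. x \<in> Y \<Longrightarrow> y \<in> Y \<Longrightarrow> E x y) \<Longrightarrow>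
        inj_on c Y \<Longrightarrow> y \<in> Y \<Longrightarrow> real (card Y) \<le> exp (v y)"
  shows "gibbs S (\<lambda>x y. E x y \<and> c x = c y) (\<lambda>x. u x + v x)"
proof (rule gibbs_step[OF g v])
  fix Y assume Y: "finite Y" "Y \<subseteq> S" "Y \<noteq> {}" "\<And>x y. x \<in> Y \<Longrightarrow> y \<in> Y \<Longrightarrow> E x y" "inj_on c Y"
  have "card Y > 0" using Y by (simp add: card_gt_0_iff)
  have "(\<Sum>y\<in>Y. exp (- v y)) \<le> (\<Sum>y\<in>Y. 1 / real (card Y))"
  proof (rule sum_mono)
    fix y assume "y \<in> Y"
    then have "real (card Y) \<le> exp (v y)" using le[of Y y] Y by blast
    then show "exp (- v y) \<le> 1 / real (card Y)"
      using \<open>card Y > 0\<close> by (simp add: exp_minus inverse_eq_divide frac_le)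
  qed
  also have "\<dots> = 1" using \<open>card Y > 0\<close> by simp
  finally show "(\<Sum>y\<in>Y. exp (- v y)) \<le> 1" .
qed

lemma gibbs_weaken:
  assumes "gibbs S E u" "\<And>x y. x \<in> S \<Longrightarrow> y \<in> S \<Longrightarrow> E x y = E' x y" "\<And>x. x \<in> S \<Longrightarrow> u x = u' x"
  shows "gibbs S E' u'"
proof -
  note D = gibbsD[OF assms(1)]
  have 1: "\<forall>x\<in>S. E' x x" using D(1) assms(2) by blast
  have 2: "\<forall>x\<in>S. \<forall>y\<in>S. E' x y \<longrightarrow> E' y x" using D(2) assms(2) by blast
  have 3: "\<forall>x\<in>S. \<forall>y\<in>S. \<forall>z\<in>S. E' x y \<longrightarrow> E' y z \<longrightarrow> E' x z"
  proof (intro ballI impI)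
    fix x y z assume "x \<in> S" "y \<in> S" "z \<in> S" "E' x y" "E' y z"
    then show "E' x z" using D(3)[of x y z] assms(2) by simp
  qed
  have 4: "\<forall>x\<in>S. \<forall>y\<in>S. E' x y \<longrightarrow> u' x = u' y"
  proof (intro ballI impI)
    fix x y assume "x \<in> S" "y \<in> S" "E' x y"
    then show "u' x = u' y" using D(4)[of x y] assms(2,3) by simp
  qed
  have 5: "(\<Sum>y\<in>Y. exp (- u' y)) \<le> 1"
    if "finite Y" "Y \<subseteq> S" "\<forall>x\<in>Y. \<forall>y\<in>Y. E' x y \<longrightarrow> x = y" for Y
  proof -
    have "(\<Sum>y\<in>Y. exp (- u' y)) = (\<Sum>y\<in>Y. exp (- u y))"
      by (rule sum.cong) (use assms(3) that in auto)
    also have "\<dots> \<le> 1" by (rule D(5)) (use that assms(2) in blast)+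
    finally show ?thesis .
  qed
  show ?thesis unfolding gibbs_def using 1 2 3 4 5 by (intro conjI allI impI) (assumption | blast)+
qed

section \<open>Partitions into level sets and Gibbs' inequality\<close>

definition fibers :: "'a set \<Rightarrow> ('a \<Rightarrow> 'b) \<Rightarrow> 'a set set" where
  "fibers S c = (\<lambda>x. {y\<in>S. c y = c x}) ` S"

lemma partition_on_fibers: "partition_on S (fibers S c)"
  unfolding partition_on_def fibers_def disjoint_def by auto

lemma fibers_image: "fibers S c = (\<lambda>v. {y\<in>S. c y = v}) ` (c ` S)"
  unfolding fibers_def by auto

lemma finite_fibers: "finite (c ` S) \<Longrightarrow> finite (fibers S c)"
  unfolding fibers_image by simp

lemma sum_fibers:
  assumes "finite (c ` S)"
  shows "(\<Sum>A\<in>fibers S c. f A) = (\<Sum>v\<in>c ` S. f {y\<in>S. c y = v})"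
  unfolding fibers_image by (subst sum.reindex) (auto simp: inj_on_def)

context prob_space begin

lemma finite_partition_sum:
  assumes "finite_partition M P"
  shows "(\<Sum>A\<in>P. measure M A) = 1"
proof -
  have "measure M (\<Union>P) = (\<Sum>A\<in>P. measure M A)"
    using assms by (intro measure_Union') (auto simp: finite_partition_def partition_on_def disjoint_def pairwise_def disjnt_def fmeasurable_eq_sets)
  moreover have "\<Union>P = space M" using assms by (auto simp: finite_partition_def partition_on_def)
  ultimately show ?thesis by (simp add: prob_space)
qed

text \<open>Relative entropy with respect to a sub-probability weight is nonnegative, by
  \<open>ln x \<le> x - 1\<close> applied to each cell. Null cells contribute nothing on the left,
  so \<open>w\<close> has to be positive only on cells of positive measure.\<close>

lemma gibbs_inequality:
  assumes P: "finite_partition M P"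
    and w: "\<And>A. A \<in> P \<Longrightarrow> measure M A > 0 \<Longrightarrow> w A > 0" "\<And>A. A \<in> P \<Longrightarrow> w A \<ge> 0" "(\<Sum>A\<in>P. w A) \<le> 1"
  shows "partition_entropy M P \<le> (\<Sum>A\<in>P. measure M A * (- ln (w A)))"
proof -
  have "measure M A * (- ln (measure M A)) - measure M A * (- ln (w A)) \<le> w A - measure M A" if "A \<in> P" for A
  proof (cases "measure M A = 0")
    case True then show ?thesis using w(2)[OF that] by simp
  next
    case False
    then have m: "measure M A > 0" by (simp add: zero_less_measure_iff)
    then have wA: "w A > 0" using w that by auto
    have "measure M A * (- ln (measure M A)) - measure M A * (- ln (w A)) = measure M A * ln (w A / measure M A)"
      using m wA by (simp add: ln_div algebra_simps)
    also have "\<dots> \<le> measure M A * (w A / measure M A - 1)"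
      by (rule mult_left_mono[OF ln_le_minus_one]) (use m wA in auto)
    also have "\<dots> = w A - measure M A" using m by (simp add: field_simps)
    finally show ?thesis .
  qed
  then have "(\<Sum>A\<in>P. measure M A * (- ln (measure M A)) - measure M A * (- ln (w A))) \<le> (\<Sum>A\<in>P. w A - measure M A)"
    by (rule sum_mono)
  also have "\<dots> \<le> 0" using w(3) finite_partition_sum[OF P] by (simp add: sum_subtractf)
  finally show ?thesis unfolding partition_entropy_def by (simp add: sum_subtractf sum_negf)
qed

lemma partition_entropy_nonneg:
  assumes P: "finite_partition M P"
  shows "partition_entropy M P \<ge> 0"
proof -
  have "measure M A * ln (measure M A) \<le> 0" if "A \<in> P" for A
    by (cases "measure M A = 0") (auto simp: mult_nonneg_nonpos zero_less_measure_iff)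
  then show ?thesis unfolding partition_entropy_def by (simp add: sum_nonpos)
qed

text \<open>Points chosen in different cells are inequivalent, because classes lie inside cells. So
  \<open>exp (- u)\<close> at points where \<open>u\<close> is almost minimal is a sub-probability
  weight on \<open>P\<close>, and Gibbs' inequality applies. Measurability of a code length
  \<open>u\<close> is never established; the majorant \<open>U\<close> is what gets
  integrated.\<close>

lemma gibbs_entropy:
  assumes P: "finite_partition M P"
    and g: "gibbs (space M) E u"
    and E: "\<And>x y A. A \<in> P \<Longrightarrow> x \<in> A \<Longrightarrow> y \<in> space M \<Longrightarrow> E x y \<Longrightarrow> y \<in> A"
    and U: "integrable M U" "\<And>x. x \<in> space M \<Longrightarrow> u x \<le> U x"
  shows "partition_entropy M P \<le> (\<integral>x. U x \<partial>M)"
proof (rule field_le_epsilon)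
  fix e :: real assume e: "e > 0"
  have P': "finite P" "P \<subseteq> sets M" "partition_on (space M) P" using P by (auto simp: finite_partition_def)
  have Pne: "A \<noteq> {}" and PS: "A \<subseteq> space M" if "A \<in> P" for A
    using that P' by (auto simp: partition_on_def)
  have bdd: "u x \<ge> 0" if "x \<in> space M" for x
    using gibbsD(5)[OF g, of "{x}"] that by simp
  \<comment> \<open>The infimum of \<open>u\<close> over a cell need not be attained. A loss of
    \<open>e\<close> in every cell is a loss of \<open>e\<close> in the mean.\<close>
  have "\<exists>y\<in>A. \<forall>x\<in>A. u y \<le> u x + e" if "A \<in> P" for A
  proof -
    have ne: "u ` A \<noteq> {}" and bd: "bdd_below (u ` A)" using Pne PS bdd that by (auto intro!: bdd_belowI[of _ 0])
    have "Inf (u ` A) < Inf (u ` A) + e" using e by simp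
    then obtain y where y: "y \<in> A" "u y < Inf (u ` A) + e" using cInf_lessD[OF ne] by blast
    have low: "Inf (u ` A) \<le> u x" if "x \<in> A" for x using bd that by (simp add: cInf_lower)
    have "u y \<le> u x + e" if "x \<in> A" for x using low[OF that] y(2) by linarith
    then show ?thesis using y(1) by blast
  qed
  then have "\<forall>A\<in>P. \<exists>y. y \<in> A \<and> (\<forall>x\<in>A. u y \<le> u x + e)" by blast
  from bchoice[OF this] obtain y where y': "\<forall>A\<in>P. y A \<in> A \<and> (\<forall>x\<in>A. u (y A) \<le> u x + e)" by blast
  then have y: "\<And>A. A \<in> P \<Longrightarrow> y A \<in> A" "\<And>A x. A \<in> P \<Longrightarrow> x \<in> A \<Longrightarrow> u (y A) \<le> u x + e" by blast+
  have dis: "A = B" if "A \<in> P" "B \<in> P" "x \<in> A" "x \<in> B" for A B x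
    using that P'(3) by (auto simp: partition_on_def disjoint_def)
  have inj: "inj_on y P" by (rule inj_onI) (use y(1) dis in metis)
  have sum1: "(\<Sum>A\<in>P. exp (- u (y A))) \<le> 1"
  proof -
    have "(\<Sum>z\<in>y ` P. exp (- u z)) \<le> 1"
    proof (rule gibbsD(5)[OF g])
      fix a b assume "a \<in> y ` P" "b \<in> y ` P" "E a b"
      then obtain A B where AB: "A \<in> P" "B \<in> P" "a = y A" "b = y B" by auto
      then have "b \<in> A" using E[of A a b] \<open>E a b\<close> y(1) PS by auto
      then show "a = b" using AB dis y(1) by metis
    qed (use P'(1) y(1) PS in auto)
    then show ?thesis using inj by (simp add: sum.reindex)
  qed
  have "partition_entropy M P \<le> (\<Sum>A\<in>P. measure M A * (- ln (exp (- u (y A)))))"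
    by (rule gibbs_inequality[OF P]) (use sum1 in auto)
  also have "\<dots> = (\<Sum>A\<in>P. measure M A * u (y A))" by simp
  also have "\<dots> \<le> (\<Sum>A\<in>P. (\<integral>x. (U x + e) * indicator A x \<partial>M))"
  proof (rule sum_mono)
    fix A assume A: "A \<in> P"
    then have As: "A \<in> sets M" using P' by auto
    have "measure M A * u (y A) = (\<integral>x. u (y A) * indicator A x \<partial>M)" using As by simp
    also have "\<dots> \<le> (\<integral>x. (U x + e) * indicator A x \<partial>M)"
    proof (rule integral_mono)
      show "integrable M (\<lambda>x. u (y A) * indicator A x)" using As by (simp add: emeasure_eq_measure)
      show "integrable M (\<lambda>x. (U x + e) * indicator A x)"
        using U(1) As by (intro integrable_real_mult_indicator) auto
      fix x assume x: "x \<in> space M"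
      show "u (y A) * indicator A x \<le> (U x + e) * indicator A x"
        using y(2)[OF A, of x] U(2)[OF x] by (auto simp: indicator_def)
    qed
    finally show "measure M A * u (y A) \<le> (\<integral>x. (U x + e) * indicator A x \<partial>M)" .
  qed
  also have "\<dots> = (\<integral>x. (\<Sum>A\<in>P. (U x + e) * indicator A x) \<partial>M)"
    using U(1) P' by (intro Bochner_Integration.integral_sum[symmetric] integrable_real_mult_indicator) auto
  also have "\<dots> = (\<integral>x. U x + e \<partial>M)"
  proof (rule Bochner_Integration.integral_cong)
    fix x assume x: "x \<in> space M"
    then obtain A where A: "A \<in> P" "x \<in> A" using P'(3) by (auto simp: partition_on_def)
    have "(\<Sum>B\<in>P. indicator B x) = (\<Sum>B\<in>P. if B = A then 1 else (0::real))"
      by (rule sum.cong) (use A dis in \<open>auto simp: indicator_def\<close>)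
    also have "\<dots> = 1" using A P'(1) by simp
    finally show "(\<Sum>A\<in>P. (U x + e) * indicator A x) = U x + e" by (simp add: sum_distrib_left[symmetric])
  qed simp
  also have "\<dots> = (\<integral>x. U x \<partial>M) + e" using U(1) by (simp add: prob_space)
  finally show "partition_entropy M P \<le> (\<integral>x. U x \<partial>M) + e" .
qed

end

section \<open>Entropy of labels\<close>

lemma fekete:
  fixes a :: "nat \<Rightarrow> real"
  assumes sub: "\<And>m n. a (m + n) \<le> a m + a n" and nn: "\<And>n. a n \<ge> 0"
  shows "convergent (\<lambda>n. a n / real n)" "n \<ge> 1 \<Longrightarrow> lim (\<lambda>n. a n / real n) \<le> a n / real n"
proof -
  define L where "L = (INF n\<in>{1..}. a n / real n)"
  have bdd: "bdd_below ((\<lambda>n. a n / real n) ` {1..})" by (rule bdd_belowI[of _ 0]) (use nn in auto)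
  have low: "L \<le> a n / real n" if "n \<ge> 1" for n
    unfolding L_def by (rule cINF_lower[OF bdd]) (use that in auto)
  have mult: "a (d * m) \<le> real d * a m + a 0" for d m
  proof (induction d)
    case (Suc d)
    have "a (Suc d * m) \<le> a m + a (d * m)" using sub[of m "d * m"] by simp
    then show ?case using Suc by (simp add: algebra_simps)
  qed simp
  have lim: "(\<lambda>n. a n / real n) \<longlonglongrightarrow> L"
  proof (rule LIMSEQ_I)
    fix e :: real assume e: "e > 0"
    have "L < L + e / 2" using e by simp
    then obtain m where m: "m \<ge> 1" "a m / real m < L + e / 2"
      unfolding L_def using cINF_less_iff[OF _ bdd, of "L + e/2"] unfolding L_def by auto
    \<comment> \<open>\<open>B\<close> covers the remainder \<open>n mod m\<close> and the term
      \<open>a 0\<close> that \<open>mult\<close> leaves over.\<close>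
    define B where "B = (\<Sum>i<m. a i) + a 0"
    have Bi: "a i + a 0 \<le> B" if "i < m" for i
      unfolding B_def using that nn by (intro add_right_mono member_le_sum) auto
    obtain N where N: "real N > 2 * B / e" using reals_Archimedean2 by blast
    have "norm (a n / real n - L) < e" if n: "n \<ge> max 1 N" for n
    proof -
      have n0: "real n > 0" and nN: "n \<ge> N" using n by auto
      have "a n \<le> a (n div m * m) + a (n mod m)" using sub[of "n div m * m" "n mod m"] by simp
      also have "\<dots> \<le> real (n div m) * a m + B"
        using mult[of "n div m" m] Bi[of "n mod m"] m by simp
      also have "real (n div m) * a m \<le> real n / real m * a m"
        by (intro mult_right_mono nn of_nat_div_le_of_nat)
      finally have "a n / real n \<le> (real n / real m * a m + B) / real n"
        using n0 by (intro divide_right_mono) auto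
      also have "\<dots> = a m / real m + B / real n" using n0 by (simp add: field_simps)
      also have "B / real n < e / 2"
      proof -
        have "2 * B / e < real n" using N nN by linarith
        then show ?thesis using e n0 by (simp add: field_simps)
      qed
      finally show ?thesis using m low[of n] n by auto
    qed
    then show "\<exists>no. \<forall>n\<ge>no. norm (a n / real n - L) < e" by blast
  qed
  then show "convergent (\<lambda>n. a n / real n)" by (auto simp: convergent_def)
  show "n \<ge> 1 \<Longrightarrow> lim (\<lambda>n. a n / real n) \<le> a n / real n"
    using low limI[OF lim] by simp
qed

definition word :: "('a \<Rightarrow> 'a) \<Rightarrow> ('a \<Rightarrow> 'b) \<Rightarrow> nat \<Rightarrow> 'a \<Rightarrow> 'b list" where
  "word T a n x = map (\<lambda>i. a ((T ^^ i) x)) [0..<n]"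

lemma word_0 [simp]: "word T a 0 x = []" by (simp add: word_def)
lemma length_word [simp]: "length (word T a n x) = n" by (simp add: word_def)
lemma word_Suc: "word T a (Suc n) x = word T a n x @ [a ((T ^^ n) x)]" by (simp add: word_def)

lemma word_add: "word T a (n + m) x = word T a n x @ word T a m ((T ^^ n) x)"
proof (induction m)
  case (Suc m)
  have "(T ^^ (n + m)) x = (T ^^ m) ((T ^^ n) x)" by (subst add.commute) (simp add: funpow_add)
  then show ?case using Suc by (simp add: word_Suc)
qed simp

lemma word_eq_iff: "word T a n x = word T a n y \<longleftrightarrow> (\<forall>i<n. a ((T ^^ i) x) = a ((T ^^ i) y))"
  by (auto simp: word_def)

text \<open>Labels take the place of partitions: a common refinement becomes a pair of labels and an
  itinerary becomes a list.\<close>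

definition fin_label :: "'a measure \<Rightarrow> ('a \<Rightarrow> 'b) \<Rightarrow> bool" where
  "fin_label M a \<longleftrightarrow> finite (a ` space M) \<and> (\<forall>v. {x\<in>space M. a x = v} \<in> sets M)"

definition label_prob :: "'a measure \<Rightarrow> ('a \<Rightarrow> 'b) \<Rightarrow> 'b \<Rightarrow> real" where
  "label_prob M a v = measure M {x\<in>space M. a x = v}"

definition label_entropy :: "'a measure \<Rightarrow> ('a \<Rightarrow> 'b) \<Rightarrow> real" where
  "label_entropy M a = partition_entropy M (fibers (space M) a)"

lemma label_entropy_eq:
  assumes "fin_label M a"
  shows "label_entropy M a = - (\<Sum>v\<in>a ` space M. label_prob M a v * ln (label_prob M a v))"
proof -
  have fin: "finite (a ` space M)" using assms by (simp add: fin_label_def)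
  show ?thesis unfolding label_entropy_def partition_entropy_def label_prob_def sum_fibers[OF fin] ..
qed

lemma finite_partition_fibers: "fin_label M a \<Longrightarrow> finite_partition M (fibers (space M) a)"
proof -
  assume "fin_label M a"
  then have "finite (a ` space M)" "fibers (space M) a \<subseteq> sets M" by (auto simp: fin_label_def fibers_def)
  then show ?thesis by (simp add: finite_partition_def partition_on_fibers finite_fibers)
qed

lemma label_prob_nonneg [simp]: "label_prob M a v \<ge> 0" by (simp add: label_prob_def)

lemma fin_label_measurable:
  assumes "fin_label M a" shows "a \<in> measurable M (count_space UNIV)"
proof (rule measurableI)
  fix A :: "'b set"
  have "a -` A \<inter> space M = (\<Union>v\<in>A \<inter> a ` space M. {x\<in>space M. a x = v})" by auto
  also have "\<dots> \<in> sets M" using assms by (intro sets.finite_UN) (auto simp: fin_label_def)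
  finally show "a -` A \<inter> space M \<in> sets M" .
qed auto

lemma fin_label_pair:
  assumes "fin_label M a" "fin_label M b" shows "fin_label M (\<lambda>x. h (a x) (b x))"
proof -
  have "(\<lambda>x. h (a x) (b x)) ` space M \<subseteq> (\<lambda>(u, v). h u v) ` (a ` space M \<times> b ` space M)" by auto
  then have fin: "finite ((\<lambda>x. h (a x) (b x)) ` space M)"
    by (rule finite_subset) (use assms in \<open>auto simp: fin_label_def\<close>)
  have "{x\<in>space M. h (a x) (b x) = v} \<in> sets M" for v
  proof -
    have "{x\<in>space M. h (a x) (b x) = v} =
      (\<Union>(u, w)\<in>{(u, w)\<in>a ` space M \<times> b ` space M. h u w = v}. {x\<in>space M. a x = u} \<inter> {x\<in>space M. b x = w})"
      by auto
    also have "\<dots> \<in> sets M"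
      by (intro sets.finite_UN) (use assms in \<open>auto simp: fin_label_def intro: finite_subset[of _ "a ` space M \<times> b ` space M"]\<close>)
    finally show ?thesis .
  qed
  with fin show ?thesis by (simp add: fin_label_def)
qed

lemma fin_label_const: "fin_label M (\<lambda>x. c)"
  unfolding fin_label_def by (auto simp: image_constant_conv)

lemma fin_label_comp:
  assumes "fin_label M a" "T \<in> measurable M M" shows "fin_label M (\<lambda>x. a (T x))"
proof -
  have sp: "T x \<in> space M" if "x \<in> space M" for x using assms(2) that by (rule measurable_space)
  have "(\<lambda>x. a (T x)) ` space M \<subseteq> a ` space M" using sp by auto
  then have "finite ((\<lambda>x. a (T x)) ` space M)" using assms(1) finite_subset by (auto simp: fin_label_def)
  moreover have "{x\<in>space M. a (T x) = v} \<in> sets M" for v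
  proof -
    have "T -` {x\<in>space M. a x = v} \<inter> space M \<in> sets M"
      by (rule measurable_sets[OF assms(2)]) (use assms(1) in \<open>simp add: fin_label_def\<close>)
    moreover have "{x\<in>space M. a (T x) = v} = T -` {x\<in>space M. a x = v} \<inter> space M" using sp by auto
    ultimately show ?thesis by simp
  qed
  ultimately show ?thesis by (simp add: fin_label_def)
qed

lemma funpow_measurable: "T \<in> measurable M M \<Longrightarrow> (T ^^ n) \<in> measurable M M"
proof (induction n)
  case (Suc n)
  have "T \<circ> T ^^ n \<in> measurable M M" by (rule measurable_comp) (use Suc in auto)
  then show ?case unfolding funpow.simps .
qed (simp add: id_def)

lemma fin_label_word:
  assumes "fin_label M a" "T \<in> measurable M M" shows "fin_label M (word T a n)"
proof (induction n)
  case 0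
  have "word T a 0 = (\<lambda>x. [])" by (rule ext) simp
  then show ?case by (simp add: fin_label_const)
next
  case (Suc n)
  have "fin_label M (\<lambda>x. a ((T ^^ n) x))" by (rule fin_label_comp[OF assms(1) funpow_measurable[OF assms(2)]])
  from fin_label_pair[OF Suc this, of "\<lambda>w s. w @ [s]"] show ?case
    by (simp add: word_Suc[abs_def])
qed

definition cell :: "'a set set \<Rightarrow> 'a \<Rightarrow> 'a set" where
  "cell P x = (THE A. A \<in> P \<and> x \<in> A)"

lemma cell_eq: "partition_on S P \<Longrightarrow> A \<in> P \<Longrightarrow> x \<in> A \<Longrightarrow> cell P x = A"
  unfolding cell_def by (rule the_equality) (auto simp: partition_on_def disjoint_def)

lemma cell_in: "partition_on S P \<Longrightarrow> x \<in> S \<Longrightarrow> cell P x \<in> P \<and> x \<in> cell P x"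
proof -
  assume P: "partition_on S P" and x: "x \<in> S"
  then obtain A where "A \<in> P" "x \<in> A" by (auto simp: partition_on_def)
  then show ?thesis using cell_eq[OF P] by auto
qed

lemma fin_label_cell: "finite_partition M P \<Longrightarrow> fin_label M (cell P)"
proof -
  assume P: "finite_partition M P"
  then have p: "partition_on (space M) P" by (simp add: finite_partition_def)
  have "cell P ` space M \<subseteq> P" using cell_in[OF p] by auto
  moreover have "{x\<in>space M. cell P x = v} = (if v \<in> P then v else {})" for v
    using cell_in[OF p] cell_eq[OF p] p by (auto simp: partition_on_def)
  ultimately show ?thesis using P unfolding fin_label_def finite_partition_def
    by (auto intro: finite_subset)
qed

lemma dyn_join_eq:
  assumes P: "partition_on (space M) P" and T: "\<And>x. x \<in> space M \<Longrightarrow> T x \<in> space M"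
  shows "dyn_join M T P n = fibers (space M) (word T (cell P) n)"
proof -
  have Tn: "(T ^^ i) x \<in> space M" if "x \<in> space M" for i x by (induction i) (use that T in auto)
  have *: "(T ^^ i) y \<in> A \<longleftrightarrow> cell P ((T ^^ i) y) = A" if "y \<in> space M" "A \<in> P" for y i A
    using cell_eq[OF P that(2)] cell_in[OF P Tn[OF that(1)]] by metis
  show ?thesis
  proof (intro equalityI subsetI)
    fix B assume "B \<in> dyn_join M T P n"
    then obtain A where A: "B \<noteq> {}" "A \<in> {..<n} \<rightarrow> P" "B = {x \<in> space M. \<forall>i<n. (T ^^ i) x \<in> A i}"
      by (auto simp: dyn_join_def)
    then obtain x where x: "x \<in> B" by auto
    have "B = {y\<in>space M. word T (cell P) n y = word T (cell P) n x}"
      using x A * by (auto simp: word_eq_iff Pi_def)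
    then show "B \<in> fibers (space M) (word T (cell P) n)" using x A by (auto simp: fibers_def)
  next
    fix B assume "B \<in> fibers (space M) (word T (cell P) n)"
    then obtain x where x: "x \<in> space M" "B = {y\<in>space M. word T (cell P) n y = word T (cell P) n x}"
      by (auto simp: fibers_def)
    have "B \<noteq> {}" using x by auto
    moreover have "(\<lambda>i. cell P ((T ^^ i) x)) \<in> {..<n} \<rightarrow> P" using cell_in[OF P Tn[OF x(1)]] by auto
    moreover have "B = {y\<in>space M. \<forall>i<n. (T ^^ i) y \<in> cell P ((T ^^ i) x)}"
      using x * cell_in[OF P Tn[OF x(1)]] by (auto simp: word_eq_iff)
    ultimately show "B \<in> dyn_join M T P n" unfolding dyn_join_def
      by (intro CollectI conjI bexI[of _ "\<lambda>i. cell P ((T ^^ i) x)"])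
  qed
qed

lemma fibers_cong:
  assumes "\<And>x y. x \<in> S \<Longrightarrow> y \<in> S \<Longrightarrow> (a x = a y) = (b x = b y)"
  shows "fibers S a = fibers S b"
proof -
  have "{y\<in>S. a y = a x} = {y\<in>S. b y = b x}" if "x \<in> S" for x using assms[OF _ that] by blast
  then show ?thesis unfolding fibers_def by (rule image_cong[OF refl])
qed

lemma dyn_join_fibers:
  assumes T: "\<And>x. x \<in> space M \<Longrightarrow> T x \<in> space M"
  shows "dyn_join M T (fibers (space M) a) n = fibers (space M) (word T a n)"
proof -
  have Tn: "(T ^^ i) x \<in> space M" if "x \<in> space M" for i x by (induction i) (use that T in auto)
  have c: "cell (fibers (space M) a) x = {y\<in>space M. a y = a x}" if "x \<in> space M" for x
    by (rule cell_eq[OF partition_on_fibers]) (use that in \<open>auto simp: fibers_def\<close>)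
  have eq: "(cell (fibers (space M) a) x = cell (fibers (space M) a) y) = (a x = a y)"
    if "x \<in> space M" "y \<in> space M" for x y
    using c that by (auto simp: set_eq_iff)
  have "dyn_join M T (fibers (space M) a) n = fibers (space M) (word T (cell (fibers (space M) a)) n)"
    by (rule dyn_join_eq[OF partition_on_fibers T])
  also have "\<dots> = fibers (space M) (word T a n)"
    by (rule fibers_cong) (use Tn eq in \<open>auto simp: word_eq_iff\<close>)
  finally show ?thesis .
qed

section \<open>Entropy of a measure-preserving map through words\<close>

locale mpt = prob_space M for M :: "'a measure" +
  fixes T :: "'a \<Rightarrow> 'a"
  assumes T_meas [measurable]: "T \<in> measurable M M" and T_inv: "distr M M T = M"
begin

lemma T_space: "x \<in> space M \<Longrightarrow> T x \<in> space M"
  using T_meas by (rule measurable_space)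

lemma Tn_meas [measurable]: "(T ^^ n) \<in> measurable M M"
  by (rule funpow_measurable[OF T_meas])

lemma Tn_space: "x \<in> space M \<Longrightarrow> (T ^^ n) x \<in> space M"
  using Tn_meas by (rule measurable_space)

lemma Tn_inv: "distr M M (T ^^ n) = M"
proof (induction n)
  case 0 then show ?case by (simp add: id_def distr_id)
next
  case (Suc n)
  have "distr M M (T ^^ Suc n) = distr (distr M M (T ^^ n)) M T"
    by (subst distr_distr) (auto simp: comp_def)
  then show ?case unfolding Suc T_inv .
qed

lemma measure_Tn:
  assumes "{x\<in>space M. Q x} \<in> sets M"
  shows "measure M {x\<in>space M. Q ((T ^^ n) x)} = measure M {x\<in>space M. Q x}"
proof -
  have "measure M {x\<in>space M. Q x} = measure (distr M M (T ^^ n)) {x\<in>space M. Q x}" by (simp add: Tn_inv)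
  also have "\<dots> = measure M ((T ^^ n) -` {x\<in>space M. Q x} \<inter> space M)"
    by (rule measure_distr[OF Tn_meas assms])
  also have "(T ^^ n) -` {x\<in>space M. Q x} \<inter> space M = {x\<in>space M. Q ((T ^^ n) x)}"
    using Tn_space by auto
  finally show ?thesis by simp
qed

lemma integral_Tn:
  fixes f :: "'a \<Rightarrow> real"
  assumes "f \<in> borel_measurable M"
  shows "(\<integral>x. f ((T ^^ n) x) \<partial>M) = (\<integral>x. f x \<partial>M)"
  using integral_distr[OF Tn_meas assms, of n] by (simp add: Tn_inv)

lemma integrable_Tn:
  fixes f :: "'a \<Rightarrow> real"
  assumes "integrable M f"
  shows "integrable M (\<lambda>x. f ((T ^^ n) x))"
  using integrable_distr[OF Tn_meas, of n f] assms by (simp add: Tn_inv)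

lemma label_sum: 
  assumes "fin_label M a" shows "(\<Sum>v\<in>a ` space M. label_prob M a v) = 1"
proof -
  have fin: "finite (a ` space M)" using assms by (simp add: fin_label_def)
  show ?thesis using finite_partition_sum[OF finite_partition_fibers[OF assms]]
    unfolding sum_fibers[OF fin] label_prob_def .
qed

lemma label_prob_word_shift:
  assumes "fin_label M a"
  shows "measure M {x\<in>space M. word T a m ((T ^^ n) x) = v} = label_prob M (word T a m) v"
  unfolding label_prob_def
  by (rule measure_Tn[where Q = "\<lambda>x. word T a m x = v"]) (use fin_label_word[OF assms T_meas, of m] in \<open>simp add: fin_label_def\<close>)

text \<open>Gibbs' inequality with the product of the two marginals as weight: the logarithm of the
  product splits, and each half is the entropy of one marginal. Invariance identifies the law of the
  last \<open>m\<close> symbols with that of the first \<open>m\<close>.\<close>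

lemma entropy_subadditive:
  assumes a: "fin_label M a"
  shows "label_entropy M (word T a (n + m)) \<le> label_entropy M (word T a n) + label_entropy M (word T a m)"
proof -
  note fw = fin_label_word[OF a T_meas]
  let ?W = "\<lambda>n. word T a n ` space M"
  let ?p = "\<lambda>n. label_prob M (word T a n)"
  have fin: "finite (?W k)" for k using fw by (simp add: fin_label_def)
  have sets: "{x\<in>space M. word T a k x = v} \<in> sets M" for k v using fw by (simp add: fin_label_def)
  have split: "take n v \<in> ?W n \<and> drop n v \<in> ?W m" if "v \<in> ?W (n + m)" for v
    using that Tn_space by (auto simp: word_add)
  have imt: "take n ` ?W (n + m) \<subseteq> ?W n" and imd: "drop n ` ?W (n + m) \<subseteq> ?W m" using split by blast+
  have le1: "?p (n + m) v \<le> ?p n (take n v)" for v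
    unfolding label_prob_def by (rule finite_measure_mono) (use sets in \<open>auto simp: word_add\<close>)
  have sets2: "{x\<in>space M. word T a m ((T ^^ n) x) = v} \<in> sets M" for v
    using fin_label_comp[OF fw Tn_meas, of m n] by (simp add: fin_label_def)
  have le2: "?p (n + m) v \<le> ?p m (drop n v)" for v
    unfolding label_prob_word_shift[OF a, of m n, symmetric] unfolding label_prob_def
    by (rule finite_measure_mono) (use sets2 in \<open>auto simp: word_add\<close>)
  \<comment> \<open>The weight must be a function of the cell, which is a set, so its word is read
    off at an arbitrary point of the cell.\<close>
  define w where "w A = (let v = word T a (n + m) (SOME x. x \<in> A) in ?p n (take n v) * ?p m (drop n v))" for A
  have wv: "w {x\<in>space M. word T a (n + m) x = v} = ?p n (take n v) * ?p m (drop n v)"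
    if "v \<in> ?W (n + m)" for v
  proof -
    have "(SOME x. x \<in> {x\<in>space M. word T a (n + m) x = v}) \<in> {x\<in>space M. word T a (n + m) x = v}"
      by (rule someI_ex) (use that in auto)
    then show ?thesis unfolding w_def Let_def by auto
  qed
  have meas_eq: "measure M {x\<in>space M. word T a (n + m) x = v} = ?p (n + m) v" for v
    by (simp add: label_prob_def)
  have inj: "inj_on (\<lambda>v. (take n v, drop n v)) (?W (n + m))"
    by (rule inj_onI) (metis append_take_drop_id prod.inject)
  have "label_entropy M (word T a (n + m)) \<le>
    (\<Sum>A\<in>fibers (space M) (word T a (n + m)). measure M A * (- ln (w A)))"
    unfolding label_entropy_def
  proof (rule gibbs_inequality[OF finite_partition_fibers[OF fw]])
    show "w A > 0" if "A \<in> fibers (space M) (word T a (n + m))" "measure M A > 0" for A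
    proof -
      from that(1) obtain v where v: "v \<in> ?W (n + m)" "A = {x\<in>space M. word T a (n + m) x = v}"
        by (auto simp: fibers_image)
      then have "?p (n + m) v > 0" using that(2) meas_eq by simp
      then show ?thesis using le1[of v] le2[of v] wv[OF v(1)] v(2) by (simp add: mult_pos_pos)
    qed
    show "w A \<ge> 0" for A unfolding w_def Let_def by simp
    have "(\<Sum>A\<in>fibers (space M) (word T a (n + m)). w A) = (\<Sum>v\<in>?W (n + m). ?p n (take n v) * ?p m (drop n v))"
      by (subst sum_fibers[OF fin]) (auto intro!: sum.cong simp del: image_iff simp: wv)
    also have "\<dots> = (\<Sum>(s, t)\<in>(\<lambda>v. (take n v, drop n v)) ` ?W (n + m). ?p n s * ?p m t)"
      by (subst sum.reindex[OF inj]) (simp add: comp_def)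
    also have "\<dots> \<le> (\<Sum>(s, t)\<in>?W n \<times> ?W m. ?p n s * ?p m t)"
      by (rule sum_mono2) (use split fin in auto)
    also have "\<dots> = (\<Sum>s\<in>?W n. ?p n s) * (\<Sum>t\<in>?W m. ?p m t)"
      by (simp add: sum_product sum.cartesian_product)
    also have "\<dots> = 1" using label_sum[OF fw] by simp
    finally show "(\<Sum>A\<in>fibers (space M) (word T a (n + m)). w A) \<le> 1" .
  qed
  also have "\<dots> = (\<Sum>v\<in>?W (n + m). ?p (n + m) v * (- ln (?p n (take n v) * ?p m (drop n v))))"
    by (subst sum_fibers[OF fin]) (auto intro!: sum.cong simp del: image_iff simp: wv meas_eq)
  also have "\<dots> = (\<Sum>v\<in>?W (n + m). ?p (n + m) v * (- ln (?p n (take n v)))) +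
      (\<Sum>v\<in>?W (n + m). ?p (n + m) v * (- ln (?p m (drop n v))))"
  proof -
    have st: "?p (n + m) v * (- ln (?p n (take n v) * ?p m (drop n v))) =
      ?p (n + m) v * (- ln (?p n (take n v))) + ?p (n + m) v * (- ln (?p m (drop n v)))" for v
    proof (cases "?p (n + m) v = 0")
      case False
      then have "?p (n + m) v > 0" using label_prob_nonneg[of M "word T a (n + m)" v] by linarith
      then have "?p n (take n v) > 0" "?p m (drop n v) > 0" using le1[of v] le2[of v] by linarith+
      then show ?thesis by (simp add: ln_mult algebra_simps)
    qed simp
    show ?thesis by (subst sum.distrib[symmetric]) (rule sum.cong[OF refl], rule st)
  qed
  \<comment> \<open>Summing the joint probabilities over all continuations of a word leaves the
    probability of the word.\<close>
  also have "(\<Sum>v\<in>?W (n + m). ?p (n + m) v * (- ln (?p n (take n v)))) = label_entropy M (word T a n)"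
  proof -
    have "(\<Sum>v\<in>?W (n + m). ?p (n + m) v * (- ln (?p n (take n v)))) =
      (\<Sum>s\<in>?W n. \<Sum>v\<in>{v\<in>?W (n + m). take n v = s}. ?p (n + m) v * (- ln (?p n (take n v))))"
      by (rule sum.group[symmetric]) (fact fin fin imt imd)+
    also have "\<dots> = (\<Sum>s\<in>?W n. ?p n s * (- ln (?p n s)))"
    proof (rule sum.cong[OF refl])
      fix s assume "s \<in> ?W n"
      have "?p n s = measure M (\<Union>v\<in>{v\<in>?W (n + m). take n v = s}. {x\<in>space M. word T a (n + m) x = v})"
        unfolding label_prob_def by (rule arg_cong[of _ _ "measure M"]) (auto simp: word_add)
      also have "\<dots> = (\<Sum>v\<in>{v\<in>?W (n + m). take n v = s}. ?p (n + m) v)"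
        unfolding label_prob_def by (rule measure_UNION') (use fin sets in \<open>auto simp: pairwise_def disjnt_def fmeasurable_eq_sets\<close>)
      finally have "(\<Sum>v\<in>{v\<in>?W (n + m). take n v = s}. ?p (n + m) v) * (- ln (?p n s)) = ?p n s * (- ln (?p n s))" by simp
      moreover have "(\<Sum>v\<in>{v\<in>?W (n + m). take n v = s}. ?p (n + m) v * (- ln (?p n (take n v)))) =
          (\<Sum>v\<in>{v\<in>?W (n + m). take n v = s}. ?p (n + m) v * (- ln (?p n s)))"
        by (rule sum.cong) auto
      ultimately show "(\<Sum>v\<in>{v\<in>?W (n + m). take n v = s}. ?p (n + m) v * (- ln (?p n (take n v)))) = ?p n s * (- ln (?p n s))"
        by (simp only: sum_distrib_right)
    qed
    finally show ?thesis by (simp only: label_entropy_eq[OF fw] mult_minus_right sum_negf)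
  qed
  also have "(\<Sum>v\<in>?W (n + m). ?p (n + m) v * (- ln (?p m (drop n v)))) = label_entropy M (word T a m)"
  proof -
    have "(\<Sum>v\<in>?W (n + m). ?p (n + m) v * (- ln (?p m (drop n v)))) =
      (\<Sum>s\<in>?W m. \<Sum>v\<in>{v\<in>?W (n + m). drop n v = s}. ?p (n + m) v * (- ln (?p m (drop n v))))"
      by (rule sum.group[symmetric]) (fact fin fin imt imd)+
    also have "\<dots> = (\<Sum>s\<in>?W m. ?p m s * (- ln (?p m s)))"
    proof (rule sum.cong[OF refl])
      fix s assume "s \<in> ?W m"
      have "?p m s = measure M (\<Union>v\<in>{v\<in>?W (n + m). drop n v = s}. {x\<in>space M. word T a (n + m) x = v})"
        unfolding label_prob_word_shift[OF a, of m n, symmetric] unfolding label_prob_def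
        by (rule arg_cong[of _ _ "measure M"]) (auto simp: word_add)
      also have "\<dots> = (\<Sum>v\<in>{v\<in>?W (n + m). drop n v = s}. ?p (n + m) v)"
        unfolding label_prob_def by (rule measure_UNION') (use fin sets in \<open>auto simp: pairwise_def disjnt_def fmeasurable_eq_sets\<close>)
      finally have "(\<Sum>v\<in>{v\<in>?W (n + m). drop n v = s}. ?p (n + m) v) * (- ln (?p m s)) = ?p m s * (- ln (?p m s))" by simp
      moreover have "(\<Sum>v\<in>{v\<in>?W (n + m). drop n v = s}. ?p (n + m) v * (- ln (?p m (drop n v)))) =
          (\<Sum>v\<in>{v\<in>?W (n + m). drop n v = s}. ?p (n + m) v * (- ln (?p m s)))"
        by (rule sum.cong) auto
      ultimately show "(\<Sum>v\<in>{v\<in>?W (n + m). drop n v = s}. ?p (n + m) v * (- ln (?p m (drop n v)))) = ?p m s * (- ln (?p m s))"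
        by (simp only: sum_distrib_right)
    qed
    finally show ?thesis by (simp only: label_entropy_eq[OF fw] mult_minus_right sum_negf)
  qed
  finally show ?thesis .
qed

lemma label_entropy_nonneg: "fin_label M a \<Longrightarrow> label_entropy M a \<ge> 0"
  unfolding label_entropy_def by (rule partition_entropy_nonneg[OF finite_partition_fibers])

lemma entropy_wrt_fibers:
  assumes "fin_label M a"
  shows "(\<lambda>n. label_entropy M (word T a n) / real n) \<longlonglongrightarrow> metric_entropy_wrt M T (fibers (space M) a)"
    "n \<ge> 1 \<Longrightarrow> metric_entropy_wrt M T (fibers (space M) a) \<le> label_entropy M (word T a n) / real n"
proof -
  have eq: "metric_entropy_wrt M T (fibers (space M) a) = lim (\<lambda>n. label_entropy M (word T a n) / real n)"
    unfolding metric_entropy_wrt_def label_entropy_def using T_space by (subst dyn_join_fibers) auto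
  note F = fekete[of "\<lambda>n. label_entropy M (word T a n)", OF entropy_subadditive[OF assms]
      label_entropy_nonneg[OF fin_label_word[OF assms T_meas]]]
  show "(\<lambda>n. label_entropy M (word T a n) / real n) \<longlonglongrightarrow> metric_entropy_wrt M T (fibers (space M) a)"
    unfolding eq using F(1) by (simp add: convergent_LIMSEQ_iff)
  show "n \<ge> 1 \<Longrightarrow> metric_entropy_wrt M T (fibers (space M) a) \<le> label_entropy M (word T a n) / real n"
    unfolding eq by (rule F(2))
qed

lemma fibers_cell: "partition_on (space M) P \<Longrightarrow> fibers (space M) (cell P) = P"
proof -
  assume P: "partition_on (space M) P"
  have "{y\<in>space M. cell P y = cell P x} = cell P x" if "x \<in> space M" for x
    using cell_in[OF P] cell_eq[OF P] that P by (auto simp: partition_on_def)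
  then have "fibers (space M) (cell P) = cell P ` space M" unfolding fibers_def by (rule image_cong[OF refl])
  also have "\<dots> = P"
  proof (intro equalityI subsetI)
    fix A assume A: "A \<in> P"
    then have "A \<noteq> {}" using P by (auto simp: partition_on_def)
    then obtain x where "x \<in> A" by auto
    then show "A \<in> cell P ` space M" using A P cell_eq[OF P A, of x] by (intro image_eqI[of _ _ x]) (auto simp: partition_on_def)
  qed (use cell_in[OF P] in auto)
  finally show ?thesis .
qed

text \<open>A partition is the family of level sets of its own cell map, so labels whose values are
  sets suffice.\<close>

lemma metric_entropy_le:
  assumes "\<And>a :: 'a \<Rightarrow> 'a set. fin_label M a \<Longrightarrow> metric_entropy_wrt M T (fibers (space M) a) \<le> h"
  shows "metric_entropy M T \<le> ereal h"
  unfolding metric_entropy_def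
proof (rule SUP_least)
  fix P assume P: "P \<in> {P. finite_partition M P}"
  then have "metric_entropy_wrt M T (fibers (space M) (cell P)) \<le> h" by (intro assms fin_label_cell) simp
  then show "ereal (metric_entropy_wrt M T P) \<le> ereal h" using P fibers_cell by (simp add: finite_partition_def)
qed

lemma metric_entropy_ge:
  assumes "fin_label M a"
  shows "ereal (metric_entropy_wrt M T (fibers (space M) a)) \<le> metric_entropy M T"
  unfolding metric_entropy_def by (rule SUP_upper) (simp add: finite_partition_fibers[OF assms])

lemma metric_entropy_nonneg: "0 \<le> metric_entropy M T"
proof -
  have f: "fin_label M (\<lambda>x. 0::nat)" by (rule fin_label_const)
  have "0 \<le> metric_entropy_wrt M T (fibers (space M) (\<lambda>x. 0::nat))"
    by (rule LIMSEQ_le_const[OF entropy_wrt_fibers(1)[OF f]])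
      (auto intro!: exI[of _ 0] divide_nonneg_nonneg label_entropy_nonneg fin_label_word[OF f T_meas])
  then show ?thesis using metric_entropy_ge[OF f] by (meson ereal_less_eq(5) order_trans)
qed

text \<open>The increments are the entropies of the next symbol given the first \<open>q\<close>
  ones. Their Cesaro means converge to the entropy of the label, so they cannot all be at least
  \<open>h\<close>.\<close>

lemma entropy_increment:
  assumes a: "fin_label M a" and h: "metric_entropy_wrt M T (fibers (space M) a) < h"
  shows "\<exists>q. label_entropy M (word T a (Suc q)) - label_entropy M (word T a q) < h"
proof (rule ccontr)
  let ?H = "\<lambda>n. label_entropy M (word T a n)"
  assume "\<not> ?thesis"
  then have "?H (Suc q) - ?H q \<ge> h" for q by (simp add: not_less)
  then have step: "?H (Suc q) \<ge> ?H q + h" for q by (metis add.commute le_diff_eq)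
  have "?H n \<ge> real n * h + ?H 0" for n
  proof (induction n)
    case (Suc n)
    then show ?case using step[of n] by (simp add: algebra_simps)
  qed simp
  then have "?H n \<ge> real n * h" for n
    using label_entropy_nonneg[OF fin_label_word[OF a T_meas], of 0] by (smt (verit))
  then have "h \<le> ?H n / real n" if "n \<ge> 1" for n using that by (simp add: field_simps)
  then have "h \<le> metric_entropy_wrt M T (fibers (space M) a)"
    by (intro LIMSEQ_le_const[OF entropy_wrt_fibers(1)[OF a]]) auto
  then show False using h by simp
qed

end

section \<open>Birkhoff sums\<close>

context prob_space begin

lemma label_integral:
  fixes F :: "'b \<Rightarrow> real"
  assumes "fin_label M c"
  shows "(\<integral>x. F (c x) \<partial>M) = (\<Sum>v\<in>c ` space M. label_prob M c v * F v)"
    and "integrable M (\<lambda>x. F (c x))"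
proof -
  have fin: "finite (c ` space M)" and sets: "{x\<in>space M. c x = v} \<in> sets M" for v
    using assms by (auto simp: fin_label_def)
  have meas: "(\<lambda>x. F (c x)) \<in> borel_measurable M"
    using measurable_compose[OF fin_label_measurable[OF assms], of F borel] by simp
  have bdd: "\<exists>B. \<forall>x\<in>space M. \<bar>F (c x)\<bar> \<le> B"
    by (rule exI[of _ "\<Sum>v\<in>c ` space M. \<bar>F v\<bar>"]) (use fin in \<open>auto intro!: member_le_sum[of _ _ "\<lambda>v. \<bar>F v\<bar>"]\<close>)
  then obtain B where "\<forall>x\<in>space M. \<bar>F (c x)\<bar> \<le> B" by blast
  then show "integrable M (\<lambda>x. F (c x))"
    by (intro integrable_const_bound[of _ B] AE_I2 meas) auto
  have "(\<integral>x. F (c x) \<partial>M) = (\<integral>x. (\<Sum>v\<in>c ` space M. F v * indicator {x\<in>space M. c x = v} x) \<partial>M)"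
  proof (rule Bochner_Integration.integral_cong[OF refl])
    fix x assume x: "x \<in> space M"
    have "(\<Sum>v\<in>c ` space M. F v * indicator {x\<in>space M. c x = v} x) = (\<Sum>v\<in>c ` space M. if v = c x then F v else 0)"
      by (rule sum.cong) (use x in \<open>auto simp: indicator_def\<close>)
    also have "\<dots> = F (c x)" using x fin by simp
    finally show "F (c x) = (\<Sum>v\<in>c ` space M. F v * indicator {x\<in>space M. c x = v} x)" by simp
  qed
  also have "\<dots> = (\<Sum>v\<in>c ` space M. (\<integral>x. F v * indicator {x\<in>space M. c x = v} x \<partial>M))"
    by (rule Bochner_Integration.integral_sum) (use sets in \<open>auto simp: emeasure_eq_measure\<close>)
  also have "\<dots> = (\<Sum>v\<in>c ` space M. label_prob M c v * F v)"
    by (rule sum.cong[OF refl]) (use sets in \<open>simp add: label_prob_def mult.commute\<close>)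
  finally show "(\<integral>x. F (c x) \<partial>M) = (\<Sum>v\<in>c ` space M. label_prob M c v * F v)" .
qed

end

context mpt begin

text \<open>\<open>W v b\<close> is the conditional probability of the symbol \<open>b\<close> after
  the word \<open>v\<close>, mixed with a little of the uniform distribution. The mixture keeps
  \<open>W\<close> positive on words of probability 0, which may well occur for the nearby maps that
  the weight is used for.\<close>

lemma conditional_weight:
  fixes a :: "'a \<Rightarrow> nat"
  assumes a: "fin_label M a" and L: "L \<ge> 1"
    and h: "metric_entropy_wrt M T (fibers (space M) a) < h"
  obtains q W where "\<And>v b. W v b > 0" "\<And>v. (\<Sum>b<L. W v b) \<le> 1" "\<And>v b. b < L \<Longrightarrow> W v b \<le> 1"
    "(\<integral>x. - ln (W (word T a q x) (a ((T ^^ q) x))) \<partial>M) < h"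
proof -
  obtain q where q: "label_entropy M (word T a (Suc q)) - label_entropy M (word T a q) < h"
    using entropy_increment[OF a h] by blast
  define D where "D = label_entropy M (word T a (Suc q)) - label_entropy M (word T a q)"
  \<comment> \<open>The factor \<open>1 - \<delta>\<close> lengthens the code by
    \<open>(h - D) / 2\<close>, half of the room between the increment \<open>D\<close> and
    \<open>h\<close>.\<close>
  define \<delta> where "\<delta> = 1 - exp (- ((h - D) / 2))"
  have hD: "h - D > 0" using q by (simp add: D_def)
  have d: "\<delta> > 0" "\<delta> < 1" "- ln (1 - \<delta>) = (h - D) / 2"
    using hD unfolding \<delta>_def by auto
  let ?p = "\<lambda>n. label_prob M (word T a n)"
  define W where "W v b = (1 - \<delta>) * (?p (Suc q) (v @ [b]) / ?p q v) + \<delta> / real L" for v b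
  note fw = fin_label_word[OF a T_meas]
  have sets: "{x\<in>space M. word T a k x = v} \<in> sets M" for k v using fw by (simp add: fin_label_def)
  have pos: "W v b > 0" for v b
    unfolding W_def using d L by (intro add_nonneg_pos mult_nonneg_nonneg divide_nonneg_nonneg) auto
  have sum1: "(\<Sum>b<L. W v b) \<le> 1" for v
  proof -
    have "(\<Sum>b<L. ?p (Suc q) (v @ [b])) = measure M (\<Union>b<L. {x\<in>space M. word T a (Suc q) x = v @ [b]})"
      unfolding label_prob_def
      by (rule measure_UNION'[symmetric]) (use sets in \<open>auto simp: pairwise_def disjnt_def fmeasurable_eq_sets\<close>)
    also have "\<dots> \<le> ?p q v"
      unfolding label_prob_def by (rule finite_measure_mono) (use sets in \<open>auto simp: word_Suc\<close>)
    \<comment> \<open>If the word \<open>v\<close> has probability 0, the quotient is 0 by the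
      convention on division.\<close>
    finally have "(\<Sum>b<L. ?p (Suc q) (v @ [b])) / ?p q v \<le> 1"
      using label_prob_nonneg[of M "word T a q" v] by (cases "?p q v = 0") (simp_all add: divide_le_eq_1_pos less_le)
    then have "(1 - \<delta>) * ((\<Sum>b<L. ?p (Suc q) (v @ [b])) / ?p q v) \<le> (1 - \<delta>) * 1"
      using d by (intro mult_left_mono) auto
    moreover have "(\<Sum>b<L. W v b) = (1 - \<delta>) * ((\<Sum>b<L. ?p (Suc q) (v @ [b])) / ?p q v) + \<delta>"
      unfolding W_def using L by (simp add: sum.distrib sum_distrib_left sum_divide_distrib)
    ultimately show ?thesis by simp
  qed
  have le1: "W v b \<le> 1" if "b < L" for v b
  proof -
    have "W v b \<le> (\<Sum>b<L. W v b)" using that pos by (intro member_le_sum) (auto intro: less_imp_le)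
    then show ?thesis using sum1[of v] by simp
  qed
  let ?F = "\<lambda>u. - ln (W (take q u) (u ! q))"
  have F: "- ln (W (word T a q x) (a ((T ^^ q) x))) = ?F (word T a (Suc q) x)" for x
    by (simp add: word_Suc nth_append)
  have lower: "?p (Suc q) u \<le> ?p q (take q u)" for u
    unfolding label_prob_def by (rule finite_measure_mono) (use sets in \<open>auto simp: word_Suc\<close>)
  have "(\<integral>x. - ln (W (word T a q x) (a ((T ^^ q) x))) \<partial>M) =
     (\<Sum>u\<in>word T a (Suc q) ` space M. ?p (Suc q) u * ?F u)"
    unfolding F by (rule label_integral(1)[OF fw])
  also have "\<dots> \<le> (\<Sum>u\<in>word T a (Suc q) ` space M. ?p (Suc q) u * ((h - D) / 2) -
      ?p (Suc q) u * ln (?p (Suc q) u) + ?p (Suc q) u * ln (?p q (take q u)))"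
  proof (rule sum_mono)
    fix u assume "u \<in> word T a (Suc q) ` space M"
    then have u: "take q u @ [u ! q] = u" by (auto simp: word_Suc nth_append)
    show "?p (Suc q) u * ?F u \<le> ?p (Suc q) u * ((h - D) / 2) -
      ?p (Suc q) u * ln (?p (Suc q) u) + ?p (Suc q) u * ln (?p q (take q u))"
    proof (cases "?p (Suc q) u = 0")
      case False
      then have p: "?p (Suc q) u > 0" using label_prob_nonneg[of M "word T a (Suc q)" u] by linarith
      then have pq: "?p q (take q u) > 0" using lower[of u] by linarith
      have Wl: "W (take q u) (u ! q) \<ge> (1 - \<delta>) * (?p (Suc q) u / ?p q (take q u))"
        unfolding W_def u using d by simp
      have pp: "(1 - \<delta>) * (?p (Suc q) u / ?p q (take q u)) > 0" using d p pq by simp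
      have "ln ((1 - \<delta>) * (?p (Suc q) u / ?p q (take q u))) \<le> ln (W (take q u) (u ! q))"
        using Wl pp pos by (subst ln_le_cancel_iff) auto
      moreover have "ln ((1 - \<delta>) * (?p (Suc q) u / ?p q (take q u))) =
          ln (1 - \<delta>) + (ln (?p (Suc q) u) - ln (?p q (take q u)))"
        using d p pq by (subst ln_mult) (auto simp: ln_div)
      ultimately have "?F u \<le> (h - D) / 2 - ln (?p (Suc q) u) + ln (?p q (take q u))"
        using d(3) by linarith
      then have "?p (Suc q) u * ?F u \<le> ?p (Suc q) u * ((h - D) / 2 - ln (?p (Suc q) u) + ln (?p q (take q u)))"
        using p by (intro mult_left_mono) auto
      then show ?thesis by (simp add: algebra_simps)
    qed simp
  qed
  also have "\<dots> = (\<Sum>u\<in>word T a (Suc q) ` space M. ?p (Suc q) u) * ((h - D) / 2) -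
      (\<Sum>u\<in>word T a (Suc q) ` space M. ?p (Suc q) u * ln (?p (Suc q) u)) +
      (\<Sum>u\<in>word T a (Suc q) ` space M. ?p (Suc q) u * ln (?p q (take q u)))"
    by (simp only: sum.distrib sum_subtractf sum_distrib_right)
  also have "(\<Sum>u\<in>word T a (Suc q) ` space M. ?p (Suc q) u) = 1" by (rule label_sum[OF fw])
  also have "(\<Sum>u\<in>word T a (Suc q) ` space M. ?p (Suc q) u * ln (?p q (take q u))) =
      (\<Sum>u\<in>word T a q ` space M. ?p q u * ln (?p q u))"
  proof -
    have t: "take q (word T a (Suc q) x) = word T a q x" for x by (simp add: word_Suc)
    show ?thesis
      using label_integral(1)[OF fw, of "\<lambda>u. ln (?p q (take q u))" "Suc q"]
        label_integral(1)[OF fw, of "\<lambda>u. ln (?p q u)" q] unfolding t by simp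
  qed
  finally have "(\<integral>x. - ln (W (word T a q x) (a ((T ^^ q) x))) \<partial>M) \<le> (h - D) / 2 + D"
    unfolding D_def label_entropy_eq[OF fw] by simp
  also have "\<dots> < h" using hD by (simp add: field_simps)
  finally show ?thesis using that[of W q] pos sum1 le1 by blast
qed

definition birk :: "('a \<Rightarrow> real) \<Rightarrow> nat \<Rightarrow> 'a \<Rightarrow> real" where
  "birk \<phi> n x = (\<Sum>i<n. \<phi> ((T ^^ i) x))"

lemma birk_0 [simp]: "birk \<phi> 0 x = 0" by (simp add: birk_def)

lemma birk_Suc: "birk \<phi> (Suc n) x = \<phi> x + birk \<phi> n (T x)"
  unfolding birk_def by (subst sum.lessThan_Suc_shift) (simp add: funpow_swap1)

lemma birk_measurable [measurable]:
  assumes [measurable]: "\<phi> \<in> borel_measurable M" shows "birk \<phi> n \<in> borel_measurable M"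
  unfolding birk_def by measurable

lemma birk_bound:
  assumes "\<And>x. x \<in> space M \<Longrightarrow> \<bar>\<phi> x\<bar> \<le> B" "x \<in> space M"
  shows "\<bar>birk \<phi> n x\<bar> \<le> real n * B"
proof -
  have "\<bar>birk \<phi> n x\<bar> \<le> (\<Sum>i<n. \<bar>\<phi> ((T ^^ i) x)\<bar>)" unfolding birk_def by (rule sum_abs)
  also have "\<dots> \<le> (\<Sum>i<n. B)" by (rule sum_mono) (use assms Tn_space in auto)
  finally show ?thesis by simp
qed

text \<open>The maximum of the Birkhoff sums of lengths 0 to \<open>n\<close>, by the recursion that
  the maximal ergodic theorem rests on.\<close>

primrec maxbirk :: "('a \<Rightarrow> real) \<Rightarrow> nat \<Rightarrow> 'a \<Rightarrow> real" where
  "maxbirk \<phi> 0 x = 0"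
| "maxbirk \<phi> (Suc n) x = max 0 (\<phi> x + maxbirk \<phi> n (T x))"

lemma maxbirk_mono: "maxbirk \<phi> n x \<le> maxbirk \<phi> (Suc n) x"
proof (induction n arbitrary: x)
  case (Suc n)
  show ?case using Suc[of "T x"] by simp
qed simp

lemma maxbirk_mono': "m \<le> n \<Longrightarrow> maxbirk \<phi> m x \<le> maxbirk \<phi> n x"
  using lift_Suc_mono_le[of "\<lambda>n. maxbirk \<phi> n x"] maxbirk_mono by blast

lemma birk_le_maxbirk: "birk \<phi> n x \<le> maxbirk \<phi> n x"
proof (induction n arbitrary: x)
  case (Suc n)
  show ?case using Suc[of "T x"] by (simp add: birk_Suc)
qed simp

lemma maxbirk_measurable [measurable]:
  assumes [measurable]: "\<phi> \<in> borel_measurable M" shows "maxbirk \<phi> n \<in> borel_measurable M"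
proof (induction n)
  case (Suc n)
  note [measurable] = Suc
  have "(\<lambda>x. max 0 (\<phi> x + maxbirk \<phi> n (T x))) \<in> borel_measurable M" by measurable
  then show ?case by simp
qed simp

lemma maxbirk_bound:
  assumes "\<And>x. x \<in> space M \<Longrightarrow> \<bar>\<phi> x\<bar> \<le> B" "x \<in> space M"
  shows "0 \<le> maxbirk \<phi> n x \<and> maxbirk \<phi> n x \<le> real n * B"
  using assms(2)
proof (induction n arbitrary: x)
  case (Suc n)
  have "0 \<le> B" using assms(1)[OF Suc.prems] by linarith
  then show ?case using Suc.IH[OF T_space[OF Suc.prems]] assms(1)[OF Suc.prems] by (auto simp: algebra_simps)
qed simp

end

section \<open>The upper half of the pointwise ergodic theorem\<close>

locale ergodic_mpt = mpt +
  assumes ergodic: "A \<in> sets M \<Longrightarrow> T -` A \<inter> space M = A \<Longrightarrow> measure M A = 0 \<or> measure M A = 1"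
begin

text \<open>The set \<open>E\<close> where the maxima are unbounded is invariant. If it had full
  measure, the functions \<open>f n\<close> would converge to \<phi> almost everywhere and
  boundedly, since they are the maximum of \<phi> and of minus a quantity that grows to infinity.
  But their integrals are nonnegative: by invariance they are increments of the integrals of
  \<open>maxbirk\<close>, which is monotone in \<open>n\<close>.\<close>

lemma birk_bounded_above:
  assumes [measurable]: "\<phi> \<in> borel_measurable M"
    and B: "\<And>x. x \<in> space M \<Longrightarrow> \<bar>\<phi> x\<bar> \<le> B" and neg: "(\<integral>x. \<phi> x \<partial>M) < 0"
  shows "AE x in M. \<exists>C. \<forall>n. birk \<phi> n x \<le> C"
proof -
  define E where "E = {x\<in>space M. \<forall>C::nat. \<exists>n. maxbirk \<phi> n x > real C}"
  have E: "E \<in> sets M" unfolding E_def by measurable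
  have unb: "\<exists>n. maxbirk \<phi> n x > c" if "x \<in> E" for x and c :: real
  proof -
    obtain C :: nat where "c \<le> real C" using real_arch_simple by blast
    moreover have "\<exists>n. maxbirk \<phi> n x > real C" using that unfolding E_def by blast
    then obtain n where "maxbirk \<phi> n x > real C" ..
    ultimately have "maxbirk \<phi> n x > c" by linarith
    then show ?thesis by blast
  qed
  have inv: "T x \<in> E \<longleftrightarrow> x \<in> E" if x: "x \<in> space M" for x
  proof
    assume Tx: "T x \<in> E"
    show "x \<in> E" unfolding E_def
    proof (safe intro!: x)
      fix C :: nat
      obtain n where "maxbirk \<phi> n (T x) > real C + B" using unb[OF Tx] by blast
      then have "maxbirk \<phi> (Suc n) x > real C" using B[OF x] by auto
      then show "\<exists>n. maxbirk \<phi> n x > real C" by blast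
    qed
  next
    assume xE: "x \<in> E"
    show "T x \<in> E" unfolding E_def
    proof (safe intro!: T_space x)
      fix C :: nat
      obtain n where n: "maxbirk \<phi> n x > real C + B" using unb[OF xE] by blast
      then have "n \<noteq> 0" using B[OF x] by (intro notI) auto
      then obtain m where "n = Suc m" using not0_implies_Suc by blast
      then have "maxbirk \<phi> m (T x) > real C" using n B[OF x] by auto
      then show "\<exists>n. maxbirk \<phi> n (T x) > real C" by blast
    qed
  qed
  have "E \<subseteq> space M" by (auto simp: E_def)
  then have "T -` E \<inter> space M = E" using inv by auto
  then have "measure M E = 0 \<or> measure M E = 1" using ergodic[OF E] by blast
  moreover have "measure M E \<noteq> 1"
  proof
    assume "measure M E = 1"
    then have AE: "AE x in M. x \<in> E" using E by (simp add: prob_eq_1)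
    define f where "f n x = maxbirk \<phi> (Suc n) x - maxbirk \<phi> n (T x)" for n x
    have f_eq: "f n x = max (- maxbirk \<phi> n (T x)) (\<phi> x)" for n x unfolding f_def by simp
    have int: "integrable M (maxbirk \<phi> n)" for n
      by (rule integrable_const_bound[of _ "real n * B"]) (use maxbirk_bound[OF B] in \<open>auto intro!: AE_I2\<close>)
    have intT: "integrable M (\<lambda>x. maxbirk \<phi> n (T x))" for n using integrable_Tn[OF int, of n 1] by simp
    have pos: "(\<integral>x. f n x \<partial>M) \<ge> 0" for n
    proof -
      have "(\<integral>x. f n x \<partial>M) = (\<integral>x. maxbirk \<phi> (Suc n) x \<partial>M) - (\<integral>x. maxbirk \<phi> n (T x) \<partial>M)"
        unfolding f_def by (rule Bochner_Integration.integral_diff[OF int intT])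
      also have "(\<integral>x. maxbirk \<phi> n (T x) \<partial>M) = (\<integral>x. maxbirk \<phi> n x \<partial>M)"
        using integral_Tn[of "maxbirk \<phi> n" 1] by simp
      finally show ?thesis using integral_mono[OF int[of n] int[of "Suc n"] maxbirk_mono] by linarith
    qed
    have "(\<lambda>n. \<integral>x. f n x \<partial>M) \<longlonglongrightarrow> (\<integral>x. \<phi> x \<partial>M)"
    proof (rule integral_dominated_convergence[where w = "\<lambda>_. B"])
      show "AE x in M. (\<lambda>n. f n x) \<longlonglongrightarrow> \<phi> x"
        using AE
      proof (eventually_elim)
        case (elim x)
        then have x: "x \<in> space M" by (auto simp: E_def)
        have "T x \<in> E" using inv[OF x] elim by blast
        then obtain m where m: "maxbirk \<phi> m (T x) > B" using unb by blast
        have "f n x = \<phi> x" if "n \<ge> m" for n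
          using maxbirk_mono'[OF that, of \<phi> "T x"] m B[OF x] unfolding f_eq by auto
        then show ?case by (intro tendsto_eventually eventually_sequentiallyI[of m])
      qed
      show "AE x in M. norm (f n x) \<le> B" for n
    proof (rule AE_I2)
      fix x assume x: "x \<in> space M"
      have "0 \<le> maxbirk \<phi> n (T x) \<and> maxbirk \<phi> n (T x) \<le> real n * B"
        by (rule maxbirk_bound[OF B T_space[OF x]])
      then show "norm (f n x) \<le> B" unfolding f_eq using B[OF x] by auto
    qed
      show "f n \<in> borel_measurable M" for n unfolding f_def by measurable
    qed auto
    then have "0 \<le> (\<integral>x. \<phi> x \<partial>M)" by (rule LIMSEQ_le_const) (use pos in auto)
    then show False using neg by simp
  qed
  ultimately have "measure M E = 0" by blast
  then have "AE x in M. x \<notin> E" using E by (subst (asm) prob_eq_0) auto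
  with AE_space show ?thesis
  proof (eventually_elim)
    case (elim x)
    then obtain C where "\<And>n. maxbirk \<phi> n x \<le> real C" by (auto simp: E_def not_less)
    then show ?case using birk_le_maxbirk by (intro exI[of _ "real C"]) (meson order_trans)
  qed
qed

lemma birk_bounded_above_linear:
  assumes [measurable]: "\<phi> \<in> borel_measurable M"
    and B: "\<And>x. x \<in> space M \<Longrightarrow> \<bar>\<phi> x\<bar> \<le> B" and c: "(\<integral>x. \<phi> x \<partial>M) < c"
  shows "AE x in M. \<exists>C. \<forall>n. birk \<phi> n x \<le> C + real n * c"
proof -
  have int: "integrable M \<phi>" by (rule integrable_const_bound[of _ B]) (use B in auto)
  have "AE x in M. \<exists>C. \<forall>n. birk (\<lambda>x. \<phi> x - c) n x \<le> C"
  proof (rule birk_bounded_above[where B = "B + \<bar>c\<bar>"])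
    show "\<bar>\<phi> x - c\<bar> \<le> B + \<bar>c\<bar>" if "x \<in> space M" for x using B[OF that] by linarith
    show "(\<integral>x. \<phi> x - c \<partial>M) < 0" using int c by (simp add: prob_space)
  qed measurable
  moreover have "birk (\<lambda>x. \<phi> x - c) n x = birk \<phi> n x - real n * c" for n x
    by (simp add: birk_def sum_subtractf)
  ultimately show ?thesis by (simp add: algebra_simps)
qed

text \<open>This bounds the conditional cost along stretches whose times depend on the orbit: up to
  an error of small mean, every window of length \<open>n\<close> has average at most
  \<open>c\<close>.\<close>

lemma birk_average_excess:
  assumes [measurable]: "\<phi> \<in> borel_measurable M"
    and B: "\<And>x. x \<in> space M \<Longrightarrow> \<bar>\<phi> x\<bar> \<le> B" and c: "(\<integral>x. \<phi> x \<partial>M) < c"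
  shows "(\<lambda>n. \<integral>x. max 0 (birk \<phi> n x / real n - c) \<partial>M) \<longlonglongrightarrow> 0"
proof -
  have "(\<lambda>n. \<integral>x. max 0 (birk \<phi> n x / real n - c) \<partial>M) \<longlonglongrightarrow> (\<integral>x. 0 \<partial>M)"
  proof (rule integral_dominated_convergence[where w = "\<lambda>_. B + \<bar>c\<bar>"])
    show "AE x in M. (\<lambda>n. max 0 (birk \<phi> n x / real n - c)) \<longlonglongrightarrow> 0"
    proof -
      have "AE x in M. \<exists>C. \<forall>n. birk \<phi> n x \<le> C + real n * c"
        by (rule birk_bounded_above_linear[OF assms(1) B c])
      then show ?thesis
    proof (eventually_elim)
      case (elim x)
      then obtain C where C: "\<And>n. birk \<phi> n x \<le> C + real n * c" by blast
      have le: "max 0 (birk \<phi> n x / real n - c) \<le> \<bar>C\<bar> / real n" if "n \<ge> 1" for n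
      proof -
        have "birk \<phi> n x / real n \<le> (C + real n * c) / real n" using C by (rule divide_right_mono) simp
        also have "\<dots> = C / real n + c" using that by (simp add: field_simps)
        also have "C / real n \<le> \<bar>C\<bar> / real n" by (rule divide_right_mono) auto
        finally show ?thesis by simp
      qed
      show ?case
      proof (rule tendsto_sandwich[where f = "\<lambda>_. 0" and h = "\<lambda>n. \<bar>C\<bar> / real n"])
        show "(\<lambda>n. \<bar>C\<bar> / real n) \<longlonglongrightarrow> 0" by (rule lim_const_over_n)
        show "\<forall>\<^sub>F n in sequentially. max 0 (birk \<phi> n x / real n - c) \<le> \<bar>C\<bar> / real n"
          using le by (rule eventually_sequentiallyI)
      qed auto
    qed
    qed
    show "AE x in M. norm (max 0 (birk \<phi> n x / real n - c)) \<le> B + \<bar>c\<bar>" for n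
    proof (rule AE_I2)
      fix x assume x: "x \<in> space M"
      have B0: "B \<ge> 0" using B[OF x] by linarith
      have "birk \<phi> n x / real n \<le> B"
      proof (cases "n = 0")
        case False
        have "\<bar>birk \<phi> n x\<bar> \<le> real n * B" by (rule birk_bound[OF B x])
        then show ?thesis using False by (simp add: field_simps)
      qed (simp add: B0)
      then show "norm (max 0 (birk \<phi> n x / real n - c)) \<le> B + \<bar>c\<bar>" using B0 by auto
    qed
  qed auto
  then show ?thesis by simp
qed

lemma birk_eventually_negative:
  assumes [measurable]: "\<phi> \<in> borel_measurable M"
    and B: "\<And>x. x \<in> space M \<Longrightarrow> \<bar>\<phi> x\<bar> \<le> B" and c: "(\<integral>x. \<phi> x \<partial>M) < 0"
  shows "(\<lambda>n. measure M {x\<in>space M. birk \<phi> n x \<ge> 0}) \<longlonglongrightarrow> 0"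
proof -
  define c where "c = (\<integral>x. \<phi> x \<partial>M) / 2"
  have c: "(\<integral>x. \<phi> x \<partial>M) < c" "c < 0" using assms(3) unfolding c_def by auto
  have "(\<lambda>n. \<integral>x. indicator {x\<in>space M. birk \<phi> n x \<ge> 0} x \<partial>M) \<longlonglongrightarrow> (\<integral>x. 0 \<partial>M :: real)"
  proof (rule integral_dominated_convergence[where w = "\<lambda>_. 1"])
    show "AE x in M. (\<lambda>n. indicator {x\<in>space M. birk \<phi> n x \<ge> 0} x) \<longlonglongrightarrow> (0::real)"
    proof -
      have "AE x in M. \<exists>C. \<forall>n. birk \<phi> n x \<le> C + real n * c"
        by (rule birk_bounded_above_linear[OF assms(1) B c(1)])
      then show ?thesis
    proof (eventually_elim)
      case (elim x)
      then obtain C where C: "\<And>n. birk \<phi> n x \<le> C + real n * c" by blast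
      obtain m :: nat where m: "C / (- c) < real m" using reals_Archimedean2 by blast
      have "birk \<phi> n x < 0" if "n \<ge> m" for n
      proof -
        have "C / (- c) < real n" using m that by linarith
        then have "C + real n * c < 0" using c(2) by (simp add: field_simps)
        then show ?thesis using C[of n] by linarith
      qed
      then have "indicator {x\<in>space M. birk \<phi> n x \<ge> 0} x = (0::real)" if "n \<ge> m" for n
        using that by (simp add: indicator_def not_le)
      then show ?case by (intro tendsto_eventually eventually_sequentiallyI[of m])
    qed
    qed
  qed auto
  then show ?thesis by simp
qed

end

section \<open>Level sets of smooth functions\<close>

text \<open>The last clause serves the induction, which adds the largest zero: the new zero of the
  derivative lies to the right of all the previous zeros, hence is not in \<open>W\<close>.\<close>

lemma rolle_zeros:
  fixes f f' :: "real \<Rightarrow> real"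
  assumes der: "\<And>t. t \<in> {a..b} \<Longrightarrow> (f has_real_derivative f' t) (at t within {a..b})"
    and Z: "finite Z" "Z \<subseteq> {a..b}" "\<And>z. z \<in> Z \<Longrightarrow> f z = 0"
  shows "\<exists>W. finite W \<and> card W = card Z - 1 \<and> W \<subseteq> {a..b} \<and> (\<forall>w\<in>W. f' w = 0) \<and> (\<forall>w\<in>W. \<exists>z\<in>Z. w \<le> z)"
  using Z
proof (induction Z rule: finite_linorder_max_induct)
  case empty
  show ?case by (intro exI[of _ "{}"]) auto
next
  case (insert m A)
  then obtain W where W: "finite W" "card W = card A - 1" "W \<subseteq> {a..b}" "\<forall>w\<in>W. f' w = 0" "\<forall>w\<in>W. \<exists>z\<in>A. w \<le> z"
    by auto
  show ?case
  proof (cases "A = {}")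
    case True
    then show ?thesis using W by (intro exI[of _ "{}"]) auto
  next
    case False
    define l where "l = Max A"
    have l: "l \<in> A" "\<And>z. z \<in> A \<Longrightarrow> z \<le> l" unfolding l_def using insert(1) False by auto
    have lm: "l < m" using insert(2) l by auto
    have sub: "{l..m} \<subseteq> {a..b}" using insert.prems(1) l by auto
    have "\<exists>x\<in>{l<..<m}. f m - f l = (\<lambda>h. f' x * h) (m - l)"
    proof (rule mvt_simple[OF lm])
      fix x assume "l \<le> x" "x \<le> m"
      then have "(f has_real_derivative f' x) (at x within {a..b})" using sub by (intro der) auto
      then have "(f has_real_derivative f' x) (at x within {l..m})" by (rule DERIV_subset[OF _ sub])
      then show "(f has_derivative (\<lambda>h. f' x * h)) (at x within {l..m})" by (simp add: has_field_derivative_def)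
    qed
    then obtain x where x: "l < x" "x < m" "f' x * (m - l) = 0"
      using insert.prems(2) l by auto
    then have "f' x = 0" using lm by auto
    moreover have "x \<notin> W" using W(5) l x by force
    moreover have "card (insert m A) = Suc (card A)" using insert(1,2) by (subst card_insert_disjoint) auto
    moreover have "card A \<ge> 1" using False insert(1) by (simp add: Suc_leI card_gt_0_iff)
    ultimately show ?thesis using W x sub l(1)
      by (intro exI[of _ "insert x W"]) (auto intro: less_imp_le)
  qed
qed

lemma iterated_rolle:
  fixes u :: "nat \<Rightarrow> real \<Rightarrow> real"
  assumes der: "\<And>i t. i < m \<Longrightarrow> t \<in> {a..b} \<Longrightarrow> (u i has_real_derivative u (Suc i) t) (at t within {a..b})"
    and Z: "finite Z" "Z \<subseteq> {a..b}" "card Z = Suc m" "\<And>z. z \<in> Z \<Longrightarrow> u 0 z = 0"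
    and i: "i \<le> m"
  shows "\<exists>W. finite W \<and> card W = Suc m - i \<and> W \<subseteq> {a..b} \<and> (\<forall>w\<in>W. u i w = 0)"
  using i
proof (induction i)
  case 0 show ?case using Z by (intro exI[of _ Z]) auto
next
  case (Suc i)
  then obtain W where W: "finite W" "card W = Suc m - i" "W \<subseteq> {a..b}" "\<forall>w\<in>W. u i w = 0" by auto
  have "\<exists>V. finite V \<and> card V = card W - 1 \<and> V \<subseteq> {a..b} \<and> (\<forall>w\<in>V. u (Suc i) w = 0) \<and> (\<forall>w\<in>V. \<exists>z\<in>W. w \<le> z)"
    by (rule rolle_zeros[where f = "u i"]) (use der[of i] Suc.prems W in auto)
  then show ?case using W(2) by (metis diff_Suc_eq_diff_pred diff_Suc_1 diff_commute)
qed

text \<open>By Rolle, each derivative up to the order \<open>m\<close> has a zero in the interval.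
  So the Hoelder condition makes the top derivative small, and the mean value theorem, applied
  \<open>m\<close> times downwards from a zero, gains one factor \<open>b - a\<close> for each
  order.\<close>

lemma small_if_many_zeros:
  fixes u :: "nat \<Rightarrow> real \<Rightarrow> real"
  assumes ab: "a < b" and C: "C \<ge> 0"
    and der: "\<And>i t. i < m \<Longrightarrow> t \<in> {a..b} \<Longrightarrow> (u i has_real_derivative u (Suc i) t) (at t within {a..b})"
    and hol: "\<And>s t. s \<in> {a..b} \<Longrightarrow> t \<in> {a..b} \<Longrightarrow> s \<noteq> t \<Longrightarrow> \<bar>u m s - u m t\<bar> \<le> C * \<bar>s - t\<bar> powr \<alpha>"
    and \<alpha>: "\<alpha> \<ge> 0"
    and Z: "finite Z" "Z \<subseteq> {a..b}" "card Z = Suc m" "\<And>z. z \<in> Z \<Longrightarrow> u 0 z = 0"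
    and t: "t \<in> {a..b}"
  shows "\<bar>u 0 t\<bar> \<le> C * (b - a) powr (real m + \<alpha>)"
proof -
  have zero: "\<exists>z\<in>{a..b}. u i z = 0" if i: "i \<le> m" for i
  proof -
    obtain W where W: "finite W" "card W = Suc m - i" "W \<subseteq> {a..b}" "\<forall>w\<in>W. u i w = 0"
      using iterated_rolle[OF der Z i] by auto
    then have "W \<noteq> {}" using i by auto
    then show ?thesis using W by auto
  qed
  have "\<bar>u (m - j) t\<bar> \<le> C * (b - a) powr (real j + \<alpha>)" if "j \<le> m" "t \<in> {a..b}" for j t
    using that
  proof (induction j arbitrary: t)
    case 0
    obtain z where z: "z \<in> {a..b}" "u m z = 0" using zero[of m] by auto
    show ?case
    proof (cases "t = z")
      case True then show ?thesis using z C by simp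
    next
      case False
      have "\<bar>u m t\<bar> \<le> C * \<bar>t - z\<bar> powr \<alpha>" using hol[of t z] z 0 False by auto
      also have "\<dots> \<le> C * (b - a) powr \<alpha>"
        using z 0 \<alpha> C by (intro mult_left_mono powr_mono2) auto
      finally show ?thesis by simp
    qed
  next
    case (Suc j)
    define i where "i = m - Suc j"
    have i: "i < m" "Suc i = m - j" using Suc.prems by (auto simp: i_def)
    obtain z where z: "z \<in> {a..b}" "u i z = 0" using zero[of i] i by auto
    have bound: "\<bar>u (Suc i) x\<bar> \<le> C * (b - a) powr (real j + \<alpha>)" if "x \<in> {a..b}" for x
      using Suc.IH[of x] Suc.prems that i by auto
    have "norm (u i t - u i z) \<le> (C * (b - a) powr (real j + \<alpha>)) * norm (t - z)"
      by (rule field_differentiable_bound[where S = "{a..b}" and f' = "u (Suc i)"])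
        (use der[OF i(1)] bound z Suc.prems in auto)
    also have "\<dots> \<le> (C * (b - a) powr (real j + \<alpha>)) * (b - a)"
      using z Suc.prems C by (intro mult_left_mono) auto
    also have "\<dots> = C * (b - a) powr (real (Suc j) + \<alpha>)"
      using ab by (simp add: powr_add powr_realpow[symmetric] algebra_simps)
    finally show ?case using z by (simp add: i_def)
  qed
  from this[of m t] t show ?thesis by simp
qed

lemma many_values_close:
  fixes u :: "nat \<Rightarrow> real \<Rightarrow> real"
  assumes ab: "a < b" and C: "C \<ge> 0"
    and der: "\<And>i t. i < m \<Longrightarrow> t \<in> {a..b} \<Longrightarrow> (u i has_real_derivative u (Suc i) t) (at t within {a..b})"
    and hol: "\<And>s t. s \<in> {a..b} \<Longrightarrow> t \<in> {a..b} \<Longrightarrow> s \<noteq> t \<Longrightarrow> \<bar>u m s - u m t\<bar> \<le> C * \<bar>s - t\<bar> powr \<alpha>"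
    and \<alpha>: "\<alpha> \<ge> 0"
    and Z: "finite Z" "Z \<subseteq> {a..b}" "card Z = Suc m" "\<And>z. z \<in> Z \<Longrightarrow> u 0 z = c"
    and t: "t \<in> {a..b}"
  shows "\<bar>u 0 t - c\<bar> \<le> C * (b - a) powr (real m + \<alpha>)"
proof -
  define v where "v i t = (if i = 0 then u 0 t - c else u i t)" for i t
  have v: "v 0 = (\<lambda>t. u 0 t - c)" "v (Suc i) = u (Suc i)" for i by (auto simp: v_def fun_eq_iff)
  have "\<bar>v 0 t\<bar> \<le> C * (b - a) powr (real m + \<alpha>)"
  proof (rule small_if_many_zeros[OF ab C _ _ \<alpha> Z(1-3) _ t])
    show "(v i has_real_derivative v (Suc i) t) (at t within {a..b})" if "i < m" "t \<in> {a..b}" for i t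
    proof (cases i)
      case 0
      have "((\<lambda>t. u 0 t - c) has_real_derivative u (Suc 0) t - 0) (at t within {a..b})"
        by (rule DERIV_diff[OF der DERIV_const]) (use that 0 in auto)
      then show ?thesis unfolding 0 v by simp
    next
      case (Suc l)
      show ?thesis using der[OF that] unfolding Suc v .
    qed
    show "\<bar>v m s - v m t\<bar> \<le> C * \<bar>s - t\<bar> powr \<alpha>" if "s \<in> {a..b}" "t \<in> {a..b}" "s \<noteq> t" for s t
      using hol[OF that] by (cases m) (simp_all add: v)
    show "v 0 z = 0" if "z \<in> Z" for z using Z(4)[OF that] by (simp add: v)
  qed
  then show ?thesis by (simp add: v)
qed

lemma card_floor_image:
  fixes Y :: "real set" and N :: nat
  assumes "finite Y" and L: "\<And>s t. s \<in> Y \<Longrightarrow> t \<in> Y \<Longrightarrow> \<bar>s - t\<bar> \<le> L" and L0: "L \<ge> 0"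
  shows "real (card ((\<lambda>t. \<lfloor>real N * t\<rfloor>) ` Y)) \<le> real N * L + 2"
proof (cases "Y = {}")
  case True then show ?thesis using L0 by simp
next
  case False
  let ?m = "Min Y" and ?M = "Max Y"
  have mM: "?m \<in> Y" "?M \<in> Y" "\<And>t. t \<in> Y \<Longrightarrow> ?m \<le> t \<and> t \<le> ?M" using assms(1) False by auto
  have "(\<lambda>t. \<lfloor>real N * t\<rfloor>) ` Y \<subseteq> {\<lfloor>real N * ?m\<rfloor>..\<lfloor>real N * ?M\<rfloor>}"
    using mM(3) by (auto intro!: floor_mono mult_left_mono)
  then have "card ((\<lambda>t. \<lfloor>real N * t\<rfloor>) ` Y) \<le> card {\<lfloor>real N * ?m\<rfloor>..\<lfloor>real N * ?M\<rfloor>}"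
    by (rule card_mono[rotated]) simp
  then have "real (card ((\<lambda>t. \<lfloor>real N * t\<rfloor>) ` Y)) \<le> real (nat (\<lfloor>real N * ?M\<rfloor> - \<lfloor>real N * ?m\<rfloor> + 1))" by simp
  also have "\<dots> \<le> real N * ?M - real N * ?m + 2"
  proof -
    have "?m \<le> ?M" using mM by auto
    then have "\<lfloor>real N * ?m\<rfloor> \<le> \<lfloor>real N * ?M\<rfloor>" by (intro floor_mono mult_left_mono) auto
    then show ?thesis by (simp add: of_nat_nat) linarith
  qed
  also have "\<dots> = real N * (?M - ?m) + 2" by (simp add: algebra_simps)
  also have "\<dots> \<le> real N * L + 2" using L[OF mM(2,1)] by (intro add_right_mono mult_left_mono) auto
  finally show ?thesis .
qed

section \<open>Cutting an arc by a grid and by level points\<close>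

definition grid_level :: "real set \<Rightarrow> nat \<Rightarrow> (real \<Rightarrow> real) \<Rightarrow> real set \<Rightarrow> real \<Rightarrow> real set" where
  "grid_level D N h Lv t = {s\<in>D. of_int \<lfloor>real N * t\<rfloor> / real N \<le> s \<and> s < t \<and> h s \<in> Lv}"

text \<open>
  The second entry counts the level points to the left of \<open>t\<close> in its grid cell, so that equal labels
  exclude level points between two points. This needs finitely many level points, as an infinite set
  has cardinality 0.
\<close>

definition piece :: "real set \<Rightarrow> nat \<Rightarrow> (real \<Rightarrow> real) \<Rightarrow> real set \<Rightarrow> real \<Rightarrow> int \<times> nat" where
  "piece D N h Lv t = (\<lfloor>real N * t\<rfloor>, card (grid_level D N h Lv t))"

lemma card_piece_image:
  fixes Y :: "real set" and N :: nat
  assumes Y: "finite Y" and L: "\<And>s t. s \<in> Y \<Longrightarrow> t \<in> Y \<Longrightarrow> \<bar>s - t\<bar> \<le> L" and L0: "L \<ge> 0"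
    and m: "\<And>t. t \<in> Y \<Longrightarrow> card (grid_level D N h Lv t) \<le> m"
  shows "real (card (piece D N h Lv ` Y)) \<le> (real N * L + 2) * real (Suc m)"
proof -
  have "piece D N h Lv ` Y \<subseteq> (\<lambda>t. \<lfloor>real N * t\<rfloor>) ` Y \<times> {..m}" using m by (auto simp: piece_def)
  then have "card (piece D N h Lv ` Y) \<le> card ((\<lambda>t. \<lfloor>real N * t\<rfloor>) ` Y \<times> {..m})"
    by (rule card_mono[rotated]) (use Y in auto)
  then have "real (card (piece D N h Lv ` Y)) \<le> real (card ((\<lambda>t. \<lfloor>real N * t\<rfloor>) ` Y)) * real (Suc m)"
    unfolding card_cartesian_product card_atMost of_nat_mult[symmetric] of_nat_le_iff .
  also have "\<dots> \<le> (real N * L + 2) * real (Suc m)"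
    by (intro mult_right_mono card_floor_image[OF Y L L0]) auto
  finally show ?thesis .
qed

text \<open>A level point in between would be counted for \<open>t'\<close> but not for
  \<open>t\<close>. Finiteness makes a proper inclusion visible in the cardinalities.\<close>

lemma piece_separates:
  assumes "piece D N h Lv t = piece D N h Lv t'" "t \<le> t'" "finite (grid_level D N h Lv t')" "N > 0"
    and s: "s \<in> D" "t \<le> s" "s < t'"
  shows "h s \<notin> Lv"
proof
  assume hs: "h s \<in> Lv"
  have fl: "\<lfloor>real N * t\<rfloor> = \<lfloor>real N * t'\<rfloor>" and c: "card (grid_level D N h Lv t) = card (grid_level D N h Lv t')"
    using assms(1) by (auto simp: piece_def)
  have sub: "grid_level D N h Lv t \<subseteq> grid_level D N h Lv t'" using fl assms(2) by (auto simp: grid_level_def)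
  have "of_int \<lfloor>real N * t'\<rfloor> / real N \<le> t"
    unfolding fl[symmetric] using assms(4) by (simp add: divide_le_eq mult.commute)
  then have "s \<in> grid_level D N h Lv t'" using s hs by (auto simp: grid_level_def)
  moreover have "s \<notin> grid_level D N h Lv t" using s by (auto simp: grid_level_def)
  ultimately have "grid_level D N h Lv t \<subset> grid_level D N h Lv t'" using sub by auto
  then show False using psubset_card_mono[OF assms(3), of "grid_level D N h Lv t"] c by simp
qed

text \<open>After reversing the sign of the decreasing coordinates all of them increase with \<tau>,
  so their sum does too, and equal sums force equal vectors. Thus the points are counted by the
  integers in the range of the sum, whose length grows linearly with the number of coordinates
  instead of exponentially.\<close>

lemma card_monotone_vectors:
  fixes \<phi> :: "nat \<Rightarrow> 'a \<Rightarrow> int" and \<tau> :: "'a \<Rightarrow> real"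
  assumes Y: "finite Y" and J: "finite J"
    and mono: "\<And>i. i \<in> J \<Longrightarrow> (\<forall>x\<in>Y. \<forall>y\<in>Y. \<tau> x \<le> \<tau> y \<longrightarrow> \<phi> i x \<le> \<phi> i y) \<or>
        (\<forall>x\<in>Y. \<forall>y\<in>Y. \<tau> x \<le> \<tau> y \<longrightarrow> \<phi> i y \<le> \<phi> i x)"
    and V: "\<And>i x y. i \<in> J \<Longrightarrow> x \<in> Y \<Longrightarrow> y \<in> Y \<Longrightarrow> \<bar>\<phi> i x - \<phi> i y\<bar> \<le> int V"
    and inj: "\<And>x y. x \<in> Y \<Longrightarrow> y \<in> Y \<Longrightarrow> (\<And>i. i \<in> J \<Longrightarrow> \<phi> i x = \<phi> i y) \<Longrightarrow> x = y"
  shows "card Y \<le> 1 + V * card J"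
proof (cases "Y = {}")
  case True then show ?thesis by simp
next
  case False
  define \<sigma> :: "nat \<Rightarrow> int" where
    "\<sigma> i = (if \<forall>x\<in>Y. \<forall>y\<in>Y. \<tau> x \<le> \<tau> y \<longrightarrow> \<phi> i x \<le> \<phi> i y then 1 else -1)" for i
  define F where "F x = (\<Sum>i\<in>J. \<sigma> i * \<phi> i x)" for x
  have m: "\<sigma> i * \<phi> i x \<le> \<sigma> i * \<phi> i y" if "i \<in> J" "x \<in> Y" "y \<in> Y" "\<tau> x \<le> \<tau> y" for i x y
    using mono[OF that(1)] that(2-) unfolding \<sigma>_def by auto
  have eq: "x = y" if xy: "x \<in> Y" "y \<in> Y" "\<tau> x \<le> \<tau> y" "F x = F y" for x y
  proof (rule inj[OF xy(1,2)])
    fix i assume i: "i \<in> J"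
    have "\<forall>i\<in>J. \<sigma> i * \<phi> i x = \<sigma> i * \<phi> i y"
    proof (rule ccontr)
      assume "\<not> ?thesis"
      then obtain k where k: "k \<in> J" "\<sigma> k * \<phi> k x < \<sigma> k * \<phi> k y" using m xy by force
      have "F x < F y" unfolding F_def by (rule sum_strict_mono_ex1[OF J]) (use m xy k in auto)
      then show False using xy(4) by simp
    qed
    then show "\<phi> i x = \<phi> i y" using i by (auto simp: \<sigma>_def split: if_splits)
  qed
  have "inj_on F Y"
  proof (rule inj_onI)
    fix x y assume "x \<in> Y" "y \<in> Y" "F x = F y"
    then show "x = y" using eq[of x y] eq[of y x] by (cases "\<tau> x \<le> \<tau> y") auto
  qed
  then have cY: "card Y = card (F ` Y)" by (simp add: card_image)
  have diff: "F x - F y \<le> int (V * card J)" if "x \<in> Y" "y \<in> Y" for x y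
  proof -
    have "F x - F y = (\<Sum>i\<in>J. \<sigma> i * \<phi> i x - \<sigma> i * \<phi> i y)" unfolding F_def by (simp add: sum_subtractf)
    also have "\<dots> \<le> (\<Sum>i\<in>J. int V)"
      by (rule sum_mono) (use V that in \<open>auto simp: \<sigma>_def abs_le_iff\<close>)
    finally show ?thesis by (simp add: mult.commute)
  qed
  let ?m = "Min (F ` Y)" and ?M = "Max (F ` Y)"
  have fin: "finite (F ` Y)" "F ` Y \<noteq> {}" using Y False by auto
  have "?M \<in> F ` Y" "?m \<in> F ` Y" using fin by (auto intro: Max_in Min_in)
  then have d: "?M - ?m \<le> int (V * card J)" using diff by (metis imageE)
  have "F ` Y \<subseteq> {?m..?M}" using fin by (intro subsetI) (auto intro: Min_le Max_ge)
  then have "card (F ` Y) \<le> card {?m..?M}" by (rule card_mono[rotated]) simp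
  also have "\<dots> = nat (?M - ?m + 1)" by simp
  also have "\<dots> \<le> 1 + V * card J" using d by linarith
  finally show ?thesis using cY by simp
qed

text \<open>The intervals of length \<open>l\<close> that start at the points of \<open>B\<close>
  are disjoint and lie below \<open>n + l\<close>.\<close>

lemma card_spaced:
  fixes B :: "nat set"
  assumes B: "B \<subseteq> {..<n}" and sp: "\<And>b b'. b \<in> B \<Longrightarrow> b' \<in> B \<Longrightarrow> b < b' \<Longrightarrow> b + l \<le> b'"
  shows "card B * l \<le> n + l"
proof -
  have fin: "finite B" using B finite_subset by blast
  have inj: "inj_on (\<lambda>(b, i). b + i) (B \<times> {..<l})"
  proof (rule inj_onI)
    fix p p' assume a: "p \<in> B \<times> {..<l}" "p' \<in> B \<times> {..<l}" "(\<lambda>(b, i). b + i) p = (\<lambda>(b, i). b + i) p'"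
    then have "fst p = fst p'"
      using sp[of "fst p" "fst p'"] sp[of "fst p'" "fst p"]
      by (cases "fst p" "fst p'" rule: linorder_cases) (auto simp: case_prod_beta)
    then show "p = p'" using a by (auto simp: case_prod_beta prod_eq_iff)
  qed
  have "card B * l = card ((\<lambda>(b, i). b + i) ` (B \<times> {..<l}))"
    by (simp add: card_image[OF inj] card_cartesian_product)
  also have "\<dots> \<le> card {..<n + l}" by (rule card_mono) (use B in \<open>auto simp: subset_eq intro!: add_strict_mono\<close>)
  finally show ?thesis by simp
qed

section \<open>Coding orbits by the size of the derivative\<close>

lemma abs_diff_double:
  fixes x :: real
  assumes "\<bar>x\<bar> \<le> e" "c = 2 * e \<or> c = - (2 * e)"
  shows "e \<le> \<bar>x - c\<bar>"
  using assms by linarith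

text \<open>\<open>D\<close> is the parameter domain, \<open>pr\<close> the parametrization, \<tau>
  a section of it with values in the unit interval, and \<open>G\<close> a lift of \<open>g\<close>.
  The derivative \<open>dg\<close> is a function on the space itself, so that it can be integrated.
  The constants 1/2 and 7 suit the unit circle with period 1, where the chord over a parameter
  difference d is \<open>2 * \<bar>sin (pi * d)\<bar>\<close>.\<close>

locale lifted = mpt M g for M :: "'a::metric_space measure" and g +
  fixes D :: "real set" and pr :: "real \<Rightarrow> 'a" and \<tau> :: "'a \<Rightarrow> real"
    and G :: "real \<Rightarrow> real" and dg :: "'a \<Rightarrow> real"
  assumes D_int: "is_interval D"
    and \<tau>: "x \<in> space M \<Longrightarrow> \<tau> x \<in> D" "x \<in> space M \<Longrightarrow> 0 \<le> \<tau> x" "x \<in> space M \<Longrightarrow> \<tau> x \<le> 1"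
      "x \<in> space M \<Longrightarrow> pr (\<tau> x) = x"
    and G_in: "t \<in> D \<Longrightarrow> G t \<in> D"
    and pr_in: "t \<in> D \<Longrightarrow> pr t \<in> space M"
    and semiconj: "t \<in> D \<Longrightarrow> pr (G t) = g (pr t)"
    and G_der: "t \<in> D \<Longrightarrow> (G has_real_derivative dg (pr t)) (at t within D)"
    and dg_cont: "continuous_on D (\<lambda>t. dg (pr t))"
    and chord: "s \<in> D \<Longrightarrow> t \<in> D \<Longrightarrow> \<bar>s - t\<bar> \<le> 1/2 \<Longrightarrow> \<bar>s - t\<bar> \<le> dist (pr s) (pr t)"
    and lip: "s \<in> D \<Longrightarrow> t \<in> D \<Longrightarrow> dist (pr s) (pr t) \<le> 7 * \<bar>s - t\<bar>"
begin

definition pos :: "nat \<Rightarrow> 'a \<Rightarrow> real" where "pos j x = (G ^^ j) (\<tau> x)"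

lemma pos_0: "pos 0 x = \<tau> x" and pos_Suc: "pos (Suc j) x = G (pos j x)"
  by (simp_all add: pos_def)

lemma pos_in: "x \<in> space M \<Longrightarrow> pos j x \<in> D"
  by (induction j) (auto simp: pos_0 pos_Suc \<tau> G_in)

lemma pr_pos: "x \<in> space M \<Longrightarrow> pr (pos j x) = (g ^^ j) x"
  by (induction j) (auto simp: pos_0 pos_Suc \<tau> semiconj pos_in)

lemma seg_D: "s \<in> D \<Longrightarrow> t \<in> D \<Longrightarrow> closed_segment s t \<subseteq> D"
  using D_int by (simp add: is_interval_convex_1 closed_segment_subset)

lemma G_contract:
  assumes "s \<in> D" "t \<in> D" "\<And>r. r \<in> closed_segment s t \<Longrightarrow> \<bar>dg (pr r)\<bar> \<le> c"
  shows "\<bar>G s - G t\<bar> \<le> c * \<bar>s - t\<bar>"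
proof -
  have sub: "closed_segment t s \<subseteq> D" using seg_D assms by auto
  have "norm (G s - G t) \<le> c * norm (s - t)"
  proof (rule field_differentiable_bound[where S = "closed_segment t s" and f' = "\<lambda>t. dg (pr t)"])
    fix r assume r: "r \<in> closed_segment t s"
    then have "(G has_real_derivative dg (pr r)) (at r within D)" using sub by (intro G_der) auto
    then show "(G has_field_derivative dg (pr r)) (at r within closed_segment t s)"
      by (rule DERIV_subset[OF _ sub])
    show "norm (dg (pr r)) \<le> c" using assms(3)[of r] r by (simp add: closed_segment_commute)
  qed auto
  then show ?thesis by simp
qed

lemma seg_below_level:
  assumes st: "s \<in> D" "t \<in> D" and s: "dg (pr s) < c"
    and no: "\<And>r. r \<in> closed_segment s t \<Longrightarrow> dg (pr r) \<noteq> c" and r: "r \<in> closed_segment s t"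
  shows "dg (pr r) < c"
proof (rule ccontr)
  assume "\<not> ?thesis"
  then have c: "dg (pr s) \<le> c" "c \<le> dg (pr r)" using s by auto
  have sub: "closed_segment s r \<subseteq> closed_segment s t" using r by (simp add: subset_closed_segment)
  have cont: "continuous_on (closed_segment s r) (\<lambda>t. dg (pr t))"
    using continuous_on_subset[OF dg_cont] sub seg_D[OF st] by blast
  have conn: "connected ((\<lambda>t. dg (pr t)) ` closed_segment s r)"
    by (rule connected_continuous_image[OF cont]) simp
  have "c \<in> (\<lambda>t. dg (pr t)) ` closed_segment s r"
    by (rule connectedD_interval[OF conn _ _ c]) auto
  then show False using no sub by auto
qed

lemma seg_above_level:
  assumes st: "s \<in> D" "t \<in> D" and s: "dg (pr s) > c"
    and no: "\<And>r. r \<in> closed_segment s t \<Longrightarrow> dg (pr r) \<noteq> c" and r: "r \<in> closed_segment s t"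
  shows "dg (pr r) > c"
proof (rule ccontr)
  assume "\<not> ?thesis"
  then have c: "dg (pr r) \<le> c" "c \<le> dg (pr s)" using s by auto
  have sub: "closed_segment s r \<subseteq> closed_segment s t" using r by (simp add: subset_closed_segment)
  have cont: "continuous_on (closed_segment s r) (\<lambda>t. dg (pr t))"
    using continuous_on_subset[OF dg_cont] sub seg_D[OF st] by blast
  have conn: "connected ((\<lambda>t. dg (pr t)) ` closed_segment s r)"
    by (rule connected_continuous_image[OF cont]) simp
  have "c \<in> (\<lambda>t. dg (pr t)) ` closed_segment s r"
    by (rule connectedD_interval[OF conn _ _ c]) auto
  then show False using no sub by auto
qed

lemma G_mono:
  assumes st: "s \<in> D" "t \<in> D" "s \<le> t"
    and no: "\<And>r. r \<in> closed_segment s t \<Longrightarrow> dg (pr r) \<noteq> 0"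
  shows "dg (pr s) > 0 \<Longrightarrow> G s \<le> G t" "dg (pr s) < 0 \<Longrightarrow> G t \<le> G s"
proof -
  have sub: "{s..t} \<subseteq> D" using seg_D[OF st(1,2)] st(3) by (simp add: closed_segment_eq_real_ivl)
  have der: "(G has_real_derivative dg (pr r)) (at r within {s..t})" if "r \<in> {s..t}" for r
    using DERIV_subset[OF G_der sub] that sub by auto
  have exit: "\<exists>r\<in>{s<..<t}. G t - G s = dg (pr r) * (t - s)" if "s < t"
    by (rule mvt_simple[OF that, where f' = "\<lambda>r h. dg (pr r) * h"])
      (use der in \<open>auto simp: has_field_derivative_def\<close>)
  show "G s \<le> G t" if "dg (pr s) > 0"
  proof (cases "s = t")
    case False
    then have "s < t" using st by simp
    then obtain r where r: "r \<in> {s<..<t}" "G t - G s = dg (pr r) * (t - s)" using exit by auto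
    have "dg (pr r) > 0" by (rule seg_above_level[OF st(1,2) that no]) (use r in \<open>auto simp: closed_segment_eq_real_ivl\<close>)
    then have "G t - G s \<ge> 0" using r(2) \<open>s < t\<close> by simp
    then show ?thesis by simp
  qed simp
  show "G t \<le> G s" if "dg (pr s) < 0"
  proof (cases "s = t")
    case False
    then have "s < t" using st by simp
    then obtain r where r: "r \<in> {s<..<t}" "G t - G s = dg (pr r) * (t - s)" using exit by auto
    have "dg (pr r) < 0" by (rule seg_below_level[OF st(1,2) that no]) (use r in \<open>auto simp: closed_segment_eq_real_ivl\<close>)
    then have "G t - G s \<le> 0" using r(2) \<open>s < t\<close> by (simp add: mult_nonpos_nonneg)
    then show ?thesis by simp
  qed simp
qed

lemma Gn_D: "t \<in> D \<Longrightarrow> (G ^^ n) t \<in> D"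
  by (induction n) (auto simp: G_in)

lemma pr_Gn: "t \<in> D \<Longrightarrow> pr ((G ^^ n) t) = (g ^^ n) (pr t)"
  by (induction n) (auto simp: semiconj Gn_D)

lemma deriv_iter:
  assumes "t \<in> D"
  shows "((G ^^ n) has_real_derivative (\<Prod>i<n. dg ((g ^^ i) (pr t)))) (at t within D)"
proof (induction n)
  case 0
  show ?case by (simp add: id_def)
next
  case (Suc n)
  have sub: "(G ^^ n) ` D \<subseteq> D" using Gn_D by auto
  have "(G has_real_derivative dg (pr ((G ^^ n) t))) (at ((G ^^ n) t) within (G ^^ n) ` D)"
    by (rule DERIV_subset[OF G_der[OF Gn_D[OF assms]] sub])
  from DERIV_image_chain[OF this Suc]
  show ?case unfolding pr_Gn[OF assms] by (simp only: funpow.simps prod.lessThan_Suc mult.commute)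
qed

lemma Gn_segment_lip:
  assumes "s \<in> D" "t \<in> D" "\<And>u. u \<in> closed_segment s t \<Longrightarrow> \<bar>\<Prod>i<n. dg ((g ^^ i) (pr u))\<bar> \<le> c"
  shows "\<bar>(G ^^ n) s - (G ^^ n) t\<bar> \<le> c * \<bar>s - t\<bar>"
proof -
  have sub: "closed_segment t s \<subseteq> D" using seg_D assms by auto
  have "norm ((G ^^ n) s - (G ^^ n) t) \<le> c * norm (s - t)"
  proof (rule field_differentiable_bound[where S = "closed_segment t s" and f' = "\<lambda>t. \<Prod>i<n. dg ((g ^^ i) (pr t))"])
    fix r assume r: "r \<in> closed_segment t s"
    then show "((G ^^ n) has_field_derivative (\<Prod>i<n. dg ((g ^^ i) (pr r)))) (at r within closed_segment t s)"
      using DERIV_subset[OF deriv_iter sub] sub by blast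
    show "norm (\<Prod>i<n. dg ((g ^^ i) (pr r))) \<le> c" using assms(3)[of r] r by (simp add: closed_segment_commute)
  qed auto
  then show ?thesis by simp
qed

end

text \<open>\<open>ad\<close> is the adapted distance, comparable to the usual one up to
  \<open>C0\<close>, and \<beta> stands for r - 1. The hypothesis \<open>many\<close> is the bound
  on the smoothness of the derivative. \<open>zone_weight\<close> and \<open>C2_weight\<close> are
  Kraft's inequality for the zone symbols and for the symbols of \<open>Q\<close>: the frequent
  symbol costs only \<eta>. Zones below \<open>K\<close> are shallow and do not end a stretch at
  scale 0. The constants up to \<open>W\<close>, except for \<open>C2\<close> and \<open>Dm\<close>,
  are meant to be common to all the maps of a sequence; \<open>C2\<close>, \<open>Dm\<close> and the
  ones from \<open>Kc\<close> on may depend on the map and on \<open>Qs\<close>.\<close>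

locale coding = lifted M g D pr \<tau> G dg
  for M :: "'a::metric_space measure" and g D pr \<tau> G dg +
  fixes ad :: "real \<Rightarrow> real \<Rightarrow> real" and R C0 \<beta> Cr :: real and Nr :: nat
    and \<eta> C1 C2 \<kappa>' \<kappa> \<epsilon> \<rho> :: real and K0 K Dm :: nat
    and P :: "'a \<Rightarrow> nat" and L :: nat and q :: nat and W :: "nat list \<Rightarrow> nat \<Rightarrow> real"
    and Kc :: "'a set" and Qs :: "'a \<Rightarrow> nat" and LQ :: nat and gap S0 :: real
    and N1 Ng n0 :: nat
  assumes ad_ge: "s \<in> D \<Longrightarrow> t \<in> D \<Longrightarrow> \<bar>s - t\<bar> \<le> ad s t"
    and ad_le: "s \<in> D \<Longrightarrow> t \<in> D \<Longrightarrow> ad s t \<le> C0 * \<bar>s - t\<bar>"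
    and ad_G: "s \<in> D \<Longrightarrow> t \<in> D \<Longrightarrow> ad (G s) (G t) \<le> exp R * ad s t"
    and R0: "R > 0" and C0: "C0 \<ge> 1" and \<beta>0: "\<beta> > 0" and Cr: "Cr \<ge> 1" and Nr: "Nr \<ge> 1"
    and many: "t1 \<in> D \<Longrightarrow> t2 \<in> D \<Longrightarrow> t1 < t2 \<Longrightarrow> finite Z \<Longrightarrow> Z \<subseteq> {t1..t2} \<Longrightarrow> card Z = Nr \<Longrightarrow>
        (\<And>z. z \<in> Z \<Longrightarrow> dg (pr z) = c) \<Longrightarrow> \<bar>dg (pr t2) - c\<bar> \<le> Cr * (t2 - t1) powr \<beta>"
    and \<eta>0: "\<eta> > 0" and C1: "C1 \<ge> 0" and C2: "C2 \<ge> 0" and \<kappa>': "\<kappa>' \<ge> 0" and \<kappa>0: "0 < \<kappa>" "\<kappa> \<le> 1"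
    and K0: "3 \<le> K0" "K0 \<le> K" "K \<le> Dm" "K0 < Dm"
    and zone_weight: "exp (- \<eta>) + 2 * exp (- C1) + (\<Sum>k\<in>{K0..Dm}. exp (- \<kappa>' * real k)) \<le> 1"
    and C0_small: "2 * C0 \<le> exp (\<kappa> * real K0)"
    and \<epsilon>0: "\<epsilon> > 0" "\<epsilon> * exp R \<le> 1/2"
    and unif: "s \<in> D \<Longrightarrow> t \<in> D \<Longrightarrow> \<bar>s - t\<bar> \<le> \<epsilon> \<Longrightarrow> \<bar>dg (pr s) - dg (pr t)\<bar> < exp (- real K0)"
    and P_lt: "x \<in> space M \<Longrightarrow> P x < L"
    and P_small: "x \<in> space M \<Longrightarrow> y \<in> space M \<Longrightarrow> P x = P y \<Longrightarrow> dist x y \<le> \<epsilon> / C0"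
    and W: "W v b > 0" "(\<Sum>b<L. W v b) \<le> 1" "b < L \<Longrightarrow> W v b \<le> 1"
    and Q_lt: "x \<in> space M \<Longrightarrow> Qs x < LQ"
    and Q_gap: "x \<in> Kc \<Longrightarrow> y \<in> Kc \<Longrightarrow> x \<in> space M \<Longrightarrow> y \<in> space M \<Longrightarrow> dist x y < gap \<Longrightarrow> Qs x = Qs y"
    and C2_weight: "exp (- \<eta>) + real LQ * exp (- C2) \<le> 1"
    and S0: "0 < S0" "7 * \<epsilon> * exp (- S0) < gap"
      "S0 \<le> max 0 (ln \<epsilon> + (real Dm + 1 + ln Cr) / \<beta>) + (1 - \<kappa>) * real Dm"
    and N1: "N1 > 0" "C0 / real N1 \<le> \<epsilon>" and Ng: "Ng > 0" "7 / real Ng \<le> gap" and n0: "n0 > 0"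
begin

text \<open>
  The zone of \<open>x\<close> is \<open>k\<close> if the derivative is about \<open>exp (- k)\<close> there; it is 0 if the derivative is not
  small, and \<open>Dm\<close> stands for all the points too close to the critical set to be resolved.
\<close>

definition zone :: "'a \<Rightarrow> nat" where
  "zone x = (if \<bar>dg x\<bar> \<ge> exp (- real K0) then 0 else if \<bar>dg x\<bar> \<le> exp (- real Dm) then Dm
     else nat \<lfloor>- ln \<bar>dg x\<bar>\<rfloor>)"

lemma zone_cases:
  obtains "zone x = 0" "\<bar>dg x\<bar> \<ge> exp (- real K0)"
  | "zone x = Dm" "\<bar>dg x\<bar> \<le> exp (- real Dm)"
  | "K0 \<le> zone x" "zone x < Dm" "exp (- real (Suc (zone x))) < \<bar>dg x\<bar>" "\<bar>dg x\<bar> \<le> exp (- real (zone x))" "\<bar>dg x\<bar> < exp (- real K0)"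
proof (cases "\<bar>dg x\<bar> \<ge> exp (- real K0)")
  case True then show ?thesis using that(1) by (simp add: zone_def)
next
  case a: False
  show ?thesis
  proof (cases "\<bar>dg x\<bar> \<le> exp (- real Dm)")
    case True then show ?thesis using that(2) a by (simp add: zone_def)
  next
    case False
    then have pos: "\<bar>dg x\<bar> > 0" using order_less_trans[OF exp_gt_zero, of "- real Dm" "\<bar>dg x\<bar>"] by simp
    have l1: "- ln \<bar>dg x\<bar> > real K0" using a pos ln_less_cancel_iff[of "\<bar>dg x\<bar>" "exp (- real K0)"] by simp
    have l2: "- ln \<bar>dg x\<bar> < real Dm" using False pos ln_less_cancel_iff[of "exp (- real Dm)" "\<bar>dg x\<bar>"] by simp
    have z: "zone x = nat \<lfloor>- ln \<bar>dg x\<bar>\<rfloor>" using a False by (simp add: zone_def)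
    then have z1: "real (zone x) \<le> - ln \<bar>dg x\<bar>" "- ln \<bar>dg x\<bar> < real (zone x) + 1"
      using l1 by linarith+
    have K: "K0 \<le> zone x" using z l1 by (simp add: le_nat_iff le_floor_iff)
    have D: "zone x < Dm" using z1(1) l2 by linarith
    have "exp (ln \<bar>dg x\<bar>) \<le> exp (- real (zone x))" using z1(1) by (subst exp_le_cancel_iff) linarith
    moreover have "exp (- real (Suc (zone x))) < exp (ln \<bar>dg x\<bar>)" using z1(2) by (subst exp_less_cancel_iff) (unfold of_nat_Suc, linarith)
    ultimately show ?thesis using that(3) K D a pos by simp
  qed
qed

lemma zone_range: "zone x = 0 \<or> (K0 \<le> zone x \<and> zone x \<le> Dm)"
  using K0 by (cases x rule: zone_cases) auto

text \<open>
  On arcs of length \<open>\<epsilon> exp (- level_scale k)\<close> that contain \<open>Nr\<close> points of a level of the derivative, the derivative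
  differs from the level by less than \<open>exp (- k - 1)\<close>, by the hypothesis \<open>many\<close>. After one more iteration,
  such an arc in zone \<open>k\<close> has length at most \<open>\<epsilon> exp (- shrunk_scale k)\<close>, the factor \<open>1 - \<kappa>\<close> absorbing constants.
\<close>

definition level_scale :: "nat \<Rightarrow> real" where "level_scale k = max 0 (ln \<epsilon> + (real k + 1 + ln Cr) / \<beta>)"
definition shrunk_scale :: "nat \<Rightarrow> real" where "shrunk_scale k = level_scale k + (1 - \<kappa>) * real k"
definition mesh :: "real \<Rightarrow> nat" where "mesh b = nat \<lceil>exp b / \<epsilon>\<rceil>"

lemma level_scale_nonneg: "level_scale k \<ge> 0" by (simp add: level_scale_def)
lemma shrunk_scale_ge: "level_scale k \<le> shrunk_scale k" using \<kappa>0 by (simp add: shrunk_scale_def)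
lemma level_scale_mono: "j \<le> k \<Longrightarrow> level_scale j \<le> level_scale k"
  unfolding level_scale_def using \<beta>0 by (intro max.mono order.refl add_left_mono divide_right_mono) auto
lemma shrunk_scale_mono: "j \<le> k \<Longrightarrow> shrunk_scale j \<le> shrunk_scale k"
  unfolding shrunk_scale_def using \<kappa>0 level_scale_mono by (intro add_mono mult_left_mono) auto

lemma mesh_bounds: "real (mesh b) \<ge> exp b / \<epsilon>" "real (mesh b) \<le> exp b / \<epsilon> + 1" "mesh b > 0" "1 / real (mesh b) \<le> \<epsilon> * exp (- b)"
proof -
  have p: "exp b / \<epsilon> > 0" using \<epsilon>0 by simp
  then show 1: "real (mesh b) \<ge> exp b / \<epsilon>" "real (mesh b) \<le> exp b / \<epsilon> + 1"
    unfolding mesh_def by linarith+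
  then have "real (mesh b) > 0" using p by linarith
  then show "mesh b > 0" by simp
  have "1 / real (mesh b) \<le> 1 / (exp b / \<epsilon>)" using 1 p by (intro frac_le) auto
  then show "1 / real (mesh b) \<le> \<epsilon> * exp (- b)" by (simp add: exp_minus field_simps)
qed

text \<open>This is the origin of \<open>level_scale\<close>: the second entry of its maximum is the
  solution \<open>b\<close> of
  \<open>Cr * (\<epsilon> * exp (- b)) powr \<beta> = exp (- (k + 1))\<close>.\<close>

lemma mesh_level: "b \<ge> level_scale k \<Longrightarrow> Cr * (1 / real (mesh b)) powr \<beta> \<le> exp (- real (Suc k))"
proof -
  assume b: "b \<ge> level_scale k"
  have "1 / real (mesh b) \<le> \<epsilon> * exp (- b)" by (rule mesh_bounds)
  also have "\<dots> \<le> \<epsilon> * exp (- (ln \<epsilon> + (real k + 1 + ln Cr) / \<beta>))"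
    using b \<epsilon>0 by (intro mult_left_mono) (auto simp: level_scale_def)
  also have "\<dots> = exp (- ((real k + 1 + ln Cr) / \<beta>))"
    using \<epsilon>0 by (simp add: exp_diff exp_minus exp_add field_simps)
  finally have "(1 / real (mesh b)) powr \<beta> \<le> exp (- ((real k + 1 + ln Cr) / \<beta>)) powr \<beta>"
    using \<beta>0 by (intro powr_mono2) auto
  also have "\<dots> = exp (- (real k + 1 + ln Cr))" using \<beta>0 by (simp add: powr_def)
  finally have "Cr * (1 / real (mesh b)) powr \<beta> \<le> Cr * exp (- (real k + 1 + ln Cr))"
    using Cr by (intro mult_left_mono) auto
  also have "\<dots> = exp (- real (Suc k))" using Cr by (simp add: exp_diff exp_minus exp_add field_simps)
  finally show ?thesis .
qed

text \<open>
  The scale \<open>s\<close> records that the class of a point lies in an arc of length \<open>\<epsilon> exp (- s)\<close> around the current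
  position. It is a function of the symbols of the code, and decreases by at most \<open>R\<close> per step.
\<close>

definition next_scale :: "real \<Rightarrow> nat \<Rightarrow> real" where
  "next_scale s k = (if k = 0 then max 0 (s - R) else if s = 0 \<and> k < K then 0
     else if s \<le> level_scale k \<or> k = Dm then shrunk_scale k else s)"

primrec scale :: "nat \<Rightarrow> 'a \<Rightarrow> real" where
  "scale 0 x = 0"
| "scale (Suc j) x = next_scale (scale j x) (zone ((g ^^ j) x))"

lemma shrunk_scale_nonneg: "shrunk_scale k \<ge> 0"
  using level_scale_nonneg[of k] shrunk_scale_ge[of k] by linarith

lemma scale_nonneg: "scale j x \<ge> 0"
  by (induction j) (auto simp: next_scale_def shrunk_scale_nonneg)

lemma scale_le: "scale j x \<le> shrunk_scale Dm"
proof (induction j)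
  case 0 then show ?case by (simp add: shrunk_scale_nonneg)
next
  case (Suc j)
  have "0 \<le> shrunk_scale Dm" by (rule shrunk_scale_nonneg)
  moreover have "shrunk_scale (zone ((g ^^ j) x)) \<le> shrunk_scale Dm" using zone_range[of "(g ^^ j) x"] K0 by (intro shrunk_scale_mono) auto
  ultimately show ?case using Suc R0 by (auto simp: next_scale_def)
qed

definition zone_sym_of :: "real \<Rightarrow> nat \<Rightarrow> nat" where
  "zone_sym_of s k = (if k = 0 then 0 else if s \<le> level_scale k then k else if k < Dm then 1 else 2)"

text \<open>The symbol 1 forgets the zone, but not the effect on the scale. It occurs only if the
  arc is already shorter than the level scale of the zone demands, and there the scale is positive
  and stays as it is.\<close>

lemma zone_sym_of_eq:
  assumes "zone_sym_of s (zone x) = zone_sym_of s (zone y)"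
  shows "next_scale s (zone x) = next_scale s (zone y)" "zone x = Dm \<longleftrightarrow> zone y = Dm"
proof -
  define k k' where "k = zone x" and "k' = zone y"
  have r: "k = 0 \<or> 3 \<le> k" "k' = 0 \<or> 3 \<le> k'" "k \<le> Dm" "k' \<le> Dm"
    using zone_range[of x] zone_range[of y] K0 unfolding k_def k'_def by auto
  have a: "0 \<le> level_scale k" "0 \<le> level_scale k'" by (rule level_scale_nonneg)+
  have "zone_sym_of s k = zone_sym_of s k'" using assms unfolding k_def k'_def .
  then consider "k = k'" | "level_scale k < s" "level_scale k' < s" "k < Dm" "k' < Dm" "k \<noteq> 0" "k' \<noteq> 0" | "k = Dm" "k' = Dm"
    using r by (auto simp: zone_sym_of_def split: if_splits)
  then have "next_scale s k = next_scale s k' \<and> (k = Dm \<longleftrightarrow> k' = Dm)"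
  proof cases
    case 2
    then have "s \<noteq> 0" using a by linarith
    then show ?thesis using 2 by (simp add: next_scale_def)
  qed auto
  then show "next_scale s (zone x) = next_scale s (zone y)" "zone x = Dm \<longleftrightarrow> zone y = Dm" unfolding k_def k'_def by auto
qed

text \<open>
  The symbols at time \<open>j\<close>: the zone, where 1 and 2 merely tell apart the zones below \<open>Dm\<close> from \<open>Dm\<close> on
  arcs that are already short; the cell of the partition \<open>P\<close>, only at scale 0; the piece of the arc
  between level points; and the \<open>Q\<close>-symbol outside the set \<open>Kc\<close>, inside which nearby points have the
  same \<open>Q\<close>-symbol.
\<close>

definition zone_sym :: "nat \<Rightarrow> 'a \<Rightarrow> nat" where "zone_sym j x = zone_sym_of (scale j x) (zone ((g ^^ j) x))"
definition place_sym :: "nat \<Rightarrow> 'a \<Rightarrow> nat" where "place_sym j x = (if scale j x = 0 then P ((g ^^ j) x) else 0)"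
text \<open>A level can be used only if the derivative at the point is known to keep away from it.
  In the zone \<open>Dm\<close> the derivative may vanish, so 0 is not a level there. The symbol 1
  does not tell the zone, so 0 is the only level there; it still fixes the sign of the
  derivative.\<close>

definition levels :: "nat \<Rightarrow> real set" where
  "levels z = (if z = 1 then {0} else if z = 2 \<or> z = Dm then {2 * exp (- real Dm), - (2 * exp (- real Dm))}
     else {0, 2 * exp (- real z), - (2 * exp (- real z))})"
definition cut_scale :: "nat \<Rightarrow> 'a \<Rightarrow> real" where "cut_scale j x = (if zone_sym j x \<ge> 3 then level_scale (zone_sym j x) else scale j x)"
definition piece_sym :: "nat \<Rightarrow> 'a \<Rightarrow> int \<times> nat" where
  "piece_sym j x = (if zone_sym j x = 0 then (0, 0)
     else piece D (mesh (cut_scale j x)) (\<lambda>t. dg (pr t)) (levels (zone_sym j x)) (pos j x))"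
definition target_sym :: "nat \<Rightarrow> 'a \<Rightarrow> nat" where
  "target_sym j x = (if (g ^^ j) x \<in> Kc then 0 else Suc (Qs ((g ^^ j) x)))"

text \<open>The conjunction is nested to the left because each conjunct is added by one application
  of \<open>gibbs_step\<close> or \<open>gibbs_count\<close>.\<close>

primrec code_eq :: "nat \<Rightarrow> 'a \<Rightarrow> 'a \<Rightarrow> bool" where
  "code_eq 0 x y = (\<lfloor>real N1 * \<tau> x\<rfloor> = \<lfloor>real N1 * \<tau> y\<rfloor>)"
| "code_eq (Suc j) x y = ((((code_eq j x y \<and> zone_sym j x = zone_sym j y) \<and> place_sym j x = place_sym j y) \<and> piece_sym j x = piece_sym j y) \<and> target_sym j x = target_sym j y)"

lemma code_eq_le: "code_eq n x y \<Longrightarrow> j \<le> n \<Longrightarrow> code_eq j x y"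
  by (induction n) (auto simp: le_Suc_eq)

lemma code_eq_less: "code_eq n x y \<Longrightarrow> j < n \<Longrightarrow> zone_sym j x = zone_sym j y \<and> place_sym j x = place_sym j y \<and> piece_sym j x = piece_sym j y \<and> target_sym j x = target_sym j y"
  using code_eq_le[of n x y "Suc j"] by auto

text \<open>The contrapositive of \<open>many\<close>: with \<open>Nr\<close> points of a level in
  the grid cell to the left of \<open>t\<close>, the derivative at \<open>t\<close> would be too
  close to the level. An infinite level set is excluded in the same way, by a subset of
  \<open>Nr\<close> points.\<close>

lemma level_card:
  assumes t: "t \<in> D" and N: "N > 0" and Lv: "finite Lv"
    and far: "\<And>c. c \<in> Lv \<Longrightarrow> \<bar>dg (pr t) - c\<bar> > Cr * (1 / real N) powr \<beta>"
  shows "finite (grid_level D N (\<lambda>t. dg (pr t)) Lv t)" (is ?A)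
    and "card (grid_level D N (\<lambda>t. dg (pr t)) Lv t) \<le> card Lv * (Nr - 1)" (is ?B)
proof -
  let ?S = "\<lambda>c. {s\<in>D. of_int \<lfloor>real N * t\<rfloor> / real N \<le> s \<and> s < t \<and> dg (pr s) = c}"
  have one: "finite (?S c) \<and> card (?S c) \<le> Nr - 1" if c: "c \<in> Lv" for c
  proof (rule ccontr)
    assume "\<not> ?thesis"
    then have "infinite (?S c) \<or> Nr \<le> card (?S c)" using Nr by auto
    then have "\<exists>Z. Z \<subseteq> ?S c \<and> finite Z \<and> card Z = Nr"
    proof
      assume "infinite (?S c)"
      from infinite_arbitrarily_large[OF this, of Nr] show ?thesis by blast
    next
      assume "Nr \<le> card (?S c)"
      from obtain_subset_with_card_n[OF this] show ?thesis by metis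
    qed
    then obtain Z where Z: "Z \<subseteq> ?S c" "finite Z" "card Z = Nr" by blast
    then have "Z \<noteq> {}" using Nr by auto
    define t1 where "t1 = Min Z"
    have t1: "t1 \<in> Z" "\<And>z. z \<in> Z \<Longrightarrow> t1 \<le> z" unfolding t1_def using Z \<open>Z \<noteq> {}\<close> by auto
    then have t1': "t1 \<in> D" "t1 < t" "of_int \<lfloor>real N * t\<rfloor> / real N \<le> t1" using Z by auto
    have "\<bar>dg (pr t) - c\<bar> \<le> Cr * (t - t1) powr \<beta>"
      by (rule many[OF t1'(1) t t1'(2) Z(2) _ Z(3)]) (use Z t1 in \<open>auto intro: less_imp_le\<close>)
    also have "\<dots> \<le> Cr * (1 / real N) powr \<beta>"
    proof (intro mult_left_mono powr_mono2)
      have "real N * t - 1 \<le> of_int \<lfloor>real N * t\<rfloor>" by linarith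
      then have "(real N * t - 1) / real N \<le> of_int \<lfloor>real N * t\<rfloor> / real N" by (rule divide_right_mono) simp
      then have "t - 1 / real N \<le> of_int \<lfloor>real N * t\<rfloor> / real N" using N by (simp add: diff_divide_distrib)
      then show "t - t1 \<le> 1 / real N" using t1'(3) by linarith
    qed (use \<beta>0 Cr t1' in auto)
    finally show False using far[OF c] by simp
  qed
  have eq: "grid_level D N (\<lambda>t. dg (pr t)) Lv t = (\<Union>c\<in>Lv. ?S c)" by (auto simp: grid_level_def)
  show ?A unfolding eq using Lv one by blast
  have "card (\<Union>c\<in>Lv. ?S c) \<le> (\<Sum>c\<in>Lv. card (?S c))" by (rule card_UN_le[OF Lv])
  also have "\<dots> \<le> (\<Sum>c\<in>Lv. Nr - 1)" by (rule sum_mono) (use one in blast)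
  finally show ?B unfolding eq by simp
qed

lemma finite_levels: "finite (levels z)" and card_levels: "card (levels z) \<le> 3"
  by (auto simp: levels_def card_insert_if)

lemma zone_sym_cases:
  obtains "zone_sym j x = 0" "zone ((g ^^ j) x) = 0"
  | "zone_sym j x = 1" "K0 \<le> zone ((g ^^ j) x)" "zone ((g ^^ j) x) < Dm" "level_scale (zone ((g ^^ j) x)) < scale j x"
  | "zone_sym j x = 2" "zone ((g ^^ j) x) = Dm" "level_scale Dm < scale j x"
  | "K0 \<le> zone_sym j x" "zone_sym j x \<le> Dm" "zone ((g ^^ j) x) = zone_sym j x" "scale j x \<le> level_scale (zone_sym j x)"
proof -
  let ?k = "zone ((g ^^ j) x)"
  have r: "?k = 0 \<or> (K0 \<le> ?k \<and> ?k \<le> Dm)" by (rule zone_range)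
  consider "?k = 0" | "K0 \<le> ?k" "?k \<le> Dm" "scale j x \<le> level_scale ?k" | "K0 \<le> ?k" "?k < Dm" "level_scale ?k < scale j x"
    | "?k = Dm" "level_scale Dm < scale j x"
    using r by fastforce
  then show ?thesis
  proof cases
    case 1
    then have "zone_sym j x = 0" by (simp add: zone_sym_def zone_sym_of_def)
    then show ?thesis by (rule that(1)) (rule 1)
  next
    case 2
    then have z: "?k = zone_sym j x" using K0 by (simp add: zone_sym_def zone_sym_of_def)
    show ?thesis by (rule that(4)[OF 2(1,2)[unfolded z] z 2(3)[unfolded z]])
  next
    case 3
    then have "zone_sym j x = 1" using K0 by (simp add: zone_sym_def zone_sym_of_def)
    then show ?thesis by (rule that(2)) (rule 3)+
  next
    case 4
    then have "zone_sym j x = 2" using K0 by (simp add: zone_sym_def zone_sym_of_def)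
    then show ?thesis by (rule that(3)) (rule 4)+
  qed
qed

text \<open>In a zone \<open>k\<close> above the bottom the derivative lies between
  \<open>exp (- k - 1)\<close> and \<open>exp (- k)\<close> in absolute value, so it is further than
  \<open>exp (- k - 1)\<close> from 0 and from the two levels at \<open>2 * exp (- k)\<close> up to
  sign; at the bottom only the latter are used. The cutting scale is at least
  \<open>level_scale k\<close>, which by \<open>mesh_level\<close> makes the error over a grid cell
  no larger than that.\<close>

lemma levels_far:
  assumes x: "x \<in> space M" and z: "zone_sym j x \<noteq> 0" and c: "c \<in> levels (zone_sym j x)"
  shows "\<bar>dg (pr (pos j x)) - c\<bar> > Cr * (1 / real (mesh (cut_scale j x))) powr \<beta>"
proof -
  let ?y = "(g ^^ j) x"
  have y: "pr (pos j x) = ?y" by (rule pr_pos[OF x])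
  have dm: "\<bar>dg ?y - c\<bar> > exp (- real (Suc Dm))"
    if "c = 2 * exp (- real Dm) \<or> c = - (2 * exp (- real Dm))" "zone ?y = Dm"
  proof -
    have "\<bar>dg ?y\<bar> \<le> exp (- real Dm)" using that(2) K0 by (cases ?y rule: zone_cases) auto
    from abs_diff_double[OF this that(1)]
    have "exp (- real Dm) \<le> \<bar>dg ?y - c\<bar>" .
    moreover have "exp (- real (Suc Dm)) < exp (- real Dm)" by simp
    ultimately show ?thesis by linarith
  qed
  show ?thesis unfolding y
  proof (cases j x rule: zone_sym_cases)
    case 2
    have "exp (- real (Suc (zone ?y))) < \<bar>dg ?y\<bar>" using 2 K0 by (cases ?y rule: zone_cases) auto
    moreover have "Cr * (1 / real (mesh (cut_scale j x))) powr \<beta> \<le> exp (- real (Suc (zone ?y)))"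
      by (rule mesh_level) (use 2 in \<open>simp add: cut_scale_def\<close>)
    ultimately show "\<bar>dg ?y - c\<bar> > Cr * (1 / real (mesh (cut_scale j x))) powr \<beta>" using c 2 by (auto simp: levels_def)
  next
    case 3
    have "Cr * (1 / real (mesh (cut_scale j x))) powr \<beta> \<le> exp (- real (Suc Dm))"
      by (rule mesh_level) (use 3 in \<open>simp add: cut_scale_def\<close>)
    moreover have "c = 2 * exp (- real Dm) \<or> c = - (2 * exp (- real Dm))" using c 3 by (auto simp: levels_def)
    ultimately show "\<bar>dg ?y - c\<bar> > Cr * (1 / real (mesh (cut_scale j x))) powr \<beta>" using dm 3 by force
  next
    case 4
    have lv: "Cr * (1 / real (mesh (cut_scale j x))) powr \<beta> \<le> exp (- real (Suc (zone ?y)))"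
      by (rule mesh_level) (use 4 K0 in \<open>simp add: cut_scale_def\<close>)
    show "\<bar>dg ?y - c\<bar> > Cr * (1 / real (mesh (cut_scale j x))) powr \<beta>"
    proof (cases "zone_sym j x = Dm")
      case True
      then have "c = 2 * exp (- real Dm) \<or> c = - (2 * exp (- real Dm))" using c K0 by (auto simp: levels_def)
      then show ?thesis using dm lv 4 True by force
    next
      case False
      then have b: "exp (- real (Suc (zone ?y))) < \<bar>dg ?y\<bar>" "\<bar>dg ?y\<bar> \<le> exp (- real (zone ?y))"
        using 4 K0 by (cases ?y rule: zone_cases; auto)+
      have e: "exp (- real (Suc (zone ?y))) < exp (- real (zone ?y))" by simp
      have "c = 0 \<or> c = 2 * exp (- real (zone ?y)) \<or> c = - (2 * exp (- real (zone ?y)))"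
        using c False 4 K0 by (auto simp: levels_def split: if_splits)
      then have "\<bar>dg ?y - c\<bar> > exp (- real (Suc (zone ?y)))"
        using b e abs_diff_double[OF b(2), of c] by fastforce
      then show ?thesis using lv by linarith
    qed
  qed (use z in auto)
qed

lemma seg_no_level:
  assumes xy: "x \<in> space M" "y \<in> space M" and s: "scale j x = scale j y" and z: "zone_sym j x = zone_sym j y" "zone_sym j x \<noteq> 0"
    and l: "piece_sym j x = piece_sym j y" and r: "r \<in> closed_segment (pos j x) (pos j y)"
  shows "dg (pr r) \<notin> levels (zone_sym j x)" "\<bar>pos j x - pos j y\<bar> \<le> 1 / real (mesh (cut_scale j x))"
proof -
  have b: "cut_scale j x = cut_scale j y" using s z by (simp add: cut_scale_def)
  let ?N = "mesh (cut_scale j x)" and ?Lv = "levels (zone_sym j x)" and ?h = "\<lambda>t. dg (pr t)"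
  have N: "?N > 0" by (rule mesh_bounds)
  have pc: "piece D ?N ?h ?Lv (pos j x) = piece D ?N ?h ?Lv (pos j y)"
    using l z b by (simp add: piece_sym_def)
  have D: "pos j x \<in> D" "pos j y \<in> D" using pos_in xy by auto
  have farx: "\<bar>dg (pr (pos j x)) - c\<bar> > Cr * (1 / real ?N) powr \<beta>" if "c \<in> ?Lv" for c
    using levels_far[OF xy(1) z(2) that] .
  have fary: "\<bar>dg (pr (pos j y)) - c\<bar> > Cr * (1 / real ?N) powr \<beta>" if "c \<in> ?Lv" for c
    using levels_far[OF xy(2), of j c] z that b by simp
  have fx: "finite (grid_level D ?N ?h ?Lv (pos j x))" by (rule level_card(1)[OF D(1) N finite_levels farx])
  have fy: "finite (grid_level D ?N ?h ?Lv (pos j y))" by (rule level_card(1)[OF D(2) N finite_levels fary])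
  have Cp: "Cr * (1 / real ?N) powr \<beta> \<ge> 0" using Cr by simp
  \<comment> \<open>\<open>piece_separates\<close> leaves out the right end of the segment; that end
    is covered by its distance from the levels.\<close>
  have exit: "dg (pr (pos j x)) \<notin> ?Lv" using farx[of "dg (pr (pos j x))"] Cp by auto
  have ey: "dg (pr (pos j y)) \<notin> ?Lv" using fary[of "dg (pr (pos j y))"] Cp by auto
  have rD: "r \<in> D" using seg_D[OF D] r by auto
  show "dg (pr r) \<notin> levels (zone_sym j x)"
  proof (cases "pos j x \<le> pos j y")
    case True
    then have "r = pos j y \<or> (pos j x \<le> r \<and> r < pos j y)" using r by (auto simp: closed_segment_eq_real_ivl)
    then show ?thesis using piece_separates[OF pc True fy N rD] ey by auto
  next
    case False
    then have "r = pos j x \<or> (pos j y \<le> r \<and> r < pos j x)" using r by (auto simp: closed_segment_eq_real_ivl)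
    then show ?thesis using piece_separates[OF pc[symmetric] _ fx N rD] False exit by auto
  qed
  have "\<lfloor>real ?N * pos j x\<rfloor> = \<lfloor>real ?N * pos j y\<rfloor>" using pc by (simp add: piece_def)
  then have "\<bar>real ?N * pos j x - real ?N * pos j y\<bar> \<le> 1" by linarith
  then have "real ?N * \<bar>pos j x - pos j y\<bar> \<le> 1" by (simp add: abs_mult flip: right_diff_distrib)
  then show "\<bar>pos j x - pos j y\<bar> \<le> 1 / real ?N" using N by (simp add: field_simps)
qed

text \<open>The bound at the beginning of a step, before the symbol of the partition
  \<open>P\<close> is read. At scale 0 the arc may have grown by a factor exp R since the last
  symbol was read.\<close>

definition pre_bound :: "real \<Rightarrow> real" where
  "pre_bound s = (if s = 0 then \<epsilon> * exp R else \<epsilon> * exp (- s))"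

text \<open>At scale 0 the cell of \<open>P\<close> brings the arc back to the length \<epsilon>.
  Points of one cell are close in the space; that they are also close in the parameter is where
  \<open>\<epsilon> * exp R \<le> 1/2\<close> is needed.\<close>

lemma post_bound:
  assumes xy: "x \<in> space M" "y \<in> space M" and s: "scale j x = scale j y"
    and pre: "ad (pos j x) (pos j y) \<le> pre_bound (scale j x)" and p: "place_sym j x = place_sym j y"
  shows "ad (pos j x) (pos j y) \<le> \<epsilon> * exp (- scale j x)"
proof (cases "scale j x = 0")
  case True
  have D: "pos j x \<in> D" "pos j y \<in> D" using pos_in xy by auto
  have "\<bar>pos j x - pos j y\<bar> \<le> 1/2"
    using ad_ge[OF D] pre True \<epsilon>0(2) by (simp add: pre_bound_def)
  then have "\<bar>pos j x - pos j y\<bar> \<le> dist ((g ^^ j) x) ((g ^^ j) y)"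
    using chord[OF D] by (simp add: pr_pos xy)
  also have "\<dots> \<le> \<epsilon> / C0"
    by (rule P_small) (use p s True xy Tn_space in \<open>auto simp: place_sym_def\<close>)
  finally have "C0 * \<bar>pos j x - pos j y\<bar> \<le> \<epsilon>" using C0 by (simp add: field_simps)
  then show ?thesis using ad_le[OF D] True by simp
next
  case False
  then show ?thesis using pre by (simp add: pre_bound_def)
qed

text \<open>A derivative that is not small lets the arc grow by at most exp R. A small one keeps its
  size up to a factor on the whole arc: the arc contains no level point, so by the intermediate
  value theorem the derivative stays between the two outer levels, and the arc contracts
  accordingly. The second claim makes the lift monotone on the arc.\<close>

lemma step_bound:
  assumes xy: "x \<in> space M" "y \<in> space M" and s: "scale j x = scale j y"
    and post: "ad (pos j x) (pos j y) \<le> \<epsilon> * exp (- scale j x)"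
    and z: "zone_sym j x = zone_sym j y" and l: "piece_sym j x = piece_sym j y"
  shows "ad (pos (Suc j) x) (pos (Suc j) y) \<le> pre_bound (scale (Suc j) x)"
    and "zone ((g ^^ j) x) \<noteq> Dm \<Longrightarrow> r \<in> closed_segment (pos j x) (pos j y) \<Longrightarrow> dg (pr r) \<noteq> 0"
proof -
  let ?t = "pos j x" and ?t' = "pos j y" and ?s = "scale j x"
  let ?k = "zone ((g ^^ j) x)" and ?k' = "zone ((g ^^ j) y)"
  have D: "?t \<in> D" "?t' \<in> D" using pos_in xy by auto
  have px: "pr ?t = (g ^^ j) x" "pr ?t' = (g ^^ j) y" using pr_pos xy by auto
  have s0: "0 \<le> ?s" by (rule scale_nonneg)
  have es: "\<epsilon> * exp (- ?s) \<le> \<epsilon>" using s0 \<epsilon>0 by simp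
  have dt: "\<bar>?t - ?t'\<bar> \<le> \<epsilon> * exp (- ?s)" using ad_ge[OF D] post by linarith
  then have dte: "\<bar>?t - ?t'\<bar> \<le> \<epsilon>" using es by linarith
  have near: "\<bar>dg (pr r) - dg (pr ?t)\<bar> < exp (- real K0)" if r: "r \<in> closed_segment ?t ?t'" for r
  proof (rule unif)
    show "r \<in> D" using r seg_D[OF D] by auto
    show "\<bar>r - ?t\<bar> \<le> \<epsilon>" using segment_bound(1)[OF r] dte by (simp add: abs_minus_commute)
  qed (rule D)
  have pos: "pos (Suc j) x = G ?t" "pos (Suc j) y = G ?t'" by (simp_all add: pos_Suc)
  have scS: "scale (Suc j) x = next_scale ?s ?k" by simp
  \<comment> \<open>The factor 2 in the derivative bound and the constant \<open>C0\<close> are both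
    absorbed by \<open>exp (\<kappa> * real k)\<close>; hence the factor \<open>1 - \<kappa>\<close>
    in \<open>shrunk_scale\<close>.\<close>
  have small: "ad (G ?t) (G ?t') \<le> \<epsilon> * exp (- (a + (1 - \<kappa>) * real k))"
    if "\<And>r. r \<in> closed_segment ?t ?t' \<Longrightarrow> \<bar>dg (pr r)\<bar> \<le> 2 * exp (- real k)"
      "\<bar>?t - ?t'\<bar> \<le> \<epsilon> * exp (- a)" "k \<ge> K0" for a k
  proof -
    have "ad (G ?t) (G ?t') \<le> C0 * \<bar>G ?t - G ?t'\<bar>" by (rule ad_le) (use D G_in in auto)
    also have "\<dots> \<le> C0 * (2 * exp (- real k) * (\<epsilon> * exp (- a)))"
    proof (rule mult_left_mono)
      have "\<bar>G ?t - G ?t'\<bar> \<le> 2 * exp (- real k) * \<bar>?t - ?t'\<bar>" by (rule G_contract[OF D that(1)])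
      also have "\<dots> \<le> 2 * exp (- real k) * (\<epsilon> * exp (- a))" by (rule mult_left_mono[OF that(2)]) simp
      finally show "\<bar>G ?t - G ?t'\<bar> \<le> 2 * exp (- real k) * (\<epsilon> * exp (- a))" .
    qed (use C0 in simp)
    also have "\<dots> = (2 * C0) * (exp (- real k) * (\<epsilon> * exp (- a)))" by simp
    also have "\<dots> \<le> exp (\<kappa> * real k) * (exp (- real k) * (\<epsilon> * exp (- a)))"
    proof (rule mult_right_mono)
      have "exp (\<kappa> * real K0) \<le> exp (\<kappa> * real k)" using that(3) \<kappa>0 by simp
      then show "2 * C0 \<le> exp (\<kappa> * real k)" using C0_small by linarith
    qed (use \<epsilon>0 in simp)
    also have "\<dots> = \<epsilon> * exp (- (a + (1 - \<kappa>) * real k))"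
      by (simp add: exp_add[symmetric] algebra_simps)
    finally show ?thesis .
  qed
  have nz: "\<bar>dg (pr r)\<bar> < 2 * exp (- real k)"
    if "\<bar>dg (pr ?t)\<bar> \<le> exp (- real k)" "2 * exp (- real k) \<in> levels (zone_sym j x)" "- (2 * exp (- real k)) \<in> levels (zone_sym j x)"
      "zone_sym j x \<noteq> 0" "r \<in> closed_segment ?t ?t'" for r k
  proof -
    have no: "dg (pr r) \<noteq> 2 * exp (- real k)" "dg (pr r) \<noteq> - (2 * exp (- real k))" if r: "r \<in> closed_segment ?t ?t'" for r
      using seg_no_level(1)[OF xy s z \<open>zone_sym j x \<noteq> 0\<close> l r] \<open>2 * exp (- real k) \<in> levels (zone_sym j x)\<close>
        \<open>- (2 * exp (- real k)) \<in> levels (zone_sym j x)\<close> by metis+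
    have e: "exp (- real k) > 0" by simp
    have "dg (pr r) < 2 * exp (- real k)"
      by (rule seg_below_level[OF D _ no(1) that(5)]) (use that(1) e in linarith)
    moreover have "dg (pr r) > - (2 * exp (- real k))"
      by (rule seg_above_level[OF D _ no(2) that(5)]) (use that(1) e in linarith)
    ultimately show ?thesis by (simp add: abs_less_iff)
  qed
  have expand: "ad (G ?t) (G ?t') \<le> exp R * (\<epsilon> * exp (- ?s))"
    by (rule order_trans[OF ad_G[OF D] mult_left_mono[OF post]]) simp
  have goal: "ad (G ?t) (G ?t') \<le> pre_bound (next_scale ?s ?k) \<and>
      (?k \<noteq> Dm \<longrightarrow> (\<forall>r\<in>closed_segment ?t ?t'. dg (pr r) \<noteq> 0))"
  proof (cases j x rule: zone_sym_cases)
    case 1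
    have "ad (G ?t) (G ?t') \<le> pre_bound (next_scale ?s ?k)"
    proof (cases "?s \<le> R")
      case True
      have "exp R * (\<epsilon> * exp (- ?s)) \<le> exp R * \<epsilon>" using es by (intro mult_left_mono) auto
      then have "ad (G ?t) (G ?t') \<le> \<epsilon> * exp R" using expand by (simp only: mult.commute[of \<epsilon> "exp R"])
      then show ?thesis using True 1 by (simp add: next_scale_def pre_bound_def)
    next
      case False
      have e: "exp R * (\<epsilon> * exp (- ?s)) = \<epsilon> * exp (- (?s - R))"
        by (simp add: mult.left_commute mult_exp_exp)
      show ?thesis using expand[unfolded e] False 1 by (simp add: next_scale_def pre_bound_def)
    qed
    moreover have "\<bar>dg (pr ?t)\<bar> \<ge> exp (- real K0)" unfolding px using 1(2) K0 by (cases "(g ^^ j) x" rule: zone_cases) auto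
    then have "dg (pr r) \<noteq> 0" if "r \<in> closed_segment ?t ?t'" for r using near[OF that] by auto
    ultimately show ?thesis by blast
  next
    case 2
    have dx: "\<bar>dg (pr ?t)\<bar> < exp (- real K0)" unfolding px using 2 K0 by (cases "(g ^^ j) x" rule: zone_cases) auto
    have sp: "?s > 0" using 2(4) level_scale_nonneg[of ?k] by linarith
    have sg: "next_scale ?s ?k = ?s" using 2 K0 sp by (auto simp: next_scale_def)
    \<comment> \<open>The symbol 1 cuts at the level 0 alone, so only the crude bound
      \<open>2 * exp (- K0)\<close> from uniform continuity is at hand. It just compensates
      \<open>C0\<close>, and the scale stays the same.\<close>
    have "ad (G ?t) (G ?t') \<le> C0 * \<bar>G ?t - G ?t'\<bar>" by (rule ad_le) (use D G_in in auto)
    also have "\<dots> \<le> C0 * (2 * exp (- real K0) * \<bar>?t - ?t'\<bar>)"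
    proof (rule mult_left_mono[OF G_contract[OF D]])
      show "\<bar>dg (pr r)\<bar> \<le> 2 * exp (- real K0)" if "r \<in> closed_segment ?t ?t'" for r
        using near[OF that] dx by linarith
    qed (use C0 in simp)
    also have "\<dots> = (2 * C0 * exp (- real K0)) * \<bar>?t - ?t'\<bar>" by simp
    also have "\<dots> \<le> 1 * \<bar>?t - ?t'\<bar>"
    proof (rule mult_right_mono)
      have "exp (\<kappa> * real K0) \<le> exp (real K0)" using \<kappa>0 by (simp add: mult_left_le_one_le)
      then have "2 * C0 \<le> exp (real K0)" using C0_small by linarith
      then have "2 * C0 * exp (- real K0) \<le> exp (real K0) * exp (- real K0)" by (rule mult_right_mono) simp
      then show "2 * C0 * exp (- real K0) \<le> 1" by (simp add: exp_minus)
    qed simp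
    finally have "ad (G ?t) (G ?t') \<le> \<epsilon> * exp (- ?s)" using dt by simp
    moreover have "dg (pr r) \<noteq> 0" if "r \<in> closed_segment ?t ?t'" for r
      using seg_no_level(1)[OF xy s z _ l that] 2 by (simp add: levels_def)
    ultimately show ?thesis using sg sp by (simp add: pre_bound_def)
  next
    case 3
    have dx: "\<bar>dg (pr ?t)\<bar> \<le> exp (- real Dm)" unfolding px using 3 K0 by (cases "(g ^^ j) x" rule: zone_cases) auto
    have dgl: "\<bar>dg (pr r)\<bar> \<le> 2 * exp (- real Dm)" if "r \<in> closed_segment ?t ?t'" for r
      using nz[OF dx _ _ _ that] 3 by (auto simp: levels_def)
    have sp: "?s > 0" using 3(3) level_scale_nonneg[of Dm] by linarith
    have sg: "next_scale ?s ?k = shrunk_scale Dm" using 3 K0 sp by (auto simp: next_scale_def)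
    have "ad (G ?t) (G ?t') \<le> \<epsilon> * exp (- (level_scale Dm + (1 - \<kappa>) * real Dm))"
    proof (rule small[OF dgl])
      have "\<epsilon> * exp (- ?s) \<le> \<epsilon> * exp (- level_scale Dm)" using 3 \<epsilon>0 by simp
      then show "\<bar>?t - ?t'\<bar> \<le> \<epsilon> * exp (- level_scale Dm)" using dt by linarith
    qed (use K0 in auto)
    then have b: "ad (G ?t) (G ?t') \<le> \<epsilon> * exp (- shrunk_scale Dm)" unfolding shrunk_scale_def .
    have "shrunk_scale Dm > 0" using S0(1,3) unfolding shrunk_scale_def level_scale_def by linarith
    then show ?thesis using b sg 3 by (simp add: pre_bound_def)
  next
    case 4
    have zne: "zone_sym j x \<noteq> 0" "zone_sym j x \<noteq> 1" "zone_sym j x \<noteq> 2" using 4 K0 by auto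
    have dx: "\<bar>dg (pr ?t)\<bar> \<le> exp (- real (zone_sym j x))" unfolding px using 4 K0 by (cases "(g ^^ j) x" rule: zone_cases) auto
    have dgl: "\<bar>dg (pr r)\<bar> \<le> 2 * exp (- real (zone_sym j x))" if "r \<in> closed_segment ?t ?t'" for r
    proof -
      have lv: "2 * exp (- real (zone_sym j x)) \<in> levels (zone_sym j x)" "- (2 * exp (- real (zone_sym j x))) \<in> levels (zone_sym j x)"
        using zne by (auto simp: levels_def)
      show ?thesis using nz[OF dx lv zne(1) that] by simp
    qed
    have "ad (G ?t) (G ?t') \<le> \<epsilon> * exp (- (level_scale (zone_sym j x) + (1 - \<kappa>) * real (zone_sym j x)))"
    proof (rule small[OF dgl])
      have "\<bar>?t - ?t'\<bar> \<le> 1 / real (mesh (cut_scale j x))" by (rule seg_no_level(2)[OF xy s z zne(1) l ends_in_segment(1)])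
      also have "\<dots> \<le> \<epsilon> * exp (- cut_scale j x)" by (rule mesh_bounds)
      finally show "\<bar>?t - ?t'\<bar> \<le> \<epsilon> * exp (- level_scale (zone_sym j x))" using 4 K0 by (simp add: cut_scale_def)
    qed (use 4 in auto)
    then have b: "ad (G ?t) (G ?t') \<le> \<epsilon> * exp (- shrunk_scale (zone_sym j x))" unfolding shrunk_scale_def .
    have An: "shrunk_scale (zone_sym j x) \<ge> 0" by (rule shrunk_scale_nonneg)
    have "ad (G ?t) (G ?t') \<le> pre_bound (next_scale ?s ?k)"
    proof (cases "?s = 0 \<and> ?k < K")
      case True
      then show ?thesis using expand 4 K0 by (simp add: next_scale_def pre_bound_def mult.commute)
    next
      case False
      then have sg: "next_scale ?s ?k = shrunk_scale (zone_sym j x)" using 4 K0 by (auto simp: next_scale_def)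
      \<comment> \<open>This is for the case that \<open>shrunk_scale\<close> is 0, where
        \<open>pre_bound\<close> is the larger number \<open>\<epsilon> * exp R\<close>.\<close>
      have "\<epsilon> * exp (- shrunk_scale (zone_sym j x)) \<le> \<epsilon> * exp R" using An R0 \<epsilon>0 by simp
      then show ?thesis unfolding sg pre_bound_def using b by auto
    qed
    moreover have "dg (pr r) \<noteq> 0" if "?k \<noteq> Dm" "r \<in> closed_segment ?t ?t'" for r
      using seg_no_level(1)[OF xy s z zne(1) l that(2)] zne 4 that(1) by (auto simp: levels_def)
    ultimately show ?thesis by blast
  qed
  then show "ad (pos (Suc j) x) (pos (Suc j) y) \<le> pre_bound (scale (Suc j) x)" unfolding pos scS by blast
  show "dg (pr r) \<noteq> 0" if "?k \<noteq> Dm" "r \<in> closed_segment ?t ?t'" using goal that by blast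
qed

lemma code_eq_inv:
  assumes xy: "x \<in> space M" "y \<in> space M" and E: "code_eq j x y"
  shows "scale j x = scale j y" "ad (pos j x) (pos j y) \<le> pre_bound (scale j x)"
proof -
  have "scale j x = scale j y \<and> ad (pos j x) (pos j y) \<le> pre_bound (scale j x)" using E
  proof (induction j)
    case 0
    have D: "\<tau> x \<in> D" "\<tau> y \<in> D" using xy \<tau> by auto
    have "\<lfloor>real N1 * \<tau> x\<rfloor> = \<lfloor>real N1 * \<tau> y\<rfloor>" using 0 by simp
    then have "\<bar>real N1 * \<tau> x - real N1 * \<tau> y\<bar> \<le> 1" by linarith
    then have "real N1 * \<bar>\<tau> x - \<tau> y\<bar> \<le> 1" by (simp add: abs_mult flip: right_diff_distrib)
    then have "\<bar>\<tau> x - \<tau> y\<bar> \<le> 1 / real N1" using N1 by (simp add: field_simps)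
    then have "C0 * \<bar>\<tau> x - \<tau> y\<bar> \<le> C0 * (1 / real N1)" using C0 by (intro mult_left_mono) auto
    then have "ad (\<tau> x) (\<tau> y) \<le> \<epsilon>" using ad_le[OF D] N1(2) by simp
    moreover have "\<epsilon> \<le> \<epsilon> * exp R" using \<epsilon>0 R0 by simp
    ultimately show ?case by (simp add: pos_0 pre_bound_def)
  next
    case (Suc j)
    then have IH: "scale j x = scale j y" "ad (pos j x) (pos j y) \<le> pre_bound (scale j x)" by auto
    have eq: "zone_sym j x = zone_sym j y" "place_sym j x = place_sym j y" "piece_sym j x = piece_sym j y" using Suc.prems by auto
    have "scale (Suc j) x = scale (Suc j) y" using zone_sym_of_eq(1)[of "scale j x" "(g ^^ j) x" "(g ^^ j) y"] eq(1) IH(1) by (simp add: zone_sym_def)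
    moreover have "ad (pos (Suc j) x) (pos (Suc j) y) \<le> pre_bound (scale (Suc j) x)"
      by (rule step_bound(1)[OF xy IH(1) post_bound[OF xy IH eq(2)] eq(1,3)])
    ultimately show ?case by blast
  qed
  then show "scale j x = scale j y" "ad (pos j x) (pos j y) \<le> pre_bound (scale j x)" by auto
qed

lemma code_eq_nonzero:
  assumes xy: "x \<in> space M" "y \<in> space M" and E: "code_eq n x y" and j: "j < n"
  shows "zone ((g ^^ j) x) = Dm \<longleftrightarrow> zone ((g ^^ j) y) = Dm"
    "zone ((g ^^ j) x) \<noteq> Dm \<Longrightarrow> r \<in> closed_segment (pos j x) (pos j y) \<Longrightarrow> dg (pr r) \<noteq> 0"
proof -
  have Ej: "code_eq j x y" using code_eq_le[OF E] j by simp
  note I = code_eq_inv[OF xy Ej] and eq = code_eq_less[OF E j]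
  show "zone ((g ^^ j) x) = Dm \<longleftrightarrow> zone ((g ^^ j) y) = Dm"
    using zone_sym_of_eq(2)[of "scale j x" "(g ^^ j) x" "(g ^^ j) y"] eq I(1) by (simp add: zone_sym_def)
  show "dg (pr r) \<noteq> 0" if "zone ((g ^^ j) x) \<noteq> Dm" "r \<in> closed_segment (pos j x) (pos j y)"
    using step_bound(2)[OF xy I(1) post_bound[OF xy I] _ _ that] eq by blast
qed

lemma code_eq_half:
  assumes xy: "x \<in> space M" "y \<in> space M" and E: "code_eq j x y"
  shows "\<bar>pos j x - pos j y\<bar> \<le> 1/2"
proof -
  have "\<bar>pos j x - pos j y\<bar> \<le> pre_bound (scale j x)"
    using ad_ge[OF pos_in[OF xy(1)] pos_in[OF xy(2)], of j j] code_eq_inv(2)[OF assms] by linarith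
  also have "\<dots> \<le> \<epsilon> * exp R"
    using \<epsilon>0 R0 scale_nonneg[of j x] by (auto simp: pre_bound_def intro!: mult_left_mono)
  finally show ?thesis using \<epsilon>0 by linarith
qed

section \<open>The costs of the symbols and Kraft's inequality for the code\<close>

definition psi :: "'a \<Rightarrow> real" where "psi x = - ln (W (word g P q x) (P ((g ^^ q) x)))"
text \<open>The conditional weight of the next symbol of \<open>P\<close> requires the
  \<open>q\<close> preceding symbols, and the code contains these only if the scale was 0
  throughout. Otherwise the symbol is paid with \<open>ln (real L)\<close>.\<close>

definition hist :: "nat \<Rightarrow> 'a \<Rightarrow> bool" where "hist j x \<longleftrightarrow> q \<le> j \<and> (\<forall>i\<le>q. scale (j - i) x = 0)"
definition C3 :: real where "C3 = ln (12 * real Nr)"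
definition zone_cost :: "nat \<Rightarrow> real" where "zone_cost z = (if z = 0 then \<eta> else if z = 1 \<or> z = 2 then C1 else \<kappa>' * real z)"
definition place_cost :: "nat \<Rightarrow> 'a \<Rightarrow> real" where
  "place_cost j x = (if scale j x = 0 then (if hist j x then psi ((g ^^ (j - q)) x) else ln (real L)) else 0)"
definition piece_cost :: "nat \<Rightarrow> 'a \<Rightarrow> real" where
  "piece_cost j x = (if zone_sym j x = 0 then 0 else C3 + max 0 (cut_scale j x - scale j x))"
definition target_cost :: "nat \<Rightarrow> 'a \<Rightarrow> real" where "target_cost j x = (if target_sym j x = 0 then \<eta> else C2)"
primrec code_cost :: "nat \<Rightarrow> 'a \<Rightarrow> real" where
  "code_cost 0 x = ln (real N1 + 1)"
| "code_cost (Suc j) x = (((code_cost j x + zone_cost (zone_sym j x)) + place_cost j x) + piece_cost j x) + target_cost j x"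

lemma L_pos: "L > 0"
proof -
  obtain x where "x \<in> space M" using not_empty by blast
  then show ?thesis using P_lt by fastforce
qed

lemma gibbs_EE0: "gibbs (space M) (code_eq 0) (code_cost 0)"
proof (rule gibbs_weaken[OF gibbs_count[OF gibbs_trivial, where c = "\<lambda>x. \<lfloor>real N1 * \<tau> x\<rfloor>" and v = "\<lambda>x. ln (real N1 + 1)"]])
  fix Y y assume Y: "finite Y" "Y \<subseteq> space M" "inj_on (\<lambda>x. \<lfloor>real N1 * \<tau> x\<rfloor>) Y"
  have "card Y = card ((\<lambda>x. \<lfloor>real N1 * \<tau> x\<rfloor>) ` Y)" using Y by (simp add: card_image)
  also have "\<dots> \<le> card {0..int N1}"
  proof (rule card_mono)
    show "(\<lambda>x. \<lfloor>real N1 * \<tau> x\<rfloor>) ` Y \<subseteq> {0..int N1}"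
    proof (rule image_subsetI)
      fix x assume "x \<in> Y"
      then have x: "0 \<le> \<tau> x" "\<tau> x \<le> 1" using \<tau> Y by auto
      have "0 \<le> real N1 * \<tau> x" "real N1 * \<tau> x \<le> real N1 * 1" using x mult_left_mono[OF x(2), of "real N1"] by simp_all
      then show "\<lfloor>real N1 * \<tau> x\<rfloor> \<in> {0..int N1}" by (auto simp: floor_le_iff)
    qed
  qed simp
  finally show "real (card Y) \<le> exp (ln (real N1 + 1))" by (simp add: add.commute)
qed auto

lemma code_eq_scale: "x \<in> space M \<Longrightarrow> y \<in> space M \<Longrightarrow> code_eq n x y \<Longrightarrow> j \<le> n \<Longrightarrow> scale j x = scale j y"
  using code_eq_inv(1) code_eq_le by blast

lemma code_eq_hist: "x \<in> space M \<Longrightarrow> y \<in> space M \<Longrightarrow> code_eq j x y \<Longrightarrow> hist j x = hist j y"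
  unfolding hist_def using code_eq_scale[of x y j] by auto

lemma code_eq_word:
  assumes xy: "x \<in> space M" "y \<in> space M" and E: "code_eq j x y" and h: "hist j x"
  shows "word g P q ((g ^^ (j - q)) x) = word g P q ((g ^^ (j - q)) y)"
  unfolding word_eq_iff
proof (intro allI impI)
  fix i assume i: "i < q"
  have q: "q \<le> j" using h by (simp add: hist_def)
  then have l: "j - q + i < j" "j - (q - i) = j - q + i" using i by auto
  have s: "scale (j - q + i) x = 0" using h i l(2) unfolding hist_def by (metis diff_le_self)
  then have "scale (j - q + i) y = 0" using code_eq_scale[OF xy E] l(1) by simp
  then have "P ((g ^^ (j - q + i)) x) = P ((g ^^ (j - q + i)) y)"
    using code_eq_less[OF E l(1)] s by (simp add: place_sym_def)
  then show "P ((g ^^ i) ((g ^^ (j - q)) x)) = P ((g ^^ i) ((g ^^ (j - q)) y))"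
    by (simp add: funpow_add add.commute[of "j - q" i])
qed

lemma psi_shift: "q \<le> j \<Longrightarrow> psi ((g ^^ (j - q)) x) = - ln (W (word g P q ((g ^^ (j - q)) x)) (P ((g ^^ j) x)))"
proof -
  assume q: "q \<le> j"
  have "(g ^^ q) ((g ^^ (j - q)) x) = (g ^^ (q + (j - q))) x" by (simp only: funpow_add comp_def)
  also have "q + (j - q) = j" using q by simp
  finally show ?thesis by (simp add: psi_def)
qed

lemma gibbs_zone:
  assumes "gibbs (space M) (code_eq j) (code_cost j)"
  shows "gibbs (space M) (\<lambda>x y. code_eq j x y \<and> zone_sym j x = zone_sym j y) (\<lambda>x. code_cost j x + zone_cost (zone_sym j x))"
proof (rule gibbs_step[OF assms])
  fix Y assume Y: "finite Y" "Y \<subseteq> space M" "inj_on (zone_sym j) Y"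
  let ?Z = "{0, 1, 2} \<union> {K0..Dm}"
  have "zone_sym j x \<in> ?Z" for x by (cases j x rule: zone_sym_cases) auto
  then have sub: "zone_sym j ` Y \<subseteq> ?Z" by (rule image_subsetI)
  have "(\<Sum>y\<in>Y. exp (- zone_cost (zone_sym j y))) = (\<Sum>z\<in>zone_sym j ` Y. exp (- zone_cost z))"
    using Y(3) by (simp add: sum.reindex)
  also have "\<dots> \<le> (\<Sum>z\<in>?Z. exp (- zone_cost z))" by (rule sum_mono2) (use sub in auto)
  also have "\<dots> = (\<Sum>z\<in>{0, 1, 2}. exp (- zone_cost z)) + (\<Sum>z\<in>{K0..Dm}. exp (- zone_cost z))"
    by (rule sum.union_disjoint) (use K0 in auto)
  also have "(\<Sum>z\<in>{K0..Dm}. exp (- zone_cost z)) = (\<Sum>k\<in>{K0..Dm}. exp (- \<kappa>' * real k))"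
    by (rule sum.cong) (use K0 in \<open>auto simp: zone_cost_def\<close>)
  also have "(\<Sum>z\<in>{0, 1, 2}. exp (- zone_cost z)) = exp (- \<eta>) + 2 * exp (- C1)" by (simp add: zone_cost_def)
  finally show "(\<Sum>y\<in>Y. exp (- zone_cost (zone_sym j y))) \<le> 1" using zone_weight by linarith
qed simp

text \<open>Whether the history is available is decided by the class, and if it is, the class also
  determines the word of length \<open>q\<close>. So within one class the weights belong to a single
  distribution, conditional or uniform.\<close>

lemma gibbs_symbol:
  assumes "gibbs (space M) (\<lambda>x y. code_eq j x y \<and> zone_sym j x = zone_sym j y) (\<lambda>x. code_cost j x + zone_cost (zone_sym j x))"
  shows "gibbs (space M) (\<lambda>x y. (code_eq j x y \<and> zone_sym j x = zone_sym j y) \<and> place_sym j x = place_sym j y)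
    (\<lambda>x. (code_cost j x + zone_cost (zone_sym j x)) + place_cost j x)"
proof (rule gibbs_step[OF assms])
  fix x y assume xy: "x \<in> space M" "y \<in> space M" and E: "code_eq j x y \<and> zone_sym j x = zone_sym j y" and p: "place_sym j x = place_sym j y"
  have s: "scale j x = scale j y" using code_eq_inv(1)[OF xy] E by blast
  show "place_cost j x = place_cost j y"
  proof (cases "scale j x = 0 \<and> hist j x")
    case True
    then have h: "hist j y" and q: "q \<le> j" using code_eq_hist[OF xy] E by (auto simp: hist_def)
    have "P ((g ^^ j) x) = P ((g ^^ j) y)" using p s True by (simp add: place_sym_def)
    then show ?thesis using True h s code_eq_word[OF xy] E by (simp add: place_cost_def psi_shift[OF q])
  next
    case False
    then show ?thesis using s code_eq_hist[OF xy] E by (auto simp: place_cost_def)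
  qed
next
  fix Y assume Y: "finite Y" "Y \<subseteq> space M" "Y \<noteq> {}" "\<And>x y. x \<in> Y \<Longrightarrow> y \<in> Y \<Longrightarrow> code_eq j x y \<and> zone_sym j x = zone_sym j y"
    and inj: "inj_on (place_sym j) Y"
  obtain y0 where y0: "y0 \<in> Y" using Y by blast
  have s: "scale j y = scale j y0" if "y \<in> Y" for y
    by (rule code_eq_inv(1)) (use Y that y0 in auto)
  show "(\<Sum>y\<in>Y. exp (- place_cost j y)) \<le> 1"
  proof (cases "scale j y0 = 0")
    case False
    then have "place_sym j y = 0" "place_cost j y = 0" if "y \<in> Y" for y using s[OF that] by (auto simp: place_sym_def place_cost_def)
    then have "Y = {y0}" using inj y0 by (auto simp: inj_on_def)
    then show ?thesis using \<open>\<And>y. y \<in> Y \<Longrightarrow> place_cost j y = 0\<close> by simp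
  next
    case True
    have place_sym: "place_sym j y = P ((g ^^ j) y)" if "y \<in> Y" for y using s[OF that] True by (simp add: place_sym_def)
    have sub: "place_sym j ` Y \<subseteq> {..<L}" using place_sym P_lt Tn_space Y by auto
    have h: "hist j y = hist j y0" if "y \<in> Y" for y by (rule code_eq_hist) (use Y that y0 in auto)
    show ?thesis
    proof (cases "hist j y0")
      case True
      let ?w = "word g P q ((g ^^ (j - q)) y0)"
      have q: "q \<le> j" using True by (simp add: hist_def)
      have e: "exp (- place_cost j y) = W ?w (place_sym j y)" if y: "y \<in> Y" for y
      proof -
        have "word g P q ((g ^^ (j - q)) y) = ?w" by (rule code_eq_word) (use Y y y0 h True in auto)
        then show ?thesis using W(1) place_sym[OF y] s[OF y] \<open>scale j y0 = 0\<close> h[OF y] True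
          by (simp add: place_cost_def psi_shift[OF q])
      qed
      have "(\<Sum>y\<in>Y. exp (- place_cost j y)) = (\<Sum>y\<in>Y. W ?w (place_sym j y))" by (rule sum.cong) (use e in auto)
      also have "\<dots> = (\<Sum>b\<in>place_sym j ` Y. W ?w b)" using inj by (simp add: sum.reindex)
      also have "\<dots> \<le> (\<Sum>b<L. W ?w b)" by (rule sum_mono2) (use sub W(1) in \<open>auto intro: less_imp_le\<close>)
      also have "\<dots> \<le> 1" by (rule W(2))
      finally show ?thesis .
    next
      case False
      have e: "exp (- place_cost j y) = 1 / real L" if y: "y \<in> Y" for y
        using s[OF y] True h[OF y] False L_pos by (simp add: place_cost_def exp_minus inverse_eq_divide)
      have "card Y \<le> L" using card_mono[OF _ sub] card_image[OF inj] by simp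
      then show ?thesis using e L_pos by simp
    qed
  qed
qed

text \<open>An arc at scale \<open>s\<close> is cut at the finer scale \<open>b\<close>. The number
  of grid cells is of the order \<open>exp (b - s)\<close> and each has boundedly many pieces, so
  the cost is the loss of scale up to the constant \<open>C3\<close>.\<close>

lemma gibbs_piece:
  assumes "gibbs (space M) (\<lambda>x y. (code_eq j x y \<and> zone_sym j x = zone_sym j y) \<and> place_sym j x = place_sym j y)
    (\<lambda>x. (code_cost j x + zone_cost (zone_sym j x)) + place_cost j x)"
  shows "gibbs (space M) (\<lambda>x y. ((code_eq j x y \<and> zone_sym j x = zone_sym j y) \<and> place_sym j x = place_sym j y) \<and> piece_sym j x = piece_sym j y)
    (\<lambda>x. ((code_cost j x + zone_cost (zone_sym j x)) + place_cost j x) + piece_cost j x)"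
proof (rule gibbs_count[OF assms])
  fix x y assume xy: "x \<in> space M" "y \<in> space M" and E: "(code_eq j x y \<and> zone_sym j x = zone_sym j y) \<and> place_sym j x = place_sym j y"
  have s: "scale j x = scale j y" using code_eq_inv(1)[OF xy] E by blast
  then show "piece_cost j x = piece_cost j y" using E by (simp add: piece_cost_def cut_scale_def)
next
  fix Y y0 assume Y: "finite Y" "Y \<subseteq> space M"
    "\<And>x y. x \<in> Y \<Longrightarrow> y \<in> Y \<Longrightarrow> (code_eq j x y \<and> zone_sym j x = zone_sym j y) \<and> place_sym j x = place_sym j y"
    and inj: "inj_on (piece_sym j) Y" and y0: "y0 \<in> Y"
  have s: "scale j y = scale j y0" if "y \<in> Y" for y by (rule code_eq_inv(1)) (use Y that y0 in auto)
  have z: "zone_sym j y = zone_sym j y0" if "y \<in> Y" for y using Y that y0 by blast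
  show "real (card Y) \<le> exp (piece_cost j y0)"
  proof (cases "zone_sym j y0 = 0")
    case True
    then have "piece_sym j y = (0, 0)" if "y \<in> Y" for y using z[OF that] by (simp add: piece_sym_def)
    then have "Y = {y0}" using inj y0 by (auto simp: inj_on_def)
    then show ?thesis using True by (simp add: piece_cost_def)
  next
    case False
    let ?s = "scale j y0" and ?b = "cut_scale j y0"
    let ?N = "mesh ?b" and ?h = "\<lambda>t. dg (pr t)" and ?Lv = "levels (zone_sym j y0)"
    define T where "T = pos j ` Y"
    have b: "cut_scale j y = ?b" if "y \<in> Y" for y using s[OF that] z[OF that] by (simp add: cut_scale_def)
    have piece_sym: "piece_sym j y = piece D ?N ?h ?Lv (pos j y)" if "y \<in> Y" for y
      using z[OF that] b[OF that] False by (simp add: piece_sym_def)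
    have "card Y = card (piece_sym j ` Y)" using inj by (simp add: card_image)
    also have "piece_sym j ` Y = piece D ?N ?h ?Lv ` T" unfolding T_def using piece_sym by (auto simp: image_image)
    finally have c: "card Y = card (piece D ?N ?h ?Lv ` T)" .
    have dist: "\<bar>s - t\<bar> \<le> \<epsilon> * exp (- ?s)" if "s \<in> T" "t \<in> T" for s t
    proof -
      from that obtain x y where xy: "x \<in> Y" "y \<in> Y" "s = pos j x" "t = pos j y" unfolding T_def by blast
      then have sp: "x \<in> space M" "y \<in> space M" using Y by auto
      have E: "code_eq j x y" "place_sym j x = place_sym j y" using Y(3)[OF xy(1,2)] by auto
      have "ad (pos j x) (pos j y) \<le> \<epsilon> * exp (- scale j x)" by (rule post_bound[OF sp code_eq_inv[OF sp E(1)] E(2)])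
      then show ?thesis using ad_ge[OF pos_in[OF sp(1)] pos_in[OF sp(2)], of j j] s[OF xy(1)] xy by simp
    qed
    have lv: "card (grid_level D ?N ?h ?Lv t) \<le> 3 * (Nr - 1)" if "t \<in> T" for t
    proof -
      from that obtain y where y: "y \<in> Y" "t = pos j y" by (auto simp: T_def)
      then have sp: "y \<in> space M" using Y by auto
      have "card (grid_level D ?N ?h ?Lv t) \<le> card ?Lv * (Nr - 1)"
      proof (rule level_card(2))
        show "t \<in> D" using y pos_in[OF sp] by simp
        show "\<bar>dg (pr t) - c\<bar> > Cr * (1 / real ?N) powr \<beta>" if "c \<in> ?Lv" for c
          using levels_far[OF sp, of j c] z[OF y(1)] b[OF y(1)] False that y by simp
      qed (use mesh_bounds finite_levels in auto)
      also have "\<dots> \<le> 3 * (Nr - 1)" by (rule mult_right_mono[OF card_levels]) simp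
      finally show ?thesis .
    qed
    have bs: "?s \<le> ?b"
      by (cases j y0 rule: zone_sym_cases) (use K0 in \<open>auto simp: cut_scale_def\<close>)
    have "real (card Y) \<le> (real ?N * (\<epsilon> * exp (- ?s)) + 2) * real (Suc (3 * (Nr - 1)))"
      unfolding c by (rule card_piece_image[OF _ dist _ lv]) (use Y \<epsilon>0 in \<open>auto simp: T_def\<close>)
    \<comment> \<open>At most \<open>exp (b - s) + 3\<close> grid cells are met, where 1 comes from
      rounding the mesh and 2 from the ends of the arc; this is at most
      \<open>4 * exp (b - s)\<close>. Each cell has at most \<open>3 * (Nr - 1) + 1\<close> pieces.
      The product gives the number \<open>12 * real Nr\<close> in \<open>C3\<close>.\<close>
    also have "\<dots> \<le> (4 * exp (?b - ?s)) * (3 * real Nr)"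
    proof (rule mult_mono)
      have "real ?N * (\<epsilon> * exp (- ?s)) \<le> (exp ?b / \<epsilon> + 1) * (\<epsilon> * exp (- ?s))"
        using mesh_bounds(2)[of ?b] \<epsilon>0 by (intro mult_right_mono) auto
      also have "\<dots> = exp (?b - ?s) + \<epsilon> * exp (- ?s)" using \<epsilon>0 by (simp add: exp_diff exp_minus field_simps)
      also have "\<epsilon> * exp (- ?s) \<le> 1"
      proof -
        have "1 \<le> exp R" using R0 by simp
        then have "\<epsilon> * 1 \<le> \<epsilon> * exp R" using \<epsilon>0 by (intro mult_left_mono) auto
        then have "\<epsilon> \<le> 1" using \<epsilon>0 by linarith
        moreover have "exp (- ?s) \<le> 1" using scale_nonneg[of j y0] by simp
        ultimately show ?thesis using \<epsilon>0 mult_le_one[of \<epsilon> "exp (- ?s)"] by simp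
      qed
      finally have "real ?N * (\<epsilon> * exp (- ?s)) + 2 \<le> exp (?b - ?s) + 3" by simp
      moreover have "1 \<le> exp (?b - ?s)" using bs by simp
      ultimately show "real ?N * (\<epsilon> * exp (- ?s)) + 2 \<le> 4 * exp (?b - ?s)" by linarith
      show "real (Suc (3 * (Nr - 1))) \<le> 3 * real Nr" using Nr by simp
    qed auto
    also have "\<dots> = exp (piece_cost j y0)"
      using False bs Nr by (simp add: piece_cost_def C3_def exp_add)
    finally show ?thesis .
  qed
qed

lemma gibbs_target:
  assumes "gibbs (space M) E u"
  shows "gibbs (space M) (\<lambda>x y. E x y \<and> target_sym j x = target_sym j y) (\<lambda>x. u x + target_cost j x)"
proof (rule gibbs_step[OF assms])
  fix Y assume Y: "finite Y" "Y \<subseteq> space M" "inj_on (target_sym j) Y"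
  have sub: "target_sym j ` Y \<subseteq> {..LQ}"
  proof (rule image_subsetI)
    fix y assume "y \<in> Y"
    then have "Qs ((g ^^ j) y) < LQ" using Y by (intro Q_lt Tn_space) auto
    then show "target_sym j y \<in> {..LQ}" by (simp add: target_sym_def)
  qed
  have "(\<Sum>y\<in>Y. exp (- target_cost j y)) = (\<Sum>b\<in>target_sym j ` Y. exp (- (if b = 0 then \<eta> else C2)))"
    using Y(3) by (simp add: sum.reindex target_cost_def)
  also have "\<dots> \<le> (\<Sum>b\<in>{..LQ}. exp (- (if b = 0 then \<eta> else C2)))" by (rule sum_mono2) (use sub in auto)
  also have "\<dots> = exp (- \<eta>) + (\<Sum>b<LQ. exp (- C2))"
    by (simp add: lessThan_Suc_atMost[symmetric] sum.lessThan_Suc_shift del: sum.lessThan_Suc)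
  also have "\<dots> \<le> 1" using C2_weight by simp
  finally show "(\<Sum>y\<in>Y. exp (- target_cost j y)) \<le> 1" .
qed (simp add: target_cost_def)

lemma gibbs_code_eq: "gibbs (space M) (code_eq n) (code_cost n)"
proof (induction n)
  case 0 show ?case by (rule gibbs_EE0)
next
  case (Suc j)
  show ?case
    by (rule gibbs_weaken[OF gibbs_target[OF gibbs_piece[OF gibbs_symbol[OF gibbs_zone[OF Suc]]]], where j1 = j]) auto
qed

text \<open>
  After a visit to the zone \<open>Dm\<close> the arcs are so short, for a long time, that they stay in one cell of
  \<open>Q\<close>. On the remaining runs the iterates of \<open>g\<close> are monotone on the arcs, so that the possible
  itineraries through a grid of mesh \<open>1 / Ng\<close> are ordered: there are only linearly many of them
  (\<open>card_monotone_vectors\<close>).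
\<close>

definition deep :: "nat \<Rightarrow> 'a \<Rightarrow> bool" where
  "deep j x \<longleftrightarrow> (\<exists>i<j. zone ((g ^^ i) x) = Dm \<and> (\<forall>l. i < l \<longrightarrow> l \<le> j \<longrightarrow> S0 \<le> scale l x))"
text \<open>Besides the multiples of \<open>n0\<close>, a run starts whenever a deep stretch has
  just ended. So every time that is not deep lies in a run of length at most \<open>n0\<close>, and
  runs remain rare because deep stretches are longer than \<open>n0\<close>.\<close>

definition start :: "nat \<Rightarrow> 'a \<Rightarrow> bool" where
  "start b x \<longleftrightarrow> \<not> deep b x \<and> (n0 dvd b \<or> (b > 0 \<and> deep (b - 1) x))"
definition run :: "nat \<Rightarrow> nat \<Rightarrow> 'a \<Rightarrow> nat set" where
  "run n b x = {j. b \<le> j \<and> j < min n (b + n0) \<and> (\<forall>i\<in>{b..j}. \<not> deep i x)}"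
definition run_sym :: "nat \<Rightarrow> nat \<Rightarrow> 'a \<Rightarrow> int list" where
  "run_sym n b x = (if start b x then map (\<lambda>j. if j \<in> run n b x then \<lfloor>real Ng * pos j x\<rfloor> else 0) [b..<min n (b + n0)] else [])"
definition run_cost :: real where "run_cost = ln (1 + (real Ng + 1) * real n0)"

primrec full_eq :: "nat \<Rightarrow> nat \<Rightarrow> 'a \<Rightarrow> 'a \<Rightarrow> bool" where
  "full_eq n 0 x y = code_eq n x y"
| "full_eq n (Suc b) x y = (full_eq n b x y \<and> run_sym n b x = run_sym n b y)"
primrec full_cost :: "nat \<Rightarrow> nat \<Rightarrow> 'a \<Rightarrow> real" where
  "full_cost n 0 x = code_cost n x"
| "full_cost n (Suc b) x = full_cost n b x + (if start b x then run_cost else 0)"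

lemma full_eq_code_eq: "full_eq n m x y \<Longrightarrow> code_eq n x y" by (induction m) auto
lemma full_eq_run_sym: "full_eq n m x y \<Longrightarrow> b < m \<Longrightarrow> run_sym n b x = run_sym n b y" by (induction m) (auto simp: less_Suc_eq)

lemma code_eq_deep: "x \<in> space M \<Longrightarrow> y \<in> space M \<Longrightarrow> code_eq n x y \<Longrightarrow> j \<le> n \<Longrightarrow> deep j x = deep j y"
proof -
  assume xy: "x \<in> space M" "y \<in> space M" and E: "code_eq n x y" and j: "j \<le> n"
  have "(zone ((g ^^ i) x) = Dm) = (zone ((g ^^ i) y) = Dm)" if "i < j" for i
    using code_eq_nonzero(1)[OF xy E, of i] that j by simp
  moreover have "scale l x = scale l y" if "l \<le> j" for l using code_eq_scale[OF xy E, of l] that j by simp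
  ultimately show ?thesis unfolding deep_def by auto
qed

lemma code_eq_start: "x \<in> space M \<Longrightarrow> y \<in> space M \<Longrightarrow> code_eq n x y \<Longrightarrow> b \<le> n \<Longrightarrow> start b x = start b y"
  unfolding start_def using code_eq_deep[of x y n b] code_eq_deep[of x y n "b - 1"] by auto

lemma code_eq_run: "x \<in> space M \<Longrightarrow> y \<in> space M \<Longrightarrow> code_eq n x y \<Longrightarrow> run n b x = run n b y"
  unfolding run_def using code_eq_deep[of x y n] by auto

text \<open>A visit to the zone \<open>Dm\<close> resets the scale to
  \<open>shrunk_scale Dm\<close>, which is at least \<open>S0\<close>, so the next time is
  deep.\<close>

lemma not_deep_Suc: "\<not> deep (Suc j) x \<Longrightarrow> zone ((g ^^ j) x) \<noteq> Dm"
proof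
  assume nd: "\<not> deep (Suc j) x" and z: "zone ((g ^^ j) x) = Dm"
  have "scale (Suc j) x = shrunk_scale Dm" using z K0 by (simp add: next_scale_def)
  then have "S0 \<le> scale (Suc j) x" using S0(3) by (simp add: shrunk_scale_def level_scale_def)
  then have "deep (Suc j) x" unfolding deep_def using z by (intro exI[of _ j]) (auto simp: le_Suc_eq)
  then show False using nd by simp
qed

text \<open>Within a run the zone \<open>Dm\<close> is not visited before the last time, so the
  derivative has no zero on the arcs and its sign is the same for all the points of the class. Each
  step then preserves the order or reverses it.\<close>

lemma run_monotone:
  assumes Y: "Y \<subseteq> space M" "\<And>x y. x \<in> Y \<Longrightarrow> y \<in> Y \<Longrightarrow> code_eq n x y" and y0: "y0 \<in> Y" and i: "i \<in> run n b y0"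
  shows "(\<forall>x\<in>Y. \<forall>y\<in>Y. pos b x \<le> pos b y \<longrightarrow> pos i x \<le> pos i y) \<or>
    (\<forall>x\<in>Y. \<forall>y\<in>Y. pos b x \<le> pos b y \<longrightarrow> pos i y \<le> pos i x)"
proof -
  have bi: "b \<le> i" using i by (simp add: run_def)
  show ?thesis using bi i
  proof (induction i rule: dec_induct)
    case base
    then show ?case by auto
  next
    case (step i)
    have r: "i \<in> run n b y0" using step by (auto simp: run_def)
    have "\<not> deep (Suc i) y0" and iN: "i < n" using step by (auto simp: run_def)
    then have nz0: "zone ((g ^^ i) y0) \<noteq> Dm" by (rule_tac not_deep_Suc)
    have nz: "dg (pr r) \<noteq> 0" if xy: "x \<in> Y" "y \<in> Y" and r: "r \<in> closed_segment (pos i x) (pos i y)" for x y r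
    proof -
      have sp: "x \<in> space M" "y \<in> space M" "y0 \<in> space M" using xy y0 Y by auto
      have "zone ((g ^^ i) x) \<noteq> Dm"
        using nz0 code_eq_nonzero(1)[OF sp(1,3) _ iN] Y(2)[OF xy(1) y0] by blast
      then show ?thesis using code_eq_nonzero(2)[OF sp(1,2) _ iN _ r] Y(2)[OF xy] by blast
    qed
    have D: "pos i x \<in> D" if "x \<in> Y" for x using pos_in Y that by auto
    have mono: "dg (pr (pos i x)) > 0 \<longrightarrow> pos (Suc i) x \<le> pos (Suc i) y" "dg (pr (pos i x)) < 0 \<longrightarrow> pos (Suc i) y \<le> pos (Suc i) x"
      if "x \<in> Y" "y \<in> Y" "pos i x \<le> pos i y" for x y
      unfolding pos_Suc using G_mono[OF D[OF that(1)] D[OF that(2)] that(3) nz[OF that(1,2)]] by auto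
    have ne: "dg (pr (pos i y0)) \<noteq> 0" by (rule nz[OF y0 y0]) simp
    show ?case
    proof (cases "dg (pr (pos i y0)) > 0")
      case True
      have pos: "dg (pr (pos i x)) > 0" if "x \<in> Y" for x
        by (rule seg_above_level[OF D[OF y0] D[OF that] True nz[OF y0 that]]) auto
      have "pos (Suc i) x \<le> pos (Suc i) y" if "x \<in> Y" "y \<in> Y" "pos i x \<le> pos i y" for x y
        using mono(1)[OF that] pos[OF that(1)] by blast
      then show ?thesis using step.IH[OF r] by blast
    next
      case False
      then have neg0: "dg (pr (pos i y0)) < 0" using ne by simp
      have neg: "dg (pr (pos i x)) < 0" if "x \<in> Y" for x
        by (rule seg_below_level[OF D[OF y0] D[OF that] neg0 nz[OF y0 that]]) auto
      have "pos (Suc i) y \<le> pos (Suc i) x" if "x \<in> Y" "y \<in> Y" "pos i x \<le> pos i y" for x y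
        using mono(2)[OF that] neg[OF that(1)] by blast
      then show ?thesis using step.IH[OF r] by blast
    qed
  qed
qed

lemma gibbs_full_eq: "m \<le> n \<Longrightarrow> gibbs (space M) (full_eq n m) (full_cost n m)"
proof (induction m)
  case 0
  then show ?case using gibbs_code_eq[of n] by (rule_tac gibbs_weaken[OF gibbs_code_eq[of n]]) auto
next
  case (Suc b)
  then have g: "gibbs (space M) (full_eq n b) (full_cost n b)" and b: "b \<le> n" by auto
  have "gibbs (space M) (\<lambda>x y. full_eq n b x y \<and> run_sym n b x = run_sym n b y) (\<lambda>x. full_cost n b x + (if start b x then run_cost else 0))"
  proof (rule gibbs_count[OF g])
    fix x y assume xy: "x \<in> space M" "y \<in> space M" and F: "full_eq n b x y"
    show "(if start b x then run_cost else 0) = (if start b y then run_cost else 0)"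
      using code_eq_start[OF xy full_eq_code_eq[OF F] b] by simp
  next
    fix Y y0 assume Y: "finite Y" "Y \<subseteq> space M" "\<And>x y. x \<in> Y \<Longrightarrow> y \<in> Y \<Longrightarrow> full_eq n b x y"
      and inj: "inj_on (run_sym n b) Y" and y0: "y0 \<in> Y"
    have E: "code_eq n x y" if "x \<in> Y" "y \<in> Y" for x y using Y(3)[OF that] full_eq_code_eq by blast
    have st: "start b y = start b y0" if "y \<in> Y" for y
      by (rule code_eq_start[OF _ _ E b]) (use that y0 Y in auto)
    have rn: "run n b y = run n b y0" if "y \<in> Y" for y
      by (rule code_eq_run[OF _ _ E]) (use that y0 Y in auto)
    show "real (card Y) \<le> exp (if start b y0 then run_cost else 0)"
    proof (cases "start b y0")
      case False
      then have "run_sym n b y = []" if "y \<in> Y" for y using st[OF that] by (simp add: run_sym_def)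
      then have "Y = {y0}" using inj y0 by (auto simp: inj_on_def)
      then show ?thesis using False by simp
    next
      case True
      let ?J = "run n b y0"
      have J: "?J \<subseteq> {b..<b + n0}" by (auto simp: run_def)
      then have finJ: "finite ?J" using finite_subset by blast
      have cJ: "card ?J \<le> n0" using card_mono[OF _ J] by simp
      \<comment> \<open>Positions in one class differ by at most 1/2, so their grid indices differ
        by at most \<open>Ng + 1\<close>. This is where \<open>run_cost\<close> comes from.\<close>
      have "card Y \<le> 1 + (Ng + 1) * card ?J"
      proof (rule card_monotone_vectors[OF Y(1) finJ, where \<tau> = "pos b" and \<phi> = "\<lambda>j x. \<lfloor>real Ng * pos j x\<rfloor>"])
        fix i assume i: "i \<in> ?J"
        have fm: "\<lfloor>real Ng * s\<rfloor> \<le> \<lfloor>real Ng * t\<rfloor>" if "s \<le> t" for s t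
          using that by (intro floor_mono mult_left_mono) auto
        show "(\<forall>x\<in>Y. \<forall>y\<in>Y. pos b x \<le> pos b y \<longrightarrow> \<lfloor>real Ng * pos i x\<rfloor> \<le> \<lfloor>real Ng * pos i y\<rfloor>) \<or>
          (\<forall>x\<in>Y. \<forall>y\<in>Y. pos b x \<le> pos b y \<longrightarrow> \<lfloor>real Ng * pos i y\<rfloor> \<le> \<lfloor>real Ng * pos i x\<rfloor>)"
          using run_monotone[OF Y(2) E y0 i] fm by blast
      next
        fix i x y assume i: "i \<in> ?J" and xy: "x \<in> Y" "y \<in> Y"
        have "i \<le> n" using i by (auto simp: run_def)
        then have "code_eq i x y" using code_eq_le[OF E[OF xy]] by simp
        then have "\<bar>pos i x - pos i y\<bar> \<le> 1/2" by (rule code_eq_half[rotated 2]) (use xy Y in auto)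
        then have "real Ng * \<bar>pos i x - pos i y\<bar> \<le> real Ng * (1/2)" by (rule mult_left_mono) simp
        then have "\<bar>real Ng * pos i x - real Ng * pos i y\<bar> \<le> real Ng" 
          by (simp add: abs_mult flip: right_diff_distrib)
        then show "\<bar>\<lfloor>real Ng * pos i x\<rfloor> - \<lfloor>real Ng * pos i y\<rfloor>\<bar> \<le> int (Ng + 1)" by linarith
      next
        fix x y assume xy: "x \<in> Y" "y \<in> Y" and eq: "\<And>i. i \<in> ?J \<Longrightarrow> \<lfloor>real Ng * pos i x\<rfloor> = \<lfloor>real Ng * pos i y\<rfloor>"
        have "run_sym n b x = run_sym n b y"
          unfolding run_sym_def using st xy True rn eq by auto
        then show "x = y" using inj xy by (auto simp: inj_on_def)
      qed
      also have "\<dots> \<le> 1 + (Ng + 1) * n0" using cJ by (intro add_left_mono mult_left_mono) auto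
      finally have "real (card Y) \<le> real (1 + (Ng + 1) * n0)" by (simp only: of_nat_le_iff)
      also have "\<dots> = exp run_cost" by (simp add: run_cost_def add_pos_nonneg algebra_simps)
      finally show ?thesis using True by simp
    qed
  qed
  then show ?case by (rule gibbs_weaken) auto
qed

text \<open>Take the earliest time, not before the last multiple of \<open>n0\<close>, from which on
  no deep time occurs up to \<open>j\<close>. Either it is that multiple, or the time before it is
  deep; in both cases it is a start.\<close>

lemma run_cover:
  assumes j: "\<not> deep j x"
  shows "\<exists>b\<le>j. start b x \<and> j < b + n0 \<and> (\<forall>i\<in>{b..j}. \<not> deep i x)"
proof -
  define c where "c = n0 * (j div n0)"
  define Q where "Q b \<longleftrightarrow> c \<le> b \<and> b \<le> j \<and> (\<forall>i\<in>{b..j}. \<not> deep i x)" for b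
  have cj: "c \<le> j" "j < c + n0"
    unfolding c_def using n0 mod_less_divisor[OF n0, of j] mult_div_mod_eq[of n0 j] by linarith+
  have Qj: "Q j" unfolding Q_def using cj j by auto
  define b where "b = (LEAST b. Q b)"
  have Qb: "Q b" unfolding b_def by (rule LeastI[where P = Q and k = j, OF Qj])
  have "n0 dvd b \<or> (b > 0 \<and> deep (b - 1) x)"
  proof (cases "b = c")
    case True then show ?thesis by (simp add: c_def)
  next
    case False
    then have b: "c \<le> b - 1" "b > 0" using Qb unfolding Q_def by auto
    have "\<not> Q (b - 1)" unfolding b_def by (rule not_less_Least) (use b in \<open>simp add: b_def\<close>)
    then obtain i where "i \<in> {b - 1..j}" "deep i x" using b Qb unfolding Q_def by auto
    then have "i = b - 1" using Qb unfolding Q_def by (cases "i = b - 1") auto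
    then show ?thesis using b \<open>deep i x\<close> by simp
  qed
  moreover have "\<not> deep b x" using Qb unfolding Q_def by auto
  ultimately show ?thesis using Qb cj unfolding Q_def start_def by (intro exI[of _ b]) auto
qed

text \<open>Outside \<open>Kc\<close> the symbol of \<open>Qs\<close> is part of the code. Inside
  \<open>Kc\<close> two positions closer than \<open>gap / 7\<close> suffice: at deep times the
  scale is at least \<open>S0\<close>, at the other times the positions share a cell of the grid of
  the run.\<close>

lemma full_eq_refines:
  assumes xy: "x \<in> space M" "y \<in> space M" and F: "full_eq n n x y" and j: "j < n"
  shows "Qs ((g ^^ j) x) = Qs ((g ^^ j) y)"
proof -
  have E: "code_eq n x y" using full_eq_code_eq[OF F] .
  have target_sym: "target_sym j x = target_sym j y" using code_eq_less[OF E j] by blast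
  have Ej: "code_eq j x y" using code_eq_le[OF E] j by simp
  have D: "pos j x \<in> D" "pos j y \<in> D" using pos_in xy by auto
  show ?thesis
  proof (cases "target_sym j x = 0")
    case False
    then show ?thesis using target_sym by (auto simp: target_sym_def split: if_splits)
  next
    case True
    then have Kc: "(g ^^ j) x \<in> Kc" "(g ^^ j) y \<in> Kc" using target_sym by (auto simp: target_sym_def split: if_splits)
    have "7 * \<bar>pos j x - pos j y\<bar> < gap"
    proof (cases "deep j x")
      case True
      then have s: "S0 \<le> scale j x" unfolding deep_def by auto
      have "\<bar>pos j x - pos j y\<bar> \<le> pre_bound (scale j x)" using ad_ge[OF D] code_eq_inv(2)[OF xy Ej] by linarith
      also have "\<dots> = \<epsilon> * exp (- scale j x)" using s S0(1) by (simp add: pre_bound_def)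
      also have "\<dots> \<le> \<epsilon> * exp (- S0)" using s \<epsilon>0 by simp
      finally have "7 * \<bar>pos j x - pos j y\<bar> \<le> 7 * \<epsilon> * exp (- S0)" by simp
      then show ?thesis using S0(2) by linarith
    next
      case False
      obtain b where b: "b \<le> j" "start b x" "j < b + n0" "\<forall>i\<in>{b..j}. \<not> deep i x" using run_cover[OF False] by blast
      have jr: "j \<in> run n b x" using b j by (simp add: run_def)
      have sy: "start b y" using code_eq_start[OF xy E, of b] b j by simp
      have jr': "j \<in> run n b y" using code_eq_run[OF xy E, of b] jr by simp
      have "run_sym n b x = run_sym n b y" by (rule full_eq_run_sym[OF F]) (use b j in simp)
      then have "map (\<lambda>j. if j \<in> run n b x then \<lfloor>real Ng * pos j x\<rfloor> else 0) [b..<min n (b + n0)] =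
        map (\<lambda>j. if j \<in> run n b y then \<lfloor>real Ng * pos j y\<rfloor> else 0) [b..<min n (b + n0)]"
        using b(2) sy by (simp add: run_sym_def)
      moreover have "j \<in> set [b..<min n (b + n0)]" using b j by simp
      ultimately have "(if j \<in> run n b x then \<lfloor>real Ng * pos j x\<rfloor> else 0) = (if j \<in> run n b y then \<lfloor>real Ng * pos j y\<rfloor> else 0)"
        unfolding map_eq_conv by blast
      then have "\<lfloor>real Ng * pos j x\<rfloor> = \<lfloor>real Ng * pos j y\<rfloor>" using jr jr' by simp
      then have "\<bar>real Ng * pos j x - real Ng * pos j y\<bar> < 1" by linarith
      then have "real Ng * \<bar>pos j x - pos j y\<bar> < 1" by (simp add: abs_mult flip: right_diff_distrib)
      then have "\<bar>pos j x - pos j y\<bar> < 1 / real Ng" using Ng by (simp add: field_simps)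
      then show ?thesis using Ng(2) by (simp add: field_simps)
    qed
    then have "dist ((g ^^ j) x) ((g ^^ j) y) < gap" using lip[OF D] by (simp add: pr_pos xy)
    then show ?thesis using Q_gap[OF Kc] Tn_space xy by blast
  qed
qed

end

section \<open>The cost of a typical orbit\<close>

text \<open>\<rho> is the price of one unit of scale, slightly above 1 / (\<beta> + 1). By
  \<open>cost\<close>, a cut in the zone k at the scale s costs at most \<kappa> k more than the
  loss of scale \<open>level_scale k - s\<close>, while the contraction leads to
  \<open>level_scale k + (1 - \<kappa>) * k\<close>. With \<open>depth\<close>, the third condition
  on \<rho> says that the price of the scale gained covers this cost. \<open>n0_le\<close> makes
  deep stretches last longer than \<open>n0\<close>.\<close>

locale coding_cost = coding M g D pr \<tau> G dg ad R C0 \<beta> Cr Nr \<eta> C1 C2 \<kappa>' \<kappa> \<epsilon> \<rho> K0 K Dm P L q W Kc Qs LQ gap S0 N1 Ng n0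
  for M :: "'a::metric_space measure" and g D pr \<tau> G dg ad R C0 \<beta> Cr Nr \<eta> C1 C2 \<kappa>' \<kappa> \<epsilon> \<rho> K0 K Dm P L q W Kc Qs LQ gap S0 N1 Ng n0 +
  fixes w :: nat and \<Psi> c :: real
  assumes dg_meas [measurable]: "dg \<in> borel_measurable M"
    and P_label: "fin_label M P" and Q_label: "fin_label M Qs"
    and Kc_sets: "{x\<in>space M. x \<in> Kc} \<in> sets M"
    and cost: "K0 \<le> k \<Longrightarrow> ln (12 * real Nr) + \<kappa>' * real k \<le> \<kappa> * real k"
    and depth: "K0 \<le> k \<Longrightarrow> max 0 (ln \<epsilon> + (real k + 1 + ln Cr) / \<beta>) \<le> (1 / \<beta> + \<kappa>) * real k"
    and \<rho>: "0 \<le> \<rho>" "\<rho> \<le> 1" "(1 - \<rho>) * (1 / \<beta> + \<kappa>) \<le> \<rho> * (1 - \<kappa>) - \<kappa>"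
    and n0_le: "real n0 * R \<le> max 0 (ln \<epsilon> + (real Dm + 1 + ln Cr) / \<beta>) + (1 - \<kappa>) * real Dm - S0"
    and w: "w > 0"
    and \<Psi>: "x \<in> space M \<Longrightarrow> - ln (W (word g P q x) (P ((g ^^ q) x))) \<le> \<Psi>"
begin

definition chi :: "nat \<Rightarrow> 'a \<Rightarrow> real" where "chi j x = (if scale j x = 0 then 1 else 0)"

lemma C3_nonneg: "C3 \<ge> 0" unfolding C3_def using Nr by (intro ln_ge_zero) auto

text \<open>An amortized count with the potential \<open>\<rho> * scale\<close>. A critical zone is
  paid by the scale that it gains; every later step at positive scale pays back at most
  \<open>\<rho> * R\<close>. Directly charged are only the shallow zones visited at scale 0, for
  which about \<open>k / \<beta>\<close> is due, and bounded amounts near the critical set.\<close>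

lemma step_cost:
  "zone_cost (zone_sym j x) + piece_cost j x \<le> \<eta> + (C1 + C3) * (if zone ((g ^^ j) x) \<noteq> 0 then 1 else 0) +
    (1 / \<beta> + 2 * \<kappa>) * (if zone ((g ^^ j) x) < K then real (zone ((g ^^ j) x)) else 0) +
    \<rho> * (scale (Suc j) x - scale j x) + \<rho> * R * (1 - chi j x)"
proof -
  let ?k = "zone ((g ^^ j) x)" and ?s = "scale j x"
  have s0: "?s \<ge> 0" by (rule scale_nonneg)
  have ch: "0 \<le> \<rho> * R * (1 - chi j x)" using \<rho> R0 by (simp add: chi_def)
  have C4: "0 \<le> (1 / \<beta> + 2 * \<kappa>) * (if ?k < K then real ?k else 0)" using \<beta>0 \<kappa>0 by simp
  have Cs: "0 \<le> C1 + C3" using C1 C3_nonneg by simp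
  show ?thesis
  proof (cases j x rule: zone_sym_cases)
    case 1
    have "0 \<le> \<rho> * (next_scale ?s 0 - ?s) + \<rho> * R * (1 - chi j x)"
    proof (cases "?s = 0")
      case True then show ?thesis using R0 by (simp add: next_scale_def chi_def)
    next
      case False
      have "- R \<le> next_scale ?s 0 - ?s" by (simp add: next_scale_def)
      then have "\<rho> * (- R) \<le> \<rho> * (next_scale ?s 0 - ?s)" using \<rho> by (intro mult_left_mono) auto
      then show ?thesis using False by (simp add: chi_def)
    qed
    then show ?thesis using 1 by (simp add: zone_cost_def piece_cost_def)
  next
    case 2
    have sg: "scale (Suc j) x = ?s" using 2 K0 level_scale_nonneg[of ?k] by (auto simp: next_scale_def)
    have "zone_cost (zone_sym j x) + piece_cost j x = C1 + C3" using 2 by (simp add: zone_cost_def piece_cost_def cut_scale_def)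
    then show ?thesis using sg ch C4 2 K0 \<eta>0 by simp
  next
    case 3
    have sg: "scale (Suc j) x = shrunk_scale Dm" using 3 K0 level_scale_nonneg[of Dm] by (auto simp: next_scale_def)
    have "0 \<le> \<rho> * (scale (Suc j) x - ?s)" using sg scale_le[of j x] \<rho> by simp
    moreover have "zone_cost (zone_sym j x) + piece_cost j x = C1 + C3" using 3 by (simp add: zone_cost_def piece_cost_def cut_scale_def)
    ultimately show ?thesis using ch C4 3 K0 \<eta>0 by simp
  next
    case 4
    let ?z = "zone_sym j x"
    have z3: "3 \<le> ?z" using 4 K0 by simp
    have "zone_cost ?z + piece_cost j x = \<kappa>' * real ?z + (C3 + (level_scale ?z - ?s))"
      using z3 4 by (simp add: zone_cost_def piece_cost_def cut_scale_def)
    also have "\<dots> \<le> \<kappa> * real ?z + (level_scale ?z - ?s)" using cost[OF 4(1)] by (simp add: C3_def)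
    finally have c: "zone_cost ?z + piece_cost j x \<le> \<kappa> * real ?z + (level_scale ?z - ?s)" .
    have a: "level_scale ?z \<le> (1 / \<beta> + \<kappa>) * real ?z" using depth[OF 4(1)] by (simp add: level_scale_def)
    show ?thesis
    proof (cases "?s = 0 \<and> ?z < K")
      case True
      then have sg: "scale (Suc j) x = 0" using 4 z3 by (simp add: next_scale_def)
      have "zone_cost ?z + piece_cost j x \<le> (1 / \<beta> + 2 * \<kappa>) * real ?z" using c a True by (simp add: algebra_simps)
      then show ?thesis using sg True 4 Cs ch \<eta>0 z3 by simp
    next
      case False
      then have sg: "scale (Suc j) x = shrunk_scale ?z" using 4 z3 by (auto simp: next_scale_def)
      have "(1 - \<rho>) * (level_scale ?z - ?s) \<le> (1 - \<rho>) * ((1 / \<beta> + \<kappa>) * real ?z)"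
        using \<rho> a s0 by (intro mult_left_mono) auto
      also have "\<dots> \<le> (\<rho> * (1 - \<kappa>) - \<kappa>) * real ?z"
        using mult_right_mono[OF \<rho>(3), of "real ?z"] by (simp add: mult.assoc)
      finally have "\<kappa> * real ?z + (level_scale ?z - ?s) \<le> \<rho> * (shrunk_scale ?z - ?s)"
        unfolding shrunk_scale_def by (simp add: algebra_simps)
      then show ?thesis using c sg C4 Cs ch \<eta>0 4 z3 by simp
    qed
  qed
qed

section \<open>Stretches at scale 0\<close>

definition exit :: "nat \<Rightarrow> 'a \<Rightarrow> real" where "exit j x = (if scale j x \<noteq> 0 \<and> scale (Suc j) x = 0 then 1 else 0)"

text \<open>Starting at scale 0, departures from scale 0 are at least as many as returns to it, and
  a departure takes a zone of index at least \<open>K\<close>.\<close>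

lemma exits_le: "(\<Sum>j<n. exit j x) \<le> (\<Sum>j<n. if zone ((g ^^ j) x) \<ge> K then 1 else 0)"
proof -
  define en where "en j = (if scale j x = 0 \<and> scale (Suc j) x \<noteq> 0 then 1 else (0::real))" for j
  have "en j - exit j x = chi j x - chi (Suc j) x" for j by (simp add: en_def exit_def chi_def)
  then have "(\<Sum>j<n. en j - exit j x) = chi 0 x - chi n x"
    using sum_lessThan_telescope'[of "\<lambda>j. chi j x" n] by simp
  moreover have "chi 0 x - chi n x \<ge> 0" by (simp add: chi_def)
  ultimately have "(\<Sum>j<n. exit j x) \<le> (\<Sum>j<n. en j)" by (simp add: sum_subtractf)
  also have "\<dots> \<le> (\<Sum>j<n. if zone ((g ^^ j) x) \<ge> K then 1 else 0)"
  proof (rule sum_mono)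
    fix j
    have "zone ((g ^^ j) x) \<ge> K" if "scale j x = 0" "scale (Suc j) x \<noteq> 0"
    proof (rule ccontr)
      assume "\<not> zone ((g ^^ j) x) \<ge> K"
      then have "scale (Suc j) x = 0" using that(1) R0 by (simp add: next_scale_def)
      then show False using that(2) by simp
    qed
    then show "en j \<le> (if zone ((g ^^ j) x) \<ge> K then 1 else 0)" by (auto simp: en_def)
  qed
  finally show ?thesis .
qed

lemma psi_nonneg: "x \<in> space M \<Longrightarrow> psi x \<ge> 0" and psi_le: "x \<in> space M \<Longrightarrow> psi x \<le> \<Psi>"
proof -
  assume x: "x \<in> space M"
  have "W (word g P q x) (P ((g ^^ q) x)) \<le> 1" by (rule W(3)) (rule P_lt[OF Tn_space[OF x]])
  then show "psi x \<ge> 0" unfolding psi_def using W(1) by simp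
  show "psi x \<le> \<Psi>" unfolding psi_def by (rule \<Psi>[OF x])
qed

text \<open>If the scale is 0 at a time \<open>j \<ge> q\<close> without history, it was positive at
  one of the \<open>q\<close> preceding times and has returned to 0 since. Each return accounts for
  at most \<open>q\<close> such times, and the first \<open>q\<close> times are added.\<close>

lemma not_hist_count:
  "(\<Sum>j<n. if scale j x = 0 \<and> \<not> hist j x then 1 else 0) \<le> real q * (1 + (\<Sum>j<n. exit j x))"
proof -
  let ?A = "\<lambda>j. if scale j x = 0 \<and> \<not> hist j x then 1 else (0::real)"
  have pt: "?A j \<le> (if j < q then 1 else 0) + (\<Sum>i\<in>{1..q}. if i \<le> j then exit (j - i) x else 0)" for j
  proof (cases "scale j x = 0 \<and> \<not> hist j x \<and> \<not> j < q")
    case True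
    then obtain i where i: "i \<le> q" "scale (j - i) x \<noteq> 0" unfolding hist_def by auto
    \<comment> \<open>The most recent time of positive scale is \<open>j - m\<close>, so the return
      to 0 happens in the step from there.\<close>
    define m where "m = (LEAST m. scale (j - m) x \<noteq> 0)"
    have m: "scale (j - m) x \<noteq> 0" "m \<le> i" unfolding m_def
      by (rule LeastI[where P = "\<lambda>m. scale (j - m) x \<noteq> 0", OF i(2)])
        (rule Least_le[where P = "\<lambda>m. scale (j - m) x \<noteq> 0", OF i(2)])
    have m0: "m \<noteq> 0" using m(1) True by (intro notI) simp
    have "\<not> scale (j - (m - 1)) x \<noteq> 0" unfolding m_def by (rule not_less_Least) (use m0 in \<open>simp add: m_def\<close>)
    moreover have "Suc (j - m) = j - (m - 1)" using m0 m(2) i(1) True by linarith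
    ultimately have "exit (j - m) x = 1" using m(1) by (simp add: exit_def)
    moreover have "(if m \<le> j then exit (j - m) x else 0) \<le> (\<Sum>i\<in>{1..q}. if i \<le> j then exit (j - i) x else 0)"
      by (rule member_le_sum) (use m m0 i in \<open>auto simp: exit_def\<close>)
    ultimately show ?thesis using m i True by auto
  next
    case False
    have "0 \<le> (\<Sum>i\<in>{1..q}. if i \<le> j then exit (j - i) x else 0)" by (rule sum_nonneg) (auto simp: exit_def)
    then show ?thesis using False by auto
  qed
  have "(\<Sum>j<n. ?A j) \<le> (\<Sum>j<n. (if j < q then 1 else 0) + (\<Sum>i\<in>{1..q}. if i \<le> j then exit (j - i) x else 0))"
    by (rule sum_mono) (rule pt)
  also have "\<dots> = (\<Sum>j<n. if j < q then 1 else 0) + (\<Sum>i\<in>{1..q}. \<Sum>j<n. if i \<le> j then exit (j - i) x else 0)"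
    by (simp add: sum.distrib) (rule sum.swap)
  also have "(\<Sum>j<n. if j < q then 1 else 0) \<le> real q"
  proof -
    have "(\<Sum>j<n. if j < q then 1 else 0) = (\<Sum>j\<in>{j. j < n \<and> j < q}. (1::real))"
      by (simp add: sum.inter_filter[symmetric])
    also have "\<dots> \<le> real q" using card_mono[of "{..<q}" "{j. j < n \<and> j < q}"] by auto
    finally show ?thesis .
  qed
  also have "(\<Sum>i\<in>{1..q}. \<Sum>j<n. if i \<le> j then exit (j - i) x else 0) \<le> (\<Sum>i\<in>{1..q}. \<Sum>j<n. exit j x)"
  proof (rule sum_mono)
    fix i
    have "(\<Sum>j<n. if i \<le> j then exit (j - i) x else 0) = (\<Sum>j\<in>{i..<n}. exit (j - i) x)"
      by (rule sum.mono_neutral_cong_right) auto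
    also have "\<dots> = (\<Sum>j\<in>(\<lambda>j. j - i) ` {i..<n}. exit j x)"
      by (subst sum.reindex) (auto simp: inj_on_def)
    also have "\<dots> \<le> (\<Sum>j<n. exit j x)" by (rule sum_mono2) (auto simp: exit_def)
    finally show "(\<Sum>j<n. if i \<le> j then exit (j - i) x else 0) \<le> (\<Sum>j<n. exit j x)" .
  qed
  finally show ?thesis by (simp add: algebra_simps)
qed

text \<open>Delaying \<open>psi\<close> by one step changes the sum over a stretch at scale 0 only
  at its ends, by at most \<Psi> for each return and once at the beginning. Averaging over the
  delays below \<open>w\<close> replaces \<open>psi\<close> by its mean over a window.\<close>

lemma shift_average:
  assumes x: "x \<in> space M"
  shows "(\<Sum>j<n. chi j x * psi ((g ^^ j) x)) \<le>
    (\<Sum>j<n. chi j x * (birk psi w ((g ^^ j) x) / real w)) + real w * \<Psi> * (1 + (\<Sum>j<n. exit j x))"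
proof -
  define A where "A i = (\<Sum>j<n. chi j x * psi ((g ^^ (j + i)) x))" for i
  define X where "X = 1 + (\<Sum>j<n. exit j x)"
  have p: "0 \<le> psi ((g ^^ i) x)" "psi ((g ^^ i) x) \<le> \<Psi>" for i
    using psi_nonneg psi_le Tn_space[OF x] by auto
  have \<Psi>0: "\<Psi> \<ge> 0" using p[of 0] by linarith
  have X1: "X \<ge> 1" unfolding X_def by (simp add: sum_nonneg exit_def)
  have chex: "chi (Suc j) x \<le> chi j x + exit j x" for j by (simp add: chi_def exit_def)
  have step: "A i \<le> A (Suc i) + \<Psi> * X" for i
  proof -
    have sh: "(\<Sum>j<n. chi (Suc j) x * psi ((g ^^ (Suc j + i)) x)) = (\<Sum>j<Suc n. chi j x * psi ((g ^^ (j + i)) x)) - chi 0 x * psi ((g ^^ i) x)"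
      by (simp only: sum.lessThan_Suc_shift) simp
    have "A i \<le> (\<Sum>j<Suc n. chi j x * psi ((g ^^ (j + i)) x))"
      unfolding A_def using p by (simp add: chi_def)
    also have "\<dots> = chi 0 x * psi ((g ^^ i) x) + (\<Sum>j<n. chi (Suc j) x * psi ((g ^^ (Suc j + i)) x))"
      using sh by simp
    also have "\<dots> \<le> \<Psi> + (\<Sum>j<n. chi j x * psi ((g ^^ (j + Suc i)) x) + exit j x * \<Psi>)"
    proof (intro add_mono sum_mono)
      show "chi 0 x * psi ((g ^^ i) x) \<le> \<Psi>" using p by (simp add: chi_def)
      fix j
      have "chi (Suc j) x * psi ((g ^^ (Suc j + i)) x) \<le> (chi j x + exit j x) * psi ((g ^^ (Suc j + i)) x)"
        by (rule mult_right_mono[OF chex p(1)])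
      also have "exit j x * psi ((g ^^ (Suc j + i)) x) \<le> exit j x * \<Psi>"
        by (rule mult_left_mono[OF p(2)]) (simp add: exit_def)
      then have "(chi j x + exit j x) * psi ((g ^^ (Suc j + i)) x) \<le> chi j x * psi ((g ^^ (Suc j + i)) x) + exit j x * \<Psi>"
        by (simp add: distrib_right)
      finally show "chi (Suc j) x * psi ((g ^^ (Suc j + i)) x) \<le> chi j x * psi ((g ^^ (j + Suc i)) x) + exit j x * \<Psi>"
        by simp
    qed
    also have "\<dots> = A (Suc i) + \<Psi> * X" unfolding A_def X_def by (simp only: sum.distrib sum_distrib_right[symmetric]) (simp add: algebra_simps)
    finally show ?thesis .
  qed
  have "A 0 \<le> A i + real i * (\<Psi> * X)" for i
  proof (induction i)
    case (Suc i)
    then show ?case using step[of i] by (simp add: algebra_simps)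
  qed simp
  moreover have "real i * (\<Psi> * X) \<le> real w * (\<Psi> * X)" if "i < w" for i
    using that \<Psi>0 X1 by (intro mult_right_mono) auto
  ultimately have "A 0 \<le> A i + real w * (\<Psi> * X)" if "i < w" for i using that by (meson add_left_mono order_trans)
  then have "(\<Sum>i<w. A 0) \<le> (\<Sum>i<w. A i + real w * (\<Psi> * X))" by (intro sum_mono) auto
  then have "real w * A 0 \<le> (\<Sum>i<w. A i) + real w * (real w * (\<Psi> * X))" by (simp add: sum.distrib)
  then have "A 0 \<le> (\<Sum>i<w. A i) / real w + real w * (\<Psi> * X)" using w by (simp add: field_simps)
  also have "(\<Sum>i<w. A i) / real w = (\<Sum>j<n. chi j x * (birk psi w ((g ^^ j) x) / real w))"
  proof -
    have "(\<Sum>i<w. A i) = (\<Sum>j<n. \<Sum>i<w. chi j x * psi ((g ^^ (j + i)) x))" unfolding A_def by (rule sum.swap)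
    also have "\<dots> = (\<Sum>j<n. chi j x * birk psi w ((g ^^ j) x))"
    proof -
      have "(g ^^ (j + i)) x = (g ^^ i) ((g ^^ j) x)" for i j by (subst add.commute) (simp add: funpow_add)
      then show ?thesis unfolding birk_def sum_distrib_left by simp
    qed
    finally show ?thesis by (simp add: sum_divide_distrib)
  qed
  finally show ?thesis unfolding A_def X_def by (simp add: mult.assoc)
qed

text \<open>With history, the cost at time \<open>j\<close> is \<open>psi\<close> at time
  \<open>j - q\<close>, where the scale was 0 as well. So these costs are bounded by the sum of
  \<open>psi\<close> over the times at scale 0.\<close>

lemma place_cost_sum:
  assumes x: "x \<in> space M"
  shows "(\<Sum>j<n. place_cost j x) \<le> (\<Sum>j<n. chi j x * psi ((g ^^ j) x)) + ln (real L) * (real q * (1 + (\<Sum>j<n. exit j x)))"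
proof -
  have lnL: "ln (real L) \<ge> 0" using L_pos by simp
  have "place_cost j x = (if hist j x then psi ((g ^^ (j - q)) x) else 0) + ln (real L) * (if scale j x = 0 \<and> \<not> hist j x then 1 else 0)" for j
    unfolding place_cost_def hist_def by (auto dest: spec[of _ 0])
  then have "(\<Sum>j<n. place_cost j x) = (\<Sum>j<n. if hist j x then psi ((g ^^ (j - q)) x) else 0) +
      ln (real L) * (\<Sum>j<n. if scale j x = 0 \<and> \<not> hist j x then 1 else 0)"
    by (simp add: sum.distrib sum_distrib_left)
  also have "(\<Sum>j<n. if hist j x then psi ((g ^^ (j - q)) x) else 0) \<le> (\<Sum>j<n. chi j x * psi ((g ^^ j) x))"
  proof -
    have "(\<Sum>j<n. if hist j x then psi ((g ^^ (j - q)) x) else 0) \<le> (\<Sum>j\<in>{q..<n}. chi (j - q) x * psi ((g ^^ (j - q)) x))"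
    proof -
      have "(\<Sum>j<n. if hist j x then psi ((g ^^ (j - q)) x) else 0) = (\<Sum>j\<in>{q..<n}. if hist j x then psi ((g ^^ (j - q)) x) else 0)"
        by (rule sum.mono_neutral_right) (auto simp: hist_def)
      also have "\<dots> \<le> (\<Sum>j\<in>{q..<n}. chi (j - q) x * psi ((g ^^ (j - q)) x))"
        by (rule sum_mono) (use psi_nonneg Tn_space x in \<open>auto simp: hist_def chi_def\<close>)
      finally show ?thesis .
    qed
    also have "\<dots> = (\<Sum>j\<in>(\<lambda>j. j - q) ` {q..<n}. chi j x * psi ((g ^^ j) x))"
      by (subst sum.reindex) (auto simp: inj_on_def)
    also have "\<dots> \<le> (\<Sum>j<n. chi j x * psi ((g ^^ j) x))"
      by (rule sum_mono2) (use psi_nonneg Tn_space x in \<open>auto simp: chi_def\<close>)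
    finally show ?thesis .
  qed
  also have "ln (real L) * (\<Sum>j<n. if scale j x = 0 \<and> \<not> hist j x then 1 else 0) \<le> ln (real L) * (real q * (1 + (\<Sum>j<n. exit j x)))"
    by (rule mult_left_mono[OF not_hist_count lnL])
  finally show ?thesis by simp
qed

section \<open>The number of runs\<close>

lemma scale_drop: "scale j x - R * real i \<le> scale (j + i) x"
proof (induction i)
  case (Suc i)
  have "scale (j + i) x - R \<le> scale (Suc (j + i)) x"
    using scale_nonneg[of "j + i" x] scale_le[of "j + i" x] R0 shrunk_scale_ge[of "zone ((g ^^ (j + i)) x)"] level_scale_nonneg[of "zone ((g ^^ (j + i)) x)"]
    by (auto simp: next_scale_def)
  then show ?case using Suc by (simp add: algebra_simps)
qed simp

text \<open>After the visit to \<open>Dm\<close> the scale is \<open>shrunk_scale Dm\<close> and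
  loses at most \<open>R\<close> in a step. By \<open>n0_le\<close> it takes more than
  \<open>n0\<close> steps to fall below \<open>S0\<close>, and all the times until then are
  deep.\<close>

lemma deep_exit:
  assumes "deep b x" "\<not> deep (Suc b) x"
  shows "n0 \<le> b" "\<And>j. b - n0 \<le> j \<Longrightarrow> j \<le> b \<Longrightarrow> b - n0 < j \<Longrightarrow> deep j x"
proof -
  obtain i where i: "i < b" "zone ((g ^^ i) x) = Dm" "\<And>l. i < l \<Longrightarrow> l \<le> b \<Longrightarrow> S0 \<le> scale l x"
    using assms(1) unfolding deep_def by blast
  have lt: "scale (Suc b) x < S0"
  proof (rule ccontr)
    assume "\<not> ?thesis"
    then have "deep (Suc b) x" unfolding deep_def using i by (intro exI[of _ i]) (auto simp: le_Suc_eq)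
    then show False using assms(2) by simp
  qed
  have s: "scale (Suc i) x = shrunk_scale Dm" using i(2) K0 by (simp add: next_scale_def)
  have "shrunk_scale Dm - R * real (b - i) \<le> scale (Suc b) x" using scale_drop[of "Suc i" x "b - i"] i(1) s by simp
  then have "shrunk_scale Dm - S0 < R * real (b - i)" using lt by linarith
  moreover have "real n0 * R \<le> shrunk_scale Dm - S0" using n0_le unfolding shrunk_scale_def level_scale_def by linarith
  ultimately have "real n0 * R < real (b - i) * R" by (simp add: mult.commute)
  then have ni: "n0 < b - i" using R0 by simp
  then show "n0 \<le> b" by simp
  fix j assume j: "b - n0 \<le> j" "j \<le> b"
  then have "i < j" using ni by linarith
  then show "deep j x" unfolding deep_def using i j by (intro exI[of _ i]) auto
qed

text \<open>Starts are multiples of \<open>n0\<close> or ends of deep stretches. Both families are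
  spaced by at least \<open>n0\<close>, the second one by \<open>deep_exit\<close>.\<close>

lemma starts_le: "(\<Sum>b<n. if start b x then 1 else 0) \<le> 2 * (real n / real n0 + 1)"
proof -
  let ?A = "{b. b < n \<and> n0 dvd b}" and ?B = "{b. b < n \<and> b > 0 \<and> deep (b - 1) x \<and> \<not> deep b x}"
  have sub: "{b. b < n \<and> start b x} \<subseteq> ?A \<union> ?B" by (auto simp: start_def)
  have "(\<Sum>b<n. if start b x then 1 else 0) = real (card {b. b < n \<and> start b x})"
  proof -
    have "{b. b < n \<and> start b x} = {b \<in> {..<n}. start b x}" by auto
    then show ?thesis by (simp add: sum.inter_filter[symmetric])
  qed
  also have "\<dots> \<le> real (card (?A \<union> ?B))" using sub by (intro of_nat_mono card_mono) auto
  also have "\<dots> \<le> real (card ?A) + real (card ?B)" using card_Un_le[of ?A ?B] by linarith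
  also have "real (card ?A) \<le> real n / real n0 + 1"
  proof -
    have "card ?A * n0 \<le> n + n0"
    proof (rule card_spaced)
      fix b b' assume b: "b \<in> ?A" "b' \<in> ?A" "b < b'"
      then obtain u v where "b = n0 * u" "b' = n0 * v" by (auto elim!: dvdE)
      then have "u < v" using b(3) n0 by simp
      then have "n0 * (u + 1) \<le> n0 * v" by (intro mult_left_mono) auto
      then show "b + n0 \<le> b'" using \<open>b = n0 * u\<close> \<open>b' = n0 * v\<close> by simp
    qed auto
    then have "real (card ?A) * real n0 \<le> real n + real n0" by (simp only: of_nat_add[symmetric] of_nat_mult[symmetric] of_nat_le_iff)
    then show ?thesis using n0 by (simp add: field_simps)
  qed
  also have "real (card ?B) \<le> real n / real n0 + 1"
  proof -
    have "card ?B * n0 \<le> n + n0"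
    proof (rule card_spaced)
      fix b b' assume b: "b \<in> ?B" "b' \<in> ?B" "b < b'"
      have d: "deep (b' - 1) x" "\<not> deep (Suc (b' - 1)) x" using b by auto
      show "b + n0 \<le> b'"
      proof (rule ccontr)
        assume "\<not> ?thesis"
        then have "deep b x" using b deep_exit(1)[OF d] by (intro deep_exit(2)[OF d]) auto
        then show False using b by simp
      qed
    qed auto
    then have "real (card ?B) * real n0 \<le> real n + real n0" by (simp only: of_nat_add[symmetric] of_nat_mult[symmetric] of_nat_le_iff)
    then show ?thesis using n0 by (simp add: field_simps)
  qed
  finally show ?thesis by simp
qed

text \<open>The charges beyond the main rate: visits near the critical set, the depth of shallow
  zones, the returns to scale 0 caused by zones from \<open>K\<close> on, the excess of windowed
  averages over \<open>c\<close>, and the times outside \<open>Kc\<close>. Each has a small integral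
  for nearby maps and measures.\<close>

definition theta :: "'a \<Rightarrow> real" where
  "theta x = (C1 + C3) * (if zone x \<noteq> 0 then 1 else 0) + (1 / \<beta> + 2 * \<kappa>) * (if zone x < K then real (zone x) else 0) +
    (ln (real L) * real q + real w * \<Psi>) * (if zone x \<ge> K then 1 else 0) +
    max 0 (birk psi w x / real w - c) + C2 * (if x \<in> Kc then 0 else 1)"

section \<open>The total cost and the entropy of a label\<close>

lemma code_cost_sum: "code_cost n x = ln (real N1 + 1) + (\<Sum>j<n. zone_cost (zone_sym j x) + piece_cost j x) + (\<Sum>j<n. place_cost j x) + (\<Sum>j<n. target_cost j x)"
  by (induction n) simp_all

lemma full_cost_sum: "full_cost n m x = code_cost n x + run_cost * (\<Sum>b<m. if start b x then 1 else 0)"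
  by (induction m) (simp_all add: algebra_simps)

lemma run_cost_nonneg: "run_cost \<ge> 0" unfolding run_cost_def by (intro ln_ge_zero) simp

definition base_cost :: "nat \<Rightarrow> real" where
  "base_cost n = ln (real N1 + 1) + \<rho> * shrunk_scale Dm + (ln (real L) * real q + real w * \<Psi>) +
    2 * run_cost * (real n / real n0 + 1) + real n * (2 * \<eta> + max c (\<rho> * R))"

text \<open>The potential telescopes to at most \<open>\<rho> * shrunk_scale Dm\<close>, a constant;
  returns to scale 0 are charged to visits of deep zones. What remains per step is a main rate, the
  small costs \<eta> and \<open>theta\<close>.\<close>

lemma full_cost_bound:
  assumes x: "x \<in> space M"
  shows "full_cost n n x \<le> base_cost n + (\<Sum>j<n. theta ((g ^^ j) x))"
proof -
  let ?y = "\<lambda>j. (g ^^ j) x"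
  define X where "X = (\<Sum>j<n. exit j x)"
  define B where "B = ln (real L) * real q + real w * \<Psi>"
  have \<Psi>0: "\<Psi> \<ge> 0" using psi_nonneg[OF x] psi_le[OF x] by linarith
  have B0: "B \<ge> 0" unfolding B_def using L_pos \<Psi>0 by simp
  have 1: "(\<Sum>j<n. zone_cost (zone_sym j x) + piece_cost j x) \<le> (\<Sum>j<n. \<eta> + (C1 + C3) * (if zone (?y j) \<noteq> 0 then 1 else 0) +
    (1 / \<beta> + 2 * \<kappa>) * (if zone (?y j) < K then real (zone (?y j)) else 0) + \<rho> * R * (1 - chi j x)) + \<rho> * shrunk_scale Dm"
  proof -
    have "(\<Sum>j<n. zone_cost (zone_sym j x) + piece_cost j x) \<le> (\<Sum>j<n. (\<eta> + (C1 + C3) * (if zone (?y j) \<noteq> 0 then 1 else 0) +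
      (1 / \<beta> + 2 * \<kappa>) * (if zone (?y j) < K then real (zone (?y j)) else 0) + \<rho> * R * (1 - chi j x)) + \<rho> * (scale (Suc j) x - scale j x))"
      by (rule sum_mono) (use step_cost[of _ x] in \<open>simp only: add.assoc add.commute add.left_commute\<close>)
    also have "\<dots> = (\<Sum>j<n. \<eta> + (C1 + C3) * (if zone (?y j) \<noteq> 0 then 1 else 0) +
      (1 / \<beta> + 2 * \<kappa>) * (if zone (?y j) < K then real (zone (?y j)) else 0) + \<rho> * R * (1 - chi j x)) + \<rho> * (\<Sum>j<n. scale (Suc j) x - scale j x)"
      by (simp only: sum.distrib sum_distrib_left)
    also have "(\<Sum>j<n. scale (Suc j) x - scale j x) = scale n x" by (subst sum_lessThan_telescope) simp
    also have "\<rho> * scale n x \<le> \<rho> * shrunk_scale Dm" using scale_le \<rho> by (intro mult_left_mono) auto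
    finally show ?thesis by simp
  qed
  have 2: "(\<Sum>j<n. place_cost j x) \<le> (\<Sum>j<n. chi j x * (birk psi w (?y j) / real w)) + B * (1 + X)"
    using place_cost_sum[OF x, of n] shift_average[OF x, of n] unfolding X_def B_def by (simp add: algebra_simps)
  have 3: "(\<Sum>j<n. target_cost j x) \<le> (\<Sum>j<n. \<eta> + C2 * (if ?y j \<in> Kc then 0 else 1))"
    by (rule sum_mono) (use \<eta>0 C2 in \<open>auto simp: target_cost_def target_sym_def\<close>)
  have 4: "B * X \<le> B * (\<Sum>j<n. if zone (?y j) \<ge> K then 1 else 0)"
    unfolding X_def by (rule mult_left_mono[OF exits_le B0])
  have 5: "run_cost * (\<Sum>b<n. if start b x then 1 else 0) \<le> run_cost * (2 * (real n / real n0 + 1))"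
    by (rule mult_left_mono[OF starts_le run_cost_nonneg])
  \<comment> \<open>At each time one of the two rates is due, the windowed average of
    \<open>psi\<close> at scale 0 and \<open>\<rho> * R\<close> otherwise. This is where the maximum
    comes from.\<close>
  have 6: "(\<Sum>j<n. chi j x * (birk psi w (?y j) / real w) + \<rho> * R * (1 - chi j x)) \<le>
      (\<Sum>j<n. max c (\<rho> * R) + max 0 (birk psi w (?y j) / real w - c))"
    by (rule sum_mono) (auto simp: chi_def max_def)
  have "full_cost n n x \<le> ln (real N1 + 1) + (\<Sum>j<n. \<eta> + (C1 + C3) * (if zone (?y j) \<noteq> 0 then 1 else 0) +
    (1 / \<beta> + 2 * \<kappa>) * (if zone (?y j) < K then real (zone (?y j)) else 0) + \<rho> * R * (1 - chi j x)) + \<rho> * shrunk_scale Dm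
    + ((\<Sum>j<n. chi j x * (birk psi w (?y j) / real w)) + B + B * (\<Sum>j<n. if zone (?y j) \<ge> K then 1 else 0))
    + (\<Sum>j<n. \<eta> + C2 * (if ?y j \<in> Kc then 0 else 1)) + run_cost * (2 * (real n / real n0 + 1))"
    unfolding full_cost_sum code_cost_sum using 1 2 3 4 5 by (simp add: distrib_left)
  also have "\<dots> = ln (real N1 + 1) + \<rho> * shrunk_scale Dm + B + run_cost * (2 * (real n / real n0 + 1)) +
    (\<Sum>j<n. chi j x * (birk psi w (?y j) / real w) + \<rho> * R * (1 - chi j x)) +
    (\<Sum>j<n. 2 * \<eta> + (C1 + C3) * (if zone (?y j) \<noteq> 0 then 1 else 0) +
    (1 / \<beta> + 2 * \<kappa>) * (if zone (?y j) < K then real (zone (?y j)) else 0) +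
    B * (if zone (?y j) \<ge> K then 1 else 0) + C2 * (if ?y j \<in> Kc then 0 else 1))"
    by (simp only: sum.distrib sum_distrib_left) (simp add: algebra_simps)
  also have "\<dots> \<le> ln (real N1 + 1) + \<rho> * shrunk_scale Dm + B + run_cost * (2 * (real n / real n0 + 1)) +
    (\<Sum>j<n. max c (\<rho> * R) + max 0 (birk psi w (?y j) / real w - c)) +
    (\<Sum>j<n. 2 * \<eta> + (C1 + C3) * (if zone (?y j) \<noteq> 0 then 1 else 0) +
    (1 / \<beta> + 2 * \<kappa>) * (if zone (?y j) < K then real (zone (?y j)) else 0) +
    B * (if zone (?y j) \<ge> K then 1 else 0) + C2 * (if ?y j \<in> Kc then 0 else 1))"
    using 6 by simp
  also have "\<dots> = base_cost n + (\<Sum>j<n. theta (?y j))"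
    unfolding base_cost_def theta_def B_def[symmetric]
    by (simp only: sum.distrib sum_distrib_left sum_constant card_lessThan) (simp add: algebra_simps)
  finally show ?thesis .
qed

lemma psi_label: "fin_label M psi"
  using fin_label_pair[OF fin_label_word[OF P_label T_meas] fin_label_comp[OF P_label Tn_meas],
      of "\<lambda>u b. - ln (W u b)"] by (simp add: psi_def[abs_def])

lemma psi_meas [measurable]: "psi \<in> borel_measurable M"
  using measurable_compose[OF fin_label_measurable[OF psi_label], of "\<lambda>x. x" borel] by simp

lemma zone_meas [measurable]: "zone \<in> measurable M (count_space UNIV)"
  unfolding zone_def by measurable

lemma theta_integrable: "integrable M theta"
proof -
  note [measurable] = Kc_sets
  have Kc': "(\<lambda>x. if x \<in> Kc then 0 else 1 :: real) \<in> borel_measurable M"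
    by (rule measurable_If) (use Kc_sets in auto)
  have meas: "theta \<in> borel_measurable M"
    unfolding theta_def using Kc' by measurable
  have "\<bar>theta x\<bar> \<le> (C1 + C3) + (1 / \<beta> + 2 * \<kappa>) * real K + (ln (real L) * real q + real w * \<Psi>) + (\<Psi> + \<bar>c\<bar>) + C2"
    if x: "x \<in> space M" for x
  proof -
    have \<Psi>0: "\<Psi> \<ge> 0" using psi_nonneg[OF x] psi_le[OF x] by linarith
    have "\<bar>birk psi w x\<bar> \<le> real w * \<Psi>"
      by (rule birk_bound[OF _ x]) (use psi_nonneg psi_le in \<open>auto simp: abs_le_iff intro: order_trans[of _ 0]\<close>)
    then have b: "birk psi w x / real w \<le> \<Psi>" using w by (simp add: field_simps)
    have B0: "ln (real L) * real q + real w * \<Psi> \<ge> 0" using L_pos \<Psi>0 by simp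
    have t1: "0 \<le> (C1 + C3) * (if zone x \<noteq> 0 then 1 else 0)" "(C1 + C3) * (if zone x \<noteq> 0 then 1 else 0) \<le> C1 + C3"
      using C1 C3_nonneg by auto
    have f: "0 \<le> 1 / \<beta> + 2 * \<kappa>" using \<beta>0 \<kappa>0 by simp
    have t2: "0 \<le> (1 / \<beta> + 2 * \<kappa>) * (if zone x < K then real (zone x) else 0)"
      "(1 / \<beta> + 2 * \<kappa>) * (if zone x < K then real (zone x) else 0) \<le> (1 / \<beta> + 2 * \<kappa>) * real K"
      using f by (auto intro!: mult_left_mono mult_nonneg_nonneg)
    have t3: "0 \<le> (ln (real L) * real q + real w * \<Psi>) * (if zone x \<ge> K then 1 else 0)"
      "(ln (real L) * real q + real w * \<Psi>) * (if zone x \<ge> K then 1 else 0) \<le> ln (real L) * real q + real w * \<Psi>"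
      using B0 by auto
    have t4: "0 \<le> max 0 (birk psi w x / real w - c)" "max 0 (birk psi w x / real w - c) \<le> \<Psi> + \<bar>c\<bar>"
      using b \<Psi>0 by auto
    have t5: "0 \<le> C2 * (if x \<in> Kc then 0 else 1)" "C2 * (if x \<in> Kc then 0 else 1) \<le> C2" using C2 by auto
    show ?thesis unfolding theta_def using t1 t2 t3 t4 t5 by linarith
  qed
  then show ?thesis by (intro integrable_const_bound[OF _ meas] AE_I2) auto
qed

lemma label_entropy_bound:
  "label_entropy M (word g Qs n) \<le> base_cost n + real n * (\<integral>x. theta x \<partial>M)"
proof -
  have int: "integrable M (\<lambda>x. theta ((g ^^ j) x))" for j by (rule integrable_Tn[OF theta_integrable])
  have "label_entropy M (word g Qs n) \<le> (\<integral>x. base_cost n + (\<Sum>j<n. theta ((g ^^ j) x)) \<partial>M)"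
    unfolding label_entropy_def
  proof (rule gibbs_entropy[OF finite_partition_fibers[OF fin_label_word[OF Q_label T_meas]] gibbs_full_eq[OF order_refl]])
    fix x y A assume A: "A \<in> fibers (space M) (word g Qs n)" "x \<in> A" "y \<in> space M" "full_eq n n x y"
    then obtain z where z: "z \<in> space M" "A = {y\<in>space M. word g Qs n y = word g Qs n z}" by (auto simp: fibers_def)
    then have x: "x \<in> space M" "word g Qs n x = word g Qs n z" using A by auto
    have "word g Qs n x = word g Qs n y"
      unfolding word_eq_iff using full_eq_refines[OF x(1) A(3,4)] by blast
    then show "y \<in> A" using z x A by simp
  next
    show "integrable M (\<lambda>x. base_cost n + (\<Sum>j<n. theta ((g ^^ j) x)))"
      using int by (intro Bochner_Integration.integrable_add Bochner_Integration.integrable_sum) auto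
  qed (rule full_cost_bound)
  also have "\<dots> = base_cost n + (\<Sum>j<n. \<integral>x. theta ((g ^^ j) x) \<partial>M)"
    using int by (simp add: prob_space Bochner_Integration.integral_sum)
  also have "(\<Sum>j<n. \<integral>x. theta ((g ^^ j) x) \<partial>M) = (\<Sum>j<n. \<integral>x. theta x \<partial>M)"
    using theta_integrable by (intro sum.cong integral_Tn) auto
  finally show ?thesis by simp
qed

theorem entropy_bound:
  "metric_entropy_wrt M g (fibers (space M) Qs) \<le>
    max c (\<rho> * R) + 2 * \<eta> + 2 * run_cost / real n0 + (\<integral>x. theta x \<partial>M)"
proof -
  define A where "A = ln (real N1 + 1) + \<rho> * shrunk_scale Dm + (ln (real L) * real q + real w * \<Psi>) + 2 * run_cost"
  define B where "B = max c (\<rho> * R) + 2 * \<eta> + 2 * run_cost / real n0 + (\<integral>x. theta x \<partial>M)"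
  have le: "label_entropy M (word g Qs n) / real n \<le> A / real n + B" if "n \<ge> 1" for n
  proof -
    have "label_entropy M (word g Qs n) \<le> A + real n * B"
      using label_entropy_bound[of n] unfolding base_cost_def A_def B_def by (simp add: algebra_simps)
    then show ?thesis using that by (simp add: field_simps)
  qed
  have "metric_entropy_wrt M g (fibers (space M) Qs) \<le> 0 + B"
  proof (rule LIMSEQ_le[OF entropy_wrt_fibers(1)[OF Q_label]])
    show "(\<lambda>n. A / real n + B) \<longlonglongrightarrow> 0 + B" by (intro tendsto_add lim_const_over_n tendsto_const)
    show "\<exists>N. \<forall>n\<ge>N. label_entropy M (word g Qs n) / real n \<le> A / real n + B" using le by blast
  qed
  then show ?thesis by (simp add: B_def)
qed

end

section \<open>Weak limits\<close>

lemma uniform_limit_compose_compact: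
  fixes a :: "nat \<Rightarrow> 'b \<Rightarrow> 'c::metric_space" and h :: "nat \<Rightarrow> 'c \<Rightarrow> 'd::metric_space"
  assumes a: "uniform_limit X a a' sequentially" and h: "uniform_limit Y h h' sequentially"
    and Y: "compact Y" "continuous_on Y h'"
    and inY: "\<And>k x. x \<in> X \<Longrightarrow> a k x \<in> Y" "\<And>x. x \<in> X \<Longrightarrow> a' x \<in> Y"
  shows "uniform_limit X (\<lambda>k x. h k (a k x)) (\<lambda>x. h' (a' x)) sequentially"
proof (rule uniform_limitI)
  fix e :: real assume e: "e > 0"
  have "uniformly_continuous_on Y h'" using Y by (simp add: compact_uniformly_continuous)
  then obtain d where d: "d > 0" "\<And>x y. x \<in> Y \<Longrightarrow> y \<in> Y \<Longrightarrow> dist y x < d \<Longrightarrow> dist (h' y) (h' x) < e / 2"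
    unfolding uniformly_continuous_on_def using e by (metis half_gt_zero)
  have "\<forall>\<^sub>F k in sequentially. \<forall>x\<in>X. dist (a k x) (a' x) < d" using uniform_limitD[OF a d(1)] .
  moreover have "\<forall>\<^sub>F k in sequentially. \<forall>y\<in>Y. dist (h k y) (h' y) < e / 2" using uniform_limitD[OF h, of "e / 2"] e by simp
  ultimately show "\<forall>\<^sub>F k in sequentially. \<forall>x\<in>X. dist (h k (a k x)) (h' (a' x)) < e"
  proof (eventually_elim, safe)
    fix k x assume A: "\<forall>x\<in>X. dist (a k x) (a' x) < d" "\<forall>y\<in>Y. dist (h k y) (h' y) < e / 2" and x: "x \<in> X"
    have "dist (h k (a k x)) (h' (a k x)) < e / 2" using A(2) inY x by blast
    moreover have "dist (h' (a k x)) (h' (a' x)) < e / 2" using d(2)[of "a' x" "a k x"] A(1) inY x by blast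
    ultimately show "dist (h k (a k x)) (h' (a' x)) < e"
      using dist_triangle[of "h k (a k x)" "h' (a' x)" "h' (a k x)"] by linarith
  qed
qed

lemma abs_prod_diff_le:
  fixes a b :: "nat \<Rightarrow> real"
  assumes "\<And>i. i < n \<Longrightarrow> 0 \<le> a i \<and> a i \<le> 1" "\<And>i. i < n \<Longrightarrow> 0 \<le> b i \<and> b i \<le> 1"
  shows "\<bar>(\<Prod>i<n. a i) - (\<Prod>i<n. b i)\<bar> \<le> (\<Sum>i<n. \<bar>a i - b i\<bar>)"
  using assms
proof (induction n)
  case (Suc n)
  let ?A = "\<Prod>i<n. a i" and ?B = "\<Prod>i<n. b i"
  have A: "0 \<le> ?A" "?A \<le> 1" using Suc.prems by (auto intro!: prod_nonneg prod_le_1)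
  have b: "0 \<le> b n" "b n \<le> 1" using Suc.prems by auto
  have "?A * a n - ?B * b n = ?A * (a n - b n) + (?A - ?B) * b n" by (simp add: algebra_simps)
  then have "\<bar>?A * a n - ?B * b n\<bar> \<le> \<bar>?A * (a n - b n)\<bar> + \<bar>(?A - ?B) * b n\<bar>" by (simp only: abs_triangle_ineq)
  also have "\<bar>?A * (a n - b n)\<bar> \<le> 1 * \<bar>a n - b n\<bar>" unfolding abs_mult using A by (intro mult_right_mono) auto
  also have "\<bar>(?A - ?B) * b n\<bar> \<le> \<bar>?A - ?B\<bar> * 1" unfolding abs_mult using b by (intro mult_left_mono) auto
  also have "\<bar>?A - ?B\<bar> \<le> (\<Sum>i<n. \<bar>a i - b i\<bar>)" using Suc by auto
  finally show ?case by simp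
qed simp

lemma le_infdistI: "A \<noteq> {} \<Longrightarrow> (\<And>a. a \<in> A \<Longrightarrow> d \<le> dist x a) \<Longrightarrow> d \<le> infdist x A"
  by (simp add: infdist_notempty cINF_greatest)

text \<open>The point \<open>y\<close> is not on the boundary, relative to \<open>X\<close>, of the
  partition into the level sets of \<open>P\<close>.\<close>

definition loc_const :: "'a::metric_space set \<Rightarrow> ('a \<Rightarrow> 'b) \<Rightarrow> 'a \<Rightarrow> bool" where
  "loc_const X P y \<longleftrightarrow> (\<exists>d>0. \<forall>z\<in>X. dist y z < d \<longrightarrow> P z = P y)"

locale weak_seq =
  fixes X :: "'a::metric_space set" and \<mu> :: "'a measure" and \<nu> :: "nat \<Rightarrow> 'a measure"
    and f :: "'a \<Rightarrow> 'a" and g :: "nat \<Rightarrow> 'a \<Rightarrow> 'a"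
  assumes X: "compact X"
    and \<mu>: "mpt \<mu> f" "sets \<mu> = sets (restrict_space borel X)"
    and \<nu>: "\<And>k. mpt (\<nu> k) (g k)" "\<And>k. sets (\<nu> k) = sets (restrict_space borel X)"
    and weak: "\<And>\<phi> :: 'a \<Rightarrow> real. continuous_on X \<phi> \<Longrightarrow> (\<lambda>k. integral\<^sup>L (\<nu> k) \<phi>) \<longlonglongrightarrow> integral\<^sup>L \<mu> \<phi>"
    and f: "continuous_on X f" and gf: "uniform_limit X g f sequentially"
begin

lemma space [simp]: "space \<mu> = X" "space (\<nu> k) = X"
  using sets_eq_imp_space_eq[OF \<mu>(2)] sets_eq_imp_space_eq[OF \<nu>(2)[of k]] by (auto simp: space_restrict_space)

lemma X_maps: "x \<in> X \<Longrightarrow> f x \<in> X" "x \<in> X \<Longrightarrow> g k x \<in> X"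
  "x \<in> X \<Longrightarrow> (f ^^ i) x \<in> X" "x \<in> X \<Longrightarrow> (g k ^^ i) x \<in> X"
  using mpt.T_space[OF \<mu>(1)] mpt.T_space[OF \<nu>(1)[of k]] mpt.Tn_space[OF \<mu>(1)] mpt.Tn_space[OF \<nu>(1)[of k]] by auto

lemma cont_meas:
  fixes \<phi> :: "'a \<Rightarrow> 'b::topological_space"
  assumes "continuous_on X \<phi>"
  shows "\<phi> \<in> borel_measurable \<mu>" "\<phi> \<in> borel_measurable (\<nu> k)"
proof -
  have "\<phi> \<in> borel_measurable (restrict_space borel X)" by (rule borel_measurable_continuous_on_restrict[OF assms])
  then show "\<phi> \<in> borel_measurable \<mu>" "\<phi> \<in> borel_measurable (\<nu> k)"
    by (simp_all add: measurable_cong_sets[OF \<mu>(2) refl] measurable_cong_sets[OF \<nu>(2) refl])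
qed

lemma cont_bounded:
  fixes \<phi> :: "'a \<Rightarrow> real"
  assumes "continuous_on X \<phi>"
  obtains B where "B \<ge> 0" "\<And>x. x \<in> X \<Longrightarrow> \<bar>\<phi> x\<bar> \<le> B"
proof -
  have "bounded (\<phi> ` X)" using compact_continuous_image[OF assms X] by (rule compact_imp_bounded)
  then obtain B where "\<And>x. x \<in> X \<Longrightarrow> \<bar>\<phi> x\<bar> \<le> B" unfolding bounded_iff by auto
  then show ?thesis using that[of "\<bar>B\<bar>"] by force
qed

lemma integrable_bounded:
  fixes \<phi> :: "'a \<Rightarrow> real"
  shows "\<phi> \<in> borel_measurable \<mu> \<Longrightarrow> (\<And>x. x \<in> X \<Longrightarrow> \<bar>\<phi> x\<bar> \<le> B) \<Longrightarrow> integrable \<mu> \<phi>"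
    and "\<phi> \<in> borel_measurable (\<nu> k) \<Longrightarrow> (\<And>x. x \<in> X \<Longrightarrow> \<bar>\<phi> x\<bar> \<le> B) \<Longrightarrow> integrable (\<nu> k) \<phi>"
proof -
  interpret m: mpt \<mu> f by (rule \<mu>)
  interpret n: mpt "\<nu> k" "g k" by (rule \<nu>)
  show "\<phi> \<in> borel_measurable \<mu> \<Longrightarrow> (\<And>x. x \<in> X \<Longrightarrow> \<bar>\<phi> x\<bar> \<le> B) \<Longrightarrow> integrable \<mu> \<phi>"
    by (rule m.integrable_const_bound[of _ B]) auto
  show "\<phi> \<in> borel_measurable (\<nu> k) \<Longrightarrow> (\<And>x. x \<in> X \<Longrightarrow> \<bar>\<phi> x\<bar> \<le> B) \<Longrightarrow> integrable (\<nu> k) \<phi>"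
    by (rule n.integrable_const_bound[of _ B]) auto
qed

lemma cont_integrable:
  fixes \<phi> :: "'a \<Rightarrow> real"
  assumes "continuous_on X \<phi>"
  shows "integrable \<mu> \<phi>" "integrable (\<nu> k) \<phi>"
  using cont_bounded[OF assms] integrable_bounded cont_meas[OF assms] by metis+

lemma integral_uniform_limit:
  fixes \<phi> :: "nat \<Rightarrow> 'a \<Rightarrow> real"
  assumes lim: "uniform_limit X \<phi> \<phi>' sequentially" and cont: "continuous_on X \<phi>'"
    and meas: "\<And>k. \<phi> k \<in> borel_measurable (\<nu> k)"
  shows "(\<lambda>k. integral\<^sup>L (\<nu> k) (\<phi> k)) \<longlonglongrightarrow> integral\<^sup>L \<mu> \<phi>'"
proof -
  have "(\<lambda>k. integral\<^sup>L (\<nu> k) (\<phi> k) - integral\<^sup>L (\<nu> k) \<phi>') \<longlonglongrightarrow> 0"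
  proof (rule LIMSEQ_I)
    fix e :: real assume e: "e > 0"
    obtain B where B: "B \<ge> 0" "\<And>x. x \<in> X \<Longrightarrow> \<bar>\<phi>' x\<bar> \<le> B" using cont_bounded[OF cont] by blast
    have "\<forall>\<^sub>F k in sequentially. \<forall>x\<in>X. dist (\<phi> k x) (\<phi>' x) < e / 2" using uniform_limitD[OF lim, of "e / 2"] e by simp
    then obtain N where N: "\<And>k x. k \<ge> N \<Longrightarrow> x \<in> X \<Longrightarrow> \<bar>\<phi> k x - \<phi>' x\<bar> < e / 2"
      unfolding eventually_sequentially dist_real_def by blast
    have "norm (integral\<^sup>L (\<nu> k) (\<phi> k) - integral\<^sup>L (\<nu> k) \<phi>' - 0) < e" if k: "k \<ge> N" for k
    proof -
      interpret n: mpt "\<nu> k" "g k" by (rule \<nu>)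
      have int1: "integrable (\<nu> k) (\<phi> k)"
      proof (rule integrable_bounded(2)[OF meas])
        show "\<bar>\<phi> k x\<bar> \<le> B + e / 2" if "x \<in> X" for x using N[OF k that] B(2)[OF that] by linarith
      qed
      note int2 = cont_integrable(2)[OF cont, of k]
      have "\<bar>integral\<^sup>L (\<nu> k) (\<phi> k) - integral\<^sup>L (\<nu> k) \<phi>'\<bar> = \<bar>\<integral>x. \<phi> k x - \<phi>' x \<partial>\<nu> k\<bar>"
        using int1 int2 by simp
      also have "\<dots> \<le> (\<integral>x. \<bar>\<phi> k x - \<phi>' x\<bar> \<partial>\<nu> k)" by (rule integral_abs_bound)
      also have "\<dots> \<le> (\<integral>x. e / 2 \<partial>\<nu> k)"
        by (rule integral_mono) (use int1 int2 N[OF k] in \<open>auto intro: less_imp_le\<close>)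
      also have "\<dots> = e / 2" by (simp add: n.prob_space[simplified])
      finally show ?thesis using e by simp
    qed
    then show "\<exists>no. \<forall>n\<ge>no. norm (integral\<^sup>L (\<nu> n) (\<phi> n) - integral\<^sup>L (\<nu> n) \<phi>' - 0) < e" by blast
  qed
  from tendsto_add[OF this weak[OF cont]] show ?thesis by simp
qed

lemma iterate_cont: "continuous_on X (f ^^ i)"
proof (induction i)
  case (Suc i)
  have "continuous_on X (f \<circ> (f ^^ i))"
    by (rule continuous_on_compose[OF Suc continuous_on_subset[OF f]]) (use X_maps in auto)
  then show ?case by simp
qed (simp add: id_def)

lemma iterate_uniform: "uniform_limit X (\<lambda>k. g k ^^ i) (f ^^ i) sequentially"
proof (induction i)
  case 0
  show ?case by (simp add: uniform_limit_iff)
next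
  case (Suc i)
  have "uniform_limit X (\<lambda>k x. g k ((g k ^^ i) x)) (\<lambda>x. f ((f ^^ i) x)) sequentially"
    by (rule uniform_limit_compose_compact[OF Suc gf X f]) (use X_maps in auto)
  then show ?case by simp
qed

lemma compose_uniform:
  fixes h :: "nat \<Rightarrow> 'a \<Rightarrow> 'b::metric_space"
  assumes "uniform_limit X h h' sequentially" "continuous_on X h'"
  shows "uniform_limit X (\<lambda>k x. h k ((g k ^^ i) x)) (\<lambda>x. h' ((f ^^ i) x)) sequentially"
  by (rule uniform_limit_compose_compact[OF iterate_uniform assms(1) X assms(2)]) (use X_maps in auto)

lemma compose_cont:
  fixes h :: "'a \<Rightarrow> 'b::topological_space"
  assumes "continuous_on X h" shows "continuous_on X (\<lambda>x. h ((f ^^ i) x))"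
  by (rule continuous_on_compose2[OF assms iterate_cont]) (use X_maps in auto)

text \<open>The indicator function of a cell is squeezed between truncated multiples of the
  distances to the cell and to its complement. The two bounds agree eventually off the boundary,
  which is a null set.\<close>

lemma approx_label:
  fixes P :: "'a \<Rightarrow> nat"
  assumes P: "AE y in \<mu>. loc_const X P y" and e: "e > 0"
  obtains \<phi> d :: "'a \<Rightarrow> real" where "continuous_on X \<phi>" "continuous_on X d"
    "\<And>x. x \<in> X \<Longrightarrow> 0 \<le> \<phi> x \<and> \<phi> x \<le> 1" "\<And>x. x \<in> X \<Longrightarrow> \<bar>(if P x = b then 1 else 0) - \<phi> x\<bar> \<le> d x"
    "integral\<^sup>L \<mu> d < e"
proof -
  interpret m: mpt \<mu> f by (rule \<mu>)
  define A where "A = {x\<in>X. P x = b}"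
  define C where "C = X - A"
  show ?thesis
  \<comment> \<open>\<open>infdist\<close> to the empty set is 0, so a trivial cell needs constant
    functions.\<close>
  proof (cases "A = {} \<or> C = {}")
    case True
    show ?thesis
    proof (rule that[of "\<lambda>x. if A = {} then 0 else 1" "\<lambda>x. 0"])
      show "\<bar>(if P x = b then 1 else 0) - (if A = {} then 0 else 1)\<bar> \<le> (0::real)" if "x \<in> X" for x
        using True that by (auto simp: A_def C_def)
    qed (use e in auto)
  next
    case False
    define up where "up m x = max 0 (1 - real m * infdist x A)" for m x
    define lo where "lo m x = min 1 (real m * infdist x C)" for m x
    have up: "0 \<le> up m x" "up m x \<le> 1" "x \<in> A \<Longrightarrow> up m x = 1" for m x
      using infdist_nonneg[of x A] by (auto simp: up_def)
    have lo: "0 \<le> lo m x" "lo m x \<le> 1" "x \<in> C \<Longrightarrow> lo m x = 0" for m x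
      using infdist_nonneg[of x C] by (auto simp: lo_def)
    have cu: "continuous_on X (up m)" and cl: "continuous_on X (lo m)" for m
      unfolding up_def lo_def by (intro continuous_intros)+
    have ind: "lo m x \<le> (if P x = b then 1 else 0)" "(if P x = b then 1 else 0) \<le> up m x" if "x \<in> X" for m x
      using that up lo by (auto simp: A_def C_def)
    have "(\<lambda>m. \<integral>x. up m x - lo m x \<partial>\<mu>) \<longlonglongrightarrow> (\<integral>x. 0 \<partial>\<mu>)"
    proof (rule integral_dominated_convergence[where w = "\<lambda>_. 1"])
      show "AE x in \<mu>. (\<lambda>m. up m x - lo m x) \<longlonglongrightarrow> 0"
        using P AE_space[of \<mu>]
      proof (eventually_elim)
        case (elim x)
        then obtain d where d: "d > 0" "\<And>z. z \<in> X \<Longrightarrow> dist x z < d \<Longrightarrow> P z = P x" unfolding loc_const_def by blast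
        have xX: "x \<in> X" using elim by simp
        obtain m0 :: nat where m0: "1 / d < real m0" using reals_Archimedean2 by blast
        have big: "1 \<le> real m * d" if "m \<ge> m0" for m
        proof -
          have "1 / d \<le> real m" using m0 that by linarith
          then show ?thesis using d(1) by (simp add: field_simps)
        qed
        have "up m x - lo m x = 0" if m: "m \<ge> m0" for m
        proof (cases "P x = b")
          case True
          have "d \<le> infdist x C"
          proof (rule le_infdistI)
            show "d \<le> dist x a" if "a \<in> C" for a using d(2)[of a] that True by (force simp: C_def A_def)
          qed (use False in simp)
          then have "1 \<le> real m * infdist x C" using big[OF m] by (meson mult_left_mono of_nat_0_le_iff order_trans)
          moreover have "up m x = 1" using True xX by (intro up) (simp add: A_def)
          ultimately show ?thesis by (simp add: lo_def)
        next
          case False': False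
          have "d \<le> infdist x A"
          proof (rule le_infdistI)
            show "d \<le> dist x a" if "a \<in> A" for a using d(2)[of a] that False' by (force simp: A_def)
          qed (use False in simp)
          then have "1 \<le> real m * infdist x A" using big[OF m] by (meson mult_left_mono of_nat_0_le_iff order_trans)
          moreover have "lo m x = 0" using False' xX by (intro lo) (simp add: A_def C_def)
          ultimately show ?thesis by (simp add: up_def)
        qed
        then show ?case by (intro tendsto_eventually eventually_sequentiallyI[of m0])
      qed
      show "AE x in \<mu>. norm (up m x - lo m x) \<le> 1" for m
      proof (rule AE_I2)
        fix x show "norm (up m x - lo m x) \<le> 1" using up(1,2)[of m x] lo(1,2)[of m x] by (auto simp: abs_le_iff)
      qed
      show "(\<lambda>x. up m x - lo m x) \<in> borel_measurable \<mu>" for m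
        by (intro borel_measurable_diff cont_meas cu cl)
    qed auto
    then have "(\<lambda>m. \<integral>x. up m x - lo m x \<partial>\<mu>) \<longlonglongrightarrow> 0" by simp
    then obtain m where m: "\<bar>\<integral>x. up m x - lo m x \<partial>\<mu>\<bar> < e" using LIMSEQ_D[OF _ e] by fastforce
    show ?thesis
    proof (rule that[of "up m" "\<lambda>x. up m x - lo m x"])
      show "\<bar>(if P x = b then 1 else 0) - up m x\<bar> \<le> up m x - lo m x" if "x \<in> X" for x
        using ind(1)[OF that] ind(2)[OF that] by (smt (verit))
    qed (use cu cl up m in \<open>auto intro: continuous_on_diff\<close>)
  qed
qed

text \<open>The indicator function of a word is a product of indicator functions along the orbit.
  Replacing each factor by a continuous function costs its mean error, which by invariance does not
  depend on the time; the continuous products converge uniformly along with the iterates of the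
  maps.\<close>

lemma word_prob_limit:
  fixes P :: "'a \<Rightarrow> nat"
  assumes P: "AE y in \<mu>. loc_const X P y"
    and lab: "fin_label \<mu> P" "\<And>k. fin_label (\<nu> k) P"
  shows "(\<lambda>k. label_prob (\<nu> k) (word (g k) P n) v) \<longlonglongrightarrow> label_prob \<mu> (word f P n) v"
proof (cases "length v = n")
  case False
  then have "label_prob M (word T P n) v = 0" for M T unfolding label_prob_def
    by (metis (mono_tags, lifting) Collect_empty_eq length_word measure_empty)
  then show ?thesis by simp
next
  case len: True
  interpret m: mpt \<mu> f by (rule \<mu>)
  define I where "I i x = (if P x = v ! i then 1 else (0::real))" for i x
  have ind: "(\<Prod>i<n. I i ((T ^^ i) x)) = (if word T P n x = v then 1 else 0)" for T x
  proof -
    have "word T P n x = v \<longleftrightarrow> (\<forall>i<n. P ((T ^^ i) x) = v ! i)"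
      using len by (auto simp: word_def list_eq_iff_nth_eq)
    then show ?thesis by (auto simp: I_def)
  qed
  have prob: "label_prob M (word T P n) v = (\<integral>x. (\<Prod>i<n. I i ((T ^^ i) x)) \<partial>M)" if "mpt M T" "fin_label M P" for M T
  proof -
    interpret mpt M T by fact
    have s: "{x\<in>space M. word T P n x = v} \<in> sets M"
      using fin_label_word[OF that(2) T_meas, of n] by (simp add: fin_label_def)
    have "(\<integral>x. (\<Prod>i<n. I i ((T ^^ i) x)) \<partial>M) = (\<integral>x. indicator {x\<in>space M. word T P n x = v} x \<partial>M)"
      unfolding ind by (rule Bochner_Integration.integral_cong) (auto simp: indicator_def)
    then show ?thesis using s by (simp add: label_prob_def)
  qed
  have Imeas: "I i \<in> borel_measurable M" if "fin_label M P" for i M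
    using measurable_compose[OF fin_label_measurable[OF that], of "\<lambda>p. if p = v ! i then 1 else 0" borel]
    by (simp add: I_def[abs_def])
  show ?thesis
  proof (rule LIMSEQ_I)
    fix e :: real assume e: "e > 0"
    \<comment> \<open>The error of the \<open>n\<close> factors is then at most \<open>e / 4\<close>
      for \<mu>, and at most slightly more for the approximating measures.\<close>
    define \<delta> where "\<delta> = e / (4 * (real n + 1))"
    have \<delta>: "\<delta> > 0" "real n * \<delta> \<le> e / 4" using e by (auto simp: \<delta>_def field_simps)
    have "\<forall>i. \<exists>\<phi> d :: 'a \<Rightarrow> real. continuous_on X \<phi> \<and> continuous_on X d \<and>
      (\<forall>x\<in>X. 0 \<le> \<phi> x \<and> \<phi> x \<le> 1) \<and> (\<forall>x\<in>X. \<bar>I i x - \<phi> x\<bar> \<le> d x) \<and> integral\<^sup>L \<mu> d < \<delta>"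
    proof
      fix i
      obtain \<phi> d :: "'a \<Rightarrow> real" where "continuous_on X \<phi>" "continuous_on X d"
        "\<And>x. x \<in> X \<Longrightarrow> 0 \<le> \<phi> x \<and> \<phi> x \<le> 1" "\<And>x. x \<in> X \<Longrightarrow> \<bar>(if P x = v ! i then 1 else 0) - \<phi> x\<bar> \<le> d x"
        "integral\<^sup>L \<mu> d < \<delta>" using approx_label[OF P \<delta>(1), where b = "v ! i"] by blast
      then show "\<exists>\<phi> d :: 'a \<Rightarrow> real. continuous_on X \<phi> \<and> continuous_on X d \<and>
      (\<forall>x\<in>X. 0 \<le> \<phi> x \<and> \<phi> x \<le> 1) \<and> (\<forall>x\<in>X. \<bar>I i x - \<phi> x\<bar> \<le> d x) \<and> integral\<^sup>L \<mu> d < \<delta>"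
        unfolding I_def by (intro exI[of _ \<phi>] exI[of _ d]) auto
    qed
    then obtain \<phi> d :: "nat \<Rightarrow> 'a \<Rightarrow> real" where \<phi>d: "\<And>i. continuous_on X (\<phi> i)" "\<And>i. continuous_on X (d i)"
      "\<And>i x. x \<in> X \<Longrightarrow> 0 \<le> \<phi> i x \<and> \<phi> i x \<le> 1" "\<And>i x. x \<in> X \<Longrightarrow> \<bar>I i x - \<phi> i x\<bar> \<le> d i x"
      "\<And>i. integral\<^sup>L \<mu> (d i) < \<delta>" by metis
    define \<Phi> :: "('a \<Rightarrow> 'a) \<Rightarrow> 'a \<Rightarrow> real" where "\<Phi> T x = (\<Prod>i<n. \<phi> i ((T ^^ i) x))" for T x
    have close: "\<bar>label_prob M (word T P n) v - (\<integral>x. \<Phi> T x \<partial>M)\<bar> \<le> (\<Sum>i<n. integral\<^sup>L M (d i))"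
      if M: "mpt M T" "fin_label M P" "space M = X" "\<And>i. \<phi> i \<in> borel_measurable M"
        "\<And>i. integrable M (d i)" for M T
    proof -
      interpret mpt M T by fact
      note [measurable] = Imeas[OF M(2)] M(4)
      have inX: "(T ^^ i) x \<in> X" if "x \<in> X" for i x using Tn_space[of x i] that M(3) by simp
      have P01: "\<bar>\<Phi> T x\<bar> \<le> 1" if "x \<in> X" for x
        unfolding \<Phi>_def using \<phi>d(3)[OF inX[OF that]] by (subst abs_of_nonneg) (auto intro!: prod_nonneg prod_le_1)
      have int1: "integrable M (\<lambda>x. \<Prod>i<n. I i ((T ^^ i) x))"
      proof (rule integrable_const_bound[of _ 1])
        show "AE x in M. norm (\<Prod>i<n. I i ((T ^^ i) x)) \<le> 1" unfolding ind by simp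
      qed measurable
      have int2: "integrable M (\<Phi> T)"
      proof (rule integrable_const_bound[of _ 1])
        show "AE x in M. norm (\<Phi> T x) \<le> 1" using P01 M(3) by (intro AE_I2) auto
        show "\<Phi> T \<in> borel_measurable M" unfolding \<Phi>_def[abs_def] by measurable
      qed
      have intd: "integrable M (\<lambda>x. d i ((T ^^ i) x))" for i by (rule integrable_Tn[OF M(5)])
      have "\<bar>label_prob M (word T P n) v - (\<integral>x. \<Phi> T x \<partial>M)\<bar> = \<bar>\<integral>x. (\<Prod>i<n. I i ((T ^^ i) x)) - \<Phi> T x \<partial>M\<bar>"
        unfolding prob[OF M(1,2)] using int1 int2 by simp
      also have "\<dots> \<le> (\<integral>x. \<bar>(\<Prod>i<n. I i ((T ^^ i) x)) - \<Phi> T x\<bar> \<partial>M)" by (rule integral_abs_bound)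
      also have "\<dots> \<le> (\<integral>x. (\<Sum>i<n. d i ((T ^^ i) x)) \<partial>M)"
      proof (rule integral_mono)
        show "integrable M (\<lambda>x. \<bar>(\<Prod>i<n. I i ((T ^^ i) x)) - \<Phi> T x\<bar>)" using int1 int2 by simp
        show "integrable M (\<lambda>x. \<Sum>i<n. d i ((T ^^ i) x))" using intd by simp
        fix x assume "x \<in> space M"
        then have x: "x \<in> X" using M(3) by simp
        have "\<bar>(\<Prod>i<n. I i ((T ^^ i) x)) - \<Phi> T x\<bar> \<le> (\<Sum>i<n. \<bar>I i ((T ^^ i) x) - \<phi> i ((T ^^ i) x)\<bar>)"
          unfolding \<Phi>_def by (rule abs_prod_diff_le) (use \<phi>d(3) inX[OF x] in \<open>auto simp: I_def\<close>)
        also have "\<dots> \<le> (\<Sum>i<n. d i ((T ^^ i) x))" by (rule sum_mono) (use \<phi>d(4) inX[OF x] in auto)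
        finally show "\<bar>(\<Prod>i<n. I i ((T ^^ i) x)) - \<Phi> T x\<bar> \<le> (\<Sum>i<n. d i ((T ^^ i) x))" .
      qed
      also have "\<dots> = (\<Sum>i<n. \<integral>x. d i ((T ^^ i) x) \<partial>M)" using intd by (simp add: Bochner_Integration.integral_sum)
      also have "\<dots> = (\<Sum>i<n. integral\<^sup>L M (d i))" using M(5) by (intro sum.cong integral_Tn) auto
      finally show ?thesis .
    qed
    have lim1: "(\<lambda>k. \<integral>x. \<Phi> (g k) x \<partial>\<nu> k) \<longlonglongrightarrow> (\<integral>x. \<Phi> f x \<partial>\<mu>)"
    proof (rule integral_uniform_limit)
      show "uniform_limit X (\<lambda>k. \<Phi> (g k)) (\<Phi> f) sequentially"
        unfolding \<Phi>_def[abs_def]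
      proof (induction n)
        case 0 show ?case by (simp add: uniform_limit_iff)
      next
        case (Suc n)
        have c: "continuous_on X (\<lambda>x. \<phi> n ((f ^^ n) x))" by (rule compose_cont[OF \<phi>d(1)])
        have u: "uniform_limit X (\<lambda>k x. \<phi> n ((g k ^^ n) x)) (\<lambda>x. \<phi> n ((f ^^ n) x)) sequentially"
          by (rule compose_uniform[OF _ \<phi>d(1)]) (simp add: uniform_limit_iff)
        have c': "continuous_on X (\<lambda>x. \<Prod>i<n. \<phi> i ((f ^^ i) x))" by (intro continuous_on_prod compose_cont[OF \<phi>d(1)])
        have "uniform_limit X (\<lambda>k x. (\<Prod>i<n. \<phi> i ((g k ^^ i) x)) * \<phi> n ((g k ^^ n) x))
            (\<lambda>x. (\<Prod>i<n. \<phi> i ((f ^^ i) x)) * \<phi> n ((f ^^ n) x)) sequentially"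
          by (rule uniform_lim_mult[OF Suc u])
            (use compact_imp_bounded[OF compact_continuous_image[OF c X]]
              compact_imp_bounded[OF compact_continuous_image[OF c' X]] in auto)
        then show ?case by simp
      qed
      show "continuous_on X (\<Phi> f)" unfolding \<Phi>_def[abs_def] by (intro continuous_on_prod compose_cont[OF \<phi>d(1)])
      show "\<Phi> (g k) \<in> borel_measurable (\<nu> k)" for k
      proof -
        interpret n: mpt "\<nu> k" "g k" by (rule \<nu>)
        note [measurable] = cont_meas(2)[OF \<phi>d(1), of _ k]
        show ?thesis unfolding \<Phi>_def by measurable
      qed
    qed
    have lim2: "(\<lambda>k. \<Sum>i<n. integral\<^sup>L (\<nu> k) (d i)) \<longlonglongrightarrow> (\<Sum>i<n. integral\<^sup>L \<mu> (d i))"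
      by (intro tendsto_sum weak \<phi>d)
    have small: "(\<Sum>i<n. integral\<^sup>L \<mu> (d i)) \<le> e / 4"
    proof -
      have "(\<Sum>i<n. integral\<^sup>L \<mu> (d i)) \<le> (\<Sum>i<n. \<delta>)" by (rule sum_mono) (use \<phi>d(5) in \<open>auto intro: less_imp_le\<close>)
      then show ?thesis using \<delta>(2) by simp
    qed
    have e8: "e / 8 > 0" using e by simp
    from LIMSEQ_D[OF lim1 e8] obtain N1 where N1: "\<And>k. k \<ge> N1 \<Longrightarrow> \<bar>(\<integral>x. \<Phi> (g k) x \<partial>\<nu> k) - (\<integral>x. \<Phi> f x \<partial>\<mu>)\<bar> < e / 8"
      by auto
    from LIMSEQ_D[OF lim2 e8] obtain N2 where N2: "\<And>k. k \<ge> N2 \<Longrightarrow> \<bar>(\<Sum>i<n. integral\<^sup>L (\<nu> k) (d i)) - (\<Sum>i<n. integral\<^sup>L \<mu> (d i))\<bar> < e / 8"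
      by auto
    have "norm (label_prob (\<nu> k) (word (g k) P n) v - label_prob \<mu> (word f P n) v) < e" if k: "k \<ge> max N1 N2" for k
    proof -
      have "\<bar>label_prob (\<nu> k) (word (g k) P n) v - (\<integral>x. \<Phi> (g k) x \<partial>\<nu> k)\<bar> \<le> (\<Sum>i<n. integral\<^sup>L (\<nu> k) (d i))"
        by (rule close[OF \<nu>(1) lab(2)]) (use cont_meas cont_integrable \<phi>d in auto)
      moreover have "\<bar>label_prob \<mu> (word f P n) v - (\<integral>x. \<Phi> f x \<partial>\<mu>)\<bar> \<le> (\<Sum>i<n. integral\<^sup>L \<mu> (d i))"
        by (rule close[OF \<mu>(1) lab(1)]) (use cont_meas cont_integrable \<phi>d in auto)
      moreover have "k \<ge> N1" "k \<ge> N2" using k by auto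
      ultimately show ?thesis using N1[of k] N2[of k] small e unfolding real_norm_def by linarith
    qed
    then show "\<exists>no. \<forall>k\<ge>no. norm (label_prob (\<nu> k) (word (g k) P n) v - label_prob \<mu> (word f P n) v) < e" by blast
  qed
qed

lemma word_integral_limit:
  fixes P :: "'a \<Rightarrow> nat" and F :: "nat list \<Rightarrow> real"
  assumes P: "AE y in \<mu>. loc_const X P y" and L: "\<And>x. x \<in> X \<Longrightarrow> P x < L"
    and lab: "fin_label \<mu> P" "\<And>k. fin_label (\<nu> k) P"
  shows "(\<lambda>k. \<integral>x. F (word (g k) P n x) \<partial>\<nu> k) \<longlonglongrightarrow> (\<integral>x. F (word f P n x) \<partial>\<mu>)"
proof -
  define V where "V = {v. set v \<subseteq> {..<L} \<and> length v = n}"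
  have finV: "finite V" unfolding V_def by (rule finite_lists_length_eq) simp
  have eq: "(\<integral>x. F (word T P n x) \<partial>M) = (\<Sum>v\<in>V. label_prob M (word T P n) v * F v)"
    if M: "mpt M T" "fin_label M P" "space M = X" for M T
  proof -
    interpret mpt M T by fact
    have fl: "fin_label M (word T P n)" by (rule fin_label_word[OF M(2) T_meas])
    have sub: "word T P n ` space M \<subseteq> V"
    proof (rule image_subsetI)
      fix x assume x: "x \<in> space M"
      show "word T P n x \<in> V" unfolding V_def word_def using L Tn_space[OF x] M(3) by auto
    qed
    have "(\<integral>x. F (word T P n x) \<partial>M) = (\<Sum>v\<in>word T P n ` space M. label_prob M (word T P n) v * F v)"
      by (rule label_integral(1)[OF fl])
    also have "\<dots> = (\<Sum>v\<in>V. label_prob M (word T P n) v * F v)"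
    proof (rule sum.mono_neutral_left[OF finV sub])
      show "\<forall>v\<in>V - word T P n ` space M. label_prob M (word T P n) v * F v = 0"
      proof
        fix v assume "v \<in> V - word T P n ` space M"
        then have e: "{x\<in>space M. word T P n x = v} = {}" by auto
        show "label_prob M (word T P n) v * F v = 0" unfolding label_prob_def e by simp
      qed
    qed
    finally show ?thesis .
  qed
  have "(\<lambda>k. \<Sum>v\<in>V. label_prob (\<nu> k) (word (g k) P n) v * F v) \<longlonglongrightarrow> (\<Sum>v\<in>V. label_prob \<mu> (word f P n) v * F v)"
    by (intro tendsto_sum tendsto_mult tendsto_const word_prob_limit P lab)
  then show ?thesis using eq[OF \<mu>(1) lab(1)] eq[OF \<nu>(1) lab(2)] by simp
qed

text \<open>For each centre only countably many spheres can have positive measure, so there are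
  balls of small radius with null boundary. A finite cover by such balls is turned into a partition
  by taking the first ball that contains a point.\<close>

lemma fine_label:
  assumes e: "e > 0"
  obtains P :: "'a \<Rightarrow> nat" and L where "\<And>x. P x < L" "AE y in \<mu>. loc_const X P y"
    "fin_label \<mu> P" "\<And>k. fin_label (\<nu> k) P" "\<And>x y. x \<in> X \<Longrightarrow> y \<in> X \<Longrightarrow> P x = P y \<Longrightarrow> dist x y \<le> e"
proof -
  interpret m: mpt \<mu> f by (rule \<mu>)
  have "\<exists>r. 0 < r \<and> r < e / 2 \<and> measure \<mu> {y\<in>X. dist x y = r} = 0" for x
  proof -
    have dm: "(\<lambda>y. dist x y) \<in> borel_measurable \<mu>" by (intro cont_meas continuous_intros)
    interpret d: prob_space "distr \<mu> borel (\<lambda>y. dist x y)" by (rule m.prob_space_distr[OF dm])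
    have c: "countable {r. measure (distr \<mu> borel (\<lambda>y. dist x y)) {r} \<noteq> 0}" by (rule d.countable_support)
    have "uncountable {0<..<e/2}" using e by (simp add: uncountable_open_interval)
    then have "\<not> {0<..<e/2} \<subseteq> {r. measure (distr \<mu> borel (\<lambda>y. dist x y)) {r} \<noteq> 0}"
      using c countable_subset by blast
    then have "\<exists>r. r \<in> {0<..<e/2} \<and> measure (distr \<mu> borel (\<lambda>y. dist x y)) {r} = 0" by blast
    then obtain r where r: "r \<in> {0<..<e/2}" "measure (distr \<mu> borel (\<lambda>y. dist x y)) {r} = 0" by blast
    have "measure (distr \<mu> borel (\<lambda>y. dist x y)) {r} = measure \<mu> {y\<in>X. dist x y = r}"
      by (subst measure_distr[OF dm]) (auto intro!: arg_cong[of _ _ "measure \<mu>"])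
    then show ?thesis using r by auto
  qed
  then obtain r where r: "\<And>x. 0 < r x" "\<And>x. r x < e / 2" "\<And>x. measure \<mu> {y\<in>X. dist x y = r x} = 0" by metis
  have "X \<subseteq> (\<Union>x\<in>X. ball x (r x))" using r(1) by auto
  then obtain F where F: "F \<subseteq> X" "finite F" "X \<subseteq> (\<Union>x\<in>F. ball x (r x))"
    using compactE_image[OF X, of X "\<lambda>x. ball x (r x)"] by auto
  obtain xs where xs: "set xs = F" using F(2) finite_list by blast
  define L where "L = Suc (length xs)"
  \<comment> \<open>The index of the first ball of the list that contains \<open>y\<close>, or the
    length of the list if there is none.\<close>
  define P where "P y = length (takeWhile (\<lambda>x. \<not> dist x y < r x) xs)" for y
  have PL: "P y < L" for y unfolding P_def L_def by (simp add: le_imp_less_Suc length_takeWhile_le)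
  have cong: "P y = P z" if "\<And>x. x \<in> F \<Longrightarrow> (dist x y < r x) = (dist x z < r x)" for y z
    unfolding P_def by (intro arg_cong[of _ _ length] takeWhile_cong refl) (use that xs in auto)
  have AE: "AE y in \<mu>. \<forall>x\<in>F. dist x y \<noteq> r x"
  proof (rule AE_finite_allI[OF F(2)])
    fix x
    have s: "{y\<in>X. dist x y = r x} \<in> sets \<mu>"
    proof -
      have [measurable]: "(\<lambda>y. dist x y) \<in> borel_measurable \<mu>" by (intro cont_meas continuous_intros)
      have "{y\<in>space \<mu>. dist x y = r x} \<in> sets \<mu>" by measurable
      then show ?thesis by simp
    qed
    have "AE y in \<mu>. y \<notin> {y\<in>X. dist x y = r x}" using r(3)[of x] m.prob_eq_0[OF s] by simp
    with AE_space show "AE y in \<mu>. dist x y \<noteq> r x" by eventually_elim auto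
  qed
  have "AE y in \<mu>. loc_const X P y" using AE
  proof (eventually_elim)
    case (elim y)
    have "\<exists>d>0. \<forall>x\<in>F. d \<le> \<bar>dist x y - r x\<bar>"
    proof (cases "F = {}")
      case True then show ?thesis by (intro exI[of _ 1]) simp
    next
      case False
      let ?d = "Min ((\<lambda>x. \<bar>dist x y - r x\<bar>) ` F)"
      have "?d > 0" using False F(2) elim by auto
      then show ?thesis using F(2) by (intro exI[of _ ?d]) auto
    qed
    then obtain d where d: "d > 0" "\<And>x. x \<in> F \<Longrightarrow> d \<le> \<bar>dist x y - r x\<bar>" by blast
    have "P z = P y" if z: "dist y z < d" for z
    proof (rule cong)
      fix x assume x: "x \<in> F"
      have "\<bar>dist x z - dist x y\<bar> \<le> dist y z"
        using dist_triangle[of x z y] dist_triangle[of x y z] by (simp add: dist_commute abs_le_iff)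
      then show "(dist x z < r x) = (dist x y < r x)" using d(2)[OF x] z by linarith
    qed
    then show ?case unfolding loc_const_def using d(1) by blast
  qed
  moreover have lab: "fin_label M P" if M: "sets M = sets (restrict_space borel X)" for M
  proof -
    have fin: "finite (P ` space M)" by (rule finite_subset[of _ "{..<L}"]) (use PL in auto)
    have sp: "space M = X" using sets_eq_imp_space_eq[OF M] by (simp add: space_restrict_space)
    have dm: "(\<lambda>y. dist x y) \<in> borel_measurable M" for x
    proof -
      have "(\<lambda>y. dist x y) \<in> borel_measurable (restrict_space borel X)"
        by (intro borel_measurable_continuous_on_restrict continuous_intros)
      then show ?thesis by (simp add: measurable_cong_sets[OF M refl])
    qed
    have "{y\<in>space M. length (takeWhile (\<lambda>x. \<not> dist x y < r x) zs) = v} \<in> sets M" for v zs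
    proof (induction zs arbitrary: v)
      case Nil then show ?case by simp
    next
      case (Cons x zs)
      have 1: "{y\<in>space M. dist x y < r x} \<in> sets M" using dm[of x] by measurable
      have "{y\<in>space M. length (takeWhile (\<lambda>x. \<not> dist x y < r x) (x # zs)) = v} =
        (if v = 0 then {y\<in>space M. dist x y < r x} else
         {y\<in>space M. length (takeWhile (\<lambda>x. \<not> dist x y < r x) zs) = v - 1} - {y\<in>space M. dist x y < r x})"
        by auto
      also have "\<dots> \<in> sets M" using 1 Cons by auto
      finally show ?case .
    qed
    then show ?thesis unfolding fin_label_def P_def using fin unfolding P_def by blast
  qed
  moreover have "dist y z \<le> e" if yz: "y \<in> X" "z \<in> X" "P y = P z" for y z
  proof -
    have nth: "P y < length xs \<and> dist (xs ! P y) y < r (xs ! P y)" if "y \<in> X" for y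
    proof -
      obtain x where "x \<in> set xs" "dist x y < r x" using F(3) \<open>y \<in> X\<close> xs by auto
      then have "P y < length xs" unfolding P_def
        by (metis (mono_tags, lifting) length_takeWhile_le nat_less_le takeWhile_eq_all_conv takeWhile_eq_take take_all_iff order_refl)
      then show ?thesis unfolding P_def using nth_length_takeWhile[of "\<lambda>x. \<not> dist x y < r x" xs] by simp
    qed
    define x where "x = xs ! P y"
    have "dist x y < r x" using nth[OF yz(1)] by (simp add: x_def)
    moreover have "dist x z < r x" using nth[OF yz(2)] yz(3) by (simp add: x_def)
    ultimately show ?thesis using dist_triangle[of y z x] r(2)[of x] by (simp add: dist_commute)
  qed
  ultimately show ?thesis using that[of P L] PL lab[OF \<mu>(2)] lab[OF \<nu>(2)] by blast
qed

end

section \<open>Coding in time blocks\<close>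

text \<open>Time is divided into blocks of length \<open>p\<close>. On the set \<open>B\<close> a
  block expands the grid cell of the point by a factor of at most 2; elsewhere only the bound
  \<open>\<Lambda> ^ p\<close> is available. The number \<open>N\<close> of grid cells is free,
  because it adds a bounded term to the total cost.\<close>

locale block_coding = lifted M g D pr \<tau> G dg
  for M :: "'a::metric_space measure" and g D pr \<tau> G dg +
  fixes p N :: nat and \<Lambda> gap \<eta> C2 :: real and B :: "'a set" and Kc :: "'a set" and Qs :: "'a \<Rightarrow> nat" and LQ :: nat
  assumes p: "p > 0" and N: "N > 0" and \<Lambda>: "\<Lambda> \<ge> 1" and \<eta>0: "\<eta> \<ge> 0" and C2: "C2 \<ge> 0"
    and G_lip: "s \<in> D \<Longrightarrow> t \<in> D \<Longrightarrow> \<bar>G s - G t\<bar> \<le> \<Lambda> * \<bar>s - t\<bar>"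
    and flat: "s \<in> D \<Longrightarrow> t \<in> D \<Longrightarrow> \<bar>s - t\<bar> \<le> 1 / real N \<Longrightarrow> pr s \<in> B \<Longrightarrow>
      \<bar>(G ^^ p) s - (G ^^ p) t\<bar> \<le> 2 * \<bar>s - t\<bar>"
    and gap: "7 * \<Lambda> ^ p / real N < gap"
    and Q_label: "fin_label M Qs" and Q_lt: "x \<in> space M \<Longrightarrow> Qs x < LQ"
    and Q_gap: "x \<in> Kc \<Longrightarrow> y \<in> Kc \<Longrightarrow> x \<in> space M \<Longrightarrow> y \<in> space M \<Longrightarrow> dist x y < gap \<Longrightarrow> Qs x = Qs y"
    and C2_weight: "exp (- \<eta>) + real LQ * exp (- C2) \<le> 1"
    and Kc_sets: "{x\<in>space M. x \<in> Kc} \<in> sets M" and B_sets: "{x\<in>space M. x \<in> B} \<in> sets M"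
begin

lemma pos_add: "pos (j + i) x = (G ^^ i) (pos j x)"
  unfolding pos_def by (subst add.commute) (simp add: funpow_add)

lemma Gn_lip: "s \<in> D \<Longrightarrow> t \<in> D \<Longrightarrow> \<bar>(G ^^ i) s - (G ^^ i) t\<bar> \<le> \<Lambda> ^ i * \<bar>s - t\<bar>"
proof (induction i)
  case (Suc i)
  have "\<bar>(G ^^ Suc i) s - (G ^^ Suc i) t\<bar> \<le> \<Lambda> * \<bar>(G ^^ i) s - (G ^^ i) t\<bar>"
    using G_lip[OF Gn_D[OF Suc.prems(1), of i] Gn_D[OF Suc.prems(2), of i]] by simp
  also have "\<dots> \<le> \<Lambda> * (\<Lambda> ^ i * \<bar>s - t\<bar>)" using Suc \<Lambda> by (intro mult_left_mono) auto
  finally show ?case by (simp add: mult.assoc)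
qed simp

definition bit :: "nat \<Rightarrow> 'a \<Rightarrow> bool" where "bit i x \<longleftrightarrow> (g ^^ (i * p)) x \<in> B"
definition gcell :: "nat \<Rightarrow> 'a \<Rightarrow> int" where "gcell i x = \<lfloor>real N * pos (i * p) x\<rfloor>"
definition cell_cost :: "nat \<Rightarrow> 'a \<Rightarrow> real" where "cell_cost i x = (if bit i x then ln 4 else ln (3 * \<Lambda> ^ p))"
definition block_target :: "nat \<Rightarrow> 'a \<Rightarrow> nat" where
  "block_target j x = (if (g ^^ j) x \<in> Kc then 0 else Suc (Qs ((g ^^ j) x)))"

primrec block_eq :: "nat \<Rightarrow> 'a \<Rightarrow> 'a \<Rightarrow> bool" where
  "block_eq 0 x y = (gcell 0 x = gcell 0 y)"
| "block_eq (Suc i) x y = ((block_eq i x y \<and> bit i x = bit i y) \<and> gcell (Suc i) x = gcell (Suc i) y)"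
primrec block_cost :: "nat \<Rightarrow> 'a \<Rightarrow> real" where
  "block_cost 0 x = ln (real N + 1)"
| "block_cost (Suc i) x = (block_cost i x + ln 2) + cell_cost i x"
primrec block_full_eq :: "nat \<Rightarrow> nat \<Rightarrow> 'a \<Rightarrow> 'a \<Rightarrow> bool" where
  "block_full_eq n 0 x y = block_eq n x y"
| "block_full_eq n (Suc j) x y = (block_full_eq n j x y \<and> block_target j x = block_target j y)"
primrec block_full_cost :: "nat \<Rightarrow> nat \<Rightarrow> 'a \<Rightarrow> real" where
  "block_full_cost n 0 x = block_cost n x"
| "block_full_cost n (Suc j) x = block_full_cost n j x + (if block_target j x = 0 then \<eta> else C2)"

lemma block_eq_le: "block_eq n x y \<Longrightarrow> i \<le> n \<Longrightarrow> block_eq i x y"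
  by (induction n) (auto simp: le_Suc_eq)

lemma block_eq_cell: "block_eq i x y \<Longrightarrow> gcell i x = gcell i y" by (cases i) auto

lemma block_eq_close:
  assumes "block_eq i x y" shows "\<bar>pos (i * p) x - pos (i * p) y\<bar> \<le> 1 / real N"
proof -
  have "\<bar>real N * pos (i * p) x - real N * pos (i * p) y\<bar> \<le> 1"
    using block_eq_cell[OF assms] unfolding gcell_def by linarith
  then have "real N * \<bar>pos (i * p) x - pos (i * p) y\<bar> \<le> 1" by (simp add: abs_mult flip: right_diff_distrib)
  then show ?thesis using N by (simp add: field_simps)
qed

text \<open>One bit per block records whether its initial point lies in \<open>B\<close>. A cell of
  the grid is stretched to at most \<open>F\<close> times its length and then meets at most
  \<open>F + 2\<close> cells, which is 4 for \<open>F = 2\<close> and at most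
  \<open>3 * \<Lambda> ^ p\<close> for \<open>F = \<Lambda> ^ p\<close>.\<close>

lemma gibbs_block_eq: "gibbs (space M) (block_eq n) (block_cost n)"
proof (induction n)
  case 0
  show ?case
  proof (rule gibbs_weaken[OF gibbs_count[OF gibbs_trivial, where c = "gcell 0" and v = "\<lambda>x. ln (real N + 1)"]])
    fix Y y assume Y: "finite Y" "Y \<subseteq> space M" "inj_on (gcell 0) Y"
    have "card Y = card (gcell 0 ` Y)" using Y by (simp add: card_image)
    also have "\<dots> \<le> card {0..int N}"
    proof (rule card_mono)
      show "gcell 0 ` Y \<subseteq> {0..int N}"
      proof (rule image_subsetI)
        fix x assume "x \<in> Y"
        then have x: "0 \<le> \<tau> x" "\<tau> x \<le> 1" using \<tau> Y by auto
        have "0 \<le> real N * \<tau> x" "real N * \<tau> x \<le> real N * 1" using x mult_left_mono[OF x(2), of "real N"] by simp_all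
        then show "gcell 0 x \<in> {0..int N}" by (auto simp: gcell_def pos_0 floor_le_iff)
      qed
    qed simp
    finally show "real (card Y) \<le> exp (ln (real N + 1))" by (simp add: add.commute)
  qed auto
next
  case (Suc i)
  have b: "gibbs (space M) (\<lambda>x y. block_eq i x y \<and> bit i x = bit i y) (\<lambda>x. block_cost i x + ln 2)"
  proof (rule gibbs_count[OF Suc])
    fix Y y assume Y: "finite Y" "inj_on (bit i) Y"
    have "card Y = card (bit i ` Y)" using Y by (simp add: card_image)
    also have "\<dots> \<le> card (UNIV :: bool set)" by (rule card_mono) auto
    finally show "real (card Y) \<le> exp (ln 2)" by simp
  qed simp
  have "gibbs (space M) (\<lambda>x y. (block_eq i x y \<and> bit i x = bit i y) \<and> gcell (Suc i) x = gcell (Suc i) y)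
    (\<lambda>x. (block_cost i x + ln 2) + cell_cost i x)"
  proof (rule gibbs_count[OF b])
    fix x y assume "block_eq i x y \<and> bit i x = bit i y"
    then show "cell_cost i x = cell_cost i y" by (simp add: cell_cost_def)
  next
    fix Y y0 assume Y: "finite Y" "Y \<subseteq> space M" "\<And>x y. x \<in> Y \<Longrightarrow> y \<in> Y \<Longrightarrow> block_eq i x y \<and> bit i x = bit i y"
      and inj: "inj_on (gcell (Suc i)) Y" and y0: "y0 \<in> Y"
    define F where "F = (if bit i y0 then 2 else \<Lambda> ^ p)"
    have F0: "F \<ge> 0" using \<Lambda> by (simp add: F_def)
    define T where "T = pos (Suc i * p) ` Y"
    have d: "\<bar>s - t\<bar> \<le> F / real N" if st: "s \<in> T" "t \<in> T" for s t
    proof -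
      from st obtain x y where xy: "x \<in> Y" "y \<in> Y" "s = pos (Suc i * p) x" "t = pos (Suc i * p) y" unfolding T_def by blast
      have D: "pos (i * p) x \<in> D" "pos (i * p) y \<in> D" using pos_in Y xy by auto
      have c: "\<bar>pos (i * p) x - pos (i * p) y\<bar> \<le> 1 / real N" using block_eq_close Y xy by blast
      have st': "s = (G ^^ p) (pos (i * p) x)" "t = (G ^^ p) (pos (i * p) y)"
        unfolding xy pos_add[symmetric] by (simp_all add: add.commute)
      have "\<bar>s - t\<bar> \<le> F * \<bar>pos (i * p) x - pos (i * p) y\<bar>"
      proof (cases "bit i y0")
        case True
        then have "bit i x" using Y(3)[OF xy(1) y0] by simp
        moreover have "x \<in> space M" using Y(2) xy(1) by auto
        ultimately have "pr (pos (i * p) x) \<in> B" by (simp only: pr_pos bit_def)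
        then show ?thesis using flat[OF D c] True unfolding st' F_def by simp
      next
        case False
        then show ?thesis using Gn_lip[OF D, of p] unfolding st' F_def by simp
      qed
      also have "\<dots> \<le> F * (1 / real N)" by (rule mult_left_mono[OF c F0])
      finally show ?thesis by simp
    qed
    have "card Y = card (gcell (Suc i) ` Y)" using inj by (simp add: card_image)
    also have "gcell (Suc i) ` Y = (\<lambda>t. \<lfloor>real N * t\<rfloor>) ` T" unfolding T_def gcell_def by (simp add: image_image)
    finally have "real (card Y) \<le> real N * (F / real N) + 2"
      using card_floor_image[of T "F / real N" N] Y(1) d F0 by (simp add: T_def)
    also have "\<dots> = F + 2" using N by simp
    also have "\<dots> \<le> exp (cell_cost i y0)"
    proof -
      have "1 \<le> \<Lambda> ^ p" using \<Lambda> by (rule one_le_power)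
      then show ?thesis by (auto simp: F_def cell_cost_def)
    qed
    finally show "real (card Y) \<le> exp (cell_cost i y0)" .
  qed
  then show ?case by (rule gibbs_weaken) auto
qed

lemma gibbs_block_full_eq: "gibbs (space M) (block_full_eq n m) (block_full_cost n m)"
proof (induction m)
  case 0 show ?case by (rule gibbs_weaken[OF gibbs_block_eq[of n]]) auto
next
  case (Suc j)
  have "gibbs (space M) (\<lambda>x y. block_full_eq n j x y \<and> block_target j x = block_target j y) (\<lambda>x. block_full_cost n j x + (if block_target j x = 0 then \<eta> else C2))"
  proof (rule gibbs_step[OF Suc])
    fix Y assume Y: "finite Y" "Y \<subseteq> space M" "inj_on (block_target j) Y"
    have sub: "block_target j ` Y \<subseteq> {..LQ}"
    proof (rule image_subsetI)
      fix y assume "y \<in> Y"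
      then have "Qs ((g ^^ j) y) < LQ" using Y by (intro Q_lt Tn_space) auto
      then show "block_target j y \<in> {..LQ}" by (simp add: block_target_def)
    qed
    have "(\<Sum>y\<in>Y. exp (- (if block_target j y = 0 then \<eta> else C2))) = (\<Sum>b\<in>block_target j ` Y. exp (- (if b = 0 then \<eta> else C2)))"
      using Y(3) by (simp add: sum.reindex)
    also have "\<dots> \<le> (\<Sum>b\<in>{..LQ}. exp (- (if b = 0 then \<eta> else C2)))" by (rule sum_mono2) (use sub in auto)
    also have "\<dots> = exp (- \<eta>) + (\<Sum>b<LQ. exp (- C2))"
      by (simp add: lessThan_Suc_atMost[symmetric] sum.lessThan_Suc_shift del: sum.lessThan_Suc)
    also have "\<dots> \<le> 1" using C2_weight by simp
    finally show "(\<Sum>y\<in>Y. exp (- (if block_target j y = 0 then \<eta> else C2))) \<le> 1" .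
  qed simp
  then show ?case by (rule gibbs_weaken) auto
qed

lemma block_full_eq_refines:
  assumes xy: "x \<in> space M" "y \<in> space M" and F: "block_full_eq n m x y" and j: "j < m" "j < n * p"
  shows "Qs ((g ^^ j) x) = Qs ((g ^^ j) y)"
proof -
  have E: "block_eq n x y" using F by (induction m) auto
  have block_target: "block_target j x = block_target j y" using F j(1) by (induction m) (auto simp: less_Suc_eq)
  show ?thesis
  proof (cases "block_target j x = 0")
    case False
    then show ?thesis using block_target by (auto simp: block_target_def split: if_splits)
  next
    case True
    then have Kc: "(g ^^ j) x \<in> Kc" "(g ^^ j) y \<in> Kc" using block_target by (auto simp: block_target_def split: if_splits)
    define i where "i = j div p"
    define l where "l = j mod p"
    have jl: "j = i * p + l" "l < p" using p by (auto simp: i_def l_def)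
    have "i < n" using j(2) p unfolding i_def by (simp add: less_mult_imp_div_less)
    then have c: "\<bar>pos (i * p) x - pos (i * p) y\<bar> \<le> 1 / real N" using block_eq_close block_eq_le[OF E] by simp
    have D: "pos i x \<in> D" "pos i y \<in> D" for i using pos_in xy by auto
    have "\<bar>pos j x - pos j y\<bar> \<le> \<Lambda> ^ l * \<bar>pos (i * p) x - pos (i * p) y\<bar>"
      unfolding jl(1) pos_add by (rule Gn_lip[OF D])
    also have "\<dots> \<le> \<Lambda> ^ p * (1 / real N)"
      using c \<Lambda> jl(2) by (intro mult_mono power_increasing) auto
    finally have "7 * \<bar>pos j x - pos j y\<bar> < gap" using gap by simp
    then have "dist ((g ^^ j) x) ((g ^^ j) y) < gap" using lip[OF D, of j j] by (simp add: pr_pos xy)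
    then show ?thesis using Q_gap[OF Kc] Tn_space xy by blast
  qed
qed

lemma block_full_cost_sum: "block_full_cost n m x = ln (real N + 1) + (\<Sum>i<n. ln 2 + cell_cost i x) + (\<Sum>j<m. if block_target j x = 0 then \<eta> else C2)"
proof -
  have "block_cost n x = ln (real N + 1) + (\<Sum>i<n. ln 2 + cell_cost i x)" by (induction n) simp_all
  then show ?thesis by (induction m) simp_all
qed

text \<open>The number 8 is 2 for the bit of a block times 4 for its cell. Divided by the block
  length this is small, so the entropy is controlled by the measure of the complement of
  \<open>B\<close>.\<close>

lemma block_entropy_bound:
  "metric_entropy_wrt M g (fibers (space M) Qs) \<le>
    (ln 8 + ln (3 * \<Lambda> ^ p) * measure M {x\<in>space M. x \<notin> B}) / real p + \<eta> + C2 * measure M {x\<in>space M. x \<notin> Kc}"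
proof -
  define b where "b = (ln 8 + ln (3 * \<Lambda> ^ p) * measure M {x\<in>space M. x \<notin> B})"
  define e where "e = \<eta> + C2 * measure M {x\<in>space M. x \<notin> Kc}"
  have nB: "{x\<in>space M. x \<notin> B} \<in> sets M" and nK: "{x\<in>space M. x \<notin> Kc} \<in> sets M"
  proof -
    have "{x\<in>space M. x \<notin> B} = space M - {x\<in>space M. x \<in> B}" "{x\<in>space M. x \<notin> Kc} = space M - {x\<in>space M. x \<in> Kc}" by auto
    then show "{x\<in>space M. x \<notin> B} \<in> sets M" "{x\<in>space M. x \<notin> Kc} \<in> sets M" using B_sets Kc_sets by auto
  qed
  have \<Lambda>1: "1 \<le> \<Lambda> ^ p" using \<Lambda> by (rule one_le_power)
  have l0: "0 \<le> ln (3 * \<Lambda> ^ p)" using \<Lambda>1 by (intro ln_ge_zero) simp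
  define U1 where "U1 x = ln 8 + ln (3 * \<Lambda> ^ p) * indicator {x\<in>space M. x \<notin> B} x" for x
  define U2 where "U2 x = \<eta> + C2 * indicator {x\<in>space M. x \<notin> Kc} x" for x
  have int1: "integrable M U1" and int2: "integrable M U2"
    unfolding U1_def U2_def using nB nK by (auto simp: emeasure_eq_measure)
  have I1: "(\<integral>x. U1 x \<partial>M) = b" and I2: "(\<integral>x. U2 x \<partial>M) = e"
    unfolding U1_def U2_def b_def e_def using nB nK by (auto simp: emeasure_eq_measure prob_space)
  have H: "label_entropy M (word g Qs (n * p)) \<le> ln (real N + 1) + real n * b + real (n * p) * e" for n
  proof -
    let ?U = "\<lambda>x. ln (real N + 1) + (\<Sum>i<n. U1 ((g ^^ (i * p)) x)) + (\<Sum>j<n * p. U2 ((g ^^ j) x))"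
    have i1: "integrable M (\<lambda>x. U1 ((g ^^ j) x))" and i2: "integrable M (\<lambda>x. U2 ((g ^^ j) x))" for j
      by (rule integrable_Tn[OF int1], rule integrable_Tn[OF int2])
    have "label_entropy M (word g Qs (n * p)) \<le> (\<integral>x. ?U x \<partial>M)"
      unfolding label_entropy_def
    proof (rule gibbs_entropy[OF finite_partition_fibers[OF fin_label_word[OF Q_label T_meas]] gibbs_block_full_eq])
      fix x y A assume A: "A \<in> fibers (space M) (word g Qs (n * p))" "x \<in> A" "y \<in> space M" "block_full_eq n (n * p) x y"
      then obtain z where z: "z \<in> space M" "A = {y\<in>space M. word g Qs (n * p) y = word g Qs (n * p) z}" by (auto simp: fibers_def)
      then have x: "x \<in> space M" "word g Qs (n * p) x = word g Qs (n * p) z" using A by auto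
      have "word g Qs (n * p) x = word g Qs (n * p) y"
        unfolding word_eq_iff using block_full_eq_refines[OF x(1) A(3,4)] by blast
      then show "y \<in> A" using z x A by simp
    next
      show "integrable M ?U" using i1 i2 by (intro Bochner_Integration.integrable_add Bochner_Integration.integrable_sum) auto
      fix x assume x: "x \<in> space M"
      have "ln 2 + cell_cost i x \<le> U1 ((g ^^ (i * p)) x)" for i
      proof -
        have "ln 2 + ln 4 = ln (8::real)" using ln_mult[of 2 "4::real"] by simp
        then show ?thesis using Tn_space[OF x, of "i * p"] by (auto simp: cell_cost_def U1_def bit_def)
      qed
      moreover have "(if block_target j x = 0 then \<eta> else C2) \<le> U2 ((g ^^ j) x)" for j
        using Tn_space[OF x, of j] \<eta>0 by (auto simp: block_target_def U2_def)
      ultimately show "block_full_cost n (n * p) x \<le> ?U x" unfolding block_full_cost_sum by (intro add_mono sum_mono order_refl)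
    qed
    also have "\<dots> = ln (real N + 1) + (\<Sum>i<n. \<integral>x. U1 ((g ^^ (i * p)) x) \<partial>M) + (\<Sum>j<n * p. \<integral>x. U2 ((g ^^ j) x) \<partial>M)"
      using i1 i2 by (simp add: prob_space Bochner_Integration.integral_sum)
    also have "(\<Sum>i<n. \<integral>x. U1 ((g ^^ (i * p)) x) \<partial>M) = (\<Sum>i<n. b)"
      unfolding I1[symmetric] using int1 by (intro sum.cong integral_Tn) auto
    also have "(\<Sum>j<n * p. \<integral>x. U2 ((g ^^ j) x) \<partial>M) = (\<Sum>j<n * p. e)"
      unfolding I2[symmetric] using int2 by (intro sum.cong integral_Tn) auto
    finally show ?thesis by simp
  qed
  have "metric_entropy_wrt M g (fibers (space M) Qs) \<le> ln (real N + 1) / real n + (b / real p + e)" if n: "n \<ge> 1" for n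
  proof -
    have np: "n * p \<ge> 1" using n p by simp
    have "metric_entropy_wrt M g (fibers (space M) Qs) \<le> label_entropy M (word g Qs (n * p)) / real (n * p)"
      by (rule entropy_wrt_fibers(2)[OF Q_label np])
    also have "\<dots> \<le> (ln (real N + 1) + real n * b + real (n * p) * e) / real (n * p)"
      by (rule divide_right_mono[OF H]) simp
    also have "\<dots> = ln (real N + 1) / real (n * p) + (b / real p + e)"
      using n p by (simp add: field_simps)
    also have "ln (real N + 1) / real (n * p) \<le> ln (real N + 1) / real n"
      using n p by (intro divide_left_mono) auto
    finally show ?thesis by simp
  qed
  then have "metric_entropy_wrt M g (fibers (space M) Qs) \<le> 0 + (b / real p + e)"
    by (intro LIMSEQ_le_const[of "\<lambda>n. ln (real N + 1) / real n + (b / real p + e)"] tendsto_add lim_const_over_n tendsto_const) auto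
  then show ?thesis unfolding b_def e_def by simp
qed

end

section \<open>Negative exponent\<close>

lemma (in mpt) metric_entropy_le_nat:
  assumes "\<And>(Q :: 'a \<Rightarrow> nat) L. fin_label M Q \<Longrightarrow> L > 0 \<Longrightarrow> (\<And>x. x \<in> space M \<Longrightarrow> Q x < L) \<Longrightarrow>
    metric_entropy_wrt M T (fibers (space M) Q) \<le> h"
  shows "metric_entropy M T \<le> ereal h"
proof (rule metric_entropy_le)
  fix a :: "'a \<Rightarrow> 'a set" assume a: "fin_label M a"
  then have "finite (a ` space M)" by (simp add: fin_label_def)
  from ex_bij_betw_finite_nat[OF this] obtain b where b: "bij_betw b (a ` space M) {0..<card (a ` space M)}" by blast
  have l: "fin_label M (\<lambda>x. b (a x))" using fin_label_pair[OF a a, of "\<lambda>u v. b u"] .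
  have lt: "b (a x) < card (a ` space M)" if "x \<in> space M" for x using b that by (auto simp: bij_betw_def)
  have pos: "card (a ` space M) > 0" using not_empty \<open>finite (a ` space M)\<close> by (simp add: card_gt_0_iff)
  have "fibers (space M) a = fibers (space M) (\<lambda>x. b (a x))"
    by (rule fibers_cong) (use b in \<open>auto simp: bij_betw_def inj_on_def\<close>)
  then show "metric_entropy_wrt M T (fibers (space M) a) \<le> h" using assms[OF l pos lt] by simp
qed

lemma separate_compact_sets:
  fixes S T :: "'a::metric_space set"
  assumes S: "compact S" and T: "compact T" and disj: "S \<inter> T = {}"
  shows "\<exists>d>0. \<forall>x\<in>S. \<forall>y\<in>T. d \<le> dist x y"
proof (cases "S \<times> T = {}")
  case True
  then show ?thesis by (intro exI[of _ 1]) auto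
next
  case False
  have cont: "continuous_on (S \<times> T) (\<lambda>z. dist (fst z) (snd z))" by (intro continuous_intros)
  obtain z where z: "z \<in> S \<times> T" "\<And>y. y \<in> S \<times> T \<Longrightarrow> dist (fst z) (snd z) \<le> dist (fst y) (snd y)"
    using continuous_attains_inf[OF compact_Times[OF S T] False cont] by blast
  have "dist (fst z) (snd z) > 0" using z(1) disj by auto
  then show ?thesis using z(2) by (intro exI[of _ "dist (fst z) (snd z)"]) force
qed

text \<open>Inner regularity in a Polish space gives compact subsets of nearly full measure in each
  of the finitely many cells. Disjoint compact sets have a positive distance, and the least of these
  distances is \<open>gap\<close>.\<close>

lemma compact_approx:
  fixes M :: "'a::polish_space measure" and c :: "'a \<Rightarrow> 'b"
  assumes "prob_space M" and sets: "sets M = sets (restrict_space borel X)" and X: "compact X"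
    and c: "fin_label M c" and d: "\<delta> > 0"
  obtains Kc gap where "gap > 0" "{x\<in>space M. x \<in> Kc} \<in> sets M" "measure M {x\<in>space M. x \<notin> Kc} \<le> \<delta>"
    "\<And>x y. x \<in> Kc \<Longrightarrow> y \<in> Kc \<Longrightarrow> dist x y < gap \<Longrightarrow> c x = c y"
proof -
  interpret prob_space M by fact
  have sp: "space M = X" using sets_eq_imp_space_eq[OF sets] by (simp add: space_restrict_space)
  have Xb: "X \<in> sets borel" using X by (simp add: borel_closed compact_imp_closed)
  have id: "(\<lambda>x. x) \<in> measurable M borel"
    unfolding measurable_cong_sets[OF sets refl] by (rule measurable_restrict_space1) simp
  \<comment> \<open>Inner regularity concerns Borel measures on the whole space, so \<open>M\<close>
    is pushed forward along the inclusion of \<open>X\<close>.\<close>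
  define N where "N = distr M borel (\<lambda>x. x)"
  interpret N: prob_space N unfolding N_def by (rule prob_space_distr[OF id])
  have sb: "A \<in> sets borel" if "A \<in> sets M" for A
    using that Xb unfolding sets by (auto simp: sets_restrict_space)
  have sM: "A \<in> sets M" if "A \<in> sets borel" "A \<subseteq> X" for A
    using that unfolding sets by (auto simp: sets_restrict_space intro!: image_eqI[of _ _ A])
  have NM: "measure N A = measure M A" if "A \<in> sets M" for A
  proof -
    have "measure N A = measure M ((\<lambda>x. x) -` A \<inter> space M)" unfolding N_def by (rule measure_distr[OF id sb[OF that]])
    also have "(\<lambda>x. x) -` A \<inter> space M = A" using sets.sets_into_space[OF that] by auto
    finally show ?thesis .
  qed
  let ?V = "c ` space M"
  have fin: "finite ?V" and As: "{x\<in>space M. c x = v} \<in> sets M" for v using c by (auto simp: fin_label_def)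
  define e where "e = \<delta> / (real (card ?V) + 1)"
  have e: "e > 0" "real (card ?V) * e \<le> \<delta>" using d by (auto simp: e_def field_simps)
  have "\<exists>K. K \<subseteq> {x\<in>space M. c x = v} \<and> compact K \<and> measure M ({x\<in>space M. c x = v} - K) \<le> e" for v
  proof -
    let ?A = "{x\<in>space M. c x = v}"
    have "emeasure N ?A = (SUP K\<in>{K. K \<subseteq> ?A \<and> compact K}. emeasure N K)"
    proof (rule inner_regular[OF _ _ sb[OF As]])
      show "sets N = sets borel" by (simp add: N_def)
      show "emeasure N (space N) \<noteq> \<infinity>" using N.emeasure_finite[of "space N"] by simp
    qed
    moreover have "emeasure N ?A - ennreal e < emeasure N ?A \<or> emeasure N ?A = 0"
      using e N.emeasure_finite by (cases "emeasure N ?A = 0") (auto intro!: ennreal_between simp: zero_less_iff_neq_zero less_top[symmetric])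
    ultimately consider "emeasure N ?A = 0" | K where "K \<subseteq> ?A" "compact K" "emeasure N ?A - ennreal e < emeasure N K"
      by (auto simp: less_SUP_iff)
    then show ?thesis
    proof cases
      case 1
      then have "measure M ?A = 0" using NM[OF As, of v] by (simp add: measure_def)
      then show ?thesis using e by (intro exI[of _ "{}"]) auto
    next
      case 2
      have Kb: "K \<in> sets borel" using 2 by (simp add: borel_closed compact_imp_closed)
      then have KM: "K \<in> sets M" using 2(1) sp by (intro sM) auto
      have "measure N ?A < measure N K + e"
      proof (rule ccontr)
        assume "\<not> ?thesis"
        then have "ennreal (measure N K) \<le> ennreal (measure N ?A - e)" by (intro ennreal_leI) simp
        also have "\<dots> = emeasure N ?A - ennreal e" using e by (simp add: N.emeasure_eq_measure ennreal_minus)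
        finally show False using 2(3) by (simp add: N.emeasure_eq_measure)
      qed
      then have "measure M ?A - measure M K \<le> e" using NM[OF As, of v] NM[OF KM] by simp
      then show ?thesis using 2 finite_measure_Diff[OF As KM 2(1)] by (intro exI[of _ K]) simp
    qed
  qed
  then have "\<exists>Kv. \<forall>v. Kv v \<subseteq> {x\<in>space M. c x = v} \<and> compact (Kv v) \<and> measure M ({x\<in>space M. c x = v} - Kv v) \<le> e"
    by (intro choice allI)
  then obtain Kv where Kv': "\<forall>v. Kv v \<subseteq> {x\<in>space M. c x = v} \<and> compact (Kv v) \<and> measure M ({x\<in>space M. c x = v} - Kv v) \<le> e" ..
  have Kv: "Kv v \<subseteq> {x\<in>space M. c x = v}" "compact (Kv v)" "measure M ({x\<in>space M. c x = v} - Kv v) \<le> e" for v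
    using spec[OF Kv', of v] by auto
  define Kc where "Kc = (\<Union>v\<in>?V. Kv v)"
  have KvM: "Kv v \<in> sets M" for v using Kv(1)[of v] Kv(2)[of v] sp by (intro sM borel_closed compact_imp_closed) auto
  have KcM: "Kc \<in> sets M" unfolding Kc_def by (rule sets.finite_UN[OF fin]) (rule KvM)
  have Kc_eq: "{x\<in>space M. x \<in> Kc} = Kc" using sets.sets_into_space[OF KcM] by auto
  have dM: "{x\<in>space M. c x = v} - Kv v \<in> sets M" for v by (rule sets.Diff[OF As KvM])
  have "measure M {x\<in>space M. x \<notin> Kc} \<le> measure M (\<Union>v\<in>?V. {x\<in>space M. c x = v} - Kv v)"
    by (rule finite_measure_mono[OF _ sets.finite_UN[OF fin dM]]) (auto simp: Kc_def)
  also have "\<dots> \<le> (\<Sum>v\<in>?V. measure M ({x\<in>space M. c x = v} - Kv v))"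
    by (rule finite_measure_subadditive_finite[OF fin]) (rule image_subsetI, rule dM)
  also have "\<dots> \<le> (\<Sum>v\<in>?V. e)" by (rule sum_mono) (rule Kv(3))
  finally have small: "measure M {x\<in>space M. x \<notin> Kc} \<le> \<delta>" using e(2) by simp
  have "\<exists>d>0. \<forall>u\<in>?V. \<forall>v\<in>?V. u \<noteq> v \<longrightarrow> (\<forall>x\<in>Kv u. \<forall>y\<in>Kv v. d \<le> dist x y)"
  proof -
    have "\<exists>d>0. u \<noteq> v \<longrightarrow> (\<forall>x\<in>Kv u. \<forall>y\<in>Kv v. d \<le> dist x y)" for u v
    proof (cases "u = v")
      case False
      have "Kv u \<inter> Kv v = {}" using Kv(1)[of u] Kv(1)[of v] False by auto
      then show ?thesis using separate_compact_sets[OF Kv(2)[of u] Kv(2)[of v]] by auto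
    qed (auto intro: exI[of _ 1])
    then have "\<forall>u. \<exists>d. \<forall>v. d v > 0 \<and> (u \<noteq> v \<longrightarrow> (\<forall>x\<in>Kv u. \<forall>y\<in>Kv v. d v \<le> dist x y))"
      by (intro allI choice) blast
    from choice[OF this] obtain d where d': "\<forall>u v. d u v > 0 \<and> (u \<noteq> v \<longrightarrow> (\<forall>x\<in>Kv u. \<forall>y\<in>Kv v. d u v \<le> dist x y))" ..
    have d: "d u v > 0" "u \<noteq> v \<Longrightarrow> x \<in> Kv u \<Longrightarrow> y \<in> Kv v \<Longrightarrow> d u v \<le> dist x y" for u v x y
      using spec[OF spec[OF d', of u], of v] by auto
    let ?d = "Min ((\<lambda>(u, v). d u v) ` (?V \<times> ?V))"
    have ne: "?V \<times> ?V \<noteq> {}" using not_empty by auto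
    have "?d > 0" using fin ne d(1) by (subst Min_gr_iff) auto
    moreover have "?d \<le> d u v" if "u \<in> ?V" "v \<in> ?V" for u v
      by (rule Min_le) (use fin that in auto)
    ultimately show ?thesis using d(2) by (intro exI[of _ ?d]) (meson order_trans)
  qed
  then obtain gap where gap: "gap > 0" "\<And>u v x y. u \<in> ?V \<Longrightarrow> v \<in> ?V \<Longrightarrow> u \<noteq> v \<Longrightarrow> x \<in> Kv u \<Longrightarrow> y \<in> Kv v \<Longrightarrow> gap \<le> dist x y"
    by blast
  have same: "c x = c y" if xy: "x \<in> Kc" "y \<in> Kc" "dist x y < gap" for x y
  proof (rule ccontr)
    assume ne: "c x \<noteq> c y"
    from xy obtain u v where uv: "u \<in> ?V" "v \<in> ?V" "x \<in> Kv u" "y \<in> Kv v" unfolding Kc_def by blast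
    have "c x = u" "c y = v" using Kv(1)[of u] Kv(1)[of v] uv by auto
    then show False using gap(2)[OF uv(1,2) _ uv(3,4)] ne xy(3) by auto
  qed
  show ?thesis by (rule that[OF gap(1) _ small same]) (use KcM Kc_eq in auto)
qed

text \<open>A frequent symbol can be coded at an arbitrarily small cost \<eta>, at the expense of a
  large but finite cost \<open>C\<close> for the \<open>L\<close> others.\<close>

lemma exists_weight:
  fixes \<eta> :: real and L :: nat
  assumes "\<eta> > 0" obtains C where "C \<ge> 0" "exp (- \<eta>) + real L * exp (- C) \<le> 1"
proof -
  have p: "1 - exp (- \<eta>) > 0" using assms by simp
  define C where "C = max 0 (- ln ((1 - exp (- \<eta>)) / (real L + 1)))"
  have "exp (- C) \<le> exp (ln ((1 - exp (- \<eta>)) / (real L + 1)))" by (subst exp_le_cancel_iff) (simp add: C_def)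
  also have "\<dots> = (1 - exp (- \<eta>)) / (real L + 1)" using p by simp
  finally have "real L * exp (- C) \<le> real L * ((1 - exp (- \<eta>)) / (real L + 1))" by (rule mult_left_mono) simp
  also have "\<dots> \<le> 1 - exp (- \<eta>)" using p by (simp add: field_simps)
  finally show ?thesis using that[of C] by (simp add: C_def)
qed

text \<open>\<beta> stands for r - 1, \<open>Nr\<close> for the integer part of r, and
  \<open>Rf\<close> for the growth rate of \<open>f\<close>. The hypothesis \<open>many\<close> has
  the same constants for all \<open>k\<close> and carries what is used of the bound on the norms.
  \<open>growth\<close> concerns \<open>f\<close> alone; it passes to \<open>g k\<close> by
  convergence of the derivatives, since the number \<open>p\<close> is fixed.\<close>

locale weak_seq_lift = weak_seq X \<mu> \<nu> f g
  for X :: "'a::polish_space set" and \<mu> \<nu> f g +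
  fixes D :: "real set" and pr :: "real \<Rightarrow> 'a" and \<tau> :: "'a \<Rightarrow> real"
    and G :: "nat \<Rightarrow> real \<Rightarrow> real" and dg :: "nat \<Rightarrow> 'a \<Rightarrow> real" and df :: "'a \<Rightarrow> real"
    and \<beta> Cr Rf :: real and Nr :: nat
  assumes lifted: "\<And>k. lifted (\<nu> k) (g k) D pr \<tau> (G k) (dg k)"
    and ergodic: "ergodic_mpt \<mu> f"
    and df_cont: "continuous_on X df" and dg_cont: "\<And>k. continuous_on X (dg k)"
    and dgf: "uniform_limit X dg df sequentially"
    and \<beta>: "\<beta> > 0" and Cr: "Cr \<ge> 1" and Nr: "Nr \<ge> 1" and Rf: "Rf \<ge> 0"
    and many: "\<And>k t1 t2 Z c. t1 \<in> D \<Longrightarrow> t2 \<in> D \<Longrightarrow> t1 < t2 \<Longrightarrow> finite Z \<Longrightarrow> Z \<subseteq> {t1..t2} \<Longrightarrow> card Z = Nr \<Longrightarrow>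
        (\<And>z. z \<in> Z \<Longrightarrow> dg k (pr z) = c) \<Longrightarrow> \<bar>dg k (pr t2) - c\<bar> \<le> Cr * (t2 - t1) powr \<beta>"
    and growth: "\<And>\<eta>. \<eta> > 0 \<Longrightarrow> \<exists>p>0. \<forall>x\<in>X. \<bar>\<Prod>i<p. df ((f ^^ i) x)\<bar> \<le> exp (real p * (Rf + \<eta>))"
begin

lemma common_bound:
  obtains \<Lambda> k0 where "\<Lambda> \<ge> 1" "\<And>x. x \<in> X \<Longrightarrow> \<bar>df x\<bar> \<le> \<Lambda>" "\<And>k x. k \<ge> k0 \<Longrightarrow> x \<in> X \<Longrightarrow> \<bar>dg k x\<bar> \<le> \<Lambda>"
proof -
  obtain B where B: "B \<ge> 0" "\<And>x. x \<in> X \<Longrightarrow> \<bar>df x\<bar> \<le> B" using cont_bounded[OF df_cont] by blast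
  have "\<forall>\<^sub>F k in sequentially. \<forall>x\<in>X. dist (dg k x) (df x) < 1" using uniform_limitD[OF dgf, of 1] by simp
  then obtain k0 where k0: "\<And>k x. k \<ge> k0 \<Longrightarrow> x \<in> X \<Longrightarrow> \<bar>dg k x - df x\<bar> < 1"
    unfolding eventually_sequentially dist_real_def by blast
  show ?thesis
  proof (rule that[of "B + 1" k0])
    show "\<bar>dg k x\<bar> \<le> B + 1" if "k \<ge> k0" "x \<in> X" for k x using k0[OF that] B(2)[OF that(2)] by linarith
    show "\<bar>df x\<bar> \<le> B + 1" if "x \<in> X" for x using B(2)[OF that] by linarith
  qed (use B in auto)
qed

lemma G_lip:
  assumes "\<And>x. x \<in> X \<Longrightarrow> \<bar>dg k x\<bar> \<le> \<Lambda>" "s \<in> D" "t \<in> D"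
  shows "\<bar>G k s - G k t\<bar> \<le> \<Lambda> * \<bar>s - t\<bar>"
proof -
  interpret l: lifted "\<nu> k" "g k" D pr \<tau> "G k" "dg k" by (rule lifted)
  show ?thesis
  proof (rule l.G_contract[OF assms(2,3)])
    fix r assume "r \<in> closed_segment s t"
    then show "\<bar>dg k (pr r)\<bar> \<le> \<Lambda>" using l.seg_D[OF assms(2,3)] l.pr_in[of r] by (intro assms(1)) auto
  qed
qed

text \<open>The logarithm of the absolute value, truncated from below. It is continuous, so its
  integrals pass to the limit, which those of the logarithm of the derivative need not do.\<close>

definition phi :: "nat \<Rightarrow> real \<Rightarrow> real" where "phi m y = ln (max \<bar>y\<bar> (exp (- real m)))"

lemma phi_cont: "continuous_on A (phi m)"
proof -
  have "max \<bar>y\<bar> (exp (- real m)) \<noteq> 0" for y :: real using exp_gt_zero[of "- real m"] by linarith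
  then show ?thesis unfolding phi_def by (intro continuous_intros) auto
qed

lemma phi_upper: "\<Lambda> \<ge> 1 \<Longrightarrow> \<bar>y\<bar> \<le> \<Lambda> \<Longrightarrow> phi m y \<le> ln \<Lambda>"
proof -
  assume a: "\<Lambda> \<ge> 1" "\<bar>y\<bar> \<le> \<Lambda>"
  have "exp (- real m) \<le> 1" by simp
  then have "exp (- real m) \<le> \<Lambda>" using a(1) by linarith
  then show ?thesis unfolding phi_def using a by (subst ln_le_cancel_iff) (auto simp: less_max_iff_disj)
qed

lemma abs_le_exp_phi: "\<bar>y\<bar> \<le> exp (phi m y)"
proof -
  have "max \<bar>y\<bar> (exp (- real m)) > 0" by (simp add: less_max_iff_disj)
  then show ?thesis unfolding phi_def by simp
qed

lemma compose_real_uniform: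
  fixes \<Theta> :: "real \<Rightarrow> real"
  assumes "continuous_on UNIV \<Theta>" "uniform_limit X d d' sequentially" "continuous_on X d'"
  shows "uniform_limit X (\<lambda>k x. \<Theta> (d k x)) (\<lambda>x. \<Theta> (d' x)) sequentially"
    "continuous_on X (\<lambda>x. \<Theta> (d' x))"
proof -
  obtain B where B: "\<And>x. x \<in> X \<Longrightarrow> \<bar>d' x\<bar> \<le> B" using cont_bounded[OF assms(3)] by blast
  have c: "uniformly_continuous_on (cball 0 (B + 1)) \<Theta>"
    by (intro compact_uniformly_continuous continuous_on_subset[OF assms(1)]) auto
  show "uniform_limit X (\<lambda>k x. \<Theta> (d k x)) (\<lambda>x. \<Theta> (d' x)) sequentially"
  proof (rule uniform_limitI)
    fix e :: real assume "e > 0"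
    then obtain \<delta> where \<delta>: "\<delta> > 0" "\<And>x y. x \<in> cball 0 (B + 1) \<Longrightarrow> y \<in> cball 0 (B + 1) \<Longrightarrow> dist y x < \<delta> \<Longrightarrow> dist (\<Theta> y) (\<Theta> x) < e"
      using c unfolding uniformly_continuous_on_def by blast
    have "\<forall>\<^sub>F k in sequentially. \<forall>x\<in>X. dist (d k x) (d' x) < min 1 \<delta>"
      using uniform_limitD[OF assms(2), of "min 1 \<delta>"] \<delta>(1) by simp
    then show "\<forall>\<^sub>F k in sequentially. \<forall>x\<in>X. dist (\<Theta> (d k x)) (\<Theta> (d' x)) < e"
    proof (eventually_elim, safe)
      fix k x assume A: "\<forall>x\<in>X. dist (d k x) (d' x) < min 1 \<delta>" and x: "x \<in> X"
      have "\<bar>d k x - d' x\<bar> < 1" "dist (d k x) (d' x) < \<delta>" using A x by (auto simp: dist_real_def)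
      moreover have "\<bar>d' x\<bar> \<le> B" using B x by blast
      ultimately show "dist (\<Theta> (d k x)) (\<Theta> (d' x)) < e" by (intro \<delta>(2)) auto
    qed
  qed
  show "continuous_on X (\<lambda>x. \<Theta> (d' x))" by (rule continuous_on_compose2[OF assms(1,3)]) simp
qed

lemma birk_uniform:
  fixes h :: "nat \<Rightarrow> 'a \<Rightarrow> real"
  assumes "uniform_limit X h h' sequentially" "continuous_on X h'"
  shows "uniform_limit X (\<lambda>k x. \<Sum>i<n. h k ((g k ^^ i) x)) (\<lambda>x. \<Sum>i<n. h' ((f ^^ i) x)) sequentially"
    "continuous_on X (\<lambda>x. \<Sum>i<n. h' ((f ^^ i) x))"
proof -
  show "uniform_limit X (\<lambda>k x. \<Sum>i<n. h k ((g k ^^ i) x)) (\<lambda>x. \<Sum>i<n. h' ((f ^^ i) x)) sequentially"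
  proof (induction n)
    case 0 show ?case by (simp add: uniform_limit_iff)
  next
    case (Suc n)
    from uniform_limit_add[OF Suc compose_uniform[OF assms, of n]] show ?case by simp
  qed
  show "continuous_on X (\<lambda>x. \<Sum>i<n. h' ((f ^^ i) x))"
    by (intro continuous_on_sum compose_cont assms)
qed

lemma prod_cont_g: "continuous_on X (\<lambda>x. \<Prod>i<n. dg k ((g k ^^ i) x))" if "continuous_on X (g k)"
proof -
  have it: "continuous_on X (g k ^^ i)" for i
  proof (induction i)
    case (Suc i)
    have "continuous_on X (g k \<circ> (g k ^^ i))"
      by (rule continuous_on_compose[OF Suc continuous_on_subset[OF that]]) (use X_maps in auto)
    then show ?case by simp
  qed (simp add: id_def)
  show ?thesis by (intro continuous_on_prod continuous_on_compose2[OF dg_cont it]) (use X_maps in auto)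
qed

text \<open>For \<mu>, the Birkhoff sums of the truncated logarithm over a long block are negative
  with probability close to 1. The block length \<open>p\<close> is fixed at this point, so the same
  holds for nearby maps and measures up to a continuous cutoff. A block with a negative sum does not
  expand, and the block code applies.\<close>

lemma negative_exponent_case:
  assumes neg: "(\<integral>x. phi m (df x) \<partial>\<mu>) < 0" and \<eta>: "\<eta> > 0" and gc: "\<And>k. continuous_on X (g k)"
  shows "\<exists>k0. \<forall>k\<ge>k0. metric_entropy (\<nu> k) (g k) \<le> ereal (5 * \<eta>)"
proof -
  interpret e: ergodic_mpt \<mu> f by (rule ergodic)
  obtain \<Lambda> k1 where \<Lambda>: "\<Lambda> \<ge> 1" "\<And>x. x \<in> X \<Longrightarrow> \<bar>df x\<bar> \<le> \<Lambda>" "\<And>k x. k \<ge> k1 \<Longrightarrow> x \<in> X \<Longrightarrow> \<bar>dg k x\<bar> \<le> \<Lambda>"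
    using common_bound by blast
  \<comment> \<open>Half of the negative mean is kept in reserve. Over a block it becomes the margin
    \<zeta> that permits a continuous cutoff in place of an indicator function.\<close>
  define c where "c = - (\<integral>x. phi m (df x) \<partial>\<mu>) / 2"
  have c: "c > 0" using neg by (simp add: c_def)
  define \<phi> where "\<phi> x = phi m (df x) + c" for x
  have cont\<phi>: "continuous_on X (\<lambda>x. phi m (df x))" by (rule continuous_on_compose2[OF phi_cont[of UNIV] df_cont]) simp
  have cont\<phi>': "continuous_on X \<phi>" unfolding \<phi>_def by (intro continuous_intros cont\<phi>)
  obtain B where B: "\<And>x. x \<in> X \<Longrightarrow> \<bar>\<phi> x\<bar> \<le> B" using cont_bounded[OF cont\<phi>'] by blast
  have lim: "(\<lambda>n. measure \<mu> {x\<in>space \<mu>. e.birk \<phi> n x \<ge> 0}) \<longlonglongrightarrow> 0"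
  proof (rule e.birk_eventually_negative[where B = B])
    have "(\<integral>x. \<phi> x \<partial>\<mu>) = (\<integral>x. phi m (df x) \<partial>\<mu>) + c"
      unfolding \<phi>_def using cont_integrable(1)[OF cont\<phi>] by (simp add: e.prob_space[simplified])
    then show "(\<integral>x. \<phi> x \<partial>\<mu>) < 0" using neg by (simp add: c_def)
  qed (use B cont_meas(1)[OF cont\<phi>'] in auto)
  define c1 where "c1 = ln 3 + ln \<Lambda>"
  have c1: "c1 > 0" unfolding c1_def using \<Lambda>(1) by (intro add_pos_nonneg) auto
  obtain n1 where n1: "\<And>n. n \<ge> n1 \<Longrightarrow> measure \<mu> {x\<in>space \<mu>. e.birk \<phi> n x \<ge> 0} < \<eta> / c1"
    using LIMSEQ_D[OF lim, of "\<eta> / c1"] \<eta> c1 by (auto simp: abs_of_nonneg measure_nonneg)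
  obtain n2 :: nat where n2: "ln 8 / \<eta> < real n2" using reals_Archimedean2 by blast
  define p where "p = max 1 (max n1 n2)"
  have p: "p > 0" "p \<ge> n1" "ln 8 / real p \<le> \<eta>"
  proof -
    show "p > 0" "p \<ge> n1" by (auto simp: p_def)
    have "ln 8 / \<eta> \<le> real p" using n2 by (simp add: p_def)
    then show "ln 8 / real p \<le> \<eta>" using \<eta> \<open>p > 0\<close> by (simp add: field_simps)
  qed
  define \<zeta> where "\<zeta> = real p * c"
  have \<zeta>: "\<zeta> > 0" using p c by (simp add: \<zeta>_def)
  \<comment> \<open>\<Theta> is 1 where the block sum is nonnegative and vanishes below -\<zeta>. So
    it dominates the indicator function of the bad blocks of \<open>g k\<close>, and is dominated by
    the one for \<open>f\<close> with the margin.\<close>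
  define \<Theta> where "\<Theta> y = min 1 (max 0 (1 + y / \<zeta>))" for y
  have \<Theta>c: "continuous_on UNIV \<Theta>" unfolding \<Theta>_def using \<zeta> by (intro continuous_intros) auto
  define S where "S k x = (\<Sum>i<p. phi m (dg k ((g k ^^ i) x)))" for k x
  define S' where "S' x = (\<Sum>i<p. phi m (df ((f ^^ i) x)))" for x
  have Su: "uniform_limit X S S' sequentially" "continuous_on X S'"
    unfolding S_def[abs_def] S'_def[abs_def]
    by (rule birk_uniform[OF compose_real_uniform[OF phi_cont dgf df_cont]])+
  have Sc: "continuous_on X (S k)" for k
  proof -
    have it: "continuous_on X (g k ^^ i)" for i
    proof (induction i)
      case (Suc i)
      have "continuous_on X (g k \<circ> (g k ^^ i))"
        by (rule continuous_on_compose[OF Suc continuous_on_subset[OF gc]]) (use X_maps in auto)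
      then show ?case by simp
    qed (simp add: id_def)
    show ?thesis unfolding S_def
      by (intro continuous_on_sum continuous_on_compose2[OF phi_cont[of UNIV] continuous_on_compose2[OF dg_cont it]]) (use X_maps in auto)
  qed
  have Sm: "S k \<in> borel_measurable (\<nu> k)" for k by (rule cont_meas(2)[OF Sc])
  have lim2: "(\<lambda>k. \<integral>x. \<Theta> (S k x) \<partial>\<nu> k) \<longlonglongrightarrow> (\<integral>x. \<Theta> (S' x) \<partial>\<mu>)"
    by (rule integral_uniform_limit[OF compose_real_uniform[OF \<Theta>c Su]])
      (rule cont_meas(2)[OF continuous_on_compose2[OF \<Theta>c Sc]], simp)
  have "(\<integral>x. \<Theta> (S' x) \<partial>\<mu>) \<le> measure \<mu> {x\<in>space \<mu>. e.birk \<phi> p x \<ge> 0}"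
  proof -
    have bm: "e.birk \<phi> p \<in> borel_measurable \<mu>" by (rule e.birk_measurable[OF cont_meas(1)[OF cont\<phi>']])
    have s: "{x\<in>space \<mu>. e.birk \<phi> p x \<ge> 0} \<in> sets \<mu>" using bm by measurable
    have "(\<integral>x. \<Theta> (S' x) \<partial>\<mu>) \<le> (\<integral>x. indicator {x\<in>space \<mu>. e.birk \<phi> p x \<ge> 0} x \<partial>\<mu>)"
    proof (rule integral_mono)
      show "integrable \<mu> (\<lambda>x. \<Theta> (S' x))" by (rule cont_integrable(1)[OF continuous_on_compose2[OF \<Theta>c Su(2)]]) simp
      show "integrable \<mu> (indicator {x\<in>space \<mu>. e.birk \<phi> p x \<ge> 0} :: 'a \<Rightarrow> real)" using s by (simp add: e.emeasure_eq_measure)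
      fix x assume x: "x \<in> space \<mu>"
      have "e.birk \<phi> p x = S' x + \<zeta>" unfolding e.birk_def S'_def \<phi>_def \<zeta>_def by (simp add: sum.distrib)
      then have "\<Theta> (S' x) = 0" if "\<not> e.birk \<phi> p x \<ge> 0"
        using that \<zeta> by (simp add: \<Theta>_def field_simps)
      then show "\<Theta> (S' x) \<le> indicator {x\<in>space \<mu>. e.birk \<phi> p x \<ge> 0} x"
        using x by (auto simp: indicator_def \<Theta>_def)
    qed
    also have "\<dots> = measure \<mu> {x\<in>space \<mu>. e.birk \<phi> p x \<ge> 0}"
      using s sets.sets_into_space[OF s] by (simp add: Int_absorb2)
    finally show ?thesis .
  qed
  then have lt: "(\<integral>x. \<Theta> (S' x) \<partial>\<mu>) < \<eta> / c1" using n1[OF p(2)] by linarith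
  from order_tendstoD(2)[OF lim2 lt] obtain k2 where k2: "\<And>k. k \<ge> k2 \<Longrightarrow> (\<integral>x. \<Theta> (S k x) \<partial>\<nu> k) < \<eta> / c1"
    unfolding eventually_sequentially by blast
  have "metric_entropy (\<nu> k) (g k) \<le> ereal (5 * \<eta>)" if k: "k \<ge> max k1 k2" for k
  proof -
    interpret l: lifted "\<nu> k" "g k" D pr \<tau> "G k" "dg k" by (rule lifted)
    \<comment> \<open>On \<open>Bk\<close> the derivative of the \<open>p\<close>-th iterate is at
      most 1 in absolute value. Uniform continuity makes it at most 2 on a cell of a sufficiently
      fine grid; the mesh may depend on \<open>k\<close>.\<close>
    define Bk where "Bk = {x. S k x \<le> 0}"
    have Bs: "{x\<in>space (\<nu> k). x \<in> Bk} \<in> sets (\<nu> k)" unfolding Bk_def using Sm[of k] by measurable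
    have Bs': "{x\<in>space (\<nu> k). x \<notin> Bk} \<in> sets (\<nu> k)" unfolding Bk_def using Sm[of k] by measurable
    have "measure (\<nu> k) {x\<in>space (\<nu> k). x \<notin> Bk} = (\<integral>x. indicator {x\<in>space (\<nu> k). x \<notin> Bk} x \<partial>\<nu> k)"
      using Bs' sets.sets_into_space[OF Bs'] by (simp add: Int_absorb2)
    also have "\<dots> \<le> (\<integral>x. \<Theta> (S k x) \<partial>\<nu> k)"
    proof (rule integral_mono)
      show "integrable (\<nu> k) (\<lambda>x. \<Theta> (S k x))" by (rule cont_integrable(2)[OF continuous_on_compose2[OF \<Theta>c Sc]]) simp
      show "integrable (\<nu> k) (indicator {x\<in>space (\<nu> k). x \<notin> Bk} :: 'a \<Rightarrow> real)" using Bs' by (simp add: l.emeasure_eq_measure)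
      fix x show "indicator {x\<in>space (\<nu> k). x \<notin> Bk} x \<le> \<Theta> (S k x)"
        using \<zeta> by (auto simp: indicator_def Bk_def \<Theta>_def)
    qed
    also have "\<dots> < \<eta> / c1" using k2 k by simp
    finally have Bsmall: "measure (\<nu> k) {x\<in>space (\<nu> k). x \<notin> Bk} < \<eta> / c1" .
    show ?thesis
    proof (rule l.metric_entropy_le_nat)
      fix Q :: "'a \<Rightarrow> nat" and LQ assume Q: "fin_label (\<nu> k) Q" "LQ > 0" "\<And>x. x \<in> space (\<nu> k) \<Longrightarrow> Q x < LQ"
      obtain C2 where C2: "C2 \<ge> 0" "exp (- \<eta>) + real LQ * exp (- C2) \<le> 1" using exists_weight[OF \<eta>] by blast
      have "\<eta> / (C2 + 1) > 0" using \<eta> C2(1) by simp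
      then obtain Kc gap where K: "gap > 0" "{x\<in>space (\<nu> k). x \<in> Kc} \<in> sets (\<nu> k)"
        "measure (\<nu> k) {x\<in>space (\<nu> k). x \<notin> Kc} \<le> \<eta> / (C2 + 1)" "\<And>x y. x \<in> Kc \<Longrightarrow> y \<in> Kc \<Longrightarrow> dist x y < gap \<Longrightarrow> Q x = Q y"
        by (rule compact_approx[OF l.prob_space_axioms \<nu>(2) X Q(1)]) (rule that)
      have "uniformly_continuous_on X (\<lambda>x. \<Prod>i<p. dg k ((g k ^^ i) x))"
        by (rule compact_uniformly_continuous[OF prod_cont_g[OF gc] X])
      then obtain d where d: "d > 0" "\<And>x y. x \<in> X \<Longrightarrow> y \<in> X \<Longrightarrow> dist y x < d \<Longrightarrow>
          \<bar>(\<Prod>i<p. dg k ((g k ^^ i) y)) - (\<Prod>i<p. dg k ((g k ^^ i) x))\<bar> < 1"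
        unfolding uniformly_continuous_on_def dist_real_def using zero_less_one by blast
      obtain N :: nat where N: "max (7 * \<Lambda> ^ p / gap) (7 / d) < real N" using reals_Archimedean2 by blast
      have "0 < 7 / d" using d(1) by simp
      then have N0: "N > 0" using N by (intro gr0I) simp
      have "7 * \<Lambda> ^ p / gap < real N" "7 / d < real N" using N by auto
      then have N1: "7 * \<Lambda> ^ p / real N < gap" "7 / real N < d"
        using N0 K(1) d(1) by (simp_all add: divide_less_eq mult.commute)
      have bc: "block_coding (\<nu> k) (g k) D pr \<tau> (G k) (dg k) p N \<Lambda> gap \<eta> C2 Bk Kc Q LQ"
      proof (unfold_locales)
        show "p > 0" "N > 0" "\<Lambda> \<ge> 1" "\<eta> \<ge> 0" "C2 \<ge> 0" using p N0 \<Lambda> \<eta> C2 by auto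
        show "\<bar>G k s - G k t\<bar> \<le> \<Lambda> * \<bar>s - t\<bar>" if "s \<in> D" "t \<in> D" for s t
          by (rule G_lip[OF \<Lambda>(3) that]) (use k in auto)
        show "\<bar>(G k ^^ p) s - (G k ^^ p) t\<bar> \<le> 2 * \<bar>s - t\<bar>"
          if st: "s \<in> D" "t \<in> D" "\<bar>s - t\<bar> \<le> 1 / real N" "pr s \<in> Bk" for s t
        proof (rule l.Gn_segment_lip[OF st(1,2)])
          fix u assume u: "u \<in> closed_segment s t"
          have uD: "u \<in> D" using l.seg_D[OF st(1,2)] u by auto
          have X2: "pr u \<in> X" "pr s \<in> X" using l.pr_in[OF uD] l.pr_in[OF st(1)] by auto
          have "dist (pr u) (pr s) \<le> 7 * \<bar>u - s\<bar>" by (rule l.lip[OF uD st(1)])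
          also have "\<dots> \<le> 7 * (1 / real N)" using segment_bound(1)[OF u] st(3) by (simp add: abs_minus_commute)
          also have "\<dots> < d" using N1 by simp
          finally have close: "\<bar>(\<Prod>i<p. dg k ((g k ^^ i) (pr u))) - (\<Prod>i<p. dg k ((g k ^^ i) (pr s)))\<bar> < 1"
            using d(2)[OF X2(2,1)] by simp
          have "\<bar>\<Prod>i<p. dg k ((g k ^^ i) (pr s))\<bar> \<le> (\<Prod>i<p. exp (phi m (dg k ((g k ^^ i) (pr s)))))"
            unfolding abs_prod by (intro prod_mono conjI abs_ge_zero abs_le_exp_phi)
          also have "\<dots> = exp (S k (pr s))" unfolding S_def by (simp add: exp_sum)
          also have "\<dots> \<le> 1" using st(4) by (simp add: Bk_def)
          finally show "\<bar>\<Prod>i<p. dg k ((g k ^^ i) (pr u))\<bar> \<le> 2" using close by linarith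
        qed
        show "7 * \<Lambda> ^ p / real N < gap" by (rule N1)
        show "fin_label (\<nu> k) Q" by (rule Q)
        show "Q x < LQ" if "x \<in> space (\<nu> k)" for x by (rule Q(3)[OF that])
        show "Q x = Q y" if "x \<in> Kc" "y \<in> Kc" "dist x y < gap" for x y by (rule K(4)[OF that])
        show "exp (- \<eta>) + real LQ * exp (- C2) \<le> 1" by (rule C2)
        show "{x\<in>space (\<nu> k). x \<in> Kc} \<in> sets (\<nu> k)" by (rule K)
        show "{x\<in>space (\<nu> k). x \<in> Bk} \<in> sets (\<nu> k)" by (rule Bs)
      qed
      have \<Lambda>p: "ln (3 * \<Lambda> ^ p) = ln 3 + real p * ln \<Lambda>" using \<Lambda>(1) by (simp add: ln_mult ln_realpow)
      have "ln (3 * \<Lambda> ^ p) \<le> real p * c1"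
      proof -
        have "ln 3 * 1 \<le> ln 3 * real p" using p by (intro mult_left_mono) auto
        then show ?thesis unfolding \<Lambda>p c1_def by (simp add: algebra_simps)
      qed
      moreover have "0 \<le> ln (3 * \<Lambda> ^ p)" unfolding \<Lambda>p using \<Lambda>(1) by simp
      ultimately have "ln (3 * \<Lambda> ^ p) * measure (\<nu> k) {x\<in>space (\<nu> k). x \<notin> Bk} \<le> (real p * c1) * (\<eta> / c1)"
        using Bsmall by (intro mult_mono) auto
      also have "\<dots> = real p * \<eta>" using c1 by simp
      finally have "(ln 8 + ln (3 * \<Lambda> ^ p) * measure (\<nu> k) {x\<in>space (\<nu> k). x \<notin> Bk}) / real p \<le> (ln 8 + real p * \<eta>) / real p"
        by (intro divide_right_mono) auto
      also have "\<dots> = ln 8 / real p + \<eta>" using p by (simp add: field_simps)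
      also have "\<dots> \<le> 2 * \<eta>" using p by simp
      finally have 1: "(ln 8 + ln (3 * \<Lambda> ^ p) * measure (\<nu> k) {x\<in>space (\<nu> k). x \<notin> Bk}) / real p \<le> 2 * \<eta>" .
      have "C2 * measure (\<nu> k) {x\<in>space (\<nu> k). x \<notin> Kc} \<le> C2 * (\<eta> / (C2 + 1))" by (rule mult_left_mono[OF K(3) C2(1)])
      also have "\<dots> \<le> \<eta>" using C2(1) \<eta> by (simp add: field_simps)
      finally show "metric_entropy_wrt (\<nu> k) (g k) (fibers (space (\<nu> k)) Q) \<le> 5 * \<eta>"
        using block_coding.block_entropy_bound[OF bc] 1 \<eta> by linarith
    qed
  qed
  then show ?thesis by blast
qed

end

section \<open>Nonnegative exponent\<close>

lemma eventually_linear_ge: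
  fixes a c :: real assumes "a > 0" shows "\<forall>\<^sub>F n in sequentially. c \<le> a * real n"
proof -
  obtain N :: nat where N: "c / a < real N" using reals_Archimedean2 by blast
  show ?thesis
  proof (rule eventually_sequentiallyI[of N])
    fix n assume "N \<le> n"
    then have "c / a \<le> real n" using N by linarith
    then show "c \<le> a * real n" using assms by (simp add: field_simps)
  qed
qed

lemma word_sub:
  assumes "i + m \<le> n" shows "take m (drop i (word T a n x)) = word T a m ((T ^^ i) x)"
proof -
  obtain r where "n = i + (m + r)" using assms by (metis add.assoc le_Suc_ex)
  then show ?thesis by (simp add: word_add)
qed

text \<open>This chooses the length of the runs: a run costs the logarithm of its length up to a
  constant, which is negligible per step.\<close>

lemma exists_log_ratio:
  fixes a \<eta> :: real assumes "a \<ge> 0" "\<eta> > 0"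
  shows "\<exists>n::nat. n > 0 \<and> 2 * ln (1 + a * real n) / real n \<le> \<eta>"
proof -
  have "(\<lambda>n. 2 * (ln (1 + a) / real n + ln (real n) / real n)) \<longlonglongrightarrow> 2 * (0 + 0)"
    by (intro tendsto_mult tendsto_const tendsto_add lim_const_over_n lim_ln_over_n)
  then have "(\<lambda>n. 2 * (ln (1 + a) / real n + ln (real n) / real n)) \<longlonglongrightarrow> 0" by simp
  from order_tendstoD(2)[OF this assms(2)] obtain N where N: "\<And>n. n \<ge> N \<Longrightarrow> 2 * (ln (1 + a) / real n + ln (real n) / real n) < \<eta>"
    unfolding eventually_sequentially by blast
  define n where "n = max 1 N"
  have n: "n > 0" "real n \<ge> 1" by (auto simp: n_def)
  have "1 + a * real n \<le> (1 + a) * real n" using n assms by (simp add: algebra_simps)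
  then have "ln (1 + a * real n) \<le> ln ((1 + a) * real n)" using n assms by (subst ln_le_cancel_iff) (auto intro: add_pos_nonneg)
  also have "\<dots> = ln (1 + a) + ln (real n)" using n assms by (simp add: ln_mult)
  finally have "2 * ln (1 + a * real n) / real n \<le> 2 * (ln (1 + a) + ln (real n)) / real n"
    by (intro divide_right_mono) auto
  also have "\<dots> = 2 * (ln (1 + a) / real n + ln (real n) / real n)" by (simp add: add_divide_distrib)
  also have "\<dots> < \<eta>" by (rule N) (simp add: n_def)
  finally show ?thesis using n(1) by (intro exI[of _ n]) simp
qed

lemma geometric_tail:
  fixes a :: real assumes "a > 0"
  shows "(\<Sum>k\<in>{m..n}. exp (- a * real k)) \<le> exp (- a * real m) / (1 - exp (- a))"
proof -
  have x: "exp (- a) < 1" using assms by simp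
  have e: "exp (- a * real k) = exp (- a) ^ k" for k by (simp add: exp_of_nat_mult[symmetric] mult.commute)
  show ?thesis
  proof (cases "m \<le> n")
    case True
    have "(1 - exp (- a)) * (\<Sum>k\<in>{m..n}. exp (- a) ^ k) = exp (- a) ^ m - exp (- a) ^ Suc n"
      by (rule sum_gp_multiplied[OF True])
    also have "\<dots> \<le> exp (- a) ^ m" by simp
    finally show ?thesis unfolding e using x by (simp add: field_simps)
  next
    case False
    then show ?thesis using x by simp
  qed
qed

text \<open>\<open>cut m\<close> is a continuous cutoff around the critical set and
  \<open>ell m\<close> a truncation of the negative part of the logarithm with its sign changed.
  Together they dominate, continuously in the derivative, the charges that depend on the
  zones.\<close>

definition cut :: "nat \<Rightarrow> real \<Rightarrow> real" where "cut m y = min 1 (max 0 (2 - exp (real m) * \<bar>y\<bar>))"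
definition ell :: "nat \<Rightarrow> real \<Rightarrow> real" where "ell m y = - ln (max (min 1 \<bar>y\<bar>) (exp (- real m)))"

lemma cut_cont: "continuous_on A (cut m)" unfolding cut_def by (intro continuous_intros)

lemma ell_cont: "continuous_on A (ell m)"
proof -
  have "max (min 1 \<bar>y\<bar>) (exp (- real m)) \<noteq> 0" for y :: real using exp_gt_zero[of "- real m"] by linarith
  then show ?thesis unfolding ell_def by (intro continuous_intros) auto
qed

lemma cut_range: "0 \<le> cut m y" "cut m y \<le> 1" by (auto simp: cut_def)

lemma cut_one: "\<bar>y\<bar> \<le> exp (- real m) \<Longrightarrow> cut m y = 1"
proof -
  assume "\<bar>y\<bar> \<le> exp (- real m)"
  then have "exp (real m) * \<bar>y\<bar> \<le> exp (real m) * exp (- real m)" by (intro mult_left_mono) auto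
  then show ?thesis by (simp add: cut_def exp_minus)
qed

lemma cut_zero: "2 * exp (- real m) < \<bar>y\<bar> \<Longrightarrow> cut m y = 0"
proof -
  assume "2 * exp (- real m) < \<bar>y\<bar>"
  then have "exp (real m) * (2 * exp (- real m)) \<le> exp (real m) * \<bar>y\<bar>" by (intro mult_left_mono) auto
  moreover have "exp (real m) * (2 * exp (- real m)) = 2" by (simp add: exp_minus)
  ultimately show ?thesis by (simp add: cut_def)
qed

lemma ell_nonneg: "0 \<le> ell m y"
proof -
  have "max (min 1 \<bar>y\<bar>) (exp (- real m)) \<le> 1" by simp
  moreover have "0 < max (min 1 \<bar>y\<bar>) (exp (- real m))" by (simp add: less_max_iff_disj)
  ultimately show ?thesis unfolding ell_def by simp
qed

lemma ell_ge: "k \<le> m \<Longrightarrow> \<bar>y\<bar> \<le> exp (- real k) \<Longrightarrow> real k \<le> ell m y"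
proof -
  assume a: "k \<le> m" "\<bar>y\<bar> \<le> exp (- real k)"
  have "max (min 1 \<bar>y\<bar>) (exp (- real m)) \<le> exp (- real k)" using a by auto
  moreover have "0 < max (min 1 \<bar>y\<bar>) (exp (- real m))" by (simp add: less_max_iff_disj)
  ultimately have "ln (max (min 1 \<bar>y\<bar>) (exp (- real m))) \<le> ln (exp (- real k))" by (subst ln_le_cancel_iff) auto
  then show ?thesis by (simp add: ell_def)
qed

lemma ell_mono: "k \<le> m \<Longrightarrow> ell k y \<le> ell m y"
proof -
  assume "k \<le> m"
  then have "max (min 1 \<bar>y\<bar>) (exp (- real m)) \<le> max (min 1 \<bar>y\<bar>) (exp (- real k))" by (intro max.mono) auto
  moreover have "0 < max (min 1 \<bar>y\<bar>) (exp (- real m))" by (simp add: less_max_iff_disj)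
  ultimately show ?thesis unfolding ell_def by (simp add: less_max_iff_disj)
qed

lemma ell_le: "y \<noteq> 0 \<Longrightarrow> ell m y \<le> - ln (min 1 \<bar>y\<bar>)"
  unfolding ell_def by (simp add: less_max_iff_disj)

lemma ell_eventually: "y \<noteq> 0 \<Longrightarrow> \<forall>\<^sub>F m in sequentially. ell m y = - ln (min 1 \<bar>y\<bar>)"
proof -
  assume y: "y \<noteq> 0"
  obtain N :: nat where N: "- ln (min 1 \<bar>y\<bar>) < real N" using reals_Archimedean2 by blast
  show ?thesis
  proof (rule eventually_sequentiallyI[of N])
    fix m assume "N \<le> m"
    then have "- real m \<le> ln (min 1 \<bar>y\<bar>)" using N by linarith
    then have "exp (- real m) \<le> exp (ln (min 1 \<bar>y\<bar>))" by (subst exp_le_cancel_iff)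
    also have "\<dots> = min 1 \<bar>y\<bar>" using y by simp
    finally show "ell m y = - ln (min 1 \<bar>y\<bar>)" unfolding ell_def by (simp add: max_absorb1)
  qed
qed

text \<open>The usual adapted distance. Applying \<open>G\<close> shifts the index of the terms by
  one, which costs a factor exp R; the term that leaves the range is compared with the term of index
  0 by the bound on the \<open>p\<close>-th iterate.\<close>

lemma (in lifted) adapted_distance:
  fixes p :: nat and \<Lambda> R :: real
  assumes p: "p > 0" and \<Lambda>: "\<Lambda> \<ge> 1" and R: "R \<ge> 0"
    and lip1: "\<And>s t. s \<in> D \<Longrightarrow> t \<in> D \<Longrightarrow> \<bar>G s - G t\<bar> \<le> \<Lambda> * \<bar>s - t\<bar>"
    and lipp: "\<And>s t. s \<in> D \<Longrightarrow> t \<in> D \<Longrightarrow> \<bar>(G ^^ p) s - (G ^^ p) t\<bar> \<le> exp (real p * R) * \<bar>s - t\<bar>"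
  defines "ad \<equiv> \<lambda>s t. Max ((\<lambda>m. exp (- R * real m) * \<bar>(G ^^ m) s - (G ^^ m) t\<bar>) ` {..<p})"
  assumes st: "s \<in> D" "t \<in> D"
  shows "\<bar>s - t\<bar> \<le> ad s t" "ad s t \<le> \<Lambda> ^ p * \<bar>s - t\<bar>" "ad (G s) (G t) \<le> exp R * ad s t"
proof -
  have ne: "{..<p} \<noteq> {}" using p by auto
  have ge: "exp (- R * real m) * \<bar>(G ^^ m) s - (G ^^ m) t\<bar> \<le> ad s t" if "m < p" for m s t
    unfolding ad_def by (rule Max_ge) (use that in auto)
  have le: "ad s t \<le> c" if "\<And>m. m < p \<Longrightarrow> exp (- R * real m) * \<bar>(G ^^ m) s - (G ^^ m) t\<bar> \<le> c" for s t c
    unfolding ad_def using ne that by (subst Max_le_iff) auto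
  have lipn: "\<bar>(G ^^ n) s - (G ^^ n) t\<bar> \<le> \<Lambda> ^ n * \<bar>s - t\<bar>" for n
  proof (induction n)
    case (Suc n)
    have "\<bar>(G ^^ Suc n) s - (G ^^ Suc n) t\<bar> \<le> \<Lambda> * \<bar>(G ^^ n) s - (G ^^ n) t\<bar>"
      using lip1[OF Gn_D[OF st(1), of n] Gn_D[OF st(2), of n]] by simp
    also have "\<dots> \<le> \<Lambda> * (\<Lambda> ^ n * \<bar>s - t\<bar>)" using Suc \<Lambda> by (intro mult_left_mono) auto
    finally show ?case by (simp add: mult.assoc)
  qed simp
  show "\<bar>s - t\<bar> \<le> ad s t" using ge[of 0 s t] p by simp
  show "ad s t \<le> \<Lambda> ^ p * \<bar>s - t\<bar>"
  proof (rule le)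
    fix m assume m: "m < p"
    have "exp (- R * real m) \<le> 1" using R by simp
    then have "exp (- R * real m) * \<bar>(G ^^ m) s - (G ^^ m) t\<bar> \<le> 1 * \<bar>(G ^^ m) s - (G ^^ m) t\<bar>" by (rule mult_right_mono) simp
    also have "\<dots> \<le> \<Lambda> ^ m * \<bar>s - t\<bar>" using lipn[of m] by simp
    also have "\<dots> \<le> \<Lambda> ^ p * \<bar>s - t\<bar>" using \<Lambda> m by (intro mult_right_mono power_increasing) auto
    finally show "exp (- R * real m) * \<bar>(G ^^ m) s - (G ^^ m) t\<bar> \<le> \<Lambda> ^ p * \<bar>s - t\<bar>" .
  qed
  show "ad (G s) (G t) \<le> exp R * ad s t"
  proof (rule le)
    fix m assume m: "m < p"
    have sw: "(G ^^ m) (G s) = (G ^^ Suc m) s" "(G ^^ m) (G t) = (G ^^ Suc m) t" by (simp_all add: funpow_swap1)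
    have ex: "exp (- R * real m) = exp R * exp (- R * real (Suc m))" by (simp add: mult_exp_exp algebra_simps)
    have "exp (- R * real (Suc m)) * \<bar>(G ^^ Suc m) s - (G ^^ Suc m) t\<bar> \<le> ad s t"
    proof (cases "Suc m < p")
      case True then show ?thesis by (rule ge)
    next
      case False
      then have Sm: "Suc m = p" using m by simp
      have "exp (- R * real p) * \<bar>(G ^^ p) s - (G ^^ p) t\<bar> \<le> exp (- R * real p) * (exp (real p * R) * \<bar>s - t\<bar>)"
        by (rule mult_left_mono[OF lipp[OF st]]) simp
      also have "\<dots> = \<bar>s - t\<bar>" by (simp add: mult.assoc[symmetric] mult_exp_exp mult.commute[of R])
      also have "\<dots> \<le> ad s t" using ge[of 0 s t] p by simp
      finally show ?thesis unfolding Sm .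
    qed
    then show "exp (- R * real m) * \<bar>(G ^^ m) (G s) - (G ^^ m) (G t)\<bar> \<le> exp R * ad s t"
      unfolding sw ex by (simp add: mult.assoc)
  qed
qed

context weak_seq_lift begin

lemma prod_uniform:
  fixes h :: "nat \<Rightarrow> 'a \<Rightarrow> real"
  assumes "uniform_limit X h h' sequentially" "continuous_on X h'"
  shows "uniform_limit X (\<lambda>k x. \<Prod>i<n. h k ((g k ^^ i) x)) (\<lambda>x. \<Prod>i<n. h' ((f ^^ i) x)) sequentially"
proof (induction n)
  case 0 show ?case by (simp add: uniform_limit_iff)
next
  case (Suc n)
  have c: "continuous_on X (\<lambda>x. h' ((f ^^ n) x))" by (rule compose_cont[OF assms(2)])
  have c': "continuous_on X (\<lambda>x. \<Prod>i<n. h' ((f ^^ i) x))" by (intro continuous_on_prod compose_cont[OF assms(2)])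
  have "uniform_limit X (\<lambda>k x. (\<Prod>i<n. h k ((g k ^^ i) x)) * h k ((g k ^^ n) x))
      (\<lambda>x. (\<Prod>i<n. h' ((f ^^ i) x)) * h' ((f ^^ n) x)) sequentially"
    by (rule uniform_lim_mult[OF Suc compose_uniform[OF assms]])
      (use compact_imp_bounded[OF compact_continuous_image[OF c X]]
        compact_imp_bounded[OF compact_continuous_image[OF c' X]] in auto)
  then show ?case by simp
qed

text \<open>If no truncated exponent is negative, the integrals of \<open>ell m\<close> are bounded
  by \<open>ln \<Lambda>\<close> for all \<open>m\<close>. Hence the critical set is null and the
  logarithm of the derivative is integrable; by dominated convergence its integral over small
  neighbourhoods of the critical set tends to 0.\<close>

lemma critical_tail:
  assumes nn: "\<And>m. 0 \<le> (\<integral>x. phi m (df x) \<partial>\<mu>)" and \<delta>: "\<delta> > 0"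
  shows "\<forall>\<^sub>F m in sequentially. \<forall>K. (\<integral>x. cut m (df x) * ell K (df x) \<partial>\<mu>) \<le> \<delta> \<and> (\<integral>x. cut m (df x) \<partial>\<mu>) \<le> \<delta>"
proof -
  interpret e: ergodic_mpt \<mu> f by (rule ergodic)
  obtain \<Lambda> where \<Lambda>: "\<Lambda> \<ge> 1" "\<And>x. x \<in> X \<Longrightarrow> \<bar>df x\<bar> \<le> \<Lambda>" using common_bound by metis
  have dfm [measurable]: "df \<in> borel_measurable \<mu>" by (rule cont_meas(1)[OF df_cont])
  have ec: "continuous_on X (\<lambda>x. ell m (df x))" and cc: "continuous_on X (\<lambda>x. cut m (df x))"
    and pc: "continuous_on X (\<lambda>x. phi m (df x))" for m
    by (rule continuous_on_compose2[OF _ df_cont, of UNIV]; simp add: ell_cont cut_cont phi_cont)+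
  have ei: "integrable \<mu> (\<lambda>x. ell m (df x))" for m by (rule cont_integrable(1)[OF ec])
  have phi_ell: "phi m y \<le> ln \<Lambda> - ell m y" if y: "\<bar>y\<bar> \<le> \<Lambda>" for m y
  proof (cases "1 \<le> \<bar>y\<bar>")
    case True
    then have "ell m y = 0" unfolding ell_def by simp
    then show ?thesis using phi_upper[OF \<Lambda>(1) y] by simp
  next
    case False
    then have "phi m y = - ell m y" unfolding phi_def ell_def by simp
    then show ?thesis using \<Lambda>(1) by simp
  qed
  have bound: "(\<integral>x. ell m (df x) \<partial>\<mu>) \<le> ln \<Lambda>" for m
  proof -
    have "0 \<le> (\<integral>x. phi m (df x) \<partial>\<mu>)" by (rule nn)
    also have "\<dots> \<le> (\<integral>x. ln \<Lambda> - ell m (df x) \<partial>\<mu>)"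
      by (rule integral_mono) (use cont_integrable(1)[OF pc] ei phi_ell \<Lambda>(2) in auto)
    also have "\<dots> = ln \<Lambda> - (\<integral>x. ell m (df x) \<partial>\<mu>)" using ei by (simp add: e.prob_space[simplified])
    finally show ?thesis by simp
  qed
  have Zs: "{x\<in>space \<mu>. df x = 0} \<in> sets \<mu>" by measurable
  have "measure \<mu> {x\<in>space \<mu>. df x = 0} = 0"
  proof (rule ccontr)
    let ?a = "measure \<mu> {x\<in>space \<mu>. df x = 0}"
    assume "?a \<noteq> 0"
    then have a: "?a > 0" using measure_nonneg[of \<mu> "{x\<in>space \<mu>. df x = 0}"] by linarith
    obtain m :: nat where m: "ln \<Lambda> / ?a < real m" using reals_Archimedean2 by blast
    have "real m * ?a = (\<integral>x. real m * indicator {x\<in>space \<mu>. df x = 0} x \<partial>\<mu>)"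
      using Zs sets.sets_into_space[OF Zs] by (simp add: Int_absorb2)
    also have "\<dots> \<le> (\<integral>x. ell m (df x) \<partial>\<mu>)"
    proof (rule integral_mono[OF _ ei])
      show "integrable \<mu> (\<lambda>x. real m * indicator {x\<in>space \<mu>. df x = 0} x)" using Zs by (simp add: e.emeasure_eq_measure)
      fix x show "real m * indicator {x\<in>space \<mu>. df x = 0} x \<le> ell m (df x)"
        using ell_nonneg[of m "df x"] ell_ge[of m m "df x"] by (auto simp: indicator_def)
    qed
    also have "\<dots> \<le> ln \<Lambda>" by (rule bound)
    finally show False using m a by (simp add: field_simps)
  qed
  then have "AE x in \<mu>. x \<notin> {x\<in>space \<mu>. df x = 0}" using e.prob_eq_0[OF Zs] by simp
  with AE_space have nz: "AE x in \<mu>. df x \<noteq> 0" by eventually_elim auto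
  define L where "L x = - ln (min 1 \<bar>df x\<bar>)" for x
  have Lm [measurable]: "L \<in> borel_measurable \<mu>" unfolding L_def by measurable
  have L0: "L x \<ge> 0" for x unfolding L_def by (cases "df x = 0") auto
  have inc: "incseq (\<lambda>m. \<integral>x. ell m (df x) \<partial>\<mu>)"
    by (rule incseq_SucI) (rule integral_mono[OF ei ei ell_mono], simp)
  obtain l where l: "(\<lambda>m. \<integral>x. ell m (df x) \<partial>\<mu>) \<longlonglongrightarrow> l"
    using incseq_convergent[OF inc, of "ln \<Lambda>"] bound by blast
  have Li: "integrable \<mu> L"
  proof (rule integrable_monotone_convergence[OF ei _ _ l Lm])
    show "AE x in \<mu>. mono (\<lambda>n. ell n (df x))" by (intro AE_I2 monoI ell_mono)
    show "AE x in \<mu>. (\<lambda>i. ell i (df x)) \<longlonglongrightarrow> L x"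
      using nz by eventually_elim (auto intro: tendsto_eventually ell_eventually simp: L_def)
  qed
  \<comment> \<open>\<open>H m\<close> dominates \<open>cut m\<close>, and almost everywhere its
    product with \<open>ell K\<close> for all \<open>K\<close> at once, which gives an estimate
    uniform in \<open>K\<close>.\<close>
  define H where "H m x = indicator {x. \<bar>df x\<bar> \<le> 2 * exp (- real m)} x * (L x + 1)" for m x
  have Hm: "H m \<in> borel_measurable \<mu>" for m
  proof -
    have "H m = (\<lambda>x. if \<bar>df x\<bar> \<le> 2 * exp (- real m) then L x + 1 else 0)" by (auto simp: H_def fun_eq_iff)
    then show ?thesis by simp
  qed
  have Hb: "0 \<le> H m x \<and> H m x \<le> L x + 1" for m x using L0[of x] by (auto simp: H_def indicator_def)
  have Hi: "integrable \<mu> (H m)" for m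
    by (rule Bochner_Integration.integrable_bound[OF _ Hm, of "\<lambda>x. L x + 1"]) (use Li Hb L0 in \<open>auto intro!: AE_I2\<close>)
  have "(\<lambda>m. \<integral>x. H m x \<partial>\<mu>) \<longlonglongrightarrow> (\<integral>x. 0 \<partial>\<mu>)"
  proof (rule integral_dominated_convergence[where w = "\<lambda>x. L x + 1"])
    show "AE x in \<mu>. (\<lambda>m. H m x) \<longlonglongrightarrow> 0"
      using nz
    proof eventually_elim
      case (elim x)
      obtain N :: nat where N: "- ln (\<bar>df x\<bar> / 2) < real N" using reals_Archimedean2 by blast
      have "H m x = 0" if "m \<ge> N" for m
      proof -
        have "- real m < ln (\<bar>df x\<bar> / 2)" using N that by linarith
        then have "exp (- real m) < exp (ln (\<bar>df x\<bar> / 2))" by (subst exp_less_cancel_iff)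
        also have "\<dots> = \<bar>df x\<bar> / 2" using elim by simp
        finally show ?thesis by (simp add: H_def)
      qed
      then show ?case by (intro tendsto_eventually eventually_sequentiallyI[of N])
    qed
    show "AE x in \<mu>. norm (H m x) \<le> L x + 1" for m using Hb by (intro AE_I2) (auto simp: abs_le_iff intro: order_trans[of _ 0])
  qed (use Li Hm in auto)
  then have "(\<lambda>m. \<integral>x. H m x \<partial>\<mu>) \<longlonglongrightarrow> 0" by simp
  from order_tendstoD(2)[OF this \<delta>] show ?thesis
  proof eventually_elim
    case (elim m)
    have cH: "cut m (df x) \<le> H m x" for x
    proof (cases "\<bar>df x\<bar> \<le> 2 * exp (- real m)")
      case True then show ?thesis using cut_range(2)[of m "df x"] L0[of x] by (simp add: H_def)
    next
      case False then show ?thesis using cut_zero[of m "df x"] by (simp add: H_def)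
    qed
    have c2: "(\<integral>x. cut m (df x) \<partial>\<mu>) \<le> (\<integral>x. H m x \<partial>\<mu>)"
      by (rule integral_mono[OF cont_integrable(1)[OF cc] Hi cH])
    have "(\<integral>x. cut m (df x) * ell K (df x) \<partial>\<mu>) \<le> (\<integral>x. H m x \<partial>\<mu>)" for K
    proof (rule integral_mono_AE[OF _ Hi])
      show "integrable \<mu> (\<lambda>x. cut m (df x) * ell K (df x))"
        by (rule cont_integrable(1)) (intro continuous_intros cc ec)
      show "AE x in \<mu>. cut m (df x) * ell K (df x) \<le> H m x"
        using nz
      proof eventually_elim
        case (elim x)
        show ?case
        proof (cases "\<bar>df x\<bar> \<le> 2 * exp (- real m)")
          case True
          have "cut m (df x) * ell K (df x) \<le> 1 * L x"
            using cut_range[of m "df x"] ell_le[OF elim, of K] ell_nonneg[of K "df x"] unfolding L_def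
            by (intro mult_mono) auto
          then show ?thesis using True by (simp add: H_def)
        next
          case False then show ?thesis using cut_zero[of m "df x"] by (simp add: H_def)
        qed
      qed
    qed
    then show ?case using c2 elim by (meson less_imp_le order_trans)
  qed
qed

text \<open>The order of the choices matters. \<open>R\<close>, \<kappa>, \<rho>, \<open>K0\<close>,
  \<epsilon>, \<open>P\<close>, \<open>W\<close>, \<open>w\<close> and \<open>K\<close> come from
  \<open>f\<close>, \<mu> and \<eta>, in this order; then \<open>k0\<close> makes four integrals
  small for all later \<open>k\<close>; only then are a map \<open>g k\<close> and a label
  \<open>Q\<close> given, and with them \<open>C2\<close>, \<open>Kc\<close>, the grid,
  \<open>n0\<close>, \<open>S0\<close> and \<open>Dm\<close>.\<close>

lemma nonneg_exponent_case:
  assumes nn: "\<And>m. 0 \<le> (\<integral>x. phi m (df x) \<partial>\<mu>)"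
    and h: "metric_entropy \<mu> f = ereal h" "Rf / (\<beta> + 1) \<le> h" and \<eta>: "\<eta> > 0"
  shows "\<exists>k0. \<forall>k\<ge>k0. metric_entropy (\<nu> k) (g k) \<le> ereal (h + 14 * \<eta>)"
proof -
  interpret e: ergodic_mpt \<mu> f by (rule ergodic)
  obtain \<Lambda> k1 where \<Lambda>: "\<Lambda> \<ge> 1" "\<And>x. x \<in> X \<Longrightarrow> \<bar>df x\<bar> \<le> \<Lambda>" "\<And>k x. k \<ge> k1 \<Longrightarrow> x \<in> X \<Longrightarrow> \<bar>dg k x\<bar> \<le> \<Lambda>"
    using common_bound by blast
  define R where "R = Rf + \<eta>"
  have R: "R > 0" using Rf \<eta> by (simp add: R_def)
  obtain p where p: "p > 0" "\<And>x. x \<in> X \<Longrightarrow> \<bar>\<Prod>i<p. df ((f ^^ i) x)\<bar> \<le> exp (real p * (Rf + \<eta> / 2))"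
    using growth[of "\<eta> / 2"] \<eta> by auto
  define C0 where "C0 = \<Lambda> ^ p"
  have C0: "C0 \<ge> 1" unfolding C0_def using \<Lambda>(1) by (rule one_le_power)
  define \<kappa> where "\<kappa> = min (1/2) (\<eta> / (2 * R))"
  have \<kappa>: "0 < \<kappa>" "\<kappa> \<le> 1/2" "2 * \<kappa> * R \<le> \<eta>"
  proof -
    show "0 < \<kappa>" "\<kappa> \<le> 1/2" using \<eta> R by (auto simp: \<kappa>_def)
    have "\<kappa> \<le> \<eta> / (2 * R)" by (simp add: \<kappa>_def)
    then show "2 * \<kappa> * R \<le> \<eta>" using R by (simp add: field_simps)
  qed
  \<comment> \<open>The value for which the third condition on \<rho> becomes an equality. It is 1 /
    (\<beta> + 1) up to an error of order \<kappa>, and \<kappa> was chosen so that this error times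
    \<open>R\<close> is at most \<eta>.\<close>
  define \<rho> where "\<rho> = (1 + 2 * \<kappa> * \<beta>) / (\<beta> + 1)"
  have \<rho>: "0 \<le> \<rho>" "\<rho> \<le> 1"
  proof -
    show "0 \<le> \<rho>" unfolding \<rho>_def using \<kappa> \<beta> by (intro divide_nonneg_nonneg) auto
    have "2 * \<kappa> * \<beta> \<le> 1 * \<beta>" using \<kappa> \<beta> by (intro mult_right_mono) auto
    then show "\<rho> \<le> 1" unfolding \<rho>_def using \<beta> by (simp add: divide_le_eq)
  qed
  have \<rho>3: "(1 - \<rho>) * (1 / \<beta> + \<kappa>) \<le> \<rho> * (1 - \<kappa>) - \<kappa>"
  proof -
    have "\<rho> * (\<beta> + 1) = 1 + 2 * \<kappa> * \<beta>" unfolding \<rho>_def using \<beta> by simp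
    then have "\<rho> * (1 + 1 / \<beta>) = 1 / \<beta> + 2 * \<kappa>" using \<beta> by (simp add: field_simps)
    then show ?thesis by (simp add: algebra_simps diff_divide_distrib)
  qed
  have \<rho>R: "\<rho> * R \<le> h + 2 * \<eta>"
  proof -
    have "\<rho> * R = Rf / (\<beta> + 1) + \<eta> / (\<beta> + 1) + (2 * \<kappa> * R) * (\<beta> / (\<beta> + 1))"
    proof -
      have "\<rho> * R = R / (\<beta> + 1) + (2 * \<kappa> * R) * (\<beta> / (\<beta> + 1))"
        by (simp add: \<rho>_def add_divide_distrib distrib_right)
      then show ?thesis by (simp add: R_def add_divide_distrib)
    qed
    also have "\<eta> / (\<beta> + 1) \<le> \<eta>" using \<eta> \<beta> by (simp add: field_simps)
    also have "(2 * \<kappa> * R) * (\<beta> / (\<beta> + 1)) \<le> \<eta> * 1"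
      using \<kappa> \<beta> R \<eta> by (intro mult_mono) (auto simp: field_simps)
    finally show ?thesis using h(2) by linarith
  qed
  define \<kappa>' where "\<kappa>' = \<kappa> / 2"
  have \<kappa>': "\<kappa>' > 0" using \<kappa> by (simp add: \<kappa>'_def)
  obtain C1 where C1: "C1 \<ge> 0" "exp (- \<eta>) + real 3 * exp (- C1) \<le> 1" using exists_weight[OF \<eta>] by blast
  define C3 where "C3 = ln (12 * real Nr)"
  have C3: "C3 \<ge> 0" unfolding C3_def using Nr by (intro ln_ge_zero) auto
  define C4 where "C4 = 1 / \<beta> + 2 * \<kappa>"
  have C4: "C4 > 0" unfolding C4_def using \<beta> \<kappa> by (intro add_pos_pos) auto
  have e1: "\<eta> / (C1 + C3 + 1) > 0" and e2: "\<eta> / (C4 + 1) > 0" using \<eta> C1 C3 C4 by auto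
  have "\<forall>\<^sub>F K0 in sequentially. 3 \<le> 1 * real K0 \<and> ln (2 * C0) \<le> \<kappa> * real K0 \<and> C3 \<le> (\<kappa> / 2) * real K0 \<and>
     C1 - ln (1 - exp (- \<kappa>')) \<le> \<kappa>' * real K0 \<and> (1 + ln Cr) / \<beta> \<le> \<kappa> * real K0 \<and>
     (\<forall>K. (\<integral>x. cut K0 (df x) * ell K (df x) \<partial>\<mu>) \<le> \<eta> / (C4 + 1) \<and> (\<integral>x. cut K0 (df x) \<partial>\<mu>) \<le> \<eta> / (C4 + 1)) \<and>
     (\<forall>K. (\<integral>x. cut K0 (df x) * ell K (df x) \<partial>\<mu>) \<le> \<eta> / (C1 + C3 + 1) \<and> (\<integral>x. cut K0 (df x) \<partial>\<mu>) \<le> \<eta> / (C1 + C3 + 1))"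
    by (intro eventually_conj eventually_linear_ge critical_tail[OF nn e1] critical_tail[OF nn e2])
      (use \<kappa> \<kappa>' in auto)
  \<comment> \<open>In this order: small zones are excluded from the symbols 0 to 2,
    \<open>C0\<close> is absorbed, \<open>C3\<close> is absorbed by half of \<kappa>, the zone
    symbols satisfy Kraft's inequality, the constant part of the level scale is absorbed, and the
    neighbourhood of the critical set has small weight.\<close>
  then obtain K0 where K0: "3 \<le> 1 * real K0" "ln (2 * C0) \<le> \<kappa> * real K0" "C3 \<le> (\<kappa> / 2) * real K0"
     "C1 - ln (1 - exp (- \<kappa>')) \<le> \<kappa>' * real K0" "(1 + ln Cr) / \<beta> \<le> \<kappa> * real K0"
     "\<And>K. (\<integral>x. cut K0 (df x) * ell K (df x) \<partial>\<mu>) \<le> \<eta> / (C4 + 1)"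
     "(\<integral>x. cut K0 (df x) \<partial>\<mu>) \<le> \<eta> / (C1 + C3 + 1)"
    unfolding eventually_sequentially by blast
  have K03: "3 \<le> K0" using K0(1) by linarith
  have C0_small: "2 * C0 \<le> exp (\<kappa> * real K0)"
  proof -
    have "exp (ln (2 * C0)) \<le> exp (\<kappa> * real K0)" using K0(2) by (subst exp_le_cancel_iff)
    then show ?thesis using C0 by simp
  qed
  have cost: "ln (12 * real Nr) + \<kappa>' * real k \<le> \<kappa> * real k" if "K0 \<le> k" for k
  proof -
    have "(\<kappa> / 2) * real K0 \<le> (\<kappa> / 2) * real k" using that \<kappa> by (intro mult_left_mono) auto
    then show ?thesis using K0(3) unfolding C3_def \<kappa>'_def by simp
  qed
  have zone: "exp (- \<eta>) + 2 * exp (- C1) + (\<Sum>k\<in>{K0..n}. exp (- \<kappa>' * real k)) \<le> 1" for n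
  proof -
    have x: "1 - exp (- \<kappa>') > 0" using \<kappa>' by simp
    have "(\<Sum>k\<in>{K0..n}. exp (- \<kappa>' * real k)) \<le> exp (- \<kappa>' * real K0) / (1 - exp (- \<kappa>'))"
      by (rule geometric_tail[OF \<kappa>'])
    also have "exp (- \<kappa>' * real K0) \<le> exp (- C1 + ln (1 - exp (- \<kappa>')))" using K0(4) by (subst exp_le_cancel_iff) linarith
    then have "exp (- \<kappa>' * real K0) / (1 - exp (- \<kappa>')) \<le> exp (- C1 + ln (1 - exp (- \<kappa>'))) / (1 - exp (- \<kappa>'))"
      using x by (intro divide_right_mono) auto
    also have "\<dots> = exp (- C1)" using x unfolding exp_add by simp
    finally show ?thesis using C1(2) by simp
  qed
  obtain d0 where d0: "d0 > 0" "\<And>x y. x \<in> X \<Longrightarrow> y \<in> X \<Longrightarrow> dist y x < d0 \<Longrightarrow> \<bar>df y - df x\<bar> < exp (- real K0) / 3"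
  proof -
    have "uniformly_continuous_on X df" by (rule compact_uniformly_continuous[OF df_cont X])
    then have "\<exists>d>0. \<forall>x\<in>X. \<forall>y\<in>X. dist y x < d \<longrightarrow> dist (df y) (df x) < exp (- real K0) / 3"
      unfolding uniformly_continuous_on_def by (metis divide_pos_pos exp_gt_zero zero_less_numeral)
    then show ?thesis using that unfolding dist_real_def by blast
  qed
  \<comment> \<open>The three bounds keep \<open>ln \<epsilon>\<close> nonpositive, one expanded
    step below 1/2, and two parameters at distance \<epsilon>, whose points are at distance at most
    7\<epsilon>, within \<open>d0\<close>.\<close>
  define \<epsilon> where "\<epsilon> = min 1 (min (exp (- R) / 2) (d0 / 8))"
  have \<epsilon>: "\<epsilon> > 0" "\<epsilon> \<le> 1" "\<epsilon> * exp R \<le> 1/2" "7 * \<epsilon> < d0"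
  proof -
    show "\<epsilon> > 0" "\<epsilon> \<le> 1" using d0 by (auto simp: \<epsilon>_def)
    have "\<epsilon> \<le> exp (- R) / 2" by (simp add: \<epsilon>_def)
    then have "\<epsilon> * exp R \<le> exp (- R) / 2 * exp R" by (rule mult_right_mono) simp
    then show "\<epsilon> * exp R \<le> 1/2" by (simp add: exp_minus)
    have "\<epsilon> \<le> d0 / 8" by (simp add: \<epsilon>_def)
    then show "7 * \<epsilon> < d0" using d0(1) by linarith
  qed
  have depth: "max 0 (ln \<epsilon> + (real k + 1 + ln Cr) / \<beta>) \<le> (1 / \<beta> + \<kappa>) * real k" if "K0 \<le> k" for k
  proof -
    have l: "ln \<epsilon> \<le> 0" using \<epsilon> by simp
    have "\<kappa> * real K0 \<le> \<kappa> * real k" using that \<kappa> by (intro mult_left_mono) auto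
    then have "(1 + ln Cr) / \<beta> \<le> \<kappa> * real k" using K0(5) by linarith
    moreover have "(real k + 1 + ln Cr) / \<beta> = real k / \<beta> + (1 + ln Cr) / \<beta>" by (simp add: add_divide_distrib add.assoc)
    moreover have "(1 / \<beta> + \<kappa>) * real k = real k / \<beta> + \<kappa> * real k" by (simp add: distrib_right)
    moreover have "0 \<le> (1 / \<beta> + \<kappa>) * real k" using \<beta> \<kappa> by simp
    ultimately show ?thesis using l by linarith
  qed
  have eC: "\<epsilon> / C0 > 0" using \<epsilon> C0 by simp
  obtain P :: "'a \<Rightarrow> nat" and L where P: "\<And>x. P x < L" "AE y in \<mu>. loc_const X P y" "fin_label \<mu> P" "\<And>k. fin_label (\<nu> k) P"
      "\<And>x y. x \<in> X \<Longrightarrow> y \<in> X \<Longrightarrow> P x = P y \<Longrightarrow> dist x y \<le> \<epsilon> / C0"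
  proof (rule fine_label[OF eC])
    fix P :: "'a \<Rightarrow> nat" and L
    assume P: "\<And>x. P x < L" "AE y in \<mu>. loc_const X P y" "fin_label \<mu> P" "\<And>k. fin_label (\<nu> k) P"
      "\<And>x y. x \<in> X \<Longrightarrow> y \<in> X \<Longrightarrow> P x = P y \<Longrightarrow> dist x y \<le> \<epsilon> / C0"
    show thesis by (rule that[OF P])
  qed
  have L1: "L \<ge> 1" using P(1) by (metis One_nat_def Suc_leI gr_zeroI not_less_zero)
  define c where "c = h + \<eta>"
  have "ereal (metric_entropy_wrt \<mu> f (fibers (space \<mu>) P)) \<le> ereal h"
    using e.metric_entropy_ge[OF P(3)] h(1) by simp
  then have hc: "metric_entropy_wrt \<mu> f (fibers (space \<mu>) P) < c" using \<eta> by (simp add: c_def)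
  obtain q W where W: "\<And>v b. W v b > 0" "\<And>v. (\<Sum>b<L. W v b) \<le> 1" "\<And>v b. b < L \<Longrightarrow> W v b \<le> 1"
    "(\<integral>x. - ln (W (word f P q x) (P ((f ^^ q) x))) \<partial>\<mu>) < c"
  proof (rule e.conditional_weight[OF P(3) L1 hc])
    fix q W
    assume W: "\<And>v b. W v b > 0" "\<And>v. (\<Sum>b<L. W v b) \<le> 1" "\<And>v b. b < L \<Longrightarrow> W v b \<le> 1"
      "(\<integral>x. - ln (W (word f P q x) (P ((f ^^ q) x))) \<partial>\<mu>) < c"
    show thesis by (rule that[OF W])
  qed
  define V where "V = {v. set v \<subseteq> {..<L} \<and> length v = q}"
  have finV: "finite V" unfolding V_def by (rule finite_lists_length_eq) simp
  \<comment> \<open>A bound over all words, not only those of orbits of \<open>f\<close>, so that it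
    serves all the maps \<open>g k\<close>.\<close>
  define \<Psi> where "\<Psi> = (\<Sum>v\<in>V. \<Sum>b<L. - ln (W v b))"
  have lnW: "0 \<le> - ln (W v b)" if "b < L" for v b using W(1)[of v b] W(3)[OF that, of v] by simp
  have \<Psi>0: "\<Psi> \<ge> 0" unfolding \<Psi>_def by (intro sum_nonneg) (use lnW in auto)
  have \<Psi>: "- ln (W v b) \<le> \<Psi>" if "v \<in> V" "b < L" for v b
  proof -
    have "- ln (W v b) \<le> (\<Sum>b<L. - ln (W v b))" using that lnW by (intro member_le_sum) auto
    also have "\<dots> \<le> \<Psi>" unfolding \<Psi>_def
      by (rule member_le_sum[OF that(1) _ finV, of "\<lambda>v. \<Sum>b<L. - ln (W v b)"]) (intro sum_nonneg lnW, simp)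
    finally show ?thesis .
  qed
  have wV: "word T P q x \<in> V" for T x unfolding V_def word_def using P(1) by auto
  define psi0 where "psi0 T x = - ln (W (word T P q x) (P ((T ^^ q) x)))" for T x
  have psi0: "0 \<le> psi0 T x" "psi0 T x \<le> \<Psi>" for T x unfolding psi0_def using lnW P(1) \<Psi>[OF wV P(1)] by auto
  define F1 where "F1 u = - ln (W (take q u) (u ! q))" for u
  have F1: "psi0 T x = F1 (word T P (Suc q) x)" for T x
    unfolding psi0_def F1_def by (simp add: word_Suc nth_append)
  have psim: "psi0 f \<in> borel_measurable \<mu>"
  proof -
    have "psi0 f = (\<lambda>x. F1 (word f P (Suc q) x))" using F1 by (simp add: fun_eq_iff)
    then show ?thesis
      using borel_measurable_integrable[OF e.label_integral(2)[OF fin_label_word[OF P(3) e.T_meas], of F1 "Suc q"]] by simp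
  qed
  have psib: "\<bar>psi0 f x\<bar> \<le> \<Psi>" for x using psi0[of f x] by linarith
  have psic: "(\<integral>x. psi0 f x \<partial>\<mu>) < c" unfolding psi0_def by (rule W(4))
  have "(\<lambda>n. \<integral>x. max 0 (e.birk (psi0 f) n x / real n - c) \<partial>\<mu>) \<longlonglongrightarrow> 0"
    by (rule e.birk_average_excess[OF psim psib psic])
  from order_tendstoD(2)[OF this \<eta>] obtain n1 where n1: "\<And>n. n \<ge> n1 \<Longrightarrow> (\<integral>x. max 0 (e.birk (psi0 f) n x / real n - c) \<partial>\<mu>) < \<eta>"
    unfolding eventually_sequentially by blast
  define w where "w = max 1 n1"
  have w: "w > 0" "(\<integral>x. max 0 (e.birk (psi0 f) w x / real w - c) \<partial>\<mu>) < \<eta>" using n1 by (auto simp: w_def)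
  \<comment> \<open>The excess of the windowed average is written as a function of the word of
    length \<open>q + 1 + w\<close>. It is not continuous in the point, but its integral converges
    because the boundary of \<open>P\<close> is null.\<close>
  define F2 where "F2 u = max 0 ((\<Sum>i<w. F1 (take (Suc q) (drop i u))) / real w - c)" for u
  have F2: "F2 (word T P (Suc q + w) x) = max 0 ((\<Sum>i<w. psi0 T ((T ^^ i) x)) / real w - c)" for T x
  proof -
    have "F1 (take (Suc q) (drop i (word T P (Suc q + w) x))) = psi0 T ((T ^^ i) x)" if "i < w" for i
      unfolding F1 by (subst word_sub) (use that in auto)
    then show ?thesis unfolding F2_def by simp
  qed
  define B where "B = ln (real L) * real q + real w * \<Psi>"
  have B: "B \<ge> 0" unfolding B_def using L1 \<Psi>0 by simp
  have eB: "\<eta> / (B + 1) > 0" using \<eta> B by simp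
  from critical_tail[OF nn eB] obtain K' where K': "\<And>m. m \<ge> K' \<Longrightarrow> (\<integral>x. cut m (df x) \<partial>\<mu>) \<le> \<eta> / (B + 1)"
    unfolding eventually_sequentially by blast
  define K where "K = max K0 K'"
  have K: "K0 \<le> K" "(\<integral>x. cut K (df x) \<partial>\<mu>) \<le> \<eta> / (B + 1)" using K' by (auto simp: K_def)
  have cutm: "(\<lambda>x. cut m (dg k x)) \<in> borel_measurable (\<nu> k)" and ellm: "(\<lambda>x. ell m (dg k x)) \<in> borel_measurable (\<nu> k)" for m k
    by (rule cont_meas(2), rule continuous_on_compose2[OF _ dg_cont, of UNIV]; simp add: cut_cont ell_cont)+
  have lim1: "(\<lambda>k. \<integral>x. cut m (dg k x) \<partial>\<nu> k) \<longlonglongrightarrow> (\<integral>x. cut m (df x) \<partial>\<mu>)" for m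
    by (rule integral_uniform_limit[OF compose_real_uniform[OF cut_cont dgf df_cont] cutm])
  have lim2: "(\<lambda>k. \<integral>x. cut K0 (dg k x) * ell K (dg k x) \<partial>\<nu> k) \<longlonglongrightarrow> (\<integral>x. cut K0 (df x) * ell K (df x) \<partial>\<mu>)"
  proof (rule integral_uniform_limit[OF compose_real_uniform[OF _ dgf df_cont, of "\<lambda>y. cut K0 y * ell K y"]])
    show "(\<lambda>x. cut K0 (dg k x) * ell K (dg k x)) \<in> borel_measurable (\<nu> k)" for k
      by (intro borel_measurable_times cutm ellm)
  qed (intro continuous_intros cut_cont ell_cont)+
  have lim3: "(\<lambda>k. \<integral>x. F2 (word (g k) P (Suc q + w) x) \<partial>\<nu> k) \<longlonglongrightarrow> (\<integral>x. F2 (word f P (Suc q + w) x) \<partial>\<mu>)"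
    by (rule word_integral_limit[OF P(2) P(1) P(3,4)])
  \<comment> \<open>The factor 2 here and in the next bounds makes the inequalities strict, so that
    they persist for large \<open>k\<close>.\<close>
  have lt3: "(\<integral>x. F2 (word f P (Suc q + w) x) \<partial>\<mu>) < 2 * \<eta>"
    unfolding F2 using w(2) \<eta> unfolding e.birk_def by linarith
  have lt1: "(\<integral>x. cut K0 (df x) \<partial>\<mu>) < 2 * (\<eta> / (C1 + C3 + 1))" using K0(7) e1 by linarith
  have lt2: "(\<integral>x. cut K0 (df x) * ell K (df x) \<partial>\<mu>) < 2 * (\<eta> / (C4 + 1))" using K0(6)[of K] e2 by linarith
  have lt4: "(\<integral>x. cut K (df x) \<partial>\<mu>) < 2 * (\<eta> / (B + 1))" using K(2) eB by linarith
  have growR: "exp (real p * (Rf + \<eta> / 2)) < exp (real p * R)" unfolding R_def using p(1) \<eta> by simp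
  have pu: "\<forall>\<^sub>F k in sequentially. \<forall>x\<in>X. dist (\<Prod>i<p. dg k ((g k ^^ i) x)) (\<Prod>i<p. df ((f ^^ i) x)) <
      exp (real p * R) - exp (real p * (Rf + \<eta> / 2))"
    by (rule uniform_limitD[OF prod_uniform[OF dgf df_cont]]) (use growR in simp)
  \<comment> \<open>One third of the allowed oscillation is spent twice for passing between
    \<open>g k\<close> and \<open>f\<close>, and once for the uniform continuity of the derivative
    of \<open>f\<close>.\<close>
  have du: "\<forall>\<^sub>F k in sequentially. \<forall>x\<in>X. dist (dg k x) (df x) < exp (- real K0) / 3"
    by (rule uniform_limitD[OF dgf]) simp
  have "\<forall>\<^sub>F k in sequentially. k1 \<le> k \<and> (\<integral>x. cut K0 (dg k x) \<partial>\<nu> k) < 2 * (\<eta> / (C1 + C3 + 1)) \<and>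
      (\<integral>x. cut K0 (dg k x) * ell K (dg k x) \<partial>\<nu> k) < 2 * (\<eta> / (C4 + 1)) \<and>
      (\<integral>x. cut K (dg k x) \<partial>\<nu> k) < 2 * (\<eta> / (B + 1)) \<and>
      (\<integral>x. F2 (word (g k) P (Suc q + w) x) \<partial>\<nu> k) < 2 * \<eta> \<and>
      (\<forall>x\<in>X. dist (\<Prod>i<p. dg k ((g k ^^ i) x)) (\<Prod>i<p. df ((f ^^ i) x)) <
        exp (real p * R) - exp (real p * (Rf + \<eta> / 2))) \<and>
      (\<forall>x\<in>X. dist (dg k x) (df x) < exp (- real K0) / 3)"
    by (intro eventually_conj eventually_ge_at_top order_tendstoD(2)[OF lim1 lt1] order_tendstoD(2)[OF lim2 lt2]
        order_tendstoD(2)[OF lim1 lt4] order_tendstoD(2)[OF lim3 lt3] pu du)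
  then obtain k0 where k0: "\<And>k. k \<ge> k0 \<Longrightarrow> k1 \<le> k \<and> (\<integral>x. cut K0 (dg k x) \<partial>\<nu> k) < 2 * (\<eta> / (C1 + C3 + 1)) \<and>
      (\<integral>x. cut K0 (dg k x) * ell K (dg k x) \<partial>\<nu> k) < 2 * (\<eta> / (C4 + 1)) \<and>
      (\<integral>x. cut K (dg k x) \<partial>\<nu> k) < 2 * (\<eta> / (B + 1)) \<and>
      (\<integral>x. F2 (word (g k) P (Suc q + w) x) \<partial>\<nu> k) < 2 * \<eta> \<and>
      (\<forall>x\<in>X. dist (\<Prod>i<p. dg k ((g k ^^ i) x)) (\<Prod>i<p. df ((f ^^ i) x)) <
        exp (real p * R) - exp (real p * (Rf + \<eta> / 2))) \<and>
      (\<forall>x\<in>X. dist (dg k x) (df x) < exp (- real K0) / 3)"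
    unfolding eventually_sequentially by blast
  have "metric_entropy (\<nu> k) (g k) \<le> ereal (h + 14 * \<eta>)" if k: "k \<ge> k0" for k
  proof -
    interpret l: lifted "\<nu> k" "g k" D pr \<tau> "G k" "dg k" by (rule lifted)
    from k0[OF k] have k1k: "k1 \<le> k" and I1: "(\<integral>x. cut K0 (dg k x) \<partial>\<nu> k) < 2 * (\<eta> / (C1 + C3 + 1))"
      and I2: "(\<integral>x. cut K0 (dg k x) * ell K (dg k x) \<partial>\<nu> k) < 2 * (\<eta> / (C4 + 1))"
      and I3: "(\<integral>x. cut K (dg k x) \<partial>\<nu> k) < 2 * (\<eta> / (B + 1))"
      and I4: "(\<integral>x. F2 (word (g k) P (Suc q + w) x) \<partial>\<nu> k) < 2 * \<eta>"
      and I5: "\<And>x. x \<in> X \<Longrightarrow> dist (\<Prod>i<p. dg k ((g k ^^ i) x)) (\<Prod>i<p. df ((f ^^ i) x)) <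
        exp (real p * R) - exp (real p * (Rf + \<eta> / 2))"
      and I6: "\<And>x. x \<in> X \<Longrightarrow> dist (dg k x) (df x) < exp (- real K0) / 3" by auto
    have prX: "pr t \<in> X" if "t \<in> D" for t using l.pr_in[OF that] by simp
    have lip1: "\<bar>G k s - G k t\<bar> \<le> \<Lambda> * \<bar>s - t\<bar>" if "s \<in> D" "t \<in> D" for s t
      by (rule G_lip[OF \<Lambda>(3)[OF k1k] that])
    have lipp: "\<bar>(G k ^^ p) s - (G k ^^ p) t\<bar> \<le> exp (real p * R) * \<bar>s - t\<bar>" if st: "s \<in> D" "t \<in> D" for s t
    proof (rule l.Gn_segment_lip[OF st])
      fix u assume "u \<in> closed_segment s t"
      then have u: "pr u \<in> X" using l.seg_D[OF st] prX by auto
      show "\<bar>\<Prod>i<p. dg k ((g k ^^ i) (pr u))\<bar> \<le> exp (real p * R)"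
        using I5[OF u] p(2)[OF u] unfolding dist_real_def by linarith
    qed
    define ad where "ad s t = Max ((\<lambda>m. exp (- R * real m) * \<bar>(G k ^^ m) s - (G k ^^ m) t\<bar>) ` {..<p})" for s t
    note ad = l.adapted_distance[OF p(1) \<Lambda>(1) less_imp_le[OF R] lip1 lipp, folded ad_def C0_def]
    have unif: "\<bar>dg k (pr s) - dg k (pr t)\<bar> < exp (- real K0)" if st: "s \<in> D" "t \<in> D" "\<bar>s - t\<bar> \<le> \<epsilon>" for s t
    proof -
      have "dist (pr s) (pr t) \<le> 7 * \<bar>s - t\<bar>" by (rule l.lip[OF st(1,2)])
      also have "\<dots> \<le> 7 * \<epsilon>" using st(3) by simp
      also have "\<dots> < d0" by (rule \<epsilon>(4))
      finally have "\<bar>df (pr s) - df (pr t)\<bar> < exp (- real K0) / 3" using d0(2)[OF prX[OF st(2)] prX[OF st(1)]] by simp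
      then show ?thesis using I6[OF prX[OF st(1)]] I6[OF prX[OF st(2)]] unfolding dist_real_def by linarith
    qed
    show ?thesis
    proof (rule l.metric_entropy_le_nat)
      fix Q :: "'a \<Rightarrow> nat" and LQ assume Q: "fin_label (\<nu> k) Q" "LQ > 0" "\<And>x. x \<in> space (\<nu> k) \<Longrightarrow> Q x < LQ"
      obtain C2 where C2: "C2 \<ge> 0" "exp (- \<eta>) + real LQ * exp (- C2) \<le> 1" using exists_weight[OF \<eta>] by blast
      have "\<eta> / (C2 + 1) > 0" using \<eta> C2(1) by simp
      then obtain Kc gap where Kc: "gap > 0" "{x\<in>space (\<nu> k). x \<in> Kc} \<in> sets (\<nu> k)"
        "measure (\<nu> k) {x\<in>space (\<nu> k). x \<notin> Kc} \<le> \<eta> / (C2 + 1)" "\<And>x y. x \<in> Kc \<Longrightarrow> y \<in> Kc \<Longrightarrow> dist x y < gap \<Longrightarrow> Q x = Q y"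
        by (rule compact_approx[OF l.prob_space_axioms \<nu>(2) X Q(1)]) (rule that)
      obtain Ng :: nat where Ng': "7 / gap < real Ng" using reals_Archimedean2 by blast
      have Ng: "Ng > 0" "7 / real Ng \<le> gap"
      proof -
        have "0 < 7 / gap" using Kc(1) by simp
        then show "Ng > 0" using Ng' by (intro gr0I) simp
        then show "7 / real Ng \<le> gap" using Ng' Kc(1) by (simp add: field_simps)
      qed
      obtain n0 :: nat where n0: "n0 > 0" "2 * ln (1 + (real Ng + 1) * real n0) / real n0 \<le> \<eta>"
        using exists_log_ratio[of "real Ng + 1" \<eta>] \<eta> by auto
      \<comment> \<open>The number 8 instead of 7 leaves a strict inequality.\<close>
      define S0 where "S0 = max 1 (ln (8 * \<epsilon> / gap))"
      have S0: "0 < S0" "7 * \<epsilon> * exp (- S0) < gap"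
      proof -
        show "0 < S0" by (simp add: S0_def)
        have "ln (8 * \<epsilon> / gap) \<le> S0" by (simp add: S0_def)
        then have "exp (ln (8 * \<epsilon> / gap)) \<le> exp S0" by (subst exp_le_cancel_iff)
        then have "8 * \<epsilon> \<le> gap * exp S0" using \<epsilon>(1) Kc(1) by (simp add: field_simps)
        then have "8 * \<epsilon> * exp (- S0) \<le> gap * exp S0 * exp (- S0)" by (rule mult_right_mono) simp
        also have "\<dots> = gap" by (simp add: mult.assoc flip: exp_add)
        finally have "8 * \<epsilon> * exp (- S0) \<le> gap" .
        moreover have "0 < \<epsilon> * exp (- S0)" using \<epsilon>(1) by simp
        ultimately show "7 * \<epsilon> * exp (- S0) < gap" by simp
      qed
      \<comment> \<open>The bottom zone is so deep that the scale needs more than \<open>n0\<close>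
        steps to come down to \<open>S0\<close> after a visit. It depends on \<open>Q\<close>
        through \<open>n0\<close> and \<open>S0\<close>, but the integral bounds below do not
        involve it.\<close>
      obtain Dm :: nat where Dm': "max (real K + 1) (2 * (real n0 * R + S0)) < real Dm" using reals_Archimedean2 by blast
      have Dm: "K \<le> Dm" "K0 < Dm" "real n0 * R + S0 \<le> (1 - \<kappa>) * real Dm"
      proof -
        show "K \<le> Dm" "K0 < Dm" using Dm' K(1) by linarith+
        have "(1/2) * real Dm \<le> (1 - \<kappa>) * real Dm" using \<kappa> by (intro mult_right_mono) auto
        moreover have "real n0 * R + S0 < (1/2) * real Dm" using Dm' by (simp add: field_simps)
        ultimately show "real n0 * R + S0 \<le> (1 - \<kappa>) * real Dm" by (meson less_imp_le less_le_trans)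
      qed
      obtain N1 :: nat where N1': "C0 / \<epsilon> < real N1" using reals_Archimedean2 by blast
      have N1: "N1 > 0" "C0 / real N1 \<le> \<epsilon>"
      proof -
        have "0 < C0 / \<epsilon>" using C0 \<epsilon>(1) by simp
        then show "N1 > 0" using N1' by (intro gr0I) simp
        then show "C0 / real N1 \<le> \<epsilon>" using N1' \<epsilon>(1) by (simp add: field_simps)
      qed
      have dgm: "dg k \<in> borel_measurable (\<nu> k)" by (rule cont_meas(2)[OF dg_cont])
      have n0R: "real n0 * R \<le> max 0 (ln \<epsilon> + (real Dm + 1 + ln Cr) / \<beta>) + (1 - \<kappa>) * real Dm - S0"
        using Dm(3) by linarith
      have S0D: "S0 \<le> max 0 (ln \<epsilon> + (real Dm + 1 + ln Cr) / \<beta>) + (1 - \<kappa>) * real Dm"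
        using n0R R by (smt (verit) mult_nonneg_nonneg of_nat_0_le_iff)
      have psiW: "- ln (W (word (g k) P q x) (P ((g k ^^ q) x))) \<le> \<Psi>" for x by (rule \<Psi>[OF wV P(1)])
      interpret cc: coding_cost "\<nu> k" "g k" D pr \<tau> "G k" "dg k" ad R C0 \<beta> Cr Nr \<eta> C1 C2 \<kappa>' \<kappa> \<epsilon> \<rho> K0 K Dm P L q W Kc Q LQ gap S0 N1 Ng n0 w \<Psi> c
      proof (unfold_locales)
        show "\<bar>s - t\<bar> \<le> ad s t" if "s \<in> D" "t \<in> D" for s t by (rule ad(1)[OF _ _ _ _ that]) auto
        show "ad s t \<le> C0 * \<bar>s - t\<bar>" if "s \<in> D" "t \<in> D" for s t by (rule ad(2)[OF _ _ _ _ that]) auto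
        show "ad (G k s) (G k t) \<le> exp R * ad s t" if "s \<in> D" "t \<in> D" for s t by (rule ad(3)[OF _ _ _ _ that]) auto
        show "\<bar>dg k (pr t2) - c\<bar> \<le> Cr * (t2 - t1) powr \<beta>"
          if "t1 \<in> D" "t2 \<in> D" "t1 < t2" "finite Z" "Z \<subseteq> {t1..t2}" "card Z = Nr" "\<And>z. z \<in> Z \<Longrightarrow> dg k (pr z) = c" for t1 t2 Z c
          by (rule many[OF that])
        show "dist x y \<le> \<epsilon> / C0" if "x \<in> space (\<nu> k)" "y \<in> space (\<nu> k)" "P x = P y" for x y
          using P(5) that by simp
        show "P x < L" for x by (rule P(1))
        show "- ln (W (word (g k) P q x) (P ((g k ^^ q) x))) \<le> \<Psi>" for x by (rule psiW)
        show "Q x = Q y" if "x \<in> Kc" "y \<in> Kc" "dist x y < gap" for x y by (rule Kc(4)[OF that])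
        show "0 \<le> \<kappa>'" "\<kappa> \<le> 1" using \<kappa>' \<kappa> by auto
      qed (fact R C0 \<beta> Cr Nr \<eta> C1 C2 \<kappa> K03 K Dm zone C0_small \<epsilon> unif P W Q C2 S0 S0D N1 Ng n0 dgm Kc cost depth \<rho> \<rho>3 n0R w psiW)+
      have C3e: "cc.C3 = C3" unfolding cc.C3_def C3_def ..
      have psie: "cc.psi = psi0 (g k)" unfolding cc.psi_def psi0_def by (simp add: fun_eq_iff)
      have F2i: "integrable (\<nu> k) (\<lambda>x. F2 (word (g k) P (Suc q + w) x))"
        by (rule l.label_integral(2)[OF fin_label_word[OF P(4) l.T_meas]])
      have Kcn: "{x\<in>space (\<nu> k). x \<notin> Kc} \<in> sets (\<nu> k)"
      proof -
        have "{x\<in>space (\<nu> k). x \<notin> Kc} = space (\<nu> k) - {x\<in>space (\<nu> k). x \<in> Kc}" by auto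
        then show ?thesis using sets.compl_sets[OF Kc(2)] by argo
      qed
      have i1: "integrable (\<nu> k) (\<lambda>x. cut m (dg k x))" for m
        by (rule integrable_bounded(2)[OF cutm, of _ _ 1]) (use cut_range in \<open>auto simp: abs_le_iff intro: order_trans[of _ 0]\<close>)
      have i2: "integrable (\<nu> k) (\<lambda>x. cut K0 (dg k x) * ell K (dg k x))"
        by (rule cont_integrable(2)) (intro continuous_intros continuous_on_compose2[OF cut_cont[of UNIV] dg_cont] continuous_on_compose2[OF ell_cont[of UNIV] dg_cont], auto)
      have i3: "integrable (\<nu> k) (indicator {x\<in>space (\<nu> k). x \<notin> Kc} :: 'a \<Rightarrow> real)" using Kcn by (simp add: l.emeasure_eq_measure)
      \<comment> \<open>A majorant of \<open>theta\<close> for which the limits apply: continuous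
        functions of the derivative, a function of words, and the complement of \<open>Kc\<close>,
        which is small for this \<open>k\<close> by choice.\<close>
      define TH where "TH x = (C1 + C3) * cut K0 (dg k x) + C4 * (cut K0 (dg k x) * ell K (dg k x)) + B * cut K (dg k x)
        + F2 (word (g k) P (Suc q + w) x) + C2 * indicator {x\<in>space (\<nu> k). x \<notin> Kc} x" for x
      have zle: "\<bar>dg k x\<bar> \<le> exp (- real m)" if "cc.zone x \<noteq> 0" "m \<le> cc.zone x \<or> m = K0" for m x
      proof -
        have "\<bar>dg k x\<bar> \<le> exp (- real (cc.zone x))" "K0 \<le> cc.zone x"
          using that(1) Dm(2) by (cases x rule: cc.zone_cases; simp)+
        moreover have "exp (- real (cc.zone x)) \<le> exp (- real m)" using that(2) calculation(2) by auto
        ultimately show ?thesis by linarith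
      qed
      have TH: "cc.theta x \<le> TH x" if x: "x \<in> space (\<nu> k)" for x
      proof -
        have t1: "(C1 + C3) * (if cc.zone x \<noteq> 0 then 1 else 0) \<le> (C1 + C3) * cut K0 (dg k x)"
        proof (rule mult_left_mono)
          have "cc.zone x \<noteq> 0 \<Longrightarrow> cut K0 (dg k x) = 1"
          proof (rule cut_one)
            assume z: "cc.zone x \<noteq> 0"
            show "\<bar>dg k x\<bar> \<le> exp (- real K0)" by (rule zle[OF z]) simp
          qed
          then show "(if cc.zone x \<noteq> 0 then 1 else 0) \<le> cut K0 (dg k x)" using cut_range(1) by auto
        qed (use C1 C3 in simp)
        have t2: "C4 * (if cc.zone x < K then real (cc.zone x) else 0) \<le> C4 * (cut K0 (dg k x) * ell K (dg k x))"
        proof (rule mult_left_mono)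
          have nn0: "0 \<le> cut K0 (dg k x) * ell K (dg k x)" using cut_range(1) ell_nonneg by (intro mult_nonneg_nonneg)
          show "(if cc.zone x < K then real (cc.zone x) else 0) \<le> cut K0 (dg k x) * ell K (dg k x)"
          proof (cases "cc.zone x < K \<and> cc.zone x \<noteq> 0")
            case True
            then have z: "\<bar>dg k x\<bar> \<le> exp (- real (cc.zone x))" "\<bar>dg k x\<bar> \<le> exp (- real K0)"
              using zle[of x] by auto
            have "real (cc.zone x) \<le> ell K (dg k x)" by (rule ell_ge) (use True z in auto)
            then show ?thesis using cut_one[OF z(2)] True by simp
          next
            case False then show ?thesis using nn0 by auto
          qed
        qed (use C4 in simp)
        have t3: "B * (if cc.zone x \<ge> K then 1 else 0) \<le> B * cut K (dg k x)"
        proof (rule mult_left_mono[OF _ B])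
          have "cc.zone x \<ge> K \<Longrightarrow> cut K (dg k x) = 1"
          proof (rule cut_one)
            assume z: "cc.zone x \<ge> K"
            have K3: "cc.zone x \<noteq> 0" using z K(1) K03 by simp
            show "\<bar>dg k x\<bar> \<le> exp (- real K)" by (rule zle[OF K3]) (use z in simp)
          qed
          then show "(if cc.zone x \<ge> K then 1 else 0) \<le> cut K (dg k x)" using cut_range(1) by auto
        qed
        have t4: "max 0 (l.birk cc.psi w x / real w - c) = F2 (word (g k) P (Suc q + w) x)"
          unfolding F2 psie l.birk_def ..
        have t5: "C2 * (if x \<in> Kc then 0 else 1) = C2 * indicator {x\<in>space (\<nu> k). x \<notin> Kc} x" using x by (simp add: indicator_def)
        show ?thesis unfolding cc.theta_def TH_def C3e B_def[symmetric] C4_def[symmetric] t4 t5 using t1 t2 t3 by linarith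
      qed
      have THi: "integrable (\<nu> k) TH" unfolding TH_def using i1 i2 i3 F2i by (intro Bochner_Integration.integrable_add integrable_mult_right)
      have "(\<integral>x. cc.theta x \<partial>\<nu> k) \<le> (\<integral>x. TH x \<partial>\<nu> k)" by (rule integral_mono[OF cc.theta_integrable THi TH])
      also have "\<dots> = (C1 + C3) * (\<integral>x. cut K0 (dg k x) \<partial>\<nu> k) + C4 * (\<integral>x. cut K0 (dg k x) * ell K (dg k x) \<partial>\<nu> k)
          + B * (\<integral>x. cut K (dg k x) \<partial>\<nu> k) + (\<integral>x. F2 (word (g k) P (Suc q + w) x) \<partial>\<nu> k)
          + C2 * measure (\<nu> k) {x\<in>space (\<nu> k). x \<notin> Kc}"
        unfolding TH_def using i1 i2 i3 F2i Kcn sets.sets_into_space[OF Kcn] by (simp add: Int_absorb2)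
      also have "\<dots> \<le> (C1 + C3) * (2 * (\<eta> / (C1 + C3 + 1))) + C4 * (2 * (\<eta> / (C4 + 1))) + B * (2 * (\<eta> / (B + 1))) + 2 * \<eta> + C2 * (\<eta> / (C2 + 1))"
        using I1 I2 I3 I4 Kc(3) C1 C2 C3 C4 B by (intro add_mono mult_left_mono) auto
      also have "\<dots> \<le> 2 * \<eta> + 2 * \<eta> + 2 * \<eta> + 2 * \<eta> + \<eta>"
      proof -
        have fr: "a * (\<eta> / (a + 1)) \<le> \<eta>" if "a \<ge> 0" for a using that \<eta> by (simp add: field_simps)
        have fr2: "a * (2 * (\<eta> / (a + 1))) \<le> 2 * \<eta>" if "a \<ge> 0" for a using that \<eta> by (simp add: field_simps)
        show ?thesis
          by (intro add_mono fr fr2 order.refl) (use C1 C2 C3 C4 B in auto)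
      qed
      finally have th: "(\<integral>x. cc.theta x \<partial>\<nu> k) \<le> 9 * \<eta>" by simp
      have run_cost: "2 * cc.run_cost / real n0 \<le> \<eta>" unfolding cc.run_cost_def by (rule n0(2))
      \<comment> \<open>The errors add up to 14\<eta>: 2 here, 2 for the frequent symbols, 1 for the
        runs and 9 for \<open>theta\<close>.\<close>
      have "max c (\<rho> * R) \<le> h + 2 * \<eta>" using \<rho>R \<eta> by (simp add: c_def)
      then show "metric_entropy_wrt (\<nu> k) (g k) (fibers (space (\<nu> k)) Q) \<le> h + 14 * \<eta>"
        using cc.entropy_bound th run_cost by linarith
    qed
  qed
  then show ?thesis by blast
qed

text \<open>The sign of the exponent is decided by the truncated integrals: it counts as negative if
  one of them is. This avoids integrating a logarithm that may take the value minus
  infinity.\<close>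

theorem limsup_entropy_le:
  assumes gc: "\<And>k. continuous_on X (g k)" and h: "ereal (Rf / (\<beta> + 1)) \<le> metric_entropy \<mu> f"
  shows "limsup (\<lambda>k. metric_entropy (\<nu> k) (g k)) \<le> metric_entropy \<mu> f"
proof -
  interpret e: ergodic_mpt \<mu> f by (rule ergodic)
  have h0: "0 \<le> metric_entropy \<mu> f" by (rule e.metric_entropy_nonneg)
  show ?thesis
  proof (cases "metric_entropy \<mu> f")
    case PInf then show ?thesis by simp
  next
    case MInf then show ?thesis using h0 by simp
  next
    case (real h')
    have h'0: "0 \<le> h'" using h0 real by simp
    have "limsup (\<lambda>k. metric_entropy (\<nu> k) (g k)) \<le> ereal (h' + \<epsilon>)" if \<epsilon>: "\<epsilon> > 0" for \<epsilon>
    proof -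
      define \<eta> where "\<eta> = \<epsilon> / 14"
      have \<eta>: "\<eta> > 0" "14 * \<eta> = \<epsilon>" using \<epsilon> by (auto simp: \<eta>_def)
      have "\<exists>k0. \<forall>k\<ge>k0. metric_entropy (\<nu> k) (g k) \<le> ereal (h' + \<epsilon>)"
      proof (cases "\<exists>m. (\<integral>x. phi m (df x) \<partial>\<mu>) < 0")
        case True
        then obtain m where "(\<integral>x. phi m (df x) \<partial>\<mu>) < 0" by blast
        from negative_exponent_case[OF this \<eta>(1) gc] obtain k0 where k0: "\<forall>k\<ge>k0. metric_entropy (\<nu> k) (g k) \<le> ereal (5 * \<eta>)" by blast
        have "ereal (5 * \<eta>) \<le> ereal (h' + \<epsilon>)" using h'0 \<eta> by simp
        then show ?thesis using k0 order_trans by blast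
      next
        case False
        then have nn: "0 \<le> (\<integral>x. phi m (df x) \<partial>\<mu>)" for m by (simp add: not_less)
        have "Rf / (\<beta> + 1) \<le> h'" using h real by simp
        from nonneg_exponent_case[OF nn real this \<eta>(1)] show ?thesis unfolding \<eta>(2) .
      qed
      then have "\<forall>\<^sub>F k in sequentially. metric_entropy (\<nu> k) (g k) \<le> ereal (h' + \<epsilon>)"
        unfolding eventually_sequentially .
      then show ?thesis by (rule Limsup_bounded)
    qed
    then show ?thesis unfolding real by (metis ereal_le_epsilon2 plus_ereal.simps(1))
  qed
qed

end

section \<open>The interval and the circle\<close>

text \<open>What the interval and the circle have in common. \<open>deck\<close> says that two
  parameters of one point differ by a translation that preserves the parametrization: by 0 for the
  interval, by an integer for the circle.\<close>

locale parametrized_space =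
  fixes I :: "('a::{real_normed_vector, polish_space}) space1" and \<tau> :: "'a \<Rightarrow> real"
  assumes dom_interval: "is_interval (pdom I)" and dom_closed: "closed (pdom I)"
    and dom_limpt: "t \<in> pdom I \<Longrightarrow> at t within pdom I \<noteq> bot"
    and dom_nonempty: "pdom I \<noteq> {}"
    and pts_compact: "compact (pts I)"
    and \<tau>: "x \<in> pts I \<Longrightarrow> \<tau> x \<in> pdom I" "x \<in> pts I \<Longrightarrow> 0 \<le> \<tau> x" "x \<in> pts I \<Longrightarrow> \<tau> x \<le> 1"
      "x \<in> pts I \<Longrightarrow> param I (\<tau> x) = x"
    and param_in: "t \<in> pdom I \<Longrightarrow> param I t \<in> pts I"
    and chord: "s \<in> pdom I \<Longrightarrow> t \<in> pdom I \<Longrightarrow> \<bar>s - t\<bar> \<le> 1/2 \<Longrightarrow> \<bar>s - t\<bar> \<le> dist (param I s) (param I t)"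
    and lip: "s \<in> pdom I \<Longrightarrow> t \<in> pdom I \<Longrightarrow> dist (param I s) (param I t) \<le> 7 * \<bar>s - t\<bar>"
    and deck: "s \<in> pdom I \<Longrightarrow> t \<in> pdom I \<Longrightarrow> param I s = param I t \<Longrightarrow> u \<in> pdom I \<Longrightarrow>
        u + (s - t) \<in> pdom I \<and> param I (u + (s - t)) = param I u"
    and lift_exists: "g ` pts I \<subseteq> pts I \<Longrightarrow> continuous_on (pts I) g \<Longrightarrow> \<exists>F. is_lift I g F"
begin

section \<open>Lifts and the derivative as a function on the space\<close>

lemma lift_of: "g ` pts I \<subseteq> pts I \<Longrightarrow> continuous_on (pts I) g \<Longrightarrow> is_lift I g (lift_of I g)"
  unfolding lift_of_def using lift_exists[of g] by (rule someI_ex)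

text \<open>The difference of two lifts is continuous, and two distinct values of it are at least
  1/2 apart: by \<open>deck\<close> such values give parameters of one point, and by
  \<open>chord\<close> a point has no two distinct parameters within 1/2. So it is constant on the
  connected domain.\<close>

lemma lift_unique:
  assumes F: "is_lift I g F" and F': "is_lift I g F'"
  obtains c where "\<And>t. t \<in> pdom I \<Longrightarrow> F t = F' t + c"
proof -
  note F = F[unfolded is_lift_def] and F' = F'[unfolded is_lift_def]
  have "(\<lambda>t. F t - F' t) constant_on pdom I"
  proof (rule continuous_discrete_range_constant)
    show "connected (pdom I)" using dom_interval by (simp add: is_interval_connected)
    show "continuous_on (pdom I) (\<lambda>t. F t - F' t)" using F F' by (intro continuous_on_diff) auto
    fix s assume s: "s \<in> pdom I"
    have "1/2 \<le> norm ((F t - F' t) - (F s - F' s))" if t: "t \<in> pdom I" "F t - F' t \<noteq> F s - F' s" for t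
    proof (rule ccontr)
      assume "\<not> ?thesis"
      then have small: "\<bar>F t - (F' t + (F s - F' s))\<bar> \<le> 1/2" by (simp add: algebra_simps)
      have D: "F t \<in> pdom I" "F s \<in> pdom I" "F' t \<in> pdom I" "F' s \<in> pdom I" using F F' s t by auto
      have eq: "param I (F s) = param I (F' s)" "param I (F t) = param I (F' t)" using F F' s t(1) by metis+
      from deck[OF D(2,4) eq(1) D(3)] have d: "F' t + (F s - F' s) \<in> pdom I" "param I (F' t + (F s - F' s)) = param I (F' t)" by auto
      from chord[OF D(1) d(1) small] have "\<bar>F t - (F' t + (F s - F' s))\<bar> \<le> 0" unfolding d(2) eq(2) by simp
      then show False using t(2) by simp
    qed
    then show "\<exists>e>0. \<forall>t. t \<in> pdom I \<and> F t - F' t \<noteq> F s - F' s \<longrightarrow> e \<le> norm ((F t - F' t) - (F s - F' s))"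
      by (intro exI[of _ "1/2"]) auto
  qed
  then obtain c where c: "\<And>t. t \<in> pdom I \<Longrightarrow> F t - F' t = c" unfolding constant_on_def by blast
  show ?thesis using that[of c] c by (simp add: algebra_simps)
qed

lemma deriv_within_eq: "(F has_real_derivative y) (at t within pdom I) \<Longrightarrow> t \<in> pdom I \<Longrightarrow> deriv_within (pdom I) F t = y"
  unfolding deriv_within_def has_real_derivative_iff_has_vector_derivative
  by (rule vector_derivative_within[OF dom_limpt])

lemma deriv_within_works:
  "F differentiable (at t within J) \<Longrightarrow> (F has_real_derivative deriv_within J F t) (at t within J)"
  unfolding deriv_within_def has_real_derivative_iff_has_vector_derivative by (simp add: vector_derivative_works)

lemma lift_derivative:
  assumes F: "is_lift I g F" "(F has_real_derivative y) (at t within pdom I)" and F': "is_lift I g F'" and t: "t \<in> pdom I"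
  shows "(F' has_real_derivative y) (at t within pdom I)"
proof -
  obtain c where c: "\<And>t. t \<in> pdom I \<Longrightarrow> F' t = F t + c" using lift_unique[OF F' F(1)] by blast
  have "((\<lambda>t. F t + c) has_real_derivative y) (at t within pdom I)"
    using DERIV_add[OF F(2) DERIV_const[of c]] by simp
  then show ?thesis by (rule has_field_derivative_transform_within[where d = 1]) (use t c in auto)
qed

text \<open>Composed with the translation by \<open>t - s\<close>, a lift is again a lift of the
  same map, and all lifts have the same derivatives. So the derivative depends only on the
  point.\<close>

lemma lift_derivative_deck:
  assumes F: "is_lift I g F" "(F has_real_derivative y) (at t within pdom I)"
    and st: "s \<in> pdom I" "t \<in> pdom I" "param I s = param I t"
  shows "(F has_real_derivative y) (at s within pdom I)"
proof -
  note L = F(1)[unfolded is_lift_def]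
  have down: "u + (t - s) \<in> pdom I" "param I (u + (t - s)) = param I u" if "u \<in> pdom I" for u
    using deck[OF st(2,1) st(3)[symmetric] that] by auto
  have up: "u + (s - t) \<in> pdom I" if "u \<in> pdom I" for u using deck[OF st that] by auto
  have im: "(\<lambda>u. u + (t - s)) ` pdom I = pdom I"
  proof (intro equalityI subsetI)
    fix u assume "u \<in> pdom I"
    then show "u \<in> (\<lambda>u. u + (t - s)) ` pdom I" using up[of u] by (intro image_eqI[of _ _ "u + (s - t)"]) auto
  qed (use down in auto)
  have lift: "is_lift I g (\<lambda>u. F (u + (t - s)))"
    unfolding is_lift_def
  proof (intro conjI ballI)
    show "continuous_on (pdom I) (\<lambda>u. F (u + (t - s)))"
      by (rule continuous_on_compose2[of "pdom I" F]) (use L im in \<open>auto intro!: continuous_intros\<close>)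
    show "(\<lambda>u. F (u + (t - s))) ` pdom I \<subseteq> pdom I" using L down by auto
    show "g (param I u) = param I (F (u + (t - s)))" if "u \<in> pdom I" for u
      using L down[OF that] by metis
  qed
  have "((\<lambda>u. F (u + (t - s))) has_real_derivative y * 1) (at s within pdom I)"
  proof (rule DERIV_image_chain[of F y "\<lambda>u. u + (t - s)", unfolded o_def])
    show "(F has_real_derivative y) (at (s + (t - s)) within (\<lambda>u. u + (t - s)) ` pdom I)"
      unfolding im using F(2) by simp
  qed (auto intro!: derivative_eq_intros)
  then show ?thesis using lift_derivative[OF lift _ F(1) st(1)] by simp
qed

definition dmap where "dmap g x = nderiv I 1 g (\<tau> x)"

context
  fixes r :: real and g :: "'a \<Rightarrow> 'a"
  assumes r: "r > 1" and g: "Cr_map r I g"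
begin

lemma r_floor: "1 \<le> nat \<lfloor>r\<rfloor>" "of_int \<lfloor>r\<rfloor> = real (nat \<lfloor>r\<rfloor>)" "0 \<le> r - of_int \<lfloor>r\<rfloor>"
  using r by (auto simp: le_nat_iff)

lemma Cr_lift: "is_lift I g (lift_of I g)"
  using g by (intro lift_of) (auto simp: Cr_map_def)

lemma Cr_maps: "x \<in> pts I \<Longrightarrow> g x \<in> pts I" and Cr_cont: "continuous_on (pts I) g"
  using g by (auto simp: Cr_map_def)

lemma nderiv_Suc:
  assumes "j < nat \<lfloor>r\<rfloor>" "t \<in> pdom I"
  shows "(nderiv I j g has_real_derivative nderiv I (Suc j) g t) (at t within pdom I)"
proof -
  have "nderiv I j g differentiable (at t within pdom I)"
    using g assms unfolding Cr_map_def Cn_on_def nderiv_def by auto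
  then show ?thesis unfolding nderiv_def funpow.simps o_def by (rule deriv_within_works)
qed

lemma lift_der: "t \<in> pdom I \<Longrightarrow> (lift_of I g has_real_derivative nderiv I 1 g t) (at t within pdom I)"
  using nderiv_Suc[of 0 t] r_floor(1) by (simp add: nderiv_def Suc_le_eq)

lemma nderiv_1_cont: "continuous_on (pdom I) (nderiv I 1 g)"
proof (cases "nat \<lfloor>r\<rfloor> = 1")
  case True then show ?thesis using g by (simp add: Cr_map_def Cn_on_def nderiv_def)
next
  case False
  then have "1 < nat \<lfloor>r\<rfloor>" using r_floor(1) by linarith
  from nderiv_Suc[OF this] show ?thesis by (rule DERIV_continuous_on)
qed

lemma nderiv_1_deck:
  assumes "s \<in> pdom I" "t \<in> pdom I" "param I s = param I t"
  shows "nderiv I 1 g s = nderiv I 1 g t"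
proof -
  have "(lift_of I g has_real_derivative nderiv I 1 g t) (at s within pdom I)"
    by (rule lift_derivative_deck[OF Cr_lift lift_der[OF assms(2)] assms])
  from deriv_within_eq[OF this assms(1)] deriv_within_eq[OF lift_der[OF assms(1)] assms(1)] show ?thesis by simp
qed

lemma dmap_param: "t \<in> pdom I \<Longrightarrow> dmap g (param I t) = nderiv I 1 g t"
  unfolding dmap_def by (intro nderiv_1_deck) (auto simp: \<tau> param_in)

text \<open>On the circle \<tau> jumps, so continuity is not inherited through it. Instead, the
  preimage of a closed set is the image under the parametrization of a compact subset of the unit
  interval.\<close>

lemma dmap_cont: "continuous_on (pts I) (dmap g)"
proof -
  have p: "continuous_on (pdom I) (param I)"
    unfolding continuous_on_iff
  proof (intro ballI allI impI)
    fix t and e :: real assume t: "t \<in> pdom I" and e: "e > 0"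
    show "\<exists>d>0. \<forall>s\<in>pdom I. dist s t < d \<longrightarrow> dist (param I s) (param I t) < e"
      by (rule exI[of _ "e / 7"]) (use e order_le_less_trans[OF lip[OF _ t]] in \<open>auto simp: dist_real_def\<close>)
  qed
  define K where "K = pdom I \<inter> {0..1}"
  have K: "compact K" unfolding K_def by (rule closed_Int_compact[OF dom_closed]) simp
  have "closed (dmap g -` B \<inter> pts I)" if B: "closed B" for B
  proof -
    have K': "compact (nderiv I 1 g -` B \<inter> K)"
    proof -
      have "continuous_on K (nderiv I 1 g)" by (rule continuous_on_subset[OF nderiv_1_cont]) (simp add: K_def)
      then have "closed (nderiv I 1 g -` B \<inter> K)"
        using B continuous_on_closed_vimage[OF compact_imp_closed[OF K]] by blast
      then show ?thesis using compact_Int_closed[OF K, of "nderiv I 1 g -` B \<inter> K"] by (simp add: Int_absorb1)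
    qed
    have "dmap g -` B \<inter> pts I = param I ` (nderiv I 1 g -` B \<inter> K)"
    proof (intro equalityI subsetI)
      fix x assume x: "x \<in> dmap g -` B \<inter> pts I"
      then have "\<tau> x \<in> nderiv I 1 g -` B \<inter> K" using \<tau> by (auto simp: K_def dmap_def)
      then show "x \<in> param I ` (nderiv I 1 g -` B \<inter> K)" using \<tau>(4)[of x] x by (intro image_eqI[of _ _ "\<tau> x"]) auto
    qed (auto simp: K_def dmap_param param_in)
    moreover have "compact (param I ` (nderiv I 1 g -` B \<inter> K))"
      by (rule compact_continuous_image[OF continuous_on_subset[OF p] K']) (auto simp: K_def)
    ultimately show ?thesis by (simp add: compact_imp_closed)
  qed
  then show ?thesis using continuous_on_closed_vimage[OF compact_imp_closed[OF pts_compact]] by blast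
qed

text \<open>The lift chosen for the iterate need not be the iterate of the chosen lift, but both
  have the same derivative; for the second one it is given by the chain rule.\<close>

lemma nderiv_iter: "t \<in> pdom I \<Longrightarrow> nderiv I 1 (g ^^ n) t = (\<Prod>i<n. dmap g ((g ^^ i) (param I t)))"
proof -
  assume t: "t \<in> pdom I"
  note L = Cr_lift[unfolded is_lift_def]
  let ?F = "lift_of I g"
  have D: "(?F ^^ n) s \<in> pdom I" if "s \<in> pdom I" for s n using that L by (induction n) auto
  have P: "(g ^^ n) (param I s) = param I ((?F ^^ n) s)" if "s \<in> pdom I" for s n
    using that L D by (induction n) auto
  have m: "(g ^^ n) ` pts I \<subseteq> pts I" for n using Cr_maps by (induction n) auto
  have c: "continuous_on (pts I) (g ^^ n)" for n
  proof (induction n)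
    case (Suc n)
    have "continuous_on (pts I) (\<lambda>x. g ((g ^^ n) x))" by (rule continuous_on_compose2[OF Cr_cont Suc.IH m])
    then show ?case by (simp add: o_def)
  qed (simp add: id_def)
  have Fc: "continuous_on (pdom I) (?F ^^ n)" for n
  proof (induction n)
    case (Suc n)
    have "continuous_on (pdom I) (\<lambda>x. ?F ((?F ^^ n) x))"
      by (rule continuous_on_compose2[of "pdom I" ?F, OF _ Suc.IH]) (use L D in auto)
    then show ?case by (simp add: o_def)
  qed (simp add: id_def)
  have lift: "is_lift I (g ^^ n) (?F ^^ n)" unfolding is_lift_def using Fc D P by auto
  have "((?F ^^ n) has_real_derivative (\<Prod>i<n. dmap g ((g ^^ i) (param I t)))) (at t within pdom I)"
  proof (induction n)
    case (Suc n)
    have "(?F has_real_derivative nderiv I 1 g ((?F ^^ n) t)) (at ((?F ^^ n) t) within (?F ^^ n) ` pdom I)"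
      by (rule DERIV_subset[OF lift_der[OF D[OF t]]]) (use D in auto)
    from DERIV_image_chain[OF this Suc.IH]
    show ?case using dmap_param[OF D[OF t], of n] by (simp add: P[OF t] mult.commute o_def)
  qed (simp add: id_def)
  from deriv_within_eq[OF lift_derivative[OF lift this lift_of[OF m c] t] t]
  show ?thesis by (simp add: nderiv_def)
qed

text \<open>The suprema are submultiplicative, so the nonnegative parts of their logarithms are
  subadditive and the limit that defines the growth rate exists. If a supremum is 0, so is its
  logarithm by convention, and both claims hold trivially.\<close>

lemma growth_rate:
  shows "0 \<le> growth_rate I g"
    and "\<eta> > 0 \<Longrightarrow> \<exists>p>0. \<forall>x\<in>pts I. \<bar>\<Prod>i<p. dmap g ((g ^^ i) x)\<bar> \<le> exp (real p * (growth_rate I g + \<eta>))"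
proof -
  define P where "P n x = \<bar>\<Prod>i<n. dmap g ((g ^^ i) x)\<bar>" for n x
  define S where "S n = (SUP x\<in>pts I. P n x)" for n
  have it: "(g ^^ i) x \<in> pts I" if "x \<in> pts I" for i x using that Cr_maps by (induction i) auto
  have pim: "param I ` pdom I = pts I"
  proof
    show "pts I \<subseteq> param I ` pdom I" using \<tau>(1,4) by (metis image_eqI subsetI)
  qed (use param_in in auto)
  have ne: "pts I \<noteq> {}" using pim dom_nonempty by auto
  have S: "(SUP t\<in>pdom I. \<bar>nderiv I 1 (g ^^ n) t\<bar>) = S n" for n
  proof -
    have "(SUP t\<in>pdom I. \<bar>nderiv I 1 (g ^^ n) t\<bar>) = (SUP t\<in>pdom I. P n (param I t))"
      by (rule SUP_cong) (simp_all add: nderiv_iter P_def del: One_nat_def)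
    then show ?thesis unfolding S_def pim[symmetric] by (simp add: image_image)
  qed
  obtain B where B: "\<And>x. x \<in> pts I \<Longrightarrow> \<bar>dmap g x\<bar> \<le> B"
    using compact_imp_bounded[OF compact_continuous_image[OF dmap_cont pts_compact]] unfolding bounded_iff by auto
  have bdd: "bdd_above (P n ` pts I)" for n
  proof (rule bdd_aboveI2)
    fix x assume "x \<in> pts I"
    then show "P n x \<le> (\<Prod>i<n. B)" unfolding P_def abs_prod by (intro prod_mono) (use B it in auto)
  qed
  have up: "P n x \<le> S n" if "x \<in> pts I" for n x unfolding S_def by (rule cSUP_upper[OF that bdd])
  have P0: "0 \<le> P n x" for n x by (simp add: P_def)
  have S0: "0 \<le> S n" for n using ne up P0 by (meson all_not_in_conv order_trans)
  have sub: "S (m + n) \<le> S m * S n" for m n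
    unfolding S_def[of "m + n"]
  proof (rule cSUP_least[OF ne])
    fix x assume x: "x \<in> pts I"
    have "P (m + n) x = P m x * P n ((g ^^ m) x)"
      unfolding P_def by (induction n) (simp_all add: abs_mult funpow_add add.commute[of m])
    also have "\<dots> \<le> S m * S n" using up[OF x] up[OF it[OF x]] P0 S0 by (intro mult_mono) auto
    finally show "P (m + n) x \<le> S m * S n" .
  qed
  define a where "a n = max 0 (ln (S n))" for n
  have gr: "growth_rate I g = lim (\<lambda>n. a n / real n)" unfolding growth_rate_def S a_def ..
  have "a (m + n) \<le> a m + a n" for m n
  proof (cases "S (m + n) = 0")
    case False
    then have p: "0 < S (m + n)" "0 < S m * S n" using S0[of "m + n"] sub[of m n] by linarith+
    then have mn: "0 < S m" "0 < S n" using S0[of m] S0[of n] by (auto simp: zero_less_mult_iff)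
    have "ln (S (m + n)) \<le> ln (S m * S n)" using sub[of m n] p by simp
    also have "\<dots> = ln (S m) + ln (S n)" using mn by (rule ln_mult_pos)
    finally show ?thesis unfolding a_def by linarith
  qed (simp add: a_def)
  from fekete(1)[OF this] have lim: "(\<lambda>n. a n / real n) \<longlonglongrightarrow> growth_rate I g"
    unfolding gr by (simp add: a_def convergent_LIMSEQ_iff)
  show "0 \<le> growth_rate I g" by (rule LIMSEQ_le_const[OF lim]) (simp add: a_def)
  assume "\<eta> > 0"
  then have "\<forall>\<^sub>F n in sequentially. a n / real n < growth_rate I g + \<eta>" by (intro order_tendstoD(2)[OF lim]) simp
  then obtain n0 where n0: "\<And>n. n \<ge> n0 \<Longrightarrow> a n / real n < growth_rate I g + \<eta>" unfolding eventually_sequentially by blast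
  define p where "p = Suc n0"
  have "a p < real p * (growth_rate I g + \<eta>)" using n0[of p] by (simp add: p_def field_simps)
  then have l: "ln (S p) \<le> real p * (growth_rate I g + \<eta>)" by (simp add: a_def)
  have "S p \<le> exp (real p * (growth_rate I g + \<eta>))"
  proof (cases "S p = 0")
    case False
    then have "S p = exp (ln (S p))" using S0[of p] by simp
    then show ?thesis using l by (metis exp_le_cancel_iff)
  qed simp
  then show "\<exists>p>0. \<forall>x\<in>pts I. \<bar>\<Prod>i<p. dmap g ((g ^^ i) x)\<bar> \<le> exp (real p * (growth_rate I g + \<eta>))"
    using up[of _ p] unfolding P_def by (intro exI[of _ p]) (force simp: p_def)
qed

text \<open>The norm is a sum of three nonnegative suprema, so the last one is bounded by
  \<open>C\<close>. On the diagonal the quotient is 0 by convention, hence the restriction to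
  distinct parameters.\<close>

lemma top_derivative_holder:
  assumes C: "Cr_norm r I g \<le> ereal C" and st: "s \<in> pdom I" "t \<in> pdom I" "s \<noteq> t"
  shows "\<bar>nderiv I (nat \<lfloor>r\<rfloor>) g s - nderiv I (nat \<lfloor>r\<rfloor>) g t\<bar> \<le> C * \<bar>s - t\<bar> powr (r - of_int \<lfloor>r\<rfloor>)"
proof -
  let ?q = "\<lambda>s t. \<bar>nderiv I (nat \<lfloor>r\<rfloor>) g s - nderiv I (nat \<lfloor>r\<rfloor>) g t\<bar> / \<bar>s - t\<bar> powr (r - of_int \<lfloor>r\<rfloor>)"
  define A1 A2 A3 where "A1 = (SUP x\<in>pts I. ereal (norm (g x)))"
    and "A2 = (SUP j\<in>{1..nat \<lfloor>r\<rfloor>}. SUP t\<in>pdom I. ereal \<bar>nderiv I j g t\<bar>)"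
    and "A3 = (SUP s\<in>pdom I. SUP t\<in>pdom I. ereal (?q s t))"
  have sum: "A1 + A2 + A3 \<le> ereal C" using C unfolding Cr_norm_def A1_def A2_def A3_def .
  have "0 \<le> A1" unfolding A1_def by (rule SUP_upper2[OF param_in[OF st(1)]]) simp
  moreover have "0 \<le> A2" unfolding A2_def
    by (rule SUP_upper2[of 1], use r_floor(1) in simp, rule SUP_upper2[OF st(1)]) simp
  ultimately have "A3 \<le> A1 + A2 + A3" by (meson add_increasing add_nonneg_nonneg order.refl)
  moreover have "ereal (?q s t) \<le> A3" unfolding A3_def
    by (rule SUP_upper2[OF st(1)], rule SUP_upper2[OF st(2)]) simp
  ultimately have "ereal (?q s t) \<le> ereal C" using sum by (meson order_trans)
  moreover have "0 < \<bar>s - t\<bar> powr (r - of_int \<lfloor>r\<rfloor>)" using st(3) by simp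
  ultimately show ?thesis by (simp add: pos_divide_le_eq)
qed

text \<open>Rolle's argument for the first derivative. It has m further derivatives, where m + 1 is
  the integer part of r, and the total exponent is m plus the fractional part of r, which is r -
  1.\<close>

lemma dmap_many_values:
  assumes C: "Cr_norm r I g \<le> ereal C" and t: "t1 \<in> pdom I" "t2 \<in> pdom I" "t1 < t2"
    and Z: "finite Z" "Z \<subseteq> {t1..t2}" "card Z = nat \<lfloor>r\<rfloor>" "\<And>z. z \<in> Z \<Longrightarrow> dmap g (param I z) = c"
  shows "\<bar>dmap g (param I t2) - c\<bar> \<le> max 1 C * (t2 - t1) powr (r - 1)"
proof -
  define m where "m = nat \<lfloor>r\<rfloor> - 1"
  have m: "nat \<lfloor>r\<rfloor> = Suc m" using r_floor(1) by (simp add: m_def)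
  have sub: "{t1..t2} \<subseteq> pdom I" using dom_interval t unfolding is_interval_1 by (meson atLeastAtMost_iff subsetI)
  have "\<bar>nderiv I (Suc 0) g t2 - c\<bar> \<le> max 1 C * (t2 - t1) powr (real m + (r - of_int \<lfloor>r\<rfloor>))"
  proof (rule many_values_close[where u = "\<lambda>i. nderiv I (Suc i) g" and a = t1 and Z = Z])
    show "(nderiv I (Suc i) g has_real_derivative nderiv I (Suc (Suc i)) g s) (at s within {t1..t2})"
      if "i < m" "s \<in> {t1..t2}" for i s
      by (rule DERIV_subset[OF nderiv_Suc sub]) (use that m sub in auto)
    show "\<bar>nderiv I (Suc m) g s - nderiv I (Suc m) g t\<bar> \<le> max 1 C * \<bar>s - t\<bar> powr (r - of_int \<lfloor>r\<rfloor>)"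
      if "s \<in> {t1..t2}" "t \<in> {t1..t2}" "s \<noteq> t" for s t
    proof -
      have "\<bar>nderiv I (Suc m) g s - nderiv I (Suc m) g t\<bar> \<le> C * \<bar>s - t\<bar> powr (r - of_int \<lfloor>r\<rfloor>)"
        unfolding m[symmetric] by (rule top_derivative_holder[OF C _ _ that(3)]) (use that sub in auto)
      also have "\<dots> \<le> max 1 C * \<bar>s - t\<bar> powr (r - of_int \<lfloor>r\<rfloor>)" by (intro mult_right_mono) auto
      finally show ?thesis .
    qed
    show "nderiv I (Suc 0) g z = c" if "z \<in> Z" for z using Z(4)[OF that] dmap_param[of z] that Z(2) sub by auto
  qed (use t Z m r_floor in auto)
  moreover have "real m + (r - of_int \<lfloor>r\<rfloor>) = r - 1" unfolding r_floor(2) m by simp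
  ultimately show ?thesis using dmap_param[OF t(2)] by simp
qed

end

lemma invariant_mpt:
  assumes "invariant_measure I g M"
  shows "mpt M g" "sets M = sets (restrict_space borel (pts I))" "space M = pts I"
proof -
  show "sets M = sets (restrict_space borel (pts I))" using assms by (simp add: invariant_measure_def borel_prob_on_def)
  from sets_eq_imp_space_eq[OF this] show "space M = pts I" by (simp add: space_restrict_space)
  show "mpt M g" using assms unfolding invariant_measure_def borel_prob_on_def mpt_def mpt_axioms_def by blast
qed

lemma lifted_invariant:
  assumes r: "r > 1" and g: "Cr_map r I g" and M: "invariant_measure I g M"
  shows "lifted M g (pdom I) (param I) \<tau> (lift_of I g) (dmap g)"
proof -
  note L = Cr_lift[OF r g, unfolded is_lift_def]
  have "continuous_on (pdom I) (\<lambda>t. dmap g (param I t))"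
    using nderiv_1_cont[OF r g] by (subst continuous_on_cong[OF refl dmap_param[OF r g]])
  moreover have "(lift_of I g has_real_derivative dmap g (param I t)) (at t within pdom I)" if "t \<in> pdom I" for t
    using lift_der[OF r g that] unfolding dmap_param[OF r g that] .
  ultimately show ?thesis
    unfolding lifted_def lifted_axioms_def invariant_mpt(3)[OF M]
    using invariant_mpt(1)[OF M] dom_interval \<tau> param_in L chord lip by auto
qed

theorem limsup_entropy_le:
  assumes r: "r > 1" and f: "Cr_map r I f" and \<mu>: "ergodic_measure I f \<mu>"
    and h: "metric_entropy \<mu> f \<ge> ereal (growth_rate I f / r)"
    and g: "\<And>k. Cr_map r I (g k)" and gf: "Cr_weakly_converges r I g f"
    and \<nu>: "\<And>k. invariant_measure I (g k) (\<nu> k)" and weak: "weak_star_converges I \<nu> \<mu>"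
  shows "limsup (\<lambda>k. metric_entropy (\<nu> k) (g k)) \<le> metric_entropy \<mu> f"
proof -
  have \<mu>i: "invariant_measure I f \<mu>" using \<mu> by (simp add: ergodic_measure_def)
  obtain C where C: "\<And>k. Cr_norm r I (g k) \<le> ereal C" using gf by (auto simp: Cr_weakly_converges_def)
  have U: "uniform_limit (pts I) g f sequentially"
    "uniform_limit (pdom I) (\<lambda>k. nderiv I 1 (g k)) (nderiv I 1 f) sequentially"
    using gf by (auto simp: Cr_weakly_converges_def C1_converges_def)
  have Ud: "uniform_limit (pts I) (\<lambda>k. dmap (g k)) (dmap f) sequentially"
    unfolding uniform_limit_iff
  proof (intro allI impI)
    fix e :: real assume "e > 0"
    from uniform_limitD[OF U(2) this]
    show "\<forall>\<^sub>F k in sequentially. \<forall>x\<in>pts I. dist (dmap (g k) x) (dmap f x) < e"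
      by (rule eventually_mono) (use \<tau> in \<open>auto simp: dmap_def\<close>)
  qed
  \<comment> \<open>With \<beta> = r - 1 the threshold \<open>Rf / (\<beta> + 1)\<close> is the
    growth rate divided by r.\<close>
  interpret w: weak_seq_lift "pts I" \<mu> \<nu> f g "pdom I" "param I" \<tau> "\<lambda>k. lift_of I (g k)" "\<lambda>k. dmap (g k)" "dmap f"
    "r - 1" "max 1 C" "growth_rate I f" "nat \<lfloor>r\<rfloor>"
  proof (intro weak_seq_lift.intro weak_seq.intro weak_seq_lift_axioms.intro)
    show "compact (pts I)" by (rule pts_compact)
    show "mpt \<mu> f" by (rule invariant_mpt(1)[OF \<mu>i])
    show "sets \<mu> = sets (restrict_space borel (pts I))" by (rule invariant_mpt(2)[OF \<mu>i])
    show "mpt (\<nu> k) (g k)" "sets (\<nu> k) = sets (restrict_space borel (pts I))" for k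
      by (rule invariant_mpt(1,2)[OF \<nu>])+
    show "(\<lambda>k. integral\<^sup>L (\<nu> k) \<phi>) \<longlonglongrightarrow> integral\<^sup>L \<mu> \<phi>" if "continuous_on (pts I) \<phi>" for \<phi> :: "'a \<Rightarrow> real"
      using weak that by (simp add: weak_star_converges_def)
    show "continuous_on (pts I) f" by (rule Cr_cont[OF r f])
    show "uniform_limit (pts I) g f sequentially" by (rule U(1))
    show "lifted (\<nu> k) (g k) (pdom I) (param I) \<tau> (lift_of I (g k)) (dmap (g k))" for k
      by (rule lifted_invariant[OF r g \<nu>])
    show "ergodic_mpt \<mu> f"
      using \<mu> invariant_mpt(1)[OF \<mu>i] unfolding ergodic_measure_def ergodic_mpt_def ergodic_mpt_axioms_def by blast
    show "continuous_on (pts I) (dmap f)" by (rule dmap_cont[OF r f])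
    show "continuous_on (pts I) (dmap (g k))" for k by (rule dmap_cont[OF r g])
    show "uniform_limit (pts I) (\<lambda>k. dmap (g k)) (dmap f) sequentially" by (rule Ud)
    show "0 < r - 1" using r by simp
    show "1 \<le> max 1 C" by simp
    show "1 \<le> nat \<lfloor>r\<rfloor>" by (rule r_floor[OF r f])
    show "0 \<le> growth_rate I f" by (rule growth_rate(1)[OF r f])
    show "\<bar>dmap (g k) (param I t2) - c\<bar> \<le> max 1 C * (t2 - t1) powr (r - 1)"
      if "t1 \<in> pdom I" "t2 \<in> pdom I" "t1 < t2" "finite Z" "Z \<subseteq> {t1..t2}" "card Z = nat \<lfloor>r\<rfloor>"
        "\<And>z. z \<in> Z \<Longrightarrow> dmap (g k) (param I z) = c" for k t1 t2 Z c
      by (rule dmap_many_values[OF r g C that])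
    show "\<exists>p>0. \<forall>x\<in>pts I. \<bar>\<Prod>i<p. dmap f ((f ^^ i) x)\<bar> \<le> exp (real p * (growth_rate I f + \<eta>))" if "\<eta> > 0" for \<eta>
      by (rule growth_rate(2)[OF r f that])
  qed
  show ?thesis by (rule w.limsup_entropy_le) (use Cr_cont[OF r g] h in auto)
qed

end

section \<open>The two model spaces\<close>

lemma parametrized_unit_interval: "parametrized_space unit_interval (\<lambda>x. x)"
proof (unfold_locales, unfold unit_interval_def space1.simps)
  show "at t within {0..1::real} \<noteq> bot" if "t \<in> {0..1}" for t
    using that by (simp add: trivial_limit_within islimpt_Icc)
  show "\<exists>F. is_lift \<lparr>pts = {0..1}, pdom = {0..1}, param = \<lambda>t. t\<rparr> g F"
    if "g ` {0..1::real} \<subseteq> {0..1}" "continuous_on {0..1} g" for g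
    using that by (intro exI[of _ g]) (auto simp: is_lift_def)
qed (auto simp: dist_real_def is_interval_cc)

text \<open>Machin's formula bounds \<pi> by 16 times the arctangent of 1/5. This makes the speed
  2\<pi> of the parametrized circle at most 7.\<close>

lemma pi_le: "pi \<le> 16 / 5"
proof -
  have "arctan (1/5) \<le> 1/5" "0 \<le> arctan (1/239)" using arctan_le_self[of "1/5"] by auto
  then show ?thesis using machin by linarith
qed

lemma dist_cis: "dist (cis a) (cis b) = 2 * \<bar>sin ((a - b) / 2)\<bar>"
proof -
  have "cis a - cis b = cis b * (cis (a - b) - 1)" by (simp add: algebra_simps cis_mult)
  then have "dist (cis a) (cis b) = norm (exp (\<i> * of_real (a - b)) - 1)"
    by (simp add: dist_norm norm_mult cis_conv_exp)
  then show ?thesis using dist_exp_i_1[of "a - b"] by simp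
qed

text \<open>The cubic Taylor bound: the error y^3 / 6 is at most 2y/3 on this range.\<close>

lemma sin_ge_third:
  fixes y :: real
  assumes "0 \<le> y" "y \<le> 2"
  shows "y / 3 \<le> sin y"
proof -
  have "\<bar>sin y - y\<bar> \<le> y ^ 3 / 6"
    using Maclaurin_sin_bound[of y 3] assms by (simp add: sin_coeff_def eval_nat_numeral)
  moreover have "y ^ 3 \<le> 4 * y"
  proof -
    have "y * y \<le> 2 * 2" using assms by (intro mult_mono) auto
    then have "y * (y * y) \<le> y * 4" using assms by (intro mult_left_mono) auto
    then show ?thesis by (simp add: power3_eq_cube)
  qed
  ultimately show ?thesis using assms by linarith
qed

text \<open>The real line is contractible, so the map composed with the covering has a continuous
  logarithm. It is purely imaginary, and its imaginary part divided by 2\<pi> is the lift.\<close>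

lemma circle_lift_exists:
  assumes "g ` sphere 0 1 \<subseteq> sphere 0 (1::real)" "continuous_on (sphere 0 1) (g :: complex \<Rightarrow> complex)"
  shows "\<exists>F. continuous_on UNIV F \<and> (\<forall>t. g (cis (2 * pi * t)) = cis (2 * pi * F t))"
proof -
  have n: "norm (g (cis (2 * pi * t))) = 1" for t
    using assms(1) by (auto simp: image_subset_iff)
  have "continuous_on UNIV (\<lambda>t. g (cis (2 * pi * t)))"
    by (rule continuous_on_compose2[OF assms(2)]) (auto intro!: continuous_intros)
  from continuous_logarithm_on_contractible[OF this contractible_UNIV]
  obtain l where l: "continuous_on UNIV l" "\<And>t. g (cis (2 * pi * t)) = exp (l t)"
    using n by (metis UNIV_I norm_zero zero_neq_one)
  have "Re (l t) = 0" for t using n[of t] unfolding l(2) norm_exp_eq_Re by simp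
  then have "exp (l t) = cis (Im (l t))" for t using exp_eq_polar[of "l t"] by simp
  then show ?thesis using l by (intro exI[of _ "\<lambda>t. Im (l t) / (2 * pi)"]) (auto intro!: continuous_intros)
qed

lemma parametrized_unit_circle: "parametrized_space unit_circle (\<lambda>x. Arg2pi x / (2 * pi))"
proof (unfold_locales, unfold unit_circle_def space1.simps)
  fix x :: complex assume x: "x \<in> sphere 0 1"
  have A: "0 \<le> Arg2pi x" "Arg2pi x < 2 * pi" "x = of_real (norm x) * exp (\<i> * of_real (Arg2pi x))"
    using Arg2pi[of x] by (auto simp: is_Arg_def)
  show "0 \<le> Arg2pi x / (2 * pi)" "Arg2pi x / (2 * pi) \<le> 1" using A by auto
  show "cis (2 * pi * (Arg2pi x / (2 * pi))) = x" using A(3) x by (simp add: cis_conv_exp)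
next
  fix s t :: real
  have d: "dist (cis (2 * pi * s)) (cis (2 * pi * t)) = 2 * \<bar>sin (pi * (s - t))\<bar>"
    unfolding dist_cis by (simp add: algebra_simps diff_divide_distrib)
  have "\<bar>sin (pi * (s - t))\<bar> \<le> \<bar>pi * (s - t)\<bar>" by (rule abs_sin_x_le_abs_x)
  also have "\<dots> \<le> (16 / 5) * \<bar>s - t\<bar>" unfolding abs_mult using pi_le by (intro mult_right_mono) auto
  finally show "dist (cis (2 * pi * s)) (cis (2 * pi * t)) \<le> 7 * \<bar>s - t\<bar>" unfolding d by linarith
  assume st: "\<bar>s - t\<bar> \<le> 1/2"
  have y: "0 \<le> pi * \<bar>s - t\<bar>" "pi * \<bar>s - t\<bar> \<le> 2"
  proof -
    have "pi * \<bar>s - t\<bar> \<le> 4 * (1/2)" using st pi_less_4 by (intro mult_mono) auto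
    then show "pi * \<bar>s - t\<bar> \<le> 2" by simp
  qed simp
  have "\<bar>sin (pi * (s - t))\<bar> = \<bar>sin (pi * \<bar>s - t\<bar>)\<bar>" by (cases "s \<ge> t") (auto simp: abs_if algebra_simps sin_diff)
  then have "pi * \<bar>s - t\<bar> / 3 \<le> \<bar>sin (pi * (s - t))\<bar>" using sin_ge_third[OF y] by linarith
  moreover have "2 * \<bar>s - t\<bar> \<le> pi * \<bar>s - t\<bar>" by (intro mult_right_mono pi_ge_two) auto
  ultimately have "2 * \<bar>s - t\<bar> / 3 \<le> \<bar>sin (pi * (s - t))\<bar>" by simp
  show "\<bar>s - t\<bar> \<le> dist (cis (2 * pi * s)) (cis (2 * pi * t))"
  \<comment> \<open>The chord over a parameter difference d is at least twice 2d/3, hence at least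
    d.\<close>
  proof -
    have "a \<le> 2 * b" if "2 * a / 3 \<le> b" "0 \<le> a" for a b :: real using that by linarith
    from this[OF _ abs_ge_zero] show ?thesis using \<open>2 * \<bar>s - t\<bar> / 3 \<le> _\<close> unfolding d by blast
  qed
next
  fix s t u :: real assume "cis (2 * pi * s) = cis (2 * pi * t)"
  moreover have "cis (2 * pi * (u + (s - t))) = cis (2 * pi * u) * (cis (2 * pi * s) / cis (2 * pi * t))"
    unfolding cis_divide cis_mult by (simp add: algebra_simps)
  ultimately show "u + (s - t) \<in> UNIV \<and> cis (2 * pi * (u + (s - t))) = cis (2 * pi * u)" by simp
next
  fix g :: "complex \<Rightarrow> complex" assume "g ` sphere 0 1 \<subseteq> sphere 0 1" "continuous_on (sphere 0 1) g"
  from circle_lift_exists[OF this]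
  show "\<exists>F. is_lift \<lparr>pts = sphere 0 1, pdom = UNIV, param = \<lambda>t. cis (2 * pi * t)\<rparr> g F"
    by (auto simp: is_lift_def)
qed auto

theorem corollary1p7:
  fixes r :: real
  assumes "r > 1"
  shows
    "(\<forall>(f :: real \<Rightarrow> real) \<mu> g \<nu>.
        Cr_map r unit_interval f \<longrightarrow>
        ergodic_measure unit_interval f \<mu> \<longrightarrow>
        metric_entropy \<mu> f \<ge> ereal (growth_rate unit_interval f / r) \<longrightarrow>
        (\<forall>k. Cr_map r unit_interval (g k)) \<longrightarrow>
        Cr_weakly_converges r unit_interval g f \<longrightarrow>
        (\<forall>k. invariant_measure unit_interval (g k) (\<nu> k)) \<longrightarrow>
        weak_star_converges unit_interval \<nu> \<mu> \<longrightarrow>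
        limsup (\<lambda>k. metric_entropy (\<nu> k) (g k)) \<le> metric_entropy \<mu> f) \<and>
     (\<forall>(f :: complex \<Rightarrow> complex) \<mu> g \<nu>.
        Cr_map r unit_circle f \<longrightarrow>
        ergodic_measure unit_circle f \<mu> \<longrightarrow>
        metric_entropy \<mu> f \<ge> ereal (growth_rate unit_circle f / r) \<longrightarrow>
        (\<forall>k. Cr_map r unit_circle (g k)) \<longrightarrow>
        Cr_weakly_converges r unit_circle g f \<longrightarrow>
        (\<forall>k. invariant_measure unit_circle (g k) (\<nu> k)) \<longrightarrow>
        weak_star_converges unit_circle \<nu> \<mu> \<longrightarrow>
        limsup (\<lambda>k. metric_entropy (\<nu> k) (g k)) \<le> metric_entropy \<mu> f)"
proof (intro conjI allI impI, goal_cases)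
  case (1 f \<mu> g \<nu>)
  show ?case
    by (rule parametrized_space.limsup_entropy_le[OF parametrized_unit_interval assms 1(1,2,3) _ 1(5) _ 1(7)])
      (use 1(4,6) in simp_all)
next
  case (2 f \<mu> g \<nu>)
  show ?case
    by (rule parametrized_space.limsup_entropy_le[OF parametrized_unit_circle assms 2(1,2,3) _ 2(5) _ 2(7)])
      (use 2(4,6) in simp_all)
qed

end
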